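(* Let $N\ge 2$, $q>1$, $0\le\tau<1$ and $\rho,\lambda\in\mathbb R$. Assume that $\theta>-2$ and $f_\rho(\beta)>0$. Consider the equation $$(E)\qquad \mathbb L_{\rho,\lambda,\tau}[u]=|x|^\theta u^q\quad\text{in }\mathbb R^N\setminus\{0\}.$$ Then every positive solution $u$ of $(E)$ is radially symmetric, $\lim_{r\to\infty}u(r)=0$ and $u'(r)<0$ for all $r=|x|>0$. Moreover: (i) For every $c\in\mathbb R_+$, there exists a unique positive solution $u_{c,0}$ of $(E)$ satisfying $u(x)\sim U_{\rho,\beta}(x)$ as $|x|\to\infty$ together with the following behaviour as $|x|\to0$, according to the case that holds: - $u(x)\sim c\,|x|^{\varpi_1(-\rho)}$ if $\beta>-\varpi_1(-\rho)$ in Case $[N_1](-\rho)$; - $u(x)\sim c\,\Psi_{\varpi_1(-\rho)}(1/|x|)$ if $\beta>-\varpi_1(-\rho)$ in Case $[N_2](-\rho)$; - $u(x)\sim c\,\log(1/|x|)$ if $\lambda=-2\rho$ and $\tau=0$; - $u(x)\sim c$ in Case $[N_0](-\rho)$ (with $\lambda\neq-2\rho$ if $\tau=0$), or if $\beta\in(0,-\varpi_2(-\rho))$ in Case $[N_2](-\rho)$. (ii) If $\beta\in(0,-\varpi_2(-\rho))$ in Case $[N_2](-\rho)$, then for every $b,c\in\mathbb R_+$ there exists a unique positive solution $u_{b,\infty}$ (respectively, $u_{c,0,b}$) of $(E)$ satisfying $u(x)\sim b\,\Phi_{\varpi_2(-\rho)}(1/|x|)$ as $|x|\to\infty$ and $u(x)\sim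 U_{\rho,\beta}(|x|)$ (respectively, $u(x)\sim c$) as $|x|\to0$. (iii) The set of all positive solutions of $(E)$ is $$\{U_{\rho,\beta}\}\cup\{u_{c,0}\}_{c>0}\cup\{u_{b,\infty}\}_{b>0}\cup\{u_{c,0,b}\}_{b,c>0}\quad\text{if }\beta\in(0,-\varpi_2(-\rho))\text{ in Case }[N_2](-\rho),$$ and it is $\{U_{\rho,\beta}\}\cup\{u_{c,0}\}_{c>0}$ otherwise.
   Context: $\mathbb R_+=(0,\infty)$, $\beta=\frac{\theta+2}{q-1}$, and $$\mathbb L_{\rho,\lambda,\tau}[u]=\Delta u-(N-2+2\rho)\frac{x\cdot\nabla u}{|x|^2}+\lambda\,\frac{u^\tau|\nabla u|^{1-\tau}}{|x|^{1+\tau}}$$ (for $\tau=0$ the last term is $\lambda|\nabla u|/|x|$). A positive solution of $(E)$ is a positive function $u\in C^1(\mathbb R^N\setminus\{0\})$ satisfying $(E)$ in the sense of distributions in $\mathbb R^N\setminus\{0\}$ (test functions in $C^1_c(\mathbb R^N\setminus\{0\})$). The notation $f\sim g$ as $|x|\to0$ (or $\infty$) means $f/g\to1$. For $\sigma\in\mathbb R$ let $f_\sigma(t)=t(t+2\sigma)+\lambda|t|^{1-\tau}$, $t\in\mathbb R$. $U_{\rho,\beta}(x)=\Lambda|x|^{-\beta}$ with $\Lambda=[f_\rho(\beta)]^{1/(q-1)}$ (also written as a function of $|x|$). For $\sigma\in\mathbb R$ and $t<0$ let $\widetilde f_\sigma(t)=-t-2\sigma+\lambda(-t)^{-\tau}$.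 When $\lambda>0$ and $\tau\in(0,1)$ let $\Upsilon=\frac{\tau+1}{2\tau}(\lambda\tau)^{1/(\tau+1)}$. Cases (to be used with $\sigma=-\rho$): - Case $[N_0](\sigma)$: (a) $\tau=0$, $\lambda\ge2\sigma$; or (b) $\lambda>0$, $\tau\in(0,1)$, $\sigma<\Upsilon$. Then $\widetilde f_\sigma>0$ on $(-\infty,0)$. - Case $[N_1](\sigma)$: (a) $\tau=0$, $\lambda<2\sigma$; or (b) $\lambda<0$, $\tau\in(0,1)$, $\sigma\in\mathbb R$. Then $\widetilde f_\sigma=0$ has exactly one negative root, $\varpi_1(\sigma)$. - Case $[N_2](\sigma)$: $\lambda>0$, $\tau\in(0,1)$, $\sigma\ge\Upsilon$. The negative roots of $\widetilde f_\sigma=0$ are $\varpi_1(\sigma)\le\varpi_2(\sigma)$, with $\varpi_1(\sigma)<-(\lambda\tau)^{1/(\tau+1)}<\varpi_2(\sigma)$ if $\sigma\neq\Upsilon$ and $\varpi_1(\sigma)=\varpi_2(\sigma)=-(\lambda\tau)^{1/(\tau+1)}$ if $\sigma=\Upsilon$. - Convention: if $\lambda=0$, the equation and $f_\sigma$ do not depend on $\tau$, and the case distinction is made with $\tau=0$. In Case $[N_2](\sigma)$: $\Psi_{\varpi_1(\sigma)}(t)=t^{-\varpi_1(\sigma)}$ if $\sigma>\Upsilon$ and $\Psi_{\varpi_1(\sigma)}(t)=t^{-\varpi_1(\sigma)}(\log t)^{\frac2{1+\tau}}$ if $\sigma=\Upsilon$, for $t>1$; $\Phi_{\varpi_2(\sigma)}(r)=r^{-\varpi_2(\sigma)}$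 if $\sigma>\Upsilon$ and $\Phi_{\varpi_2(\sigma)}(r)=r^{-\varpi_2(\sigma)}|\log r|^{\frac2{1+\tau}}$ if $\sigma=\Upsilon$, for $r\in(0,1)$. *)

theory Defs
  imports "HOL-Analysis.Analysis" "HOL-Library.Landau_Symbols" "HOL-Library.FuncSet"
begin

subsection \<open>Positive solutions\<close>

definition grad :: "('a::real_inner \<Rightarrow> real) \<Rightarrow> 'a \<Rightarrow> 'a" where
  "grad f x = (THE D. GDERIV f x :> D)"

text \<open>To be used for open \<open>S\<close> only, since \<open>GDERIV\<close> is the derivative in a full neighbourhood.\<close>

definition C1_on :: "('a::real_inner) set \<Rightarrow> ('a \<Rightarrow> real) \<Rightarrow> bool" where
  "C1_on S f \<longleftrightarrow> (\<forall>x\<in>S. \<exists>D. GDERIV f x :> D) \<and> continuous_on S (grad f)"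

text \<open>The space of \<open>C\<^sup>1\<close> functions with compact support in the punctured space, each function
  being extended by zero to the origin.\<close>

definition test_function :: "('a::euclidean_space \<Rightarrow> real) \<Rightarrow> bool" where
  "test_function \<phi> \<longleftrightarrow>
     C1_on UNIV \<phi> \<and> compact (closure {x. \<phi> x \<noteq> 0}) \<and> 0 \<notin> closure {x. \<phi> x \<noteq> 0}"

text \<open>The value of the distribution \<open>L[u]\<close> at the test function \<open>\<phi>\<close>, where \<open>u\<close> is positive
  and of class \<open>C\<^sup>1\<close>: the Laplacian of \<open>u\<close> acts by \<open>\<phi> \<mapsto> - \<integral> \<nabla>u \<bullet> \<nabla>\<phi>\<close>, the other terms
  are continuous functions. Recall that \<open>0 powr a = 0\<close>; as \<open>u > 0\<close> and \<open>\<tau> < 1\<close>, all uses of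
  \<open>powr\<close> below agree with the usual power.\<close>

definition L_action ::
  "real \<Rightarrow> real \<Rightarrow> real \<Rightarrow> ('a::euclidean_space \<Rightarrow> real) \<Rightarrow> ('a \<Rightarrow> real) \<Rightarrow> real" where
  "L_action \<rho> lam \<tau> u \<phi> =
     (LINT x:-{0}|lborel.
        - (grad u x \<bullet> grad \<phi> x)
        + (- (real DIM('a) - 2 + 2 * \<rho>) * ((x \<bullet> grad u x) / (norm x)\<^sup>2)
           + lam * (u x powr \<tau> * norm (grad u x) powr (1 - \<tau>) / norm x powr (1 + \<tau>))) * \<phi> x)"

text \<open>A function on the punctured space is represented by its unique extension in
  \<open>extensional (-{0})\<close>, so that equality of such functions is equality away from the origin.\<close>

definition positive_solutions ::
  "real \<Rightarrow> real \<Rightarrow> real \<Rightarrow> real \<Rightarrow> real \<Rightarrow> ('a::euclidean_space \<Rightarrow> real) set" where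
  "positive_solutions q \<tau> \<rho> lam \<theta> =
     {u \<in> extensional (-{0}).
        C1_on (-{0}) u \<and> (\<forall>x\<in>-{0}. u x > 0) \<and>
        (\<forall>\<phi>. test_function \<phi> \<longrightarrow>
           L_action \<rho> lam \<tau> u \<phi> = (LINT x:-{0}|lborel. norm x powr \<theta> * u x powr q * \<phi> x))}"

subsection \<open>The explicit solution\<close>

definition beta :: "real \<Rightarrow> real \<Rightarrow> real" where
  "beta q \<theta> = (\<theta> + 2) / (q - 1)"

definition f_fun :: "real \<Rightarrow> real \<Rightarrow> real \<Rightarrow> real \<Rightarrow> real" where
  "f_fun lam \<tau> \<sigma> t = t * (t + 2 * \<sigma>) + lam * \<bar>t\<bar> powr (1 - \<tau>)"

definition U_sol ::
  "real \<Rightarrow> real \<Rightarrow> real \<Rightarrow> real \<Rightarrow> real \<Rightarrow> 'a::euclidean_space \<Rightarrow> real" where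
  "U_sol q \<tau> \<rho> lam \<theta> =
     restrict (\<lambda>x. f_fun lam \<tau> \<rho> (beta q \<theta>) powr (1 / (q - 1)) * norm x powr (- beta q \<theta>)) (-{0})"

subsection \<open>Cases and characteristic exponents\<close>

definition f_tilde :: "real \<Rightarrow> real \<Rightarrow> real \<Rightarrow> real \<Rightarrow> real" where
  "f_tilde lam \<tau> \<sigma> t = - t - 2 * \<sigma> + lam * (- t) powr (- \<tau>)"

definition Upsilon :: "real \<Rightarrow> real \<Rightarrow> real" where
  "Upsilon lam \<tau> = (\<tau> + 1) / (2 * \<tau>) * (lam * \<tau>) powr (1 / (\<tau> + 1))"

text \<open>If \<open>lam = 0\<close>, the equation does not depend on \<open>\<tau>\<close> and the cases are distinguished as for
  \<open>\<tau> = 0\<close>. So \<open>\<tau> = 0\<close> is replaced by the following condition; the alternatives with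
  \<open>lam > 0\<close> or \<open>lam < 0\<close> are not affected.\<close>

definition tau_zero :: "real \<Rightarrow> real \<Rightarrow> bool" where
  "tau_zero lam \<tau> \<longleftrightarrow> \<tau> = 0 \<or> lam = 0"

definition case_N0 :: "real \<Rightarrow> real \<Rightarrow> real \<Rightarrow> bool" where
  "case_N0 lam \<tau> \<sigma> \<longleftrightarrow>
     tau_zero lam \<tau> \<and> lam \<ge> 2 * \<sigma> \<or> lam > 0 \<and> \<tau> \<in> {0<..<1} \<and> \<sigma> < Upsilon lam \<tau>"

definition case_N1 :: "real \<Rightarrow> real \<Rightarrow> real \<Rightarrow> bool" where
  "case_N1 lam \<tau> \<sigma> \<longleftrightarrow>
     tau_zero lam \<tau> \<and> lam < 2 * \<sigma> \<or> lam < 0 \<and> \<tau> \<in> {0<..<1}"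

definition case_N2 :: "real \<Rightarrow> real \<Rightarrow> real \<Rightarrow> bool" where
  "case_N2 lam \<tau> \<sigma> \<longleftrightarrow> lam > 0 \<and> \<tau> \<in> {0<..<1} \<and> \<sigma> \<ge> Upsilon lam \<tau>"

text \<open>The negative roots of \<open>f_tilde\<close>: there is exactly one in the case \<open>N1\<close>, given by \<open>varpi1\<close>,
  and in the case \<open>N2\<close> they are \<open>varpi1 \<le> varpi2\<close>, with equality iff \<open>\<sigma> = Upsilon lam \<tau>\<close>.
  There are none in the case \<open>N0\<close>, where these constants are not used.\<close>

definition varpi1 :: "real \<Rightarrow> real \<Rightarrow> real \<Rightarrow> real" where
  "varpi1 lam \<tau> \<sigma> = (LEAST t. t < 0 \<and> f_tilde lam \<tau> \<sigma> t = 0)"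

definition varpi2 :: "real \<Rightarrow> real \<Rightarrow> real \<Rightarrow> real" where
  "varpi2 lam \<tau> \<sigma> = (GREATEST t. t < 0 \<and> f_tilde lam \<tau> \<sigma> t = 0)"

text \<open>\<open>Psi1\<close> is meant for \<open>t > 1\<close> and \<open>Phi2\<close> for \<open>0 < r < 1\<close>.\<close>

definition Psi1 :: "real \<Rightarrow> real \<Rightarrow> real \<Rightarrow> real \<Rightarrow> real" where
  "Psi1 lam \<tau> \<sigma> t =
     (if \<sigma> = Upsilon lam \<tau> then t powr (- varpi1 lam \<tau> \<sigma>) * (ln t) powr (2 / (1 + \<tau>))
      else t powr (- varpi1 lam \<tau> \<sigma>))"

definition Phi2 :: "real \<Rightarrow> real \<Rightarrow> real \<Rightarrow> real \<Rightarrow> real" where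
  "Phi2 lam \<tau> \<sigma> r =
     (if \<sigma> = Upsilon lam \<tau> then r powr (- varpi2 lam \<tau> \<sigma>) * \<bar>ln r\<bar> powr (2 / (1 + \<tau>))
      else r powr (- varpi2 lam \<tau> \<sigma>))"

text \<open>The regime in which additional solutions exist.\<close>

definition case_N2_low :: "real \<Rightarrow> real \<Rightarrow> real \<Rightarrow> real \<Rightarrow> bool" where
  "case_N2_low lam \<tau> \<sigma> b \<longleftrightarrow> case_N2 lam \<tau> \<sigma> \<and> b \<in> {0<..<- varpi2 lam \<tau> \<sigma>}"

subsection \<open>Families of solutions\<close>

text \<open>If \<open>f_fun lam \<tau> \<rho> (beta q \<theta>) > 0\<close>, exactly one of the four premises below holds.\<close>

definition behaviour_at_0 ::
  "real \<Rightarrow> real \<Rightarrow> real \<Rightarrow> real \<Rightarrow> real \<Rightarrow> real \<Rightarrow> ('a::euclidean_space \<Rightarrow> real) \<Rightarrow> bool" where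
  "behaviour_at_0 q \<tau> \<rho> lam \<theta> c u \<longleftrightarrow>
     (case_N1 lam \<tau> (-\<rho>) \<and> beta q \<theta> > - varpi1 lam \<tau> (-\<rho>) \<longrightarrow>
        u \<sim>[at 0] (\<lambda>x. c * norm x powr varpi1 lam \<tau> (-\<rho>))) \<and>
     (case_N2 lam \<tau> (-\<rho>) \<and> beta q \<theta> > - varpi1 lam \<tau> (-\<rho>) \<longrightarrow>
        u \<sim>[at 0] (\<lambda>x. c * Psi1 lam \<tau> (-\<rho>) (1 / norm x))) \<and>
     (lam = - 2 * \<rho> \<and> tau_zero lam \<tau> \<longrightarrow>
        u \<sim>[at 0] (\<lambda>x. c * ln (1 / norm x))) \<and>
     (case_N0 lam \<tau> (-\<rho>) \<and> (tau_zero lam \<tau> \<longrightarrow> lam \<noteq> - 2 * \<rho>) \<or>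
      case_N2_low lam \<tau> (-\<rho>) (beta q \<theta>) \<longrightarrow>
        u \<sim>[at 0] (\<lambda>x. c))"

definition is_u_c0 ::
  "real \<Rightarrow> real \<Rightarrow> real \<Rightarrow> real \<Rightarrow> real \<Rightarrow> real \<Rightarrow> ('a::euclidean_space \<Rightarrow> real) \<Rightarrow> bool" where
  "is_u_c0 q \<tau> \<rho> lam \<theta> c u \<longleftrightarrow>
     u \<in> positive_solutions q \<tau> \<rho> lam \<theta> \<and>
     u \<sim>[at_infinity] U_sol q \<tau> \<rho> lam \<theta> \<and>
     behaviour_at_0 q \<tau> \<rho> lam \<theta> c u"

definition is_u_binf ::
  "real \<Rightarrow> real \<Rightarrow> real \<Rightarrow> real \<Rightarrow> real \<Rightarrow> real \<Rightarrow> ('a::euclidean_space \<Rightarrow> real) \<Rightarrow> bool" where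
  "is_u_binf q \<tau> \<rho> lam \<theta> b u \<longleftrightarrow>
     u \<in> positive_solutions q \<tau> \<rho> lam \<theta> \<and>
     u \<sim>[at_infinity] (\<lambda>x. b * Phi2 lam \<tau> (-\<rho>) (1 / norm x)) \<and>
     u \<sim>[at 0] U_sol q \<tau> \<rho> lam \<theta>"

definition is_u_c0b ::
  "real \<Rightarrow> real \<Rightarrow> real \<Rightarrow> real \<Rightarrow> real \<Rightarrow> real \<Rightarrow> real \<Rightarrow> ('a::euclidean_space \<Rightarrow> real) \<Rightarrow> bool" where
  "is_u_c0b q \<tau> \<rho> lam \<theta> c b u \<longleftrightarrow>
     u \<in> positive_solutions q \<tau> \<rho> lam \<theta> \<and>
     u \<sim>[at_infinity] (\<lambda>x. b * Phi2 lam \<tau> (-\<rho>) (1 / norm x)) \<and>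
     u \<sim>[at 0] (\<lambda>x. c)"

definition u_c0 ::
  "real \<Rightarrow> real \<Rightarrow> real \<Rightarrow> real \<Rightarrow> real \<Rightarrow> real \<Rightarrow> 'a::euclidean_space \<Rightarrow> real" where
  "u_c0 q \<tau> \<rho> lam \<theta> c = (THE u. is_u_c0 q \<tau> \<rho> lam \<theta> c u)"

definition u_binf ::
  "real \<Rightarrow> real \<Rightarrow> real \<Rightarrow> real \<Rightarrow> real \<Rightarrow> real \<Rightarrow> 'a::euclidean_space \<Rightarrow> real" where
  "u_binf q \<tau> \<rho> lam \<theta> b = (THE u. is_u_binf q \<tau> \<rho> lam \<theta> b u)"

definition u_c0b ::
  "real \<Rightarrow> real \<Rightarrow> real \<Rightarrow> real \<Rightarrow> real \<Rightarrow> real \<Rightarrow> real \<Rightarrow> 'a::euclidean_space \<Rightarrow> real" where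
  "u_c0b q \<tau> \<rho> lam \<theta> c b = (THE u. is_u_c0b q \<tau> \<rho> lam \<theta> c b u)"

end

theory Submission
  imports Defs "HOL-Complex_Analysis.Great_Picard"
begin

text \<open>The maximum principle holds for \<open>C\<^sup>1\<close> functions with a continuous weak Laplacian. Combined with
  doubling of variables and reflections, it replaces elliptic regularity theory: it gives a Keller--Osserman bound,
  a gradient bound and a Harnack inequality, and then the radial symmetry.

  For a radial solution, \<open>\<zeta> t = ln u + \<beta> t - ln \<Lambda>\<close> with \<open>t = ln |x|\<close> satisfies
  \<open>\<zeta>'' = F 0 exp ((q - 1) \<zeta>) - F \<zeta>'\<close>, where \<open>F p = f (\<beta> - p)\<close>, and is bounded above, hence nonpositive. It is
  zero, or monotone, or has a single maximum. At an end where it tends to \<open>- \<infinity>\<close>, its slope tends to the nearest root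
  of \<open>F\<close>, and \<open>\<zeta>\<close> minus an explicit function converges, with a logarithmic correction at a double root. By comparison, these
  limits determine \<open>\<zeta>\<close>. They are all attained: up to a translation, a solution with a maximum is determined by the
  maximal value, the corresponding combination of the two limits is a decreasing function of it, and the set of its values is
  closed; monotone solutions are limits of solutions whose maximal value tends to zero.\<close>

section \<open>The weak Laplacian\<close>

text \<open>A solution is only C^1, so second derivatives cannot be evaluated at a maximum. What
  survives is that its weak Laplacian is continuous, a property stable under sums, products, smooth
  compositions and reflections. Doubling is therefore done along a mirror image: near a maximising
  pair, a point and its reflection give a function of one point with a continuous weak Laplacian, to
  which the ordinary maximum principle applies. The second obstacle is the power 1 - \<tau> of the
  gradient, for \<tau> > 0 only Hoelder continuous where the gradient vanishes; in the variable
  \<open>p\<close> this is the slope \<beta>. Comparisons are arranged so that slopes agree at the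
  point under study: the term cancels and the monotone absorption decides. Cauchy uniqueness serves
  only for slopes below \<beta>, and around the zero solution a Lipschitz bound centred at slope 0
  is enough. Slopes and exponents are related by p = \<beta> - s: a positive root s of
  \<open>f\<close> belongs to |x|^(-s), the simple root 0 to solutions with a finite positive limit
  at the origin, the double root 0 to the logarithm.\<close>

definition test_pair :: "'a::euclidean_space set => ('a => real) => ('a => 'a) => bool" where
  "test_pair K \<phi> W \<longleftrightarrow> compact K \<and> (\<forall>x. GDERIV \<phi> x :> W x) \<and> continuous_on UNIV W \<and> (\<forall>x. x \<notin> K --> \<phi> x = 0)"

lemma GDERIV_unique:
  assumes "GDERIV f x :> D" "GDERIV f x :> E" shows "D = E"
proof -
  have "(%h. inner h D) = (%h. inner h E)"
    using assms has_derivative_unique unfolding gderiv_def by blast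
  then have "inner (D - E) D = inner (D - E) E" by metis
  then have "inner (D - E) (D - E) = 0" by (simp add: inner_diff_right)
  then show ?thesis by simp
qed

lemma grad_eq: "GDERIV f x :> D ==> grad f x = D"
  unfolding grad_def using GDERIV_unique by blast

lemma GDERIV_cong_open:
  assumes "GDERIV f x :> D" "open S" "x \<in> S" "!!y. y \<in> S ==> f y = g y"
  shows "GDERIV g x :> D"
  using assms has_derivative_transform_within_open unfolding gderiv_def by metis

lemma GDERIV_isCont: "GDERIV f x :> D ==> isCont f x"
  unfolding gderiv_def by (rule has_derivative_continuous)

lemma test_pair_grad_zero:
  assumes "test_pair K \<phi> W" "x \<notin> K" shows "W x = 0"
proof -
  have op: "open (-K)" using assms compact_imp_closed unfolding test_pair_def by blast
  have "GDERIV \<phi> x :> W x" using assms unfolding test_pair_def by blast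
  then have "GDERIV (%x. 0) x :> W x"
    by (rule GDERIV_cong_open[OF _ op]) (use assms in \<open>auto simp: test_pair_def\<close>)
  then show ?thesis using GDERIV_unique GDERIV_const by blast
qed

lemma test_pair_cont: "test_pair K \<phi> W ==> continuous_on S \<phi>"
  by (intro continuous_at_imp_continuous_on ballI) (auto simp: test_pair_def intro: GDERIV_isCont)

lemma integrable_compact_supp:
  fixes f :: "'a::euclidean_space => real"
  assumes "compact K" "continuous_on K f" "!!x. x \<notin> K ==> f x = 0"
  shows "integrable lborel f"
proof -
  have "integrable lborel (%x. indicator K x *\<^sub>R f x)"
    by (rule borel_integrable_compact[OF assms(1,2)])
  moreover have "(%x. indicator K x *\<^sub>R f x) = f" using assms(3) by (force simp: indicator_def)
  ultimately show ?thesis by simp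
qed

section \<open>Integration by parts and isometry invariance of the Lebesgue integral\<close>

lemma integral_translate:
  fixes f :: "'a::euclidean_space => real"
  assumes "f \<in> borel_measurable borel"
  shows "(\<integral>x. f (c + x) \<partial>lborel) = (\<integral>x. f x \<partial>lborel)"
proof -
  have "(\<integral>x. f x \<partial>lborel) = (\<integral>x. f x \<partial>distr lborel borel ((+) c))"
    by (simp add: lborel_distr_plus)
  also have "... = (\<integral>x. f (c + x) \<partial>lborel)"
    by (rule integral_distr) (use assms in auto)
  finally show ?thesis by simp
qed

text \<open>Translation invariance replaces integration by parts: the difference quotients along
  \<open>b\<close> have integral zero and converge to \<open>b \<bullet> W x\<close>. Steps of
  length at most 1 keep all supports in one ball, so the Lipschitz constant of the test function
  gives an integrable majorant.\<close>

lemma integral_directional_derivative: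
  assumes tp: "test_pair K \<phi> W"
  shows "(\<integral>x. b \<bullet> W x \<partial>lborel) = 0"
proof -
  have cK: "compact K" and G: "!!x. GDERIV \<phi> x :> W x" and cW: "continuous_on UNIV W"
    using tp unfolding test_pair_def by auto
  have z: "!!x. x \<notin> K ==> \<phi> x = 0" using tp unfolding test_pair_def by auto
  have cphi: "continuous_on UNIV \<phi>" using test_pair_cont[OF tp] .
  have "bounded (W ` K)"
    using cK cW by (meson compact_continuous_image compact_imp_bounded continuous_on_subset subset_UNIV)
  then obtain M where M: "M > 0" "!!x. x \<in> K ==> norm (W x) <= M"
    unfolding bounded_pos by blast
  have M': "norm (W x) <= M" for x
    using M test_pair_grad_zero[OF tp] by (cases "x \<in> K") auto
  have lip: "norm (\<phi> y - \<phi> x) <= M * norm (y - x)" for x y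
  proof (rule differentiable_bound[where S=UNIV and f'="%x h. inner h (W x)"])
    show "!!x. x \<in> UNIV ==> (\<phi> has_derivative (%h. h \<bullet> W x)) (at x within UNIV)"
      using G unfolding gderiv_def by auto
    show "onorm (%h. h \<bullet> W x) <= M" for x
    proof (rule onorm_bound)
      show "0 <= M" using M by simp
      show "norm (h \<bullet> W x) <= M * norm h" for h
        using Cauchy_Schwarz_ineq2[of h "W x"] M'[of x]
        by (metis mult.commute mult_left_mono norm_ge_zero order_trans real_norm_def)
    qed
  qed auto
  obtain R where R: "!!x. x \<in> K ==> norm x <= R" "R > 0"
    using compact_imp_bounded[OF cK] unfolding bounded_pos by blast
  define t where "t n = 1 / real (Suc n)" for n
  have t: "t n > 0" "t n <= 1" for n unfolding t_def by auto
  have t0: "t \<longlonglongrightarrow> 0" unfolding t_def by (rule LIMSEQ_Suc[OF lim_1_over_n])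
  let ?D = "%n x. (\<phi> (t n *\<^sub>R b + x) - \<phi> x) / t n"
  have meas: "\<phi> \<in> borel_measurable borel" using cphi by (rule borel_measurable_continuous_onI)
  have intphi: "integrable lborel \<phi>"
    by (rule integrable_compact_supp[OF cK continuous_on_subset[OF cphi] z]) auto
  have Dint: "(\<integral>x. ?D n x \<partial>lborel) = 0" for n
  proof -
    have i2: "integrable lborel (%x. \<phi> (t n *\<^sub>R b + x))"
    proof (rule integrable_compact_supp[where K="(%x. - (t n *\<^sub>R b) + x) ` K"])
      show "compact ((%x. - (t n *\<^sub>R b) + x) ` K)" using cK by (rule compact_translation)
      show "continuous_on ((%x. - (t n *\<^sub>R b) + x) ` K) (%x. \<phi> (t n *\<^sub>R b + x))"
        by (intro continuous_on_compose2[OF cphi] continuous_intros) auto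
      show "\<phi> (t n *\<^sub>R b + x) = 0" if "x \<notin> (%x. - (t n *\<^sub>R b) + x) ` K" for x
      proof (rule z)
        show "t n *\<^sub>R b + x \<notin> K"
          using that imageI[of "t n *\<^sub>R b + x" K "%x. - (t n *\<^sub>R b) + x"] by auto
      qed
    qed
    have "(\<integral>x. \<phi> (t n *\<^sub>R b + x) - \<phi> x \<partial>lborel) = 0"
      using integral_translate[OF meas, of "t n *\<^sub>R b"] i2 intphi by simp
    then show ?thesis by simp
  qed
  have "(%n. \<integral>x. ?D n x \<partial>lborel) \<longlonglongrightarrow> (\<integral>x. b \<bullet> W x \<partial>lborel)"
  proof (rule integral_dominated_convergence[where w="%x. indicator (cball 0 (R + norm b)) x *\<^sub>R (M * norm b)"])
    show "(%x. b \<bullet> W x) \<in> borel_measurable lborel"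
      using cW by (auto intro!: borel_measurable_continuous_onI continuous_intros)
    show "!!n. (%x. ?D n x) \<in> borel_measurable lborel" using meas by measurable
    show "integrable lborel (%x. indicator (cball 0 (R + norm b)) x *\<^sub>R (M * norm b))"
      by (rule borel_integrable_compact) auto
    show "AE x in lborel. (%n. ?D n x) \<longlonglongrightarrow> b \<bullet> W x"
    proof (intro AE_I2)
      fix x
      have "(\<phi> has_derivative (%h. inner h (W x))) (at (x + 0 *\<^sub>R b))" using G[of x] unfolding gderiv_def by simp
      moreover have "((%s. x + s *\<^sub>R b) has_derivative (%s. s *\<^sub>R b)) (at (0::real))"
        by (auto intro!: derivative_eq_intros)
      ultimately have "((%s. \<phi> (x + s *\<^sub>R b)) has_derivative (%s. inner (s *\<^sub>R b) (W x))) (at 0)"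
        by (rule has_derivative_compose[rotated])
      then have "DERIV (%s. \<phi> (x + s *\<^sub>R b)) 0 :> b \<bullet> W x"
        by (simp add: has_field_derivative_def mult_commute_abs)
      then have "((%h. (\<phi> (x + h *\<^sub>R b) - \<phi> x) / h) \<longlongrightarrow> b \<bullet> W x) (at 0)"
        by (simp add: DERIV_def)
      then have "(%n. (\<phi> (x + t n *\<^sub>R b) - \<phi> x) / t n) \<longlonglongrightarrow> b \<bullet> W x"
        by (rule filterlim_compose) (use t0 t in \<open>auto simp: filterlim_at less_imp_neq[THEN not_sym]\<close>)
      then show "(%n. ?D n x) \<longlonglongrightarrow> b \<bullet> W x" by (simp add: add.commute)
    qed
    show "AE x in lborel. norm (?D n x) <= indicator (cball 0 (R + norm b)) x *\<^sub>R (M * norm b)" for n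
    proof (intro AE_I2)
      fix x :: 'a
      have "norm (?D n x) <= M * norm b"
        using lip[of "t n *\<^sub>R b + x" x] t[of n] by (simp add: field_simps)
      moreover have "?D n x = 0" if "norm x > R + norm b"
      proof -
        have "t n * norm b <= norm b" using t[of n] by (simp add: mult_left_le_one_le)
        then have "norm (t n *\<^sub>R b + x) > R"
          using norm_triangle_ineq4[of "t n *\<^sub>R b + x" "t n *\<^sub>R b"] that t[of n] by simp
        moreover have "norm x > R" using that norm_ge_zero[of b] by linarith
        ultimately show ?thesis using z R by (metis diff_self div_0 linorder_not_less)
      qed
      ultimately show "norm (?D n x) <= indicator (cball 0 (R + norm b)) x *\<^sub>R (M * norm b)"
        by (cases "norm x > R + norm b") (auto simp: indicator_def)
    qed
  qed
  then show ?thesis unfolding Dint using LIMSEQ_unique tendsto_const by blast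
qed

text \<open>Uniqueness of translation invariant measures: the image measure \<open>\<mu>\<close> is
  translation invariant because \<open>f\<close> is additive, and Fubini with the unit ball shows
  that it is proportional to \<open>lborel\<close>. The factor is 1, since \<open>f\<close> maps the
  ball onto itself.\<close>

lemma lborel_orthogonal_invariant:
  fixes f :: "'a::euclidean_space => 'a"
  assumes f: "orthogonal_transformation f"
  shows "distr lborel borel f = lborel"
proof -
  have lf: "linear f" and nf: "!!x. norm (f x) = norm x"
    using f by (auto simp: orthogonal_transformation)
  have cf: "continuous_on UNIV f"
    using lf by (simp add: linear_continuous_on linear_conv_bounded_linear)
  have mf[measurable]: "f \<in> borel_measurable borel"
    using cf by (rule borel_measurable_continuous_onI)
  obtain g where g: "orthogonal_transformation g" "!!x. f (g x) = x" "!!x. g (f x) = x"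
    using orthogonal_transformation_inv[OF f] orthogonal_transformation_bij[OF f]
    by (metis bij_inv_eq_iff)
  have emf: "emeasure lborel (cball (0::'a) r) ~= \<infinity>" for r :: real
    using emeasure_lborel_cball_finite[of "0::'a" r] by (simp add: less_top)
  define \<mu> where "\<mu> = distr lborel borel f"
  have sets\<mu>[measurable_cong, simp]: "sets \<mu> = sets borel" unfolding \<mu>_def by simp
  have space\<mu>[simp]: "space \<mu> = UNIV" unfolding \<mu>_def by simp
  have nn\<mu>: "(\<integral>\<^sup>+x. h x \<partial>\<mu>) = (\<integral>\<^sup>+x. h (f x) \<partial>lborel)" if [measurable]: "h \<in> borel_measurable borel" for h
    unfolding \<mu>_def by (rule nn_integral_distr) auto
  have tr: "(\<integral>\<^sup>+x. h (c + x) \<partial>lborel) = (\<integral>\<^sup>+x. h x \<partial>lborel)"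
    if [measurable]: "h \<in> borel_measurable borel" for h and c :: 'a
  proof -
    have "(\<integral>\<^sup>+x. h x \<partial>lborel) = (\<integral>\<^sup>+x. h x \<partial>distr lborel borel ((+) c))"
      by (simp add: lborel_distr_plus)
    also have "... = (\<integral>\<^sup>+x. h (c + x) \<partial>lborel)" by (rule nn_integral_distr) auto
    finally show ?thesis by simp
  qed
  have tr\<mu>: "(\<integral>\<^sup>+x. h (c + x) \<partial>\<mu>) = (\<integral>\<^sup>+x. h x \<partial>\<mu>)"
    if [measurable]: "h \<in> borel_measurable borel" for h c
  proof -
    have "(\<integral>\<^sup>+x. h (c + x) \<partial>\<mu>) = (\<integral>\<^sup>+x. h (f (g c + x)) \<partial>lborel)"
      by (subst nn\<mu>) (auto simp: g linear_add[OF lf])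
    also have "... = (\<integral>\<^sup>+x. h (f x) \<partial>lborel)" by (rule tr) measurable
    also have "... = (\<integral>\<^sup>+x. h x \<partial>\<mu>)" by (rule nn\<mu>[symmetric]) measurable
    finally show ?thesis .
  qed
  have em: "emeasure \<mu> (cball 0 r) = emeasure lborel (cball (0::'a) r)" for r
  proof -
    have "f -` cball 0 r = cball 0 r" using nf by auto
    then show ?thesis unfolding \<mu>_def by (simp add: emeasure_distr)
  qed
  have sf: "sigma_finite_measure \<mu>"
  proof
    show "\<exists>A. countable A \<and> A \<subseteq> sets \<mu> \<and> \<Union>A = space \<mu> \<and> (\<forall>a\<in>A. emeasure \<mu> a ~= \<infinity>)"
    proof (intro exI conjI ballI)
      show "countable (range (%n::nat. cball (0::'a) (real n)))" by simp
      show "\<Union>(range (%n::nat. cball (0::'a) (real n))) = space \<mu>"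
        by (auto simp: real_arch_simple)
      show "emeasure \<mu> a ~= \<infinity>" if "a \<in> range (%n::nat. cball (0::'a) (real n))" for a
        using that em emf by auto
    qed auto
  qed
  interpret L: sigma_finite_measure "lborel :: 'a measure" by (rule lborel.sigma_finite_measure_axioms)
  interpret M: sigma_finite_measure \<mu> by (rule sf)
  interpret P: pair_sigma_finite \<mu> "lborel :: 'a measure" ..
  let ?B = "cball (0::'a) 1"
  have Bm[measurable]: "?B \<in> sets borel" by simp
  have setsp: "sets (\<mu> \<Otimes>\<^sub>M lborel) = sets ((borel :: 'a measure) \<Otimes>\<^sub>M (borel :: 'a measure))"
    by (rule sets_pair_measure_cong) auto
  \<comment> \<open>A double integral of the indicators of \<open>?B\<close> and \<open>A\<close> is
    translated in one variable, then in the other, which exchanges the two measures. The symmetry of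
    the ball absorbs the sign.\<close>
  have key: "emeasure \<mu> A * emeasure lborel ?B = emeasure lborel A * emeasure \<mu> ?B"
    if [measurable]: "A \<in> sets borel" for A
  proof -
    have "emeasure \<mu> A * emeasure lborel ?B
        = (\<integral>\<^sup>+y. indicator ?B y * (\<integral>\<^sup>+x. indicator A x \<partial>\<mu>) \<partial>lborel)"
      by (simp add: nn_integral_cmult_indicator mult.commute[of "indicator ?B _"])
    also have "... = (\<integral>\<^sup>+y. indicator ?B y * (\<integral>\<^sup>+x. indicator A (y + x) \<partial>\<mu>) \<partial>lborel)"
      by (subst tr\<mu>) auto
    also have "... = (\<integral>\<^sup>+y. (\<integral>\<^sup>+x. indicator ?B y * indicator A (y + x) \<partial>\<mu>) \<partial>lborel)"
      by (subst nn_integral_cmult[symmetric]) auto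
    also have "... = (\<integral>\<^sup>+x. (\<integral>\<^sup>+y. indicator ?B y * indicator A (y + x) \<partial>lborel) \<partial>\<mu>)"
      by (rule P.Fubini'; subst measurable_cong_sets[OF setsp refl]; unfold split_beta'; measurable)
    also have "... = (\<integral>\<^sup>+x. (\<integral>\<^sup>+y. indicator ?B ((- x) + y) * indicator A y \<partial>lborel) \<partial>\<mu>)"
    proof (rule nn_integral_cong)
      fix x
      have "(\<integral>\<^sup>+y. indicator ?B ((- x) + (x + y)) * indicator A (x + y) \<partial>lborel)
          = (\<integral>\<^sup>+y. indicator ?B ((- x) + y) * indicator A y \<partial>lborel)"
        by (rule tr) measurable
      then show "(\<integral>\<^sup>+y. indicator ?B y * indicator A (y + x) \<partial>lborel)
          = (\<integral>\<^sup>+y. indicator ?B ((- x) + y) * indicator A y \<partial>lborel)" by (simp add: add.commute)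
    qed
    also have "... = (\<integral>\<^sup>+y. (\<integral>\<^sup>+x. indicator ?B ((- x) + y) * indicator A y \<partial>\<mu>) \<partial>lborel)"
      by (rule P.Fubini'[symmetric]; subst measurable_cong_sets[OF setsp refl]; unfold split_beta'; measurable)
    also have "... = (\<integral>\<^sup>+y. (\<integral>\<^sup>+x. indicator ?B ((- y) + x) \<partial>\<mu>) * indicator A y \<partial>lborel)"
      by (subst nn_integral_multc[symmetric])
        (auto intro!: nn_integral_cong simp: indicator_def norm_minus_commute)
    also have "... = (\<integral>\<^sup>+y. (\<integral>\<^sup>+x. indicator ?B x \<partial>\<mu>) * indicator A y \<partial>lborel)"
      by (subst tr\<mu>) auto
    also have "... = emeasure lborel A * emeasure \<mu> ?B"
      by (subst nn_integral_cmult) (auto simp: mult.commute)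
    finally show ?thesis .
  qed
  have fin: "emeasure lborel ?B ~= \<infinity>" using emf .
  have pos: "emeasure lborel ?B ~= 0"
  proof -
    have "emeasure lborel (ball (0::'a) 1) ~= 0"
      using open_not_negligible[of "ball (0::'a) 1"] by (simp add: negligible_iff_null_sets null_sets_completion_iff null_sets_def)
    moreover have "emeasure lborel (ball (0::'a) 1) <= emeasure lborel ?B" by (rule emeasure_mono) auto
    ultimately show ?thesis by (metis le_zero_eq)
  qed
  have "emeasure \<mu> A = emeasure lborel A" if "A \<in> sets \<mu>" for A
    using key[of A] em[of 1] fin pos that
    by (metis ennreal_mult_cancel_left infinity_ennreal_def mult.commute sets\<mu>)
  then show ?thesis unfolding \<mu>_def[symmetric] by (intro measure_eqI) auto
qed

lemma integral_isometry:
  fixes f :: "'a::euclidean_space => 'a" and h :: "'a => real"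
  assumes f: "orthogonal_transformation f" and h: "h \<in> borel_measurable borel"
  shows "(\<integral>x. h (c + f x) \<partial>lborel) = (\<integral>x. h x \<partial>lborel)"
proof -
  have mf[measurable]: "f \<in> borel_measurable borel"
    using f by (intro borel_measurable_continuous_onI linear_continuous_on)
      (simp add: orthogonal_transformation linear_conv_bounded_linear)
  note h[measurable]
  have "(\<integral>x. h x \<partial>lborel) = (\<integral>x. h (c + x) \<partial>distr lborel borel f)"
    by (simp add: lborel_orthogonal_invariant[OF f] integral_translate)
  also have "... = (\<integral>x. h (c + f x) \<partial>lborel)" by (rule integral_distr) measurable
  finally show ?thesis by simp
qed

text \<open>\<open>F\<close> is the distributional Laplacian of the C^1 function \<open>w\<close>.
  Carrying the gradient and the Laplacian as arguments lets the rules below be chained like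
  differentiation rules.\<close>

definition wl :: "'a::euclidean_space set => ('a => real) => ('a => 'a) => ('a => real) => bool" where
  "wl S w V F \<longleftrightarrow> open S \<and> (\<forall>x\<in>S. GDERIV w x :> V x) \<and> continuous_on S V \<and> continuous_on S F \<and>
     (\<forall>K \<phi> W. test_pair K \<phi> W \<and> K \<subseteq> S --> (\<integral>x. V x \<bullet> W x + F x * \<phi> x \<partial>lborel) = 0)"

lemma wlD:
  assumes "wl S w V F"
  shows "open S" "!!x. x \<in> S ==> GDERIV w x :> V x" "continuous_on S V" "continuous_on S F"
    "!!K \<phi> W. test_pair K \<phi> W ==> K \<subseteq> S ==> (\<integral>x. V x \<bullet> W x + F x * \<phi> x \<partial>lborel) = 0"
  using assms unfolding wl_def by auto

lemma wl_cont: "wl S w V F ==> continuous_on S w"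
  by (intro continuous_at_imp_continuous_on ballI) (auto dest: wlD(2) intro: GDERIV_isCont)

lemma test_pair_integrable:
  assumes tp: "test_pair K \<phi> W" and KS: "K \<subseteq> S" and c: "continuous_on S V" "continuous_on S F"
  shows "integrable lborel (%x. V x \<bullet> W x)" "integrable lborel (%x. F x * \<phi> x)"
proof -
  have cK: "compact K" "continuous_on K W" "continuous_on K \<phi>"
    using tp test_pair_cont[OF tp] by (auto simp: test_pair_def intro: continuous_on_subset)
  have cV: "continuous_on K V" "continuous_on K F" using c KS continuous_on_subset by auto
  show "integrable lborel (%x. V x \<bullet> W x)"
    by (rule integrable_compact_supp[OF cK(1)])
      (use test_pair_grad_zero[OF tp] in \<open>auto intro!: continuous_intros cK cV\<close>)
  show "integrable lborel (%x. F x * \<phi> x)"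
    by (rule integrable_compact_supp[OF cK(1)])
      (use tp in \<open>auto simp: test_pair_def intro!: continuous_intros cK cV\<close>)
qed

lemma wl_mono:
  assumes "wl S w V F" "open T" "T \<subseteq> S" shows "wl T w V F"
  using assms unfolding wl_def by (meson continuous_on_subset order_trans subset_iff)

lemma wl_cong:
  assumes w: "wl S w V F" and eq: "!!x. x \<in> S ==> w' x = w x" "!!x. x \<in> S ==> V' x = V x" "!!x. x \<in> S ==> F' x = F x"
  shows "wl S w' V' F'"
  unfolding wl_def
proof (intro conjI ballI allI impI)
  show "open S" using w by (rule wlD)
  show "GDERIV w' x :> V' x" if "x \<in> S" for x
    using GDERIV_cong_open[OF wlD(2)[OF w that] wlD(1)[OF w] that, of w'] eq that by simp
  show "continuous_on S V'" "continuous_on S F'"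
    using wlD(3,4)[OF w] eq by (auto cong: continuous_on_cong)
  fix K \<phi> W assume a: "test_pair K \<phi> W \<and> K \<subseteq> S"
  have e: "V' x \<bullet> W x + F' x * \<phi> x = V x \<bullet> W x + F x * \<phi> x" for x
  proof (cases "x \<in> K")
    case True then show ?thesis using eq a by auto
  next
    case False then show ?thesis using a test_pair_grad_zero[of K \<phi> W x] by (auto simp: test_pair_def)
  qed
  show "(\<integral>x. V' x \<bullet> W x + F' x * \<phi> x \<partial>lborel) = 0"
    by (simp only: e wlD(5)[OF w conjunct1[OF a] conjunct2[OF a]])
qed

lemma wl_inner: "wl UNIV (%x. x \<bullet> e) (%x. e) (%x. 0)"
  unfolding wl_def using integral_directional_derivative
  by (auto simp: gderiv_def intro!: derivative_eq_intros)

lemma wl_const: "wl UNIV (%x. c) (%x. 0) (%x. 0)"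
  unfolding wl_def by (auto intro: GDERIV_const)

lemma wl_add:
  assumes "wl S w1 V1 F1" "wl S w2 V2 F2"
  shows "wl S (%x. w1 x + w2 x) (%x. V1 x + V2 x) (%x. F1 x + F2 x)"
  unfolding wl_def
proof (intro conjI ballI allI impI)
  note 1 = wlD[OF assms(1)] and 2 = wlD[OF assms(2)]
  show "open S" by (rule 1)
  show "GDERIV (%x. w1 x + w2 x) x :> V1 x + V2 x" if "x \<in> S" for x
    using 1(2)[OF that] 2(2)[OF that] by (rule GDERIV_add)
  show "continuous_on S (%x. V1 x + V2 x)" "continuous_on S (%x. F1 x + F2 x)"
    by (intro continuous_intros 1 2)+
  fix K \<phi> W assume a: "test_pair K \<phi> W \<and> K \<subseteq> S"
  then have tp: "test_pair K \<phi> W" "K \<subseteq> S" by auto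
  note i1 = test_pair_integrable[OF tp 1(3,4)] and i2 = test_pair_integrable[OF tp 2(3,4)]
  have "(\<integral>x. (V1 x + V2 x) \<bullet> W x + (F1 x + F2 x) * \<phi> x \<partial>lborel)
      = (\<integral>x. (V1 x \<bullet> W x + F1 x * \<phi> x) + (V2 x \<bullet> W x + F2 x * \<phi> x) \<partial>lborel)"
    by (simp add: algebra_simps inner_add_left)
  also have "... = (\<integral>x. (V1 x \<bullet> W x + F1 x * \<phi> x) \<partial>lborel) + (\<integral>x. (V2 x \<bullet> W x + F2 x * \<phi> x) \<partial>lborel)"
    by (rule Bochner_Integration.integral_add) (intro Bochner_Integration.integrable_add i1 i2)+
  finally show "(\<integral>x. (V1 x + V2 x) \<bullet> W x + (F1 x + F2 x) * \<phi> x \<partial>lborel) = 0"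
    using 1(5)[OF tp] 2(5)[OF tp] by simp
qed

text \<open>For the product and chain rules a factor is moved into the test function. It is only
  C^1, and only near the support, so the product has to be extended by zero.\<close>

lemma test_pair_mult:
  assumes tp: "test_pair K \<phi> W" and KS: "K \<subseteq> S" "open S"
    and h: "!!x. x \<in> S ==> GDERIV h x :> H x" and cH: "continuous_on S H"
  shows "test_pair K (%x. h x * \<phi> x) (%x. h x *\<^sub>R W x + \<phi> x *\<^sub>R H x)"
  unfolding test_pair_def
proof (intro conjI allI impI)
  show cK: "compact K" using tp by (simp add: test_pair_def)
  have opK: "open (-K)" using compact_imp_closed[OF cK] by blast
  have zero: "\<phi> x = 0" "W x = 0" if "x \<in> -K" for x
    using that tp test_pair_grad_zero[OF tp] by (auto simp: test_pair_def)
  have ch: "continuous_on S h"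
    by (intro continuous_at_imp_continuous_on ballI) (auto dest: h intro: GDERIV_isCont)
  show "h x * \<phi> x = 0" if "x \<notin> K" for x using that zero by auto
  show "GDERIV (%x. h x * \<phi> x) x :> h x *\<^sub>R W x + \<phi> x *\<^sub>R H x" for x
  proof (cases "x \<in> S")
    case True
    then show ?thesis using GDERIV_mult[OF h[OF True]] tp by (auto simp: test_pair_def)
  next
    case False
    then have "x \<in> -K" using KS by auto
    moreover have "GDERIV (%x. h x * \<phi> x) x :> 0"
      by (rule GDERIV_cong_open[OF GDERIV_const[of 0] opK]) (use zero \<open>x \<in> -K\<close> in auto)
    ultimately show ?thesis using zero by simp
  qed
  have "continuous_on (S \<union> -K) (%x. h x *\<^sub>R W x + \<phi> x *\<^sub>R H x)"
  proof (rule continuous_on_open_Un[OF KS(2) opK])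
    show "continuous_on S (%x. h x *\<^sub>R W x + \<phi> x *\<^sub>R H x)"
      using tp by (intro continuous_intros ch cH test_pair_cont[OF tp])
        (auto simp: test_pair_def intro: continuous_on_subset)
    have "continuous_on (-K) (%x. 0 :: 'a)" by simp
    then show "continuous_on (-K) (%x. h x *\<^sub>R W x + \<phi> x *\<^sub>R H x)"
      by (rule continuous_on_eq) (use zero in auto)
  qed
  moreover have "S \<union> -K = UNIV" using KS by auto
  ultimately show "continuous_on UNIV (%x. h x *\<^sub>R W x + \<phi> x *\<^sub>R H x)" by simp
qed

text \<open>Test the second equation with \<open>w1 x * \<phi> x\<close>, the first with
  \<open>w2 x * \<phi> x\<close>, and add: the gradients of the new factors produce the cross
  term.\<close>

lemma wl_mult:
  assumes "wl S w1 V1 F1" "wl S w2 V2 F2"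
  shows "wl S (%x. w1 x * w2 x) (%x. w1 x *\<^sub>R V2 x + w2 x *\<^sub>R V1 x)
    (%x. w1 x * F2 x + w2 x * F1 x + 2 * (V1 x \<bullet> V2 x))"
  unfolding wl_def
proof (intro conjI ballI allI impI)
  note 1 = wlD[OF assms(1)] and 2 = wlD[OF assms(2)]
  note c = wl_cont[OF assms(1)] wl_cont[OF assms(2)]
  show "open S" by (rule 1)
  show "GDERIV (%x. w1 x * w2 x) x :> w1 x *\<^sub>R V2 x + w2 x *\<^sub>R V1 x" if "x \<in> S" for x
    using 1(2)[OF that] 2(2)[OF that] by (rule GDERIV_mult)
  show "continuous_on S (%x. w1 x *\<^sub>R V2 x + w2 x *\<^sub>R V1 x)"
    "continuous_on S (%x. w1 x * F2 x + w2 x * F1 x + 2 * (V1 x \<bullet> V2 x))"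
    by (intro continuous_intros 1 2 c)+
  fix K \<phi> W assume a: "test_pair K \<phi> W \<and> K \<subseteq> S"
  then have tp: "test_pair K \<phi> W" and KS: "K \<subseteq> S" by auto
  note t1 = test_pair_mult[OF tp KS 1(1) 1(2) 1(3)] and t2 = test_pair_mult[OF tp KS 2(1) 2(2) 2(3)]
  have i1: "integrable lborel (%x. V2 x \<bullet> (w1 x *\<^sub>R W x + \<phi> x *\<^sub>R V1 x) + F2 x * (w1 x * \<phi> x))"
    by (intro Bochner_Integration.integrable_add test_pair_integrable[OF t1 KS 2(3,4)])
  have i2: "integrable lborel (%x. V1 x \<bullet> (w2 x *\<^sub>R W x + \<phi> x *\<^sub>R V2 x) + F1 x * (w2 x * \<phi> x))"
    by (intro Bochner_Integration.integrable_add test_pair_integrable[OF t2 KS 1(3,4)])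
  have "(\<integral>x. (w1 x *\<^sub>R V2 x + w2 x *\<^sub>R V1 x) \<bullet> W x + (w1 x * F2 x + w2 x * F1 x + 2 * (V1 x \<bullet> V2 x)) * \<phi> x \<partial>lborel)
     = (\<integral>x. (V2 x \<bullet> (w1 x *\<^sub>R W x + \<phi> x *\<^sub>R V1 x) + F2 x * (w1 x * \<phi> x)) +
         (V1 x \<bullet> (w2 x *\<^sub>R W x + \<phi> x *\<^sub>R V2 x) + F1 x * (w2 x * \<phi> x)) \<partial>lborel)"
    by (rule Bochner_Integration.integral_cong)
      (auto simp: algebra_simps inner_add_left inner_add_right inner_commute)
  also have "... = 0" unfolding Bochner_Integration.integral_add[OF i1 i2]
    using 2(5)[OF t1 KS] 1(5)[OF t2 KS] by simp
  finally show "(\<integral>x. (w1 x *\<^sub>R V2 x + w2 x *\<^sub>R V1 x) \<bullet> W x + (w1 x * F2 x + w2 x * F1 x + 2 * (V1 x \<bullet> V2 x)) * \<phi> x \<partial>lborel) = 0" .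
qed

lemma wl_cmult:
  assumes "wl S w V F" shows "wl S (%x. c * w x) (%x. c *\<^sub>R V x) (%x. c * F x)"
  using wl_mult[OF wl_mono[OF wl_const[of c] wlD(1)[OF assms]] assms] by simp

lemma wl_minus:
  assumes "wl S w V F" shows "wl S (%x. - w x) (%x. - V x) (%x. - F x)"
  using wl_cmult[OF assms, of "-1"] by simp

lemma wl_diff:
  assumes "wl S w1 V1 F1" "wl S w2 V2 F2"
  shows "wl S (%x. w1 x - w2 x) (%x. V1 x - V2 x) (%x. F1 x - F2 x)"
  using wl_add[OF assms(1) wl_minus[OF assms(2)]] by simp

lemma wl_sum:
  assumes "finite I" "open S" "!!i. i \<in> I ==> wl S (w i) (V i) (F i)"
  shows "wl S (%x. \<Sum>i\<in>I. w i x) (%x. \<Sum>i\<in>I. V i x) (%x. \<Sum>i\<in>I. F i x)"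
  using assms
proof (induction I rule: finite_induct)
  case empty then show ?case using wl_mono[OF wl_const] by simp
next
  case (insert i I) then show ?case using wl_add[of S "w i" "V i" "F i"] by simp
qed

text \<open>The equation of \<open>w\<close> is tested with \<open>g' (w x) * \<phi> x\<close>; the
  gradient of the first factor yields the quadratic term.\<close>

lemma wl_compose:
  assumes w: "wl S w V F"
    and g: "!!x. x \<in> S ==> DERIV g (w x) :> g' (w x)"
    and g': "!!x. x \<in> S ==> DERIV g' (w x) :> g'' (w x)"
    and c: "continuous_on S (%x. g'' (w x))"
  shows "wl S (%x. g (w x)) (%x. g' (w x) *\<^sub>R V x) (%x. g' (w x) * F x + g'' (w x) * (norm (V x))^2)"
  unfolding wl_def
proof (intro conjI ballI allI impI)
  note 1 = wlD[OF w]
  note c1 = wl_cont[OF w]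
  show "open S" by (rule 1)
  have gd': "GDERIV (%x. g' (w x)) x :> g'' (w x) *\<^sub>R V x" if "x \<in> S" for x
    using GDERIV_DERIV_compose[OF 1(2)[OF that] g'[OF that]] .
  have cg': "continuous_on S (%x. g' (w x))"
    by (intro continuous_at_imp_continuous_on ballI) (auto dest: gd' intro: GDERIV_isCont)
  show "GDERIV (%x. g (w x)) x :> g' (w x) *\<^sub>R V x" if "x \<in> S" for x
    using GDERIV_DERIV_compose[OF 1(2)[OF that] g[OF that]] .
  show "continuous_on S (%x. g' (w x) *\<^sub>R V x)"
    "continuous_on S (%x. g' (w x) * F x + g'' (w x) * (norm (V x))^2)"
    by (intro continuous_intros 1 c c1 cg')+
  have cgV: "continuous_on S (%x. g'' (w x) *\<^sub>R V x)" by (intro continuous_intros 1 c)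
  fix K \<phi> W assume a: "test_pair K \<phi> W \<and> K \<subseteq> S"
  then have tp: "test_pair K \<phi> W" and KS: "K \<subseteq> S" by auto
  note t1 = test_pair_mult[OF tp KS 1(1) gd' cgV]
  have "(\<integral>x. (g' (w x) *\<^sub>R V x) \<bullet> W x + (g' (w x) * F x + g'' (w x) * (norm (V x))^2) * \<phi> x \<partial>lborel)
     = (\<integral>x. V x \<bullet> (g' (w x) *\<^sub>R W x + \<phi> x *\<^sub>R g'' (w x) *\<^sub>R V x) + F x * (g' (w x) * \<phi> x) \<partial>lborel)"
    by (rule Bochner_Integration.integral_cong)
      (auto simp: algebra_simps inner_add_left inner_add_right power2_norm_eq_inner)
  also have "... = 0" using 1(5)[OF t1 KS] .
  finally show "(\<integral>x. (g' (w x) *\<^sub>R V x) \<bullet> W x + (g' (w x) * F x + g'' (w x) * (norm (V x))^2) * \<phi> x \<partial>lborel) = 0" .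
qed

lemma wl_norm_square: "wl UNIV (%x. (norm (x - c))^2) (%x. 2 *\<^sub>R (x - c)) (%x::'a::euclidean_space. 2 * real DIM('a))"
proof -
  have lin: "wl UNIV (%x. x \<bullet> b - c \<bullet> b) (%x. b) (%x. 0)" for b :: 'a
    using wl_diff[OF wl_inner[of b] wl_const[of "c \<bullet> b"]] by simp
  have "wl UNIV (%x. \<Sum>b\<in>Basis. (x \<bullet> b - c \<bullet> b) * (x \<bullet> b - c \<bullet> b))
      (%x. \<Sum>b\<in>Basis. (x \<bullet> b - c \<bullet> b) *\<^sub>R b + (x \<bullet> b - c \<bullet> b) *\<^sub>R b)
      (%x::'a. \<Sum>b\<in>Basis. (x \<bullet> b - c \<bullet> b) * 0 + (x \<bullet> b - c \<bullet> b) * 0 + 2 * (b \<bullet> b))"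
    by (rule wl_sum[OF finite_Basis open_UNIV wl_mult[OF lin lin]])
  then show ?thesis
  proof (rule wl_cong)
    fix x :: 'a
    show "(norm (x - c))^2 = (\<Sum>b\<in>Basis. (x \<bullet> b - c \<bullet> b) * (x \<bullet> b - c \<bullet> b))"
      unfolding power2_norm_eq_inner by (subst euclidean_inner) (simp add: inner_diff_left)
    have "2 *\<^sub>R (x - c) = (\<Sum>b\<in>Basis. (2 *\<^sub>R (x - c) \<bullet> b) *\<^sub>R b)"
      by (rule euclidean_representation[symmetric])
    also have "... = (\<Sum>b\<in>Basis. (x \<bullet> b - c \<bullet> b) *\<^sub>R b + (x \<bullet> b - c \<bullet> b) *\<^sub>R b)"
      by (rule sum.cong) (auto simp: inner_diff_left algebra_simps scaleR_add_left[symmetric])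
    finally show "2 *\<^sub>R (x - c) = (\<Sum>b\<in>Basis. (x \<bullet> b - c \<bullet> b) *\<^sub>R b + (x \<bullet> b - c \<bullet> b) *\<^sub>R b)" .
    show "2 * real DIM('a) = (\<Sum>b\<in>Basis. (x \<bullet> b - c \<bullet> b) * 0 + (x \<bullet> b - c \<bullet> b) * 0 + 2 * (b \<bullet> (b::'a)))"
      by simp
  qed
qed

text \<open>Stated for involutions, because the isometries to be used are reflections. Such an
  \<open>f\<close> is its own inverse and its own adjoint, so gradients transform by
  \<open>f\<close> itself.\<close>

lemma wl_isometry:
  fixes f :: "'a::euclidean_space => 'a"
  assumes w: "wl S w V F" and f: "orthogonal_transformation f" and ff: "!!x. f (f x) = x"
  shows "wl ((%x. c + f x) -` S) (%x. w (c + f x)) (%x. f (V (c + f x))) (%x. F (c + f x))"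
  unfolding wl_def
proof (intro conjI ballI allI impI)
  note 1 = wlD[OF w]
  let ?g = "%x. c + f x"
  let ?k = "%y. f (y - c)"
  have lf: "linear f" and fi: "!!x y. f x \<bullet> f y = x \<bullet> y"
    using f unfolding orthogonal_transformation_def by auto
  have bf: "bounded_linear f" using lf by (simp add: linear_conv_bounded_linear)
  have adj: "f x \<bullet> y = x \<bullet> f y" for x y using fi[of x "f y"] ff by simp
  have cf: "continuous_on T f" for T using bf by (rule linear_continuous_on)
  have cg: "continuous_on T ?g" for T by (intro continuous_intros cf)
  have ck: "continuous_on T ?k" for T
    by (intro continuous_on_compose2[OF cf[of UNIV]] continuous_intros) auto
  have gk: "?g (?k y) = y" "?k (?g x) = x" for x y by (auto simp: ff)
  show "open (?g -` S)" by (rule open_vimage[OF 1(1) cg])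
  have dg: "(?g has_derivative f) (at x)" for x
    using has_derivative_add[OF has_derivative_const bounded_linear_imp_has_derivative[OF bf], of c] by simp
  have dk: "(?k has_derivative f) (at y)" for y
  proof -
    have "((%y. y - c) has_derivative (%h. h)) (at y)" using has_derivative_diff[OF has_derivative_ident has_derivative_const, of c "at y"] by simp
    from bounded_linear.has_derivative[OF bf this] show ?thesis .
  qed
  show "GDERIV (%x. w (c + f x)) x :> f (V (c + f x))" if "x \<in> ?g -` S" for x
  proof -
    have "(w has_derivative (%h. h \<bullet> V (?g x))) (at (?g x))" using 1(2)[of "?g x"] that by (simp add: gderiv_def)
    from has_derivative_compose[OF dg this] show ?thesis by (simp add: gderiv_def adj)
  qed
  show "continuous_on (?g -` S) (%x. f (V (c + f x)))"
    by (intro continuous_on_compose2[OF cf[of UNIV]] continuous_on_compose2[OF 1(3)] cg) auto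
  show "continuous_on (?g -` S) (%x. F (c + f x))"
    by (intro continuous_on_compose2[OF 1(4)] cg) auto
  fix K \<phi> W assume a: "test_pair K \<phi> W \<and> K \<subseteq> ?g -` S"
  then have tp: "test_pair K \<phi> W" and KS: "K \<subseteq> ?g -` S" by auto
  have tp': "test_pair (?g ` K) (%y. \<phi> (?k y)) (%y. f (W (?k y)))"
    unfolding test_pair_def
  proof (intro conjI allI impI)
    show "compact (?g ` K)" using tp cg by (auto simp: test_pair_def intro!: compact_continuous_image)
    show "GDERIV (%y. \<phi> (?k y)) y :> f (W (?k y))" for y
    proof -
      have "(\<phi> has_derivative (%h. h \<bullet> W (?k y))) (at (?k y))" using tp by (simp add: gderiv_def test_pair_def)
      from has_derivative_compose[OF dk this] show ?thesis by (simp add: gderiv_def adj)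
    qed
    have "continuous_on UNIV W" using tp by (simp add: test_pair_def)
    from continuous_on_compose2[OF cf[of UNIV] continuous_on_compose2[OF this ck[of UNIV]]]
    show "continuous_on UNIV (%y. f (W (?k y)))" by simp
    show "\<phi> (?k y) = 0" if "y \<notin> ?g ` K" for y
    proof -
      have "?k y \<notin> K" using that gk(1)[of y] by (metis image_eqI)
      then show ?thesis using tp by (simp add: test_pair_def)
    qed
  qed
  have gKS: "?g ` K \<subseteq> S" using KS by auto
  let ?h = "%y. V y \<bullet> f (W (?k y)) + F y * \<phi> (?k y)"
  have ih: "integrable lborel ?h"
    by (intro Bochner_Integration.integrable_add test_pair_integrable[OF tp' gKS 1(3,4)])
  have "(\<integral>x. f (V (?g x)) \<bullet> W x + F (?g x) * \<phi> x \<partial>lborel) = (\<integral>x. ?h (?g x) \<partial>lborel)"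
    by (rule Bochner_Integration.integral_cong) (auto simp: ff adj)
  also have "... = (\<integral>y. ?h y \<partial>lborel)"
    by (rule integral_isometry[OF f]) (use borel_measurable_integrable[OF ih] in simp)
  also have "... = 0" using 1(5)[OF tp' gKS] .
  finally show "(\<integral>x. f (V (?g x)) \<bullet> W x + F (?g x) * \<phi> x \<partial>lborel) = 0" .
qed

section \<open>The maximum principle for functions with a continuous weak Laplacian\<close>

lemma GDERIV_local_max_zero:
  assumes "GDERIV w x :> V" "0 < r" "!!y. y \<in> ball x r ==> w y <= w x"
  shows "V = 0"
proof -
  have "(%h. h \<bullet> V) = (%h. 0)"
    by (rule differential_zero_maxmin[of x "ball x r" w]) (use assms in \<open>auto simp: gderiv_def\<close>)
  then have "V \<bullet> V = 0" by metis
  then show ?thesis by simp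
qed

text \<open>The square of the positive part is C^1 across zero, so it is admissible in a test
  function; the positive part itself is not.\<close>

lemma pos_part_square_deriv:
  "DERIV (%t::real. (max t 0)^2) t :> 2 * max t 0"
proof (cases "t = 0")
  case False
  show ?thesis
  proof (cases "t > 0")
    case True
    have "DERIV (%t::real. t^2) t :> 2 * max t 0"
      using True by (auto intro!: derivative_eq_intros)
    then show ?thesis
      by (rule has_field_derivative_transform_within_open[where S="{0<..}"]) (use True in auto)
  next
    case neg: False
    have "DERIV (%t::real. 0) t :> 2 * max t 0"
      using neg by (auto intro!: derivative_eq_intros)
    then show ?thesis
      by (rule has_field_derivative_transform_within_open[where S="{..<0}"]) (use neg False in auto)
  qed
next
  case True
  have "((%h. ((max (0 + h) 0)^2 - (max 0 0)^2) / h) \<longlongrightarrow> (0::real)) (at 0)"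
  proof (rule Lim_null_comparison[where g="%h. \<bar>h\<bar>"])
    show "\<forall>\<^sub>F x in at (0::real). norm (((max (0 + x) 0)^2 - (max 0 0)^2) / x) <= \<bar>x\<bar>"
      by (rule always_eventually) (auto simp: max_def power2_eq_square)
    show "((%h::real. \<bar>h\<bar>) \<longlongrightarrow> 0) (at 0)" by (auto intro!: tendsto_eq_intros)
  qed
  then show ?thesis using True by (simp add: DERIV_def)
qed

text \<open>The test function is the square of the positive part of
  \<open>w x - w x0 - \<eta> |x - x0|\<^sup>2 + \<eta> r\<^sup>2 / 2\<close>, which is supported in the ball.\<close>

lemma wl_local_max:
  assumes w: "wl S w V F" and x0: "x0 \<in> S" and r: "0 < r" and mx: "!!y. y \<in> ball x0 r ==> w y <= w x0"
  shows "F x0 <= 0"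
proof (rule ccontr)
  assume neg: "\<not> F x0 <= 0"
  note 1 = wlD[OF w]
  obtain r1 where r1: "r1 > 0" "ball x0 r1 \<subseteq> S" using 1(1) x0 open_contains_ball by blast
  have "isCont F x0" using 1(1,4) x0 continuous_on_eq_continuous_at by blast
  then obtain r2 where r2: "r2 > 0" "!!y. dist y x0 < r2 ==> \<bar>F y - F x0\<bar> < F x0 / 2"
    using neg unfolding continuous_at_eps_delta dist_real_def by (metis half_gt_zero not_le)
  define s where "s = min r (min r1 r2)"
  have s: "s > 0" "ball x0 s \<subseteq> S" "!!y. y \<in> ball x0 s ==> w y <= w x0"
    "!!y. y \<in> ball x0 s ==> F y > F x0 / 2"
  proof -
    show "s > 0" using r r1 r2 unfolding s_def by auto
    show "ball x0 s \<subseteq> S" using r1 unfolding s_def by auto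
    show "!!y. y \<in> ball x0 s ==> w y <= w x0" using mx unfolding s_def by auto
    show "F y > F x0 / 2" if "y \<in> ball x0 s" for y
    proof -
      have "dist y x0 < r2" using that unfolding s_def by (simp add: dist_commute)
      from r2(2)[OF this] show ?thesis by linarith
    qed
  qed
  \<comment> \<open>The added paraboloid then has Laplacian \<open>F x0 / 4\<close>, while
    \<open>F\<close> exceeds \<open>F x0 / 2\<close> on the ball, so the Laplacian of
    \<open>k\<close> stays positive.\<close>
  define \<eta> where "\<eta> = F x0 / (8 * real DIM('a))"
  have dpos: "real DIM('a) > 0" by simp
  have \<eta>: "\<eta> > 0" "2 * real DIM('a) * \<eta> = F x0 / 4" using neg dpos unfolding \<eta>_def by (auto simp: field_simps)
  let ?B = "ball x0 s"
  let ?K = "%x. w x - (\<eta> * (norm (x - x0))^2 + (w x0 - \<eta> * s^2 / 2))"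
  have wB: "wl ?B w V F" by (rule wl_mono[OF w]) (use s in auto)
  have "wl ?B (%x. \<eta> * (norm (x - x0))^2 + (w x0 - \<eta> * s^2 / 2)) (%x. \<eta> *\<^sub>R (2 *\<^sub>R (x - x0)) + 0)
     (%x. \<eta> * (2 * real DIM('a)) + 0)"
    by (intro wl_add wl_cmult wl_mono[OF wl_norm_square] wl_mono[OF wl_const]) auto
  from wl_diff[OF wB this]
  have wK: "wl ?B ?K (%x. V x - (2 * \<eta>) *\<^sub>R (x - x0)) (%x. F x - 2 * real DIM('a) * \<eta>)"
    by (simp add: mult_ac)
  define V' where "V' = (%x. V x - (2 * \<eta>) *\<^sub>R (x - x0))"
  define k where "k = ?K"
  define F' where "F' = (%x. F x - 2 * real DIM('a) * \<eta>)"
  have wK: "wl ?B k V' F'" using wK unfolding k_def V'_def F'_def .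
  have F'pos: "F' x > 0" if "x \<in> ?B" for x using s(4)[OF that] \<eta> neg unfolding F'_def by linarith
  have kx0: "k x0 > 0" using \<eta> s unfolding k_def by simp
  \<comment> \<open>Beyond three quarters of the radius, |x - x0|^2 is at least 9/16 s^2 and hence
    exceeds s^2 / 2, so the positive part of \<open>k\<close> lives in a compact subset of the open
    ball.\<close>
  have kneg: "k x <= 0" if "x \<in> ?B" "norm (x - x0) >= s * (3/4)" for x
  proof -
    have "(s * (3/4))^2 <= (norm (x - x0))^2" by (rule power_mono[OF that(2)]) (use s in auto)
    moreover have "(s * (3/4))^2 = 9/16 * s^2" by (simp add: power2_eq_square)
    ultimately have "s^2 / 2 <= (norm (x - x0))^2" using zero_le_power2[of s] by linarith
    then have "\<eta> * (s^2 / 2) <= \<eta> * (norm (x - x0))^2" using \<eta> by simp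
    then show ?thesis using s(3)[OF that(1)] unfolding k_def by simp
  qed
  define C where "C = cball x0 (s * (3/4))"
  have CB: "C \<subseteq> ?B" using s unfolding C_def by auto
  define \<phi> where "\<phi> = (%x. if x \<in> ?B then (max (k x) 0)^2 else 0)"
  define W where "W = (%x. if x \<in> ?B then (2 * max (k x) 0) *\<^sub>R V' x else 0)"
  have out: "\<phi> x = 0" "W x = 0" if "x \<notin> C" for x
  proof -
    have "norm (x - x0) >= s * (3/4)" using that unfolding C_def by (simp add: dist_norm norm_minus_commute)
    then show "\<phi> x = 0" "W x = 0" using kneg[of x] unfolding \<phi>_def W_def by (auto simp: max_def)
  qed
  have opC: "open (-C)" unfolding C_def by auto
  have gphi: "GDERIV \<phi> x :> W x" for x
  proof (cases "x \<in> ?B")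
    case True
    have "GDERIV (%x. (max (k x) 0)^2) x :> (2 * max (k x) 0) *\<^sub>R V' x"
      by (rule GDERIV_DERIV_compose[OF wlD(2)[OF wK True] pos_part_square_deriv])
    then have "GDERIV \<phi> x :> (2 * max (k x) 0) *\<^sub>R V' x"
      by (rule GDERIV_cong_open[OF _ open_ball True]) (auto simp: \<phi>_def)
    then show ?thesis using True by (simp add: W_def)
  next
    case False
    then have "x \<in> -C" using CB by auto
    have "GDERIV \<phi> x :> 0"
      by (rule GDERIV_cong_open[OF GDERIV_const[of 0] opC \<open>x \<in> -C\<close>]) (use out in auto)
    then show ?thesis using False by (simp add: W_def)
  qed
  have cW: "continuous_on UNIV W"
  proof -
    have "continuous_on (?B \<union> -C) W"
    proof (rule continuous_on_open_Un[OF open_ball opC])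
      have "continuous_on ?B (%x. (2 * max (k x) 0) *\<^sub>R V' x)"
        by (intro continuous_intros wl_cont[OF wK] wlD(3)[OF wK])
      then show "continuous_on ?B W" by (rule continuous_on_eq) (auto simp: W_def)
      have "continuous_on (-C) (%x. 0 :: 'a)" by simp
      then show "continuous_on (-C) W" by (rule continuous_on_eq) (use out in auto)
    qed
    moreover have "?B \<union> -C = UNIV" using CB by auto
    ultimately show ?thesis by simp
  qed
  have tp: "test_pair C \<phi> W"
    unfolding test_pair_def using gphi cW out by (auto simp: C_def)
  have I0: "(\<integral>x. V' x \<bullet> W x + F' x * \<phi> x \<partial>lborel) = 0" by (rule wlD(5)[OF wK tp CB])
  let ?h = "%x. V' x \<bullet> W x + F' x * \<phi> x"
  have hint: "integrable lborel ?h"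
    by (intro Bochner_Integration.integrable_add test_pair_integrable[OF tp CB wlD(3,4)[OF wK]])
  \<comment> \<open>\<open>W\<close> is a nonnegative multiple of \<open>V'\<close>, so both terms
    of the integrand are nonnegative. As the integral vanishes, so does the continuous integrand,
    although its second term is positive at \<open>x0\<close>.\<close>
  have hpos: "?h x >= 0" for x
    using F'pos[of x] by (cases "x \<in> ?B") (auto simp: W_def \<phi>_def max_def intro!: add_nonneg_nonneg mult_nonneg_nonneg)
  have "?h x = 0" if "x \<in> ?B" for x
  proof (rule ccontr)
    assume nz: "?h x ~= 0"
    have AE0: "AE x in lborel. ?h x = 0"
      using integral_nonneg_eq_0_iff_AE[OF hint] hpos I0 by auto
    have ch: "continuous_on ?B ?h"
      by (intro continuous_intros wlD[OF wK] continuous_on_subset[OF cW] test_pair_cont[OF tp]) auto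
    have op: "open {x \<in> ?B. ?h x ~= 0}"
    proof -
      have "open (?B \<inter> ?h -` (-{0}))" by (rule continuous_open_preimage[OF ch]) auto
      moreover have "?B \<inter> ?h -` (-{0}) = {x \<in> ?B. ?h x ~= 0}" by auto
      ultimately show ?thesis by simp
    qed
    have "{x \<in> ?B. ?h x ~= 0} \<in> null_sets lborel"
    proof -
      have "AE x in lborel. x \<notin> {x \<in> ?B. ?h x ~= 0}" using AE0 by eventually_elim auto
      then show ?thesis using op by (subst AE_iff_null_sets) auto
    qed
    then have "negligible {x \<in> ?B. ?h x ~= 0}"
      by (simp add: negligible_iff_null_sets null_sets_completionI)
    then show False using open_not_negligible[OF op] that nz by auto
  qed
  then have "?h x0 = 0" using s by simp
  moreover have "?h x0 > 0"
    using kx0 F'pos[of x0] s by (auto simp: W_def \<phi>_def intro!: add_nonneg_pos)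
  ultimately show False by simp
qed

section \<open>Weak form of the equation\<close>

definition sol_drift :: "real => real => real => ('a::euclidean_space => real) => ('a => 'a) => 'a => real" where
  "sol_drift \<rho> lam \<tau> u V x =
     - (real DIM('a) - 2 + 2 * \<rho>) * ((x \<bullet> V x) / (norm x)^2)
     + lam * (u x powr \<tau> * norm (V x) powr (1 - \<tau>) / norm x powr (1 + \<tau>))"

definition sol_lap :: "real => real => real => real => real => ('a::euclidean_space => real) => ('a => 'a) => 'a => real" where
  "sol_lap q \<tau> \<rho> lam \<theta> u V x = norm x powr \<theta> * u x powr q - sol_drift \<rho> lam \<tau> u V x"

lemma continuous_on_sol_drift:
  fixes u :: "'a::euclidean_space => real"
  assumes "\<tau> < 1" "!!x. x \<in> -{0} ==> 0 < u x" "continuous_on (-{0}) u" "continuous_on (-{0}) V"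
  shows "continuous_on (-{0}) (sol_drift \<rho> lam \<tau> u V)"
proof -
  have h1: "continuous_on (-{0}) (%x. norm (V x) powr (1 - \<tau>))"
    using assms(1) by (intro continuous_on_powr' continuous_on_norm assms(4) continuous_on_const) auto
  have h2: "continuous_on (-{0}) (%x. u x powr \<tau>)"
  proof (intro continuous_on_powr assms(3) continuous_on_const ballI)
    show "u x ~= 0" if "x \<in> -{0}" for x using assms(2)[OF that] by simp
  qed
  have h3: "continuous_on (-{0}) (%x::'a. norm x powr (1 + \<tau>))"
    by (intro continuous_on_powr continuous_on_norm continuous_on_const continuous_on_id) auto
  show ?thesis unfolding sol_drift_def
    by (intro continuous_on_add continuous_on_mult continuous_on_divide continuous_on_inner
        continuous_on_power continuous_on_norm continuous_on_id continuous_on_const h1 h2 h3 assms(4)) auto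
qed

lemma continuous_on_source:
  fixes u :: "'a::euclidean_space => real"
  assumes "!!x. x \<in> -{0} ==> 0 < u x" "continuous_on (-{0}) u"
  shows "continuous_on (-{0}) (%x. norm x powr \<theta> * u x powr q)"
proof -
  have "u x ~= 0" if "x \<in> -{0}" for x using assms(1)[OF that] by simp
  then show ?thesis using assms by (intro continuous_intros) auto
qed

lemma C1_on_GDERIV: "C1_on S f ==> x \<in> S ==> GDERIV f x :> grad f x"
  unfolding C1_on_def using grad_eq by fastforce

lemma test_pair_imp_test_function:
  assumes tp: "test_pair K \<phi> W" and K: "K \<subseteq> -{0}"
  shows "test_function \<phi>" "grad \<phi> = W"
proof -
  show g: "grad \<phi> = W" using tp by (auto simp: test_pair_def intro!: ext grad_eq)
  have cK: "compact K" using tp by (simp add: test_pair_def)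
  have sub: "closure {x. \<phi> x ~= 0} \<subseteq> K"
    using tp compact_imp_closed[OF cK] by (intro closure_minimal) (auto simp: test_pair_def)
  then have "compact (closure {x. \<phi> x ~= 0})"
    using cK by (metis closed_closure compact_Int_closed inf.absorb2)
  then show "test_function \<phi>"
    unfolding test_function_def C1_on_def g using tp sub K by (auto simp: test_pair_def)
qed

lemma test_function_imp_test_pair:
  assumes "test_function \<phi>"
  shows "test_pair (closure {x. \<phi> x ~= 0}) \<phi> (grad \<phi>)" "closure {x. \<phi> x ~= 0} \<subseteq> -{0}"
proof -
  have C: "C1_on UNIV \<phi>" "compact (closure {x. \<phi> x ~= 0})" "0 \<notin> closure {x. \<phi> x ~= 0}"
    using assms unfolding test_function_def by auto
  show "test_pair (closure {x. \<phi> x ~= 0}) \<phi> (grad \<phi>)"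
    unfolding test_pair_def
  proof (intro conjI allI impI)
    show "GDERIV \<phi> x :> grad \<phi> x" for x by (rule C1_on_GDERIV[OF C(1) UNIV_I])
    show "\<phi> x = 0" if "x \<notin> closure {x. \<phi> x ~= 0}" for x
    proof (rule ccontr)
      assume "\<phi> x ~= 0"
      then have "x \<in> closure {x. \<phi> x ~= 0}" by (intro subsetD[OF closure_subset] CollectI)
      with that show False by contradiction
    qed
    show "continuous_on UNIV (grad \<phi>)" using C(1) by (simp add: C1_on_def)
  qed (rule C(2))
  show "closure {x. \<phi> x ~= 0} \<subseteq> -{0}" using C(3) by auto
qed

text \<open>Integrals over the punctured space and over the whole space agree, because the test
  function and its gradient vanish at the origin.\<close>

lemma weak_form_iff:
  fixes u :: "'a::euclidean_space => real"
  assumes \<tau>: "\<tau> < 1" and pos: "!!x. x \<in> -{0} ==> 0 < u x"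
    and c: "continuous_on (-{0}) u" "continuous_on (-{0}) V" and V: "!!x. x \<in> -{0} ==> GDERIV u x :> V x"
    and tp: "test_pair K \<phi> W" and K: "K \<subseteq> -{0}"
  shows "L_action \<rho> lam \<tau> u \<phi> = (LINT x:-{0}|lborel. norm x powr \<theta> * u x powr q * \<phi> x)
     \<longleftrightarrow> (\<integral>x. V x \<bullet> W x + sol_lap q \<tau> \<rho> lam \<theta> u V x * \<phi> x \<partial>lborel) = 0"
proof -
  let ?c = "%x. norm x powr \<theta> * u x powr q"
  let ?b = "sol_drift \<rho> lam \<tau> u V"
  have z: "\<phi> 0 = 0" "W 0 = 0" using tp K test_pair_grad_zero[OF tp, of 0] by (auto simp: test_pair_def)
  note cb = continuous_on_sol_drift[OF \<tau> pos c] and cc = continuous_on_source[OF pos c(1)]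
  note i1 = test_pair_integrable(1)[OF tp K c(2) cb]
  note i2 = test_pair_integrable(2)[OF tp K c(2) cb]
  note i3 = test_pair_integrable(2)[OF tp K c(2) cc]
  have gu: "grad u x = V x" if "x ~= 0" for x using V[of x] that grad_eq by auto
  have gphi: "grad \<phi> = W" by (rule test_pair_imp_test_function[OF tp K])
  have "L_action \<rho> lam \<tau> u \<phi> = (\<integral>x. - (V x \<bullet> W x) + ?b x * \<phi> x \<partial>lborel)"
    unfolding L_action_def set_lebesgue_integral_def
    by (rule Bochner_Integration.integral_cong) (auto simp: gphi gu z sol_drift_def indicator_def)
  also have "... = - (\<integral>x. V x \<bullet> W x \<partial>lborel) + (\<integral>x. ?b x * \<phi> x \<partial>lborel)"
    using i1 i2 by simp
  finally have 1: "L_action \<rho> lam \<tau> u \<phi> = ..." .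
  have 2: "(LINT x:-{0}|lborel. ?c x * \<phi> x) = (\<integral>x. ?c x * \<phi> x \<partial>lborel)"
    unfolding set_lebesgue_integral_def
    by (rule Bochner_Integration.integral_cong) (auto simp: z indicator_def)
  have "(\<integral>x. V x \<bullet> W x + sol_lap q \<tau> \<rho> lam \<theta> u V x * \<phi> x \<partial>lborel)
      = (\<integral>x. V x \<bullet> W x + (?c x * \<phi> x - ?b x * \<phi> x) \<partial>lborel)"
    by (rule Bochner_Integration.integral_cong) (auto simp: sol_lap_def algebra_simps)
  also have "... = (\<integral>x. V x \<bullet> W x \<partial>lborel) + ((\<integral>x. ?c x * \<phi> x \<partial>lborel) - (\<integral>x. ?b x * \<phi> x \<partial>lborel))"
    using i1 i2 i3 by simp
  finally show ?thesis unfolding 1 2 by linarith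
qed

text \<open>From here on the equation is used only through \<open>wl\<close>. Positivity of
  \<open>u\<close> and \<open>\<tau> < 1\<close> make the right-hand side continuous, also where the
  gradient vanishes.\<close>

lemma positive_solutions_iff:
  fixes u :: "'a::euclidean_space => real"
  assumes \<tau>: "\<tau> < 1"
  shows "u \<in> positive_solutions q \<tau> \<rho> lam \<theta> \<longleftrightarrow>
    u \<in> extensional (-{0}) \<and> (\<forall>x\<in>-{0}. u x > 0) \<and> (\<exists>V. wl (-{0}) u V (sol_lap q \<tau> \<rho> lam \<theta> u V))"
proof
  assume u: "u \<in> positive_solutions q \<tau> \<rho> lam \<theta>"
  then have e: "u \<in> extensional (-{0})" "C1_on (-{0}) u" and pos: "!!x. x \<in> -{0} ==> u x > 0"
    and weak: "!!\<phi> :: 'a => real. test_function \<phi> ==>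
      L_action \<rho> lam \<tau> u \<phi> = (LINT x:-{0}|lborel. norm x powr \<theta> * u x powr q * \<phi> x)"
    unfolding positive_solutions_def by auto
  have G: "GDERIV u x :> grad u x" if "x \<in> -{0}" for x
    by (rule C1_on_GDERIV[OF e(2) that])
  have cV: "continuous_on (-{0}) (grad u)" using e(2) unfolding C1_on_def by simp
  have cu: "continuous_on (-{0}) u"
    by (intro continuous_at_imp_continuous_on ballI GDERIV_isCont[OF G])
  have "wl (-{0}) u (grad u) (sol_lap q \<tau> \<rho> lam \<theta> u (grad u))"
    unfolding wl_def
  proof (intro conjI ballI allI impI G cV)
    show "continuous_on (-{0}) (sol_lap q \<tau> \<rho> lam \<theta> u (grad u))"
      unfolding sol_lap_def
      by (intro continuous_intros continuous_on_sol_drift[OF \<tau> pos cu cV] continuous_on_source[OF pos cu])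
    fix K :: "'a set" and \<phi> :: "'a => real" and W :: "'a => 'a"
    assume "test_pair K \<phi> W \<and> K \<subseteq> -{0}"
    then have tp: "test_pair K \<phi> W" "K \<subseteq> -{0}" by auto
    show "(\<integral>x. grad u x \<bullet> W x + sol_lap q \<tau> \<rho> lam \<theta> u (grad u) x * \<phi> x \<partial>lborel) = 0"
      using weak_form_iff[OF \<tau> pos cu cV G tp] weak[OF test_pair_imp_test_function(1)[OF tp]] by blast
  qed auto
  then show "u \<in> extensional (-{0}) \<and> (\<forall>x\<in>-{0}. u x > 0) \<and> (\<exists>V. wl (-{0}) u V (sol_lap q \<tau> \<rho> lam \<theta> u V))"
    using e pos by blast
next
  assume "u \<in> extensional (-{0}) \<and> (\<forall>x\<in>-{0}. u x > 0) \<and> (\<exists>V. wl (-{0}) u V (sol_lap q \<tau> \<rho> lam \<theta> u V))"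
  then obtain V where e: "u \<in> extensional (-{0})" and pos: "!!x. x \<in> -{0} ==> u x > 0"
    and w: "wl (-{0}) u V (sol_lap q \<tau> \<rho> lam \<theta> u V)" by auto
  note G = wlD(2)[OF w] and cV = wlD(3)[OF w] and cu = wl_cont[OF w]
  have "continuous_on (-{0}) (grad u)"
    by (rule continuous_on_eq[OF cV]) (use grad_eq[OF G] in simp)
  then have "C1_on (-{0}) u" unfolding C1_on_def using G by blast
  moreover have "L_action \<rho> lam \<tau> u \<phi> = (LINT x:-{0}|lborel. norm x powr \<theta> * u x powr q * \<phi> x)"
    if "test_function \<phi>" for \<phi> :: "'a => real"
    using weak_form_iff[OF \<tau> pos cu cV G test_function_imp_test_pair[OF that]]
      wlD(5)[OF w test_function_imp_test_pair[OF that]] by blast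
  ultimately show "u \<in> positive_solutions q \<tau> \<rho> lam \<theta>"
    unfolding positive_solutions_def using e pos by blast
qed

lemma wl_ln:
  assumes w: "wl S u V F" and pos: "!!x. x \<in> S ==> 0 < u x"
  shows "wl S (%x. ln (u x)) (%x. (1 / u x) *\<^sub>R V x) (%x. F x / u x - (norm ((1 / u x) *\<^sub>R V x))^2)"
proof -
  have "wl S (%x. ln (u x)) (%x. (1 / u x) *\<^sub>R V x)
     (%x. (1 / u x) * F x + (- (1 / (u x)^2)) * (norm (V x))^2)"
  proof (rule wl_compose[OF w, where g=ln and g'="%y. 1 / y" and g''="%y. - (1 / y^2)"])
    show "DERIV ln (u x) :> 1 / u x" if "x \<in> S" for x
      using pos[OF that] by (auto intro!: derivative_eq_intros)
    show "DERIV (%y. 1 / y) (u x) :> - (1 / (u x)^2)" if "x \<in> S" for x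
      using pos[OF that] by (auto intro!: derivative_eq_intros simp: power2_eq_square divide_simps)
    show "continuous_on S (%x. - (1 / (u x)^2))"
      by (intro continuous_intros wl_cont[OF w]) (use pos in fastforce)
  qed
  then show ?thesis
  proof (rule wl_cong)
    fix x assume "x \<in> S"
    then show "F x / u x - (norm ((1 / u x) *\<^sub>R V x))^2 = 1 / u x * F x + - (1 / (u x)^2) * (norm (V x))^2"
      using pos[of x] by (simp add: power_divide)
  qed auto
qed

section \<open>A priori estimates\<close>

text \<open>Makes the mixed term linear in \<open>u\<close> and its gradient with a constant
  independent of \<tau>, the form in which the Lipschitz and Harnack estimates accept it.\<close>

lemma powr_interpolation_le:
  fixes a b \<tau> :: real
  assumes "0 <= a" "0 <= b" "0 <= \<tau>" "\<tau> <= 1"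
  shows "a powr \<tau> * b powr (1 - \<tau>) <= a + b"
proof -
  define m where "m = max a b"
  have m: "0 <= m" "a <= m" "b <= m" "m <= a + b" using assms unfolding m_def by auto
  have "a powr \<tau> * b powr (1 - \<tau>) <= m powr \<tau> * m powr (1 - \<tau>)"
    by (intro mult_mono powr_mono2) (use assms m in auto)
  also have "... = m" using m by (simp add: powr_add[symmetric])
  finally show ?thesis using m by simp
qed

lemma sol_drift_bound:
  fixes u :: "'a::euclidean_space => real"
  assumes x: "x ~= 0" and u: "0 < u x" and \<tau>: "0 <= \<tau>" "\<tau> < 1"
  shows "\<bar>sol_drift \<rho> lam \<tau> u V x\<bar>
    <= (\<bar>real DIM('a) - 2 + 2 * \<rho>\<bar> + \<bar>lam\<bar>) * (norm (V x) / norm x + u x / (norm x)^2)"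
proof -
  let ?r = "norm x"
  let ?A = "norm (V x) / ?r" let ?E = "u x / ?r^2"
  have r: "?r > 0" using x by simp
  have nn: "?A >= 0" "?E >= 0" using u by auto
  have "\<bar>x \<bullet> V x\<bar> <= ?r * norm (V x)" by (rule Cauchy_Schwarz_ineq2)
  then have "\<bar>(x \<bullet> V x) / ?r^2\<bar> <= ?r * norm (V x) / ?r^2"
    using r by (simp add: divide_right_mono)
  also have "... = ?A" using r by (simp add: power2_eq_square)
  finally have 1: "\<bar>(x \<bullet> V x) / ?r^2\<bar> <= ?A" .
  have "u x powr \<tau> * norm (V x) powr (1 - \<tau>) / ?r powr (1 + \<tau>) = ?E powr \<tau> * ?A powr (1 - \<tau>)"
  proof -
    have "(?r^2) powr \<tau> * ?r powr (1 - \<tau>) = ?r powr (1 + \<tau>)"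
      using r by (simp add: powr_powr powr_add[symmetric] add.commute flip: powr_numeral)
    then show ?thesis using r u by (simp add: powr_divide)
  qed
  also have "... <= ?E + ?A" by (rule powr_interpolation_le) (use nn \<tau> in auto)
  finally have 2: "\<bar>u x powr \<tau> * norm (V x) powr (1 - \<tau>) / ?r powr (1 + \<tau>)\<bar> <= ?A + ?E" by simp
  let ?k = "real DIM('a) - 2 + 2 * \<rho>"
  have "\<bar>sol_drift \<rho> lam \<tau> u V x\<bar> <= \<bar>?k\<bar> * \<bar>(x \<bullet> V x) / ?r^2\<bar>
      + \<bar>lam\<bar> * \<bar>u x powr \<tau> * norm (V x) powr (1 - \<tau>) / ?r powr (1 + \<tau>)\<bar>"
    unfolding sol_drift_def abs_mult[symmetric] mult_minus_left
    by (rule order_trans[OF abs_triangle_ineq]) simp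
  also have "... <= \<bar>?k\<bar> * (?A + ?E) + \<bar>lam\<bar> * (?A + ?E)"
    by (intro add_mono mult_left_mono 2) (use 1 nn in auto)
  finally show ?thesis by (simp add: algebra_simps)
qed

lemma powr_comparable:
  fixes r s \<theta> :: real
  assumes "0 < r" "r / 2 <= s" "s <= 2 * r"
  shows "2 powr (- \<bar>\<theta>\<bar>) * r powr \<theta> <= s powr \<theta>"
proof -
  have s: "s > 0" using assms by linarith
  have "2 powr (- \<bar>\<theta>\<bar>) <= (s / r) powr \<theta>"
  proof (cases "\<theta> >= 0")
    case True
    have "(1/2) powr \<theta> <= (s / r) powr \<theta>"
      by (rule powr_mono2) (use True assms in \<open>auto simp: field_simps\<close>)
    then show ?thesis using True by (simp add: powr_divide powr_minus_divide)
  next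
    case False
    have "2 powr \<theta> <= (s / r) powr \<theta>"
      by (rule powr_mono2') (use False assms s in \<open>auto simp: field_simps\<close>)
    then show ?thesis using False by simp
  qed
  then show ?thesis using assms s by (simp add: powr_divide field_simps)
qed

lemma wl_ln_const_minus_norm_square:
  "wl (ball x0 (R::real)) (%x::'a::euclidean_space. ln (R^2 - (norm (x - x0))^2))
     (%x. (- (2 / (R^2 - (norm (x - x0))^2))) *\<^sub>R (x - x0))
     (%x. - (2 * real DIM('a) / (R^2 - (norm (x - x0))^2)) - 4 * (norm (x - x0))^2 / (R^2 - (norm (x - x0))^2)^2)"
proof -
  let ?B = "ball x0 R"
  have pos: "R^2 - (norm (x - x0))^2 > 0" if "x \<in> ?B" for x
    using that by (simp add: dist_norm norm_minus_commute power_strict_mono)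
  have w: "wl ?B (%x::'a. (norm (x - x0))^2) (%x. 2 *\<^sub>R (x - x0)) (%x. 2 * real DIM('a))"
    by (rule wl_mono[OF wl_norm_square]) auto
  have "wl ?B (%x. ln (R^2 - (norm (x - x0))^2))
      (%x. (- (1 / (R^2 - (norm (x - x0))^2))) *\<^sub>R 2 *\<^sub>R (x - x0))
      (%x. (- (1 / (R^2 - (norm (x - x0))^2))) * (2 * real DIM('a)) +
         (- (1 / (R^2 - (norm (x - x0))^2)^2)) * (norm (2 *\<^sub>R (x - x0)))^2)"
  proof (rule wl_compose[OF w, where g="%y. ln (R^2 - y)" and g'="%y. - (1 / (R^2 - y))" and g''="%y. - (1 / (R^2 - y)^2)"])
    fix x assume x: "x \<in> ?B"
    show "DERIV (%y. ln (R^2 - y)) ((norm (x - x0))^2) :> - (1 / (R^2 - (norm (x - x0))^2))"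
      using pos[OF x] by (auto intro!: derivative_eq_intros)
    show "DERIV (%y. - (1 / (R^2 - y))) ((norm (x - x0))^2) :> - (1 / (R^2 - (norm (x - x0))^2)^2)"
      using pos[OF x] by (auto intro!: derivative_eq_intros simp: power2_eq_square divide_simps)
  next
    show "continuous_on ?B (%x. - (1 / (R^2 - (norm (x - x0))^2)^2))"
      using pos by (intro continuous_intros) fastforce
  qed
  then show ?thesis
    by (rule wl_cong) (auto simp: power_mult_distrib)
qed

text \<open>Keller--Osserman bound: at a maximum of \<open>u\<^sup>q\<^sup>-\<^sup>1 D\<^sup>2\<close>, where
  \<open>D = r\<^sup>2/4 - |x - x0|\<^sup>2\<close> and \<open>r = |x0|\<close>, the absorption is controlled by the derivatives of \<open>ln D\<close>.\<close>

lemma keller_osserman: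
  fixes q \<tau> \<rho> lam \<theta> :: real
  assumes q: "q > 1" and \<tau>: "0 <= \<tau>" "\<tau> < 1"
  shows "\<exists>C. \<forall>(u :: 'a::euclidean_space => real) V x. (\<forall>x\<in>-{0}. u x > 0) --> wl (-{0}) u V (sol_lap q \<tau> \<rho> lam \<theta> u V) -->
     x ~= 0 --> u x powr (q - 1) * norm x powr (\<theta> + 2) <= C"
proof -
  define a where "a = q - 1"
  have a: "a > 0" using q unfolding a_def by simp
  define n where "n = real DIM('a)"
  have n: "n >= 0" unfolding n_def by simp
  define B where "B = \<bar>real DIM('a) - 2 + 2 * \<rho>\<bar> + \<bar>lam\<bar>"
  have B: "B >= 0" unfolding B_def by simp
  \<comment> \<open>The summands come from the squared gradient of ln u, from the Laplacian of 2 ln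
    D, and from the drift; each is compared with \<open>Y^2\<close>.\<close>
  define C1 where "C1 = 4 / a^2 + (2 / a) * (2 * n + 1) + B * (4 / a + 4)"
  define C where "C = 16 * C1 / 2 powr (- \<bar>\<theta>\<bar>)"
  show ?thesis
  proof (intro exI[of _ C] allI impI)
    fix u :: "'a => real" and V and x0 :: 'a
    assume pos': "\<forall>x\<in>-{0}. u x > 0" and w: "wl (-{0}) u V (sol_lap q \<tau> \<rho> lam \<theta> u V)" and x0: "x0 ~= 0"
    have pos: "u x > 0" if "x ~= 0" for x using pos' that by auto
    define r where "r = norm x0"
    have r: "r > 0" using x0 unfolding r_def by simp
    define R where "R = r / 2"
    have R: "R > 0" using r unfolding R_def by simp
    define D where "D x = R^2 - (norm (x - x0))^2" for x :: 'a
    have near: "r / 2 <= norm x" "norm x <= 2 * r" if "norm (x - x0) <= R" for x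
      using that norm_triangle_ineq2[of x0 x] norm_triangle_ineq2[of x x0] unfolding R_def r_def
      by (simp_all add: norm_minus_commute)
    have nz: "x ~= 0" if "x \<in> cball x0 R" for x
      using near(1)[of x] that r by (auto simp: dist_norm norm_minus_commute)
    \<comment> \<open>The square makes the powers match: at the maximum, r^2 times each term is at
      most a multiple of (r^2 / D)^2, so multiplication by D^2 removes \<open>D\<close>
      altogether.\<close>
    let ?G = "%x. u x powr a * (D x)^2"
    have "continuous_on (cball x0 R) ?G"
      unfolding D_def using nz pos
      by (intro continuous_intros continuous_on_subset[OF wl_cont[OF w]]) fastforce+
    then obtain y where y: "y \<in> cball x0 R" "!!x. x \<in> cball x0 R ==> ?G x <= ?G y"
      using continuous_attains_sup[of "cball x0 R" ?G] R by force
    have G0: "?G x0 = u x0 powr a * (r^2 / 4)^2" unfolding D_def R_def by (simp add: power_divide)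
    have "?G x0 > 0" unfolding G0 using pos[OF x0] r by simp
    then have "?G y > 0" using y(2)[of x0] R by simp
    then have "D y ~= 0" by auto
    then have yB: "y \<in> ball x0 R"
      using y(1) unfolding D_def by (auto simp: dist_norm norm_minus_commute order_less_le)
    have Dpos: "D x > 0" if "x \<in> ball x0 R" for x
      using that unfolding D_def by (simp add: dist_norm norm_minus_commute power_strict_mono)
    have y0: "y ~= 0" using nz y(1) by auto
    have sub: "ball x0 R \<subseteq> -{0}"
    proof
      show "x \<in> -{0}" if "x \<in> ball x0 R" for x using nz[of x] that by auto
    qed
    define p where "p x = (1 / u x) *\<^sub>R V x" for x
    define F where "F = sol_lap q \<tau> \<rho> lam \<theta> u V"
    have w1: "wl (ball x0 R) (%x. ln (u x)) p (%x. F x / u x - (norm (p x))^2)"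
      unfolding p_def F_def by (rule wl_ln[OF wl_mono[OF w open_ball sub]]) (use pos' sub in blast)
    have w2: "wl (ball x0 R) (%x. ln (D x)) (%x. (- (2 / D x)) *\<^sub>R (x - x0))
        (%x. - (2 * n / D x) - 4 * (norm (x - x0))^2 / (D x)^2)"
      unfolding D_def n_def by (rule wl_ln_const_minus_norm_square)
    note wH = wl_add[OF wl_cmult[OF w1, of a] wl_cmult[OF w2, of 2]]
    have mx: "a * ln (u x) + 2 * ln (D x) <= a * ln (u y) + 2 * ln (D y)" if "x \<in> ball x0 R" for x
    proof -
      have e: "ln (?G z) = a * ln (u z) + 2 * ln (D z)" if "z \<in> ball x0 R" for z
        using Dpos[OF that] pos[of z] nz[of z] that by (auto simp: ln_mult ln_powr ln_realpow)
      have "?G x > 0" using Dpos[OF that] pos[of x] nz[of x] that by auto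
      then have "ln (?G x) <= ln (?G y)" using y(2)[of x] that \<open>?G y > 0\<close> by auto
      then show ?thesis using e[OF that] e[OF yB] by simp
    qed
    obtain s where s: "s > 0" "ball y s \<subseteq> ball x0 R" using yB by (meson open_ball openE)
    have lap: "a * (F y / u y - (norm (p y))^2) + 2 * (- (2 * n / D y) - 4 * (norm (y - x0))^2 / (D y)^2) <= 0"
      by (rule wl_local_max[OF wH yB s(1)]) (use mx s in auto)
    \<comment> \<open>The vanishing gradient turns the gradient of ln u at the maximum into an
      explicit multiple of (y - x0) / D, so the drift can be estimated before any gradient bound is
      known.\<close>
    have grd: "a *\<^sub>R p y + 2 *\<^sub>R (- (2 / D y)) *\<^sub>R (y - x0) = 0"
      by (rule GDERIV_local_max_zero[OF wlD(2)[OF wH yB] s(1)]) (use mx s in auto)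
    define Y where "Y = r^2 / D y"
    have D1: "D y > 0" using Dpos[OF yB] .
    have D2: "D y <= r^2 / 4" unfolding D_def R_def by (simp add: power_divide)
    have Y: "Y >= 1" unfolding Y_def using D1 D2 zero_le_power2[of r] by (simp add: field_simps)
    have dist: "norm (y - x0) <= r / 2" using y(1) unfolding R_def by (simp add: dist_norm norm_minus_commute)
    have np: "norm (p y) = (4 / (a * D y)) * norm (y - x0)"
    proof -
      have "a *\<^sub>R p y = (4 / D y) *\<^sub>R (y - x0)" using grd by (simp add: algebra_simps)
      then have "a * norm (p y) = (4 / D y) * norm (y - x0)"
        using a D1 by (metis abs_of_pos divide_pos_pos norm_scaleR zero_less_numeral)
      then show ?thesis using a D1 by (simp add: field_simps)
    qed
    have rp: "r * norm (p y) <= (2 / a) * Y"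
    proof -
      have "r * norm (p y) = (4 / (a * D y)) * (r * norm (y - x0))" using np by simp
      also have "... <= (4 / (a * D y)) * (r * (r / 2))"
        using dist a D1 r by (intro mult_left_mono) auto
      also have "... = (2 / a) * Y" unfolding Y_def by (simp add: power2_eq_square)
      finally show ?thesis .
    qed
    have uy: "u y > 0" using pos[OF y0] .
    have ny: "norm y > 0" "r / 2 <= norm y" "norm y <= 2 * r"
      using y0 near[of y] y(1) by (auto simp: dist_norm norm_minus_commute)
    have fu: "F y / u y <= (norm (p y))^2 + (2 / a) * (2 * n / D y + 4 * (norm (y - x0))^2 / (D y)^2)"
      using lap a by (simp add: field_simps)
    have r2fu: "r^2 * (F y / u y) <= (4 / a^2) * Y^2 + (2 / a) * (2 * n * Y + Y^2)"
    proof -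
      have "r^2 * (F y / u y) <= (r * norm (p y))^2 + (2 / a) * (2 * n * Y + (r^2 / (D y)^2) * (4 * (norm (y - x0))^2))"
        using mult_left_mono[OF fu, of "r^2"] unfolding Y_def
        by (simp add: power_mult_distrib ring_distribs mult_ac)
      also have "... <= ((2 / a) * Y)^2 + (2 / a) * (2 * n * Y + (r^2 / (D y)^2) * r^2)"
      proof (intro add_mono mult_left_mono)
        show "(r * norm (p y))^2 <= ((2 / a) * Y)^2" using rp r by (intro power_mono) auto
        have "(norm (y - x0))^2 <= (r / 2)^2" using dist by (intro power_mono) auto
        then show "4 * (norm (y - x0))^2 <= r^2" by (simp add: power_divide)
      qed (use a n in auto)
      also have "... = (4 / a^2) * Y^2 + (2 / a) * (2 * n * Y + Y^2)"
        unfolding Y_def by (simp add: power_mult_distrib power_divide power2_eq_square mult_ac)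
      finally show ?thesis .
    qed
    have src: "norm y powr \<theta> * u y powr a <= F y / u y + B * (norm (p y) / norm y + 1 / (norm y)^2)"
    proof -
      have e1: "norm y powr \<theta> * u y powr q = norm y powr \<theta> * u y powr a * u y"
        using uy unfolding a_def by (simp add: powr_diff)
      have e2: "norm (V y) = u y * norm (p y)" using uy unfolding p_def by simp
      have "norm y powr \<theta> * u y powr q = F y + sol_drift \<rho> lam \<tau> u V y"
        unfolding F_def sol_lap_def by simp
      also have "... <= F y + B * (norm (V y) / norm y + u y / (norm y)^2)"
        using sol_drift_bound[where u=u and V=V and x=y and \<rho>=\<rho> and lam=lam, OF y0 uy \<tau>] unfolding B_def by linarith
      also have "... = (F y / u y + B * (norm (p y) / norm y + 1 / (norm y)^2)) * u y"
        using uy ny unfolding e2 by (simp add: field_simps)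
      finally show ?thesis using uy unfolding e1 by simp
    qed
    have "r^2 * (B * (norm (p y) / norm y + 1 / (norm y)^2)) <= B * ((4 / a) * Y + 4)"
    proof -
      have t1: "r / norm y <= 2" using ny by (simp add: field_simps)
      have "r * norm (p y) * (r / norm y) <= (2 / a) * Y * 2"
        by (rule mult_mono[OF rp t1]) (use r Y a in auto)
      moreover have "(r / norm y)^2 <= 2^2" using t1 r ny by (intro power_mono) auto
      ultimately have "r * norm (p y) * (r / norm y) + (r / norm y)^2 <= (4 / a) * Y + 4" by simp
      then have "B * (r * norm (p y) * (r / norm y) + (r / norm y)^2) <= B * ((4 / a) * Y + 4)"
        using B by (rule mult_left_mono)
      then show ?thesis by (simp add: power2_eq_square algebra_simps)
    qed
    then have "r^2 * (norm y powr \<theta> * u y powr a) <= (4 / a^2) * Y^2 + (2 / a) * (2 * n * Y + Y^2) + B * ((4 / a) * Y + 4)"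
      using mult_left_mono[OF src, of "r^2"] r2fu by (simp add: ring_distribs)
    also have "... <= C1 * Y^2"
    proof -
      have YY: "Y <= Y^2" "1 <= Y^2" using Y by (auto simp: power2_eq_square intro: mult_mono[of 1 Y 1 Y, simplified])
      have "(2 / a) * (2 * n * Y + Y^2) <= (2 / a) * (2 * n * Y^2 + Y^2)"
        using YY n a by (intro mult_left_mono add_mono) auto
      moreover have "B * ((4 / a) * Y + 4) <= B * ((4 / a) * Y^2 + 4 * Y^2)"
        using YY B a by (intro mult_left_mono add_mono) auto
      ultimately show ?thesis unfolding C1_def by (simp add: algebra_simps)
    qed
    finally have "r^2 * (norm y powr \<theta> * u y powr a) * (D y)^2 <= C1 * Y^2 * (D y)^2"
      by (rule mult_right_mono) auto
    also have "... = C1 * r^2 * r^2" unfolding Y_def using D1 by (simp add: power_divide power2_eq_square)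
    finally have "r^2 * (norm y powr \<theta> * ?G y) <= r^2 * (C1 * r^2)" by (simp add: mult_ac)
    then have "norm y powr \<theta> * ?G y <= C1 * r^2" using r by (simp add: mult_le_cancel_left)
    moreover have "2 powr (- \<bar>\<theta>\<bar>) * r powr \<theta> * ?G x0 <= norm y powr \<theta> * ?G y"
      by (rule mult_mono[OF powr_comparable[OF r ny(2,3)] y(2)]) (use R \<open>?G x0 > 0\<close> in auto)
    ultimately have "2 powr (- \<bar>\<theta>\<bar>) * r powr \<theta> * (u x0 powr a * (r^2 / 4)^2) <= C1 * r^2"
      unfolding G0 by linarith
    then have "r^2 * (2 powr (- \<bar>\<theta>\<bar>) * (u x0 powr a * (r powr \<theta> * r^2))) <= r^2 * (16 * C1)"
      by (simp add: power_divide power2_eq_square mult_ac)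
    then have "2 powr (- \<bar>\<theta>\<bar>) * (u x0 powr a * (r powr \<theta> * r^2)) <= 16 * C1" using r by (simp add: mult_le_cancel_left)
    moreover have "r powr \<theta> * r^2 = r powr (\<theta> + 2)" using r by (simp add: powr_add)
    ultimately show "u x0 powr (q - 1) * norm x0 powr (\<theta> + 2) <= C"
      unfolding C_def a_def[symmetric] r_def[symmetric] by (simp add: field_simps)
  qed
qed

section \<open>Reflections and the interior Lipschitz estimate\<close>

definition reflection :: "'a::real_inner => 'a => 'a" where
  "reflection e x = x - (2 * (x \<bullet> e)) *\<^sub>R e"

lemma reflection_orthogonal:
  assumes "norm e = 1"
  shows "orthogonal_transformation (reflection e)" "reflection e (reflection e x) = x"
proof -
  have ee: "e \<bullet> e = 1" using assms by (simp add: norm_eq_1)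
  show "reflection e (reflection e x) = x"
    unfolding reflection_def by (simp add: inner_diff_left ee algebra_simps)
  have "linear (reflection e)"
    unfolding reflection_def by (intro linearI) (simp_all add: inner_add_left algebra_simps scaleR_add_left)
  moreover have "reflection e v \<bullet> reflection e w = v \<bullet> w" for v w
    unfolding reflection_def by (simp add: inner_diff_left inner_diff_right ee inner_commute algebra_simps)
  ultimately show "orthogonal_transformation (reflection e)"
    unfolding orthogonal_transformation_def by blast
qed

lemma norm_sub_bisector_reflection:
  assumes "norm e = 1"
  shows "norm (x - ((2 * (m \<bullet> e)) *\<^sub>R e + reflection e x)) = \<bar>2 * ((x - m) \<bullet> e)\<bar>"
proof -
  have "x - ((2 * (m \<bullet> e)) *\<^sub>R e + reflection e x) = (2 * ((x - m) \<bullet> e)) *\<^sub>R e"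
    unfolding reflection_def by (simp add: inner_diff_left algebra_simps)
  then show ?thesis using assms by simp
qed

text \<open>The affine reflection exchanging two given points, written as a translation after a
  linear reflection, which is the form that \<open>wl_isometry\<close> accepts.\<close>

lemma bisector_reflection_swaps:
  assumes xy: "x ~= y" and e: "e = (1 / norm (x - y)) *\<^sub>R (x - y)" and m: "m = (1/2) *\<^sub>R (x + y)"
  shows "norm e = 1" "(2 * (m \<bullet> e)) *\<^sub>R e + reflection e x = y" "2 * ((x - m) \<bullet> e) = norm (x - y)"
proof -
  define s where "s = norm (x - y)"
  have s: "s > 0" using xy unfolding s_def by simp
  show n: "norm e = 1" unfolding e using xy by simp
  have ss: "(x - y) \<bullet> (x - y) = s * s" unfolding s_def by (simp add: power2_norm_eq_inner[symmetric] power2_eq_square)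
  have xm: "x - m = (1/2) *\<^sub>R (x - y)" unfolding m by (simp add: algebra_simps scaleR_2[symmetric] flip: scaleR_add_left)
  show l: "2 * ((x - m) \<bullet> e) = norm (x - y)"
    unfolding xm e using ss s by (simp add: s_def[symmetric])
  have "(2 * (m \<bullet> e)) *\<^sub>R e + reflection e x = x - (2 * ((x - m) \<bullet> e)) *\<^sub>R e"
    unfolding reflection_def by (simp add: inner_diff_left algebra_simps)
  also have "... = y" unfolding l using s by (simp add: e s_def[symmetric])
  finally show "(2 * (m \<bullet> e)) *\<^sub>R e + reflection e x = y" .
qed

text \<open>Doubling of variables: the difference of \<open>u\<close> and its reflection in the bisecting hyperplane of a
  maximising pair has a local maximum, so that the Laplacian at the two points can be compared
  although \<open>u\<close> is only of class \<open>C\<^sup>1\<close>.\<close>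

lemma lipschitz_estimate:
  fixes u :: "'a::euclidean_space => real"
  assumes w: "wl S u V F" and sub: "cball x0 R \<subseteq> S" and R: "0 < R" and M: "0 < M"
    and osc: "!!x y. x \<in> cball x0 R ==> y \<in> cball x0 R ==> u x - u y <= M"
    and F: "!!x. x \<in> cball x0 R ==> \<bar>F x\<bar> <= b1 * norm (V x) + b2 * M"
    and b: "0 <= b1" "b1 * R <= 1" "b2 * R^2 <= 1"
    and y: "norm (y - x0) <= R / 4"
  shows "u x0 - u y <= (2 * real DIM('a) + 4) * (M / R) * norm (y - x0)"
proof (rule ccontr)
  define n where "n = real DIM('a)"
  have n: "n >= 1" unfolding n_def by (simp add: DIM_positive Suc_leI)
  \<comment> \<open>\<open>K\<close> is the slope to be refuted and \<open>L\<close> localises: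
    \<open>L * (R / 2)^2 = M\<close> keeps \<open>x\<close> within \<open>R / 2\<close> of the
    centre. The factor \<open>2 * n + 4\<close> is large enough for the boundary |x - z| = R / 4 and
    for the final inequality.\<close>
  define K where "K = (2 * n + 4) * (M / R)"
  define L where "L = 4 * M / R^2"
  have K: "K > 0" and L: "L > 0" using n M R unfolding K_def L_def by auto
  \<comment> \<open>The concave correction has second derivative - 2 K / R, which supplies the large
    term on the left of the final inequality.\<close>
  define \<phi> where "\<phi> s = K * (s - s^2 / R)" for s
  assume "\<not> u x0 - u y <= (2 * real DIM('a) + 4) * (M / R) * norm (y - x0)"
  then have big: "u x0 - u y > K * norm (y - x0)" unfolding K_def n_def by simp
  let ?Q = "{p \<in> cball x0 R \<times> cball x0 R. norm (fst p - snd p) <= R / 4}"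
  let ?T = "%p. u (fst p) - u (snd p) - \<phi> (norm (fst p - snd p)) - L * (norm (fst p - x0))^2"
  have cQ: "compact ?Q"
  proof -
    have "closed {p :: 'a \<times> 'a. norm (fst p - snd p) <= R / 4}"
      by (intro closed_Collect_le continuous_intros)
    then have "compact ((cball x0 R \<times> cball x0 R) \<inter> {p. norm (fst p - snd p) <= R / 4})"
      by (intro compact_Int_closed compact_Times compact_cball)
    moreover have "(cball x0 R \<times> cball x0 R) \<inter> {p. norm (fst p - snd p) <= R / 4} = ?Q" by auto
    ultimately show ?thesis by simp
  qed
  have cu: "continuous_on (cball x0 R) u" using wl_cont[OF w] sub continuous_on_subset by blast
  have cT: "continuous_on ?Q ?T"
  proof -
    have "continuous_on ?Q (%p. u (fst p))" "continuous_on ?Q (%p. u (snd p))"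
      by (rule continuous_on_compose2[OF cu]; auto intro!: continuous_intros)+
    then show ?thesis unfolding \<phi>_def by (intro continuous_intros) (use R in auto)
  qed
  have inQ: "(x0, y) \<in> ?Q" using y R by (auto simp: dist_norm norm_minus_commute)
  obtain p where p: "p \<in> ?Q" "!!p'. p' \<in> ?Q ==> ?T p' <= ?T p"
    using continuous_attains_sup[OF cQ _ cT] inQ by blast
  define x z where "x = fst p" and "z = snd p"
  have xz: "x \<in> cball x0 R" "z \<in> cball x0 R" "norm (x - z) <= R / 4"
    using p(1) unfolding x_def z_def by auto
  define s where "s = norm (x - z)"
  have T0: "?T (x0, y) > 0"
  proof -
    have "K * (norm (y - x0) - (norm (y - x0))^2 / R) <= K * norm (y - x0)"
      using K R by (intro mult_left_mono) auto
    then show ?thesis using big unfolding \<phi>_def by (simp add: norm_minus_commute)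
  qed
  then have Tp: "u x - u z - \<phi> s - L * (norm (x - x0))^2 > 0"
    using p(2)[OF inQ] unfolding x_def z_def s_def by simp
  have s0: "0 <= s" "s <= R / 4" using xz unfolding s_def by auto
  have \<phi>0: "\<phi> s >= 0"
  proof -
    have "s * s <= s * R" using s0 R by (intro mult_left_mono) auto
    then show ?thesis using K R unfolding \<phi>_def by (simp add: power2_eq_square field_simps)
  qed
  have oM: "u x - u z <= M" by (rule osc[OF xz(1,2)])
  have near: "norm (x - x0) < R / 2"
  proof (rule ccontr)
    assume "\<not> norm (x - x0) < R / 2"
    then have "(R / 2)^2 <= (norm (x - x0))^2" using R by (intro power_mono) auto
    then have "L * (R / 2)^2 <= L * (norm (x - x0))^2" using L by simp
    moreover have "L * (R / 2)^2 = M" unfolding L_def using R by (simp add: power2_eq_square)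
    ultimately show False using Tp oM \<phi>0 by linarith
  qed
  have sR: "s < R / 4"
  proof (rule ccontr)
    assume "\<not> s < R / 4"
    then have e: "s = R / 4" using s0 by simp
    have "\<phi> s = (2 * n + 4) * M * (3 / 16)"
      unfolding e \<phi>_def K_def using R by (simp add: power2_eq_square field_simps)
    also have "... >= M" using n M by (simp add: field_simps)
    finally show False using Tp oM L zero_le_power2[of "norm (x - x0)"] mult_nonneg_nonneg[of L "(norm (x - x0))^2"] by linarith
  qed
  have xzne: "x ~= z"
  proof
    assume "x = z"
    then have "L * (norm (x - x0))^2 < 0" using Tp \<phi>0 by simp
    then show False using L by (simp add: mult_less_0_iff)
  qed
  then have spos: "s > 0" unfolding s_def by simp
  have zin: "norm (z - x0) < 3 * R / 4"
    using norm_triangle_ineq[of "z - x" "x - x0"] near sR unfolding s_def by (simp add: norm_minus_commute)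
  have xb: "x \<in> ball x0 R" "z \<in> ball x0 R" using near zin R by (auto simp: dist_norm norm_minus_commute)
  define \<delta> where "\<delta> = min (R / 4 - s) (R / 4)"
  have \<delta>: "\<delta> > 0" "\<delta> <= R / 4 - s" "\<delta> <= R / 4"
  proof -
    show "\<delta> > 0" using sR R unfolding \<delta>_def by simp
    show "\<delta> <= R / 4 - s" "\<delta> <= R / 4" unfolding \<delta>_def by (rule min.cobounded1, rule min.cobounded2)
  qed
  have max1: "u x' - \<phi> (norm (x' - z)) - L * (norm (x' - x0))^2 <= u x - \<phi> (norm (x - z)) - L * (norm (x - x0))^2"
    if "x' \<in> ball x \<delta>" for x'
  proof -
    have d: "norm (x' - x) < \<delta>" using that by (simp add: dist_norm norm_minus_commute)
    have "norm (x' - z) <= R / 4" using norm_triangle_ineq[of "x' - x" "x - z"] d \<delta> unfolding s_def by simp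
    moreover have "norm (x' - x0) <= R" using norm_triangle_ineq[of "x' - x" "x - x0"] d \<delta> near R by simp
    ultimately have "(x', z) \<in> ?Q" using xz by (auto simp: dist_norm norm_minus_commute)
    from p(2)[OF this] show ?thesis unfolding x_def z_def by simp
  qed
  have max2: "- u z' - \<phi> (norm (z' - x)) <= - u z - \<phi> (norm (z - x))" if "z' \<in> ball z \<delta>" for z'
  proof -
    have d: "norm (z' - z) < \<delta>" using that by (simp add: dist_norm norm_minus_commute)
    have "norm (x - z') <= R / 4" using norm_triangle_ineq[of "x - z" "z - z'"] d \<delta> unfolding s_def by (simp add: norm_minus_commute)
    moreover have "norm (z' - x0) <= R" using norm_triangle_ineq[of "z' - z" "z - x0"] d \<delta> zin R by simp
    ultimately have "(x, z') \<in> ?Q" using xz by (auto simp: dist_norm norm_minus_commute)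
    from p(2)[OF this] show ?thesis unfolding x_def z_def by (simp add: norm_minus_commute)
  qed
  define \<phi>' where "\<phi>' t = K * (1 - 2 * t / R)" for t
  have d\<phi>: "DERIV \<phi> t :> \<phi>' t" for t
    unfolding \<phi>_def \<phi>'_def using R by (auto intro!: derivative_eq_intros)
  have gn: "GDERIV (%x. \<phi> (norm (x - c))) x :> \<phi>' (norm (x - c)) *\<^sub>R sgn (x - c)" if "x ~= c" for x c :: 'a
  proof -
    have "(norm has_derivative (%h. h \<bullet> sgn (x - c))) (at (x - c))"
      using GDERIV_norm[of "x - c"] that by (simp add: gderiv_def)
    moreover have "((%x. x - c) has_derivative (%h. h)) (at x)"
      using has_derivative_diff[OF has_derivative_ident has_derivative_const, of c "at x"] by simp
    ultimately have "GDERIV (%x. norm (x - c)) x :> sgn (x - c)"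
      unfolding gderiv_def by (rule has_derivative_compose[rotated])
    then show ?thesis by (rule GDERIV_DERIV_compose[OF _ d\<phi>])
  qed
  have gsq: "GDERIV (%x. L * (norm (x - x0))^2) x :> (2 * L) *\<^sub>R (x - x0)" for x
    using wlD(2)[OF wl_cmult[OF wl_norm_square[of x0], of L]] by (simp add: mult_ac)
  have \<phi>'s: "0 <= \<phi>' s" "\<phi>' s <= K"
    unfolding \<phi>'_def using K R s0 by (simp_all add: field_simps)
  have nsgn: "norm (sgn (x - z)) = 1" "norm (sgn (z - x)) = 1" using xzne by (simp_all add: norm_sgn)
  \<comment> \<open>Varying one point of the pair at a time determines the gradients at both points,
    and the hypothesis on \<open>F\<close> then bounds the Laplacians there.\<close>
  have Vx: "norm (V x) <= K + L * R"
  proof -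
    have "V x - \<phi>' (norm (x - z)) *\<^sub>R sgn (x - z) - (2 * L) *\<^sub>R (x - x0) = 0"
      by (rule GDERIV_local_max_zero[OF GDERIV_diff[OF GDERIV_diff[OF wlD(2)[OF w] gn[OF xzne]] gsq] \<delta>(1)])
        (use max1 sub xz in auto)
    then have "V x = \<phi>' s *\<^sub>R sgn (x - z) + (2 * L) *\<^sub>R (x - x0)" unfolding s_def by (simp add: algebra_simps)
    then have "norm (V x) <= \<phi>' s * 1 + 2 * L * norm (x - x0)"
      using norm_triangle_ineq[of "\<phi>' s *\<^sub>R sgn (x - z)" "(2 * L) *\<^sub>R (x - x0)"] \<phi>'s L nsgn by simp
    also have "... <= K + 2 * L * (R / 2)" using \<phi>'s L near by (intro add_mono mult_left_mono) auto
    finally show ?thesis by simp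
  qed
  have Vz: "norm (V z) <= K"
  proof -
    have "- V z - \<phi>' (norm (z - x)) *\<^sub>R sgn (z - x) = 0"
      by (rule GDERIV_local_max_zero[OF GDERIV_diff[OF GDERIV_minus[OF wlD(2)[OF w]] gn] \<delta>(1)])
        (use max2 sub xz xzne in auto)
    then have "- V z = \<phi>' s *\<^sub>R sgn (z - x)" unfolding s_def by (simp add: norm_minus_commute)
    then have "norm (V z) = norm (\<phi>' s *\<^sub>R sgn (z - x))" by (metis norm_minus_cancel)
    then show ?thesis using \<phi>'s nsgn by simp
  qed
  define e where "e = (1 / norm (x - z)) *\<^sub>R (x - z)"
  define m where "m = (1/2) *\<^sub>R (x + z)"
  note sw = bisector_reflection_swaps[OF xzne e_def m_def]
  define f where "f = reflection e"
  define c where "c = (2 * (m \<bullet> e)) *\<^sub>R e"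
  note orth = reflection_orthogonal[OF sw(1), folded f_def]
  have gx: "c + f x = z" using sw(2) unfolding c_def f_def .
  have cg: "continuous_on UNIV (%x. c + f x)"
    using orth(1) by (intro continuous_intros linear_continuous_on)
      (simp add: orthogonal_transformation_def linear_conv_bounded_linear)
  have iso: "norm ((c + f a) - (c + f b)) = norm (a - b)" for a b
  proof -
    have "(c + f a) - (c + f b) = f (a - b)"
      using orth(1) by (simp add: orthogonal_transformation linear_diff)
    then show ?thesis using orth(1) by (simp add: orthogonal_transformation)
  qed
  let ?S = "S \<inter> (%x. c + f x) -` S"
  have opS: "open ?S" using wlD(1)[OF w] cg by (intro open_Int open_vimage) auto
  have xS: "x \<in> ?S" using sub xz gx by auto
  have w1: "wl ?S u V F" by (rule wl_mono[OF w opS]) auto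
  have w2: "wl ?S (%x. u (c + f x)) (%x. f (V (c + f x))) (%x. F (c + f x))"
    by (rule wl_mono[OF wl_isometry[OF w orth] opS]) auto
  \<comment> \<open>On the side of \<open>x\<close>, \<open>l \<xi>\<close> is the distance from
    \<xi> to its mirror image. Being affine, it turns the distance penalty into a smooth function of
    one point.\<close>
  define l where "l \<xi> = \<xi> \<bullet> (2 *\<^sub>R e) + - (2 * (m \<bullet> e))" for \<xi>
  have l: "l \<xi> = 2 * ((\<xi> - m) \<bullet> e)" for \<xi> unfolding l_def by (simp add: inner_diff_left)
  have w3: "wl ?S l (%_. 2 *\<^sub>R e) (%_. 0)"
  proof -
    have "wl UNIV l (%_. 2 *\<^sub>R e + 0) (%_. 0 + 0)"
      unfolding l_def by (rule wl_add[OF wl_inner wl_const])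
    then show ?thesis using wl_mono[OF _ opS] by simp
  qed
  have w4: "wl ?S (%\<xi>. \<phi> (l \<xi>)) (%\<xi>. \<phi>' (l \<xi>) *\<^sub>R 2 *\<^sub>R e) (%\<xi>. \<phi>' (l \<xi>) * 0 + (- 2 * K / R) * (norm (2 *\<^sub>R e))^2)"
  proof (rule wl_compose[OF w3, where g''="%_. - 2 * K / R"])
    show "DERIV \<phi>' (l \<xi>) :> - 2 * K / R" for \<xi>
      unfolding \<phi>'_def using R by (auto intro!: derivative_eq_intros)
  qed (auto intro: d\<phi>)
  have w5: "wl ?S (%x. L * (norm (x - x0))^2) (%x. L *\<^sub>R 2 *\<^sub>R (x - x0)) (%x. L * (2 * n))"
    unfolding n_def by (rule wl_mono[OF wl_cmult[OF wl_norm_square] opS]) auto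
  note wH = wl_diff[OF wl_diff[OF w1 w2] wl_add[OF w4 w5]]
  have lx: "l x = s" unfolding l sw(3) s_def ..
  obtain \<delta>2 where \<delta>2: "\<delta>2 > 0" "!!\<xi>. norm (\<xi> - x) < \<delta>2 ==> l \<xi> > 0"
  proof
    show "s / 2 > 0" using spos by simp
    fix \<xi> assume "norm (\<xi> - x) < s / 2"
    moreover have "l \<xi> = s + 2 * ((\<xi> - x) \<bullet> e)" unfolding lx[symmetric] l by (simp add: inner_diff_left)
    moreover have "\<bar>(\<xi> - x) \<bullet> e\<bar> <= norm (\<xi> - x)" using Cauchy_Schwarz_ineq2[of "\<xi> - x" e] sw(1) by simp
    ultimately show "l \<xi> > 0" by linarith
  qed
  define \<epsilon> where "\<epsilon> = min \<delta>2 (\<delta> / 2)"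
  have \<epsilon>: "\<epsilon> > 0" "\<epsilon> <= \<delta>2" "\<epsilon> <= \<delta> / 2" using \<delta> \<delta>2 unfolding \<epsilon>_def by auto
  have "F x - F (c + f x) - ((\<phi>' (l x) * 0 + (- 2 * K / R) * (norm (2 *\<^sub>R e))^2) + L * (2 * n)) <= 0"
  proof (rule wl_local_max[OF wH xS \<epsilon>(1)])
    fix \<xi> assume "\<xi> \<in> ball x \<epsilon>"
    then have d: "norm (\<xi> - x) < \<epsilon>" by (simp add: dist_norm norm_minus_commute)
    have ln: "norm (\<xi> - (c + f \<xi>)) = l \<xi>"
      unfolding c_def f_def norm_sub_bisector_reflection[OF sw(1)] l[symmetric]
      using \<delta>2(2)[of \<xi>] d \<epsilon> by simp
    have d2: "norm ((c + f \<xi>) - z) < \<epsilon>" using iso[of \<xi> x] d gx by simp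
    have tri: "norm (\<xi> - y) <= norm (\<xi> - x) + norm (x - z) + norm (z - y)" for y
      using norm_triangle_ineq[of "\<xi> - x" "x - z"] norm_triangle_ineq[of "\<xi> - z" "z - y"] by simp
    from tri[of "c + f \<xi>"] have "norm (\<xi> - (c + f \<xi>)) <= R / 4" using d d2 \<epsilon> \<delta> unfolding s_def by (simp add: norm_minus_commute)
    moreover have "norm (\<xi> - x0) <= R" using norm_triangle_ineq[of "\<xi> - x" "x - x0"] d \<epsilon> \<delta> near R by simp
    moreover have "norm ((c + f \<xi>) - x0) <= R"
      using norm_triangle_ineq[of "(c + f \<xi>) - z" "z - x0"] d2 \<epsilon> \<delta> zin R by simp
    ultimately have "(\<xi>, c + f \<xi>) \<in> ?Q" by (auto simp: dist_norm norm_minus_commute)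
    from p(2)[OF this] have "u \<xi> - u (c + f \<xi>) - \<phi> (l \<xi>) - L * (norm (\<xi> - x0))^2 <= u x - u z - \<phi> s - L * (norm (x - x0))^2"
      unfolding x_def z_def s_def by (simp add: ln)
    then show "u \<xi> - u (c + f \<xi>) - (\<phi> (l \<xi>) + L * (norm (\<xi> - x0))^2) <= u x - u (c + f x) - (\<phi> (l x) + L * (norm (x - x0))^2)"
      unfolding gx lx by simp
  qed
  \<comment> \<open>The gradient of \<open>l\<close> has length 2, so the second derivative of
    \<phi> enters with the factor 4.\<close>
  then have ineq: "8 * K / R <= F z - F x + 2 * n * L" unfolding gx using sw(1) by (simp add: mult_ac)
  have "F z <= b1 * K + b2 * M"
    using F[OF xz(2)] mult_left_mono[OF Vz b(1)] by linarith
  moreover have "- F x <= b1 * (K + L * R) + b2 * M"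
    using F[OF xz(1)] mult_left_mono[OF Vx b(1)] by linarith
  ultimately have "8 * K / R <= b1 * (2 * K + L * R) + 2 * b2 * M + 2 * n * L"
    using ineq by (simp add: algebra_simps)
  then have "8 * K / R * R^2 <= (b1 * (2 * K + L * R) + 2 * b2 * M + 2 * n * L) * R^2"
    by (rule mult_right_mono) simp
  then have "8 * (K * R) <= (b1 * R) * (2 * (K * R) + L * R^2) + 2 * (b2 * R^2) * M + 2 * n * (L * R^2)"
    using R by (simp add: power2_eq_square algebra_simps)
  moreover have LR: "L * R^2 = 4 * M" unfolding L_def using R by simp
  ultimately have "8 * (K * R) <= (b1 * R) * (2 * (K * R) + 4 * M) + 2 * (b2 * R^2) * M + 2 * n * (4 * M)"
    by (simp only: LR)
  moreover have KR: "K * R = (2 * n + 4) * M" unfolding K_def using R by simp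
  moreover have "(b1 * R) * (2 * (K * R) + 4 * M) <= 1 * (2 * (K * R) + 4 * M)"
    using b K R M by (intro mult_right_mono) auto
  moreover have "(b2 * R^2) * M <= 1 * M" using b M by (intro mult_right_mono) auto
  ultimately have "8 * ((2 * n + 4) * M) <= 1 * (2 * ((2 * n + 4) * M) + 4 * M) + 2 * (1 * M) + 2 * n * (4 * M)"
    unfolding KR by linarith
  then have "(4 * n + 18) * M <= 0" by (simp add: algebra_simps)
  then show False using n M by (simp add: mult_le_0_iff)
qed

text \<open>For an exponent \<open>n\<close> equal to the dimension the coefficient is 2 n (n + 2) >
  0: the barrier is strictly subharmonic, with room for the lower-order terms.\<close>

lemma wl_inverse_power_norm:
  "wl (-{x0}) (%x::'a::euclidean_space. inverse (((norm (x - x0))^2) ^ n))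
    (%x. (- real n * inverse (((norm (x - x0))^2) ^ (Suc n))) *\<^sub>R 2 *\<^sub>R (x - x0))
    (%x. 2 * real n * (2 * (real n + 1) - real DIM('a)) * inverse (((norm (x - x0))^2) ^ (Suc n)))"
proof -
  let ?w = "%x::'a. (norm (x - x0))^2"
  have pos: "?w x > 0" if "x \<in> -{x0}" for x using that by auto
  have w: "wl (-{x0}) ?w (%x. 2 *\<^sub>R (x - x0)) (%x. 2 * real DIM('a))"
    by (rule wl_mono[OF wl_norm_square]) auto
  have d: "DERIV (%y. inverse (y ^ m)) y :> - real m * inverse (y ^ Suc m)" if "y > 0" for y :: real and m
  proof (cases m)
    case (Suc k)
    have "y * y ^ (k - Suc 0) = y ^ k" if "k ~= 0" using that by (cases k) auto
    then show ?thesis using that Suc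
      by (cases "k = 0") (auto intro!: derivative_eq_intros simp: field_simps power2_eq_square)
  qed simp
  have "wl (-{x0}) (%x. inverse (?w x ^ n)) (%x. (- real n * inverse (?w x ^ Suc n)) *\<^sub>R 2 *\<^sub>R (x - x0))
     (%x. (- real n * inverse (?w x ^ Suc n)) * (2 * real DIM('a))
        + (- real n * (- real (Suc n) * inverse (?w x ^ Suc (Suc n)))) * (norm (2 *\<^sub>R (x - x0)))^2)"
  proof (rule wl_compose[OF w, where g="%y. inverse (y ^ n)" and g'="%y. - real n * inverse (y ^ Suc n)"
        and g''="%y. - real n * (- real (Suc n) * inverse (y ^ Suc (Suc n)))"])
    show "DERIV (%y. - real n * inverse (y ^ Suc n)) (?w x) :> - real n * (- real (Suc n) * inverse (?w x ^ Suc (Suc n)))"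
      if "x \<in> -{x0}" for x
      by (rule DERIV_cmult[OF d[OF pos[OF that]]])
    show "continuous_on (-{x0}) (%x. - real n * (- real (Suc n) * inverse (?w x ^ Suc (Suc n))))"
      by (intro continuous_intros) auto
  qed (rule d[OF pos])
  then show ?thesis
  proof (rule wl_cong)
    fix x assume "x \<in> -{x0}"
    then have p: "?w x > 0" by (rule pos)
    define X where "X = ?w x"
    have X: "X > 0" using p unfolding X_def .
    have e: "(norm (2 *\<^sub>R (x - x0)))^2 = 4 * X" unfolding X_def by (simp add: power_mult_distrib)
    have "inverse (X ^ Suc (Suc n)) * X = inverse (X ^ Suc n)" using X by (simp add: field_simps)
    then have "(- real n * (- real (Suc n) * inverse (X ^ Suc (Suc n)))) * (4 * X)
       = 4 * real n * (real n + 1) * inverse (X ^ Suc n)"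
      by (metis (no_types, opaque_lifting) mult.assoc mult.commute mult_minus_left minus_minus of_nat_Suc add.commute mult.left_commute)
    then show "2 * real n * (2 * (real n + 1) - real DIM('a)) * inverse (?w x ^ (Suc n))
       = (- real n * inverse (?w x ^ Suc n)) * (2 * real DIM('a))
        + (- real n * (- real (Suc n) * inverse (?w x ^ Suc (Suc n)))) * (norm (2 *\<^sub>R (x - x0)))^2"
      unfolding e X_def[symmetric] by (simp add: algebra_simps del: power_Suc)
  qed auto
qed

text \<open>The maximum point \<open>x0\<close> of \<open>(R - |x - c|)\<^sup>2\<^sup>N u\<close> is surrounded by a ball on which \<open>u\<close> is comparable
  with \<open>u x0\<close>; a barrier \<open>|x - x0|\<^sup>-\<^sup>2\<^sup>N\<close>, with the same exponent, carries this positivity back to the centre.\<close>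

lemma harnack_local:
  fixes u :: "'a::euclidean_space => real"
  assumes w: "wl S u V F" and sub: "cball c (3 * R) \<subseteq> S" and R: "0 < R"
    and pos: "!!x. x \<in> cball c (3 * R) ==> 0 < u x"
    and F: "!!x. x \<in> cball c (3 * R) ==> \<bar>F x\<bar> <= b1 * norm (V x) + b2 * u x"
    and b: "0 <= b1" "0 <= b2" "b1 * R <= 1/2" "b2 * R^2 <= 1/2"
    and x: "norm (x - c) <= R / 2"
  shows "u x <= 4 * (2 * ((2 * real DIM('a) + 4) * 4 * 4 ^ DIM('a))) ^ (2 * DIM('a)) * u c"
proof -
  define N where "N = DIM('a)"
  define n where "n = real N"
  have N1: "N >= 1" unfolding N_def by (simp add: DIM_positive Suc_leI)
  then have n: "n >= 1" unfolding n_def by simp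
  \<comment> \<open>Chosen so that the Lipschitz estimate on the ball of radius
    \<open>d0 / 2\<close>, applied at distance \<open>\<kappa> * d0\<close> with
    \<open>\<kappa> = 1 / Q\<close>, loses exactly half of \<open>u x0\<close>.\<close>
  define Q where "Q = (2 * n + 4) * 4 * 4 ^ N"
  have Q8: "Q >= 8"
  proof -
    have "(1::real) <= 4 ^ N" by simp
    then have "(2 * n + 4) * 4 * 1 <= Q" unfolding Q_def using n by (intro mult_left_mono) auto
    moreover have "(2 * n + 4) * 4 * 1 = 8 * n + 16" by simp
    ultimately show ?thesis using n by linarith
  qed
  define \<kappa> where "\<kappa> = 1 / Q"
  have \<kappa>: "\<kappa> > 0" "\<kappa> <= 1/8" "\<kappa> * Q = 1" using Q8 unfolding \<kappa>_def by (auto simp: field_simps)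
  define d where "d x = R - norm (x - c)" for x
  have in3: "x \<in> cball c (3 * R)" if "norm (x - c) <= 3 * R" for x
    using that by (simp add: dist_norm norm_minus_commute)
  have cu: "continuous_on (cball c (3 * R)) u" using wl_cont[OF w] sub continuous_on_subset by blast
  have cuR: "continuous_on (cball c R) u" by (rule continuous_on_subset[OF cu]) (use R in auto)
  have "continuous_on (cball c R) (%x. d x ^ (2 * N) * u x)"
    unfolding d_def by (intro continuous_intros cuR)
  then obtain x0 where x0: "x0 \<in> cball c R" "!!y. y \<in> cball c R ==> d y ^ (2 * N) * u y <= d x0 ^ (2 * N) * u x0"
    using continuous_attains_sup[of "cball c R" "%x. d x ^ (2 * N) * u x"] R by force
  define d0 where "d0 = d x0"
  have nx0: "norm (x0 - c) <= R" using x0(1) by (simp add: dist_norm norm_minus_commute)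
  have uc: "u c > 0" using pos[of c] R by simp
  have ux0: "u x0 > 0" using pos[OF in3[of x0]] nx0 R by simp
  have "d c ^ (2 * N) * u c > 0" using uc R unfolding d_def by simp
  then have "d0 ^ (2 * N) * u x0 > 0" using x0(2)[of c] R unfolding d0_def by simp
  then have "d0 ~= 0" using N1 by (auto simp: power_0_left)
  then have d0: "d0 > 0" "d0 <= R" using nx0 unfolding d0_def d_def by auto
  define M where "M = 4 ^ N * u x0"
  have M: "M > 0" using ux0 unfolding M_def by simp
  \<comment> \<open>On this ball \<open>d\<close> drops by a factor of at most 2, so maximality of
    the weighted function costs 2^(2 N) = 4^N.\<close>
  have half: "u y <= M" "0 < u y" "y \<in> cball c (3 * R)" if "y \<in> cball x0 (d0 / 2)" for y
  proof -
    have yx: "norm (y - x0) <= d0 / 2" using that by (simp add: dist_norm norm_minus_commute)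
    then have dy: "d y >= d0 / 2"
      using norm_triangle_ineq[of "y - x0" "x0 - c"] unfolding d0_def d_def by simp
    then have yR: "norm (y - c) <= R" using d0 unfolding d_def by linarith
    then show y3: "y \<in> cball c (3 * R)" using R by (intro in3) simp
    then show uy: "0 < u y" by (rule pos)
    have "(d0 / 2) ^ (2 * N) * u y <= d y ^ (2 * N) * u y"
      using dy d0 uy by (intro mult_right_mono power_mono) auto
    also have le: "... <= d0 ^ (2 * N) * u x0"
      using x0(2)[of y] yR unfolding d0_def by (simp add: dist_norm norm_minus_commute)
    finally have "(d0 / 2) ^ (2 * N) * u y <= d0 ^ (2 * N) * u x0" .
    moreover have "(2::real) ^ (2 * N) = 4 ^ N" by (simp add: power_mult)
    ultimately have "d0 ^ (2 * N) * u y <= d0 ^ (2 * N) * M"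
      unfolding M_def power_divide by (simp add: field_simps)
    then show "u y <= M" using d0 by (simp add: mult_le_cancel_left)
  qed
  have nearx0: "u y >= u x0 / 2" if "norm (y - x0) <= \<kappa> * d0" for y
  proof -
    have "u x0 - u y <= (2 * real DIM('a) + 4) * (M / (d0 / 2)) * norm (y - x0)"
    proof (rule lipschitz_estimate[OF w _ _ M, where ?b1.0=b1 and ?b2.0=b2])
      show "cball x0 (d0 / 2) \<subseteq> S" using half(3) sub by blast
      show "u y - u z <= M" if "y \<in> cball x0 (d0 / 2)" "z \<in> cball x0 (d0 / 2)" for y z
        using half(1)[OF that(1)] half(2)[OF that(2)] by simp
      show "\<bar>F y\<bar> <= b1 * norm (V y) + b2 * M" if "y \<in> cball x0 (d0 / 2)" for y
        using F[OF half(3)[OF that]] mult_left_mono[OF half(1)[OF that] b(2)] by linarith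
      have "b1 * (d0 / 2) <= b1 * R" using b d0 by (intro mult_left_mono) auto
      then show "b1 * (d0 / 2) <= 1" using b by linarith
      have "b2 * (d0 / 2)^2 <= b2 * R^2" using b d0 by (intro mult_left_mono power_mono) auto
      then show "b2 * (d0 / 2)^2 <= 1" using b by linarith
      have "\<kappa> * d0 <= (1/8) * d0" using \<kappa> d0 by (intro mult_right_mono) auto
      then show "norm (y - x0) <= d0 / 2 / 4" using that by linarith
    qed (use d0 b in auto)
    also have "... <= (2 * real DIM('a) + 4) * (M / (d0 / 2)) * (\<kappa> * d0)"
      using that M d0 by (intro mult_left_mono) auto
    also have "... = (\<kappa> * Q) * (u x0 / 2)"
      unfolding M_def Q_def n_def N_def using d0 by (simp add: field_simps)
    finally show ?thesis unfolding \<kappa> by simp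
  qed
  \<comment> \<open>The maximal value of the weighted function. Estimating \<open>G\<close> rather
    than \<open>u x0\<close> keeps the bound independent of how close \<open>x0\<close> is to the
    boundary of the ball.\<close>
  define G where "G = d0 ^ (2 * N) * u x0"
  have main: "G <= 4 * Q ^ (2 * N) * R ^ (2 * N) * u c"
  proof (cases "norm (c - x0) <= \<kappa> * d0")
    case True
    have "u x0 <= 2 * u c" using nearx0[OF True] by simp
    moreover have "d0 ^ (2 * N) <= R ^ (2 * N)" using d0 by (intro power_mono) auto
    ultimately have "G <= R ^ (2 * N) * (2 * u c)" unfolding G_def using ux0 d0 R by (intro mult_mono) auto
    moreover have "1 * (R ^ (2 * N) * (2 * u c)) <= (2 * Q ^ (2 * N)) * (R ^ (2 * N) * (2 * u c))"
    proof (rule mult_right_mono)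
      have "1 <= Q ^ (2 * N)" using Q8 by (intro one_le_power) auto
      then show "1 <= 2 * Q ^ (2 * N)" by linarith
    qed (use R uc in auto)
    ultimately show ?thesis by (simp add: mult_ac)
  next
    case False
    define k0 where "k0 = \<kappa> * d0"
    have k0: "k0 > 0" "k0 <= R"
    proof -
      show "k0 > 0" using \<kappa> d0 unfolding k0_def by simp
      have "\<kappa> * d0 <= 1 * R" using \<kappa> d0 by (intro mult_mono) auto
      then show "k0 <= R" unfolding k0_def by simp
    qed
    define W where "W x = (norm (x - x0))^2" for x
    \<comment> \<open>\<open>A\<close> makes the barrier at most \<open>u x0 / 2\<close> on the
      inner sphere, and \<open>E\<close> makes it vanish on the sphere of radius
      \<open>2 * R\<close>, so a negative minimum of \<open>u - bb\<close> is interior.\<close>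
    define A where "A = (u x0 / 2) * (k0^2) ^ N"
    have A: "A > 0" using ux0 k0 unfolding A_def by simp
    define E where "E = inverse (((2 * R)^2) ^ N)"
    have E: "E > 0" using R unfolding E_def by simp
    define bb where "bb x = A * (inverse (W x ^ N) - E)" for x
    let ?Ann = "{x. k0 <= norm (x - x0)} \<inter> cball x0 (2 * R)"
    have cAnn: "compact ?Ann" by (intro closed_Int_compact closed_Collect_le continuous_intros compact_cball)
    have Ann3: "y \<in> cball c (3 * R)" if "y \<in> ?Ann" for y
      using that nx0 norm_triangle_ineq[of "y - x0" "x0 - c"] by (intro in3) (auto simp: dist_norm norm_minus_commute)
    have cAnn': "c \<in> ?Ann" using False nx0 R unfolding k0_def by (auto simp: dist_norm norm_minus_commute)
    have Wpos: "W y > 0" if "y ~= x0" for y using that unfolding W_def by simp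
    have AnnW: "W y > 0" "y ~= x0" if "y \<in> ?Ann" for y using that k0 unfolding W_def by auto
    have "continuous_on ?Ann (%x. u x - bb x)"
      unfolding bb_def W_def
      by (intro continuous_intros continuous_on_subset[OF cu] subsetI Ann3) (use AnnW(2) in auto)
    then obtain y where y: "y \<in> ?Ann" "!!z. z \<in> ?Ann ==> u y - bb y <= u z - bb z"
      using continuous_attains_inf[OF cAnn] cAnn' by blast
    have "u y - bb y >= 0"
    proof (rule ccontr)
      assume "\<not> u y - bb y >= 0"
      then have neg: "u y < bb y" by simp
      have uy: "u y > 0" using pos[OF Ann3[OF y(1)]] .
      have y1: "norm (y - x0) ~= k0"
      proof
        assume e: "norm (y - x0) = k0"
        have "bb y <= A * inverse (W y ^ N)" unfolding bb_def using A E by (intro mult_left_mono) auto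
        also have "... = u x0 / 2" unfolding A_def W_def e using k0 by simp
        also have "... <= u y" by (rule nearx0) (use e k0_def in auto)
        finally show False using neg by simp
      qed
      have y2: "norm (y - x0) ~= 2 * R"
      proof
        assume e: "norm (y - x0) = 2 * R"
        have "bb y = 0" unfolding bb_def W_def e E_def by simp
        then show False using neg uy by simp
      qed
      define s where "s = norm (y - x0)"
      have s: "k0 < s" "s < 2 * R" using y(1) y1 y2 unfolding s_def by (auto simp: dist_norm norm_minus_commute)
      define \<delta> where "\<delta> = min (s - k0) (2 * R - s)"
      have \<delta>: "\<delta> > 0" using s unfolding \<delta>_def by simp
      let ?S = "S \<inter> -{x0}"
      have opS: "open ?S" using wlD(1)[OF w] by auto
      have yS: "y \<in> ?S" using Ann3[OF y(1)] sub AnnW(2)[OF y(1)] by auto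
      have wu: "wl ?S u V F" by (rule wl_mono[OF w opS]) auto
      have w1: "wl ?S (%x. inverse (W x ^ N)) (%x. (- n * inverse (W x ^ Suc N)) *\<^sub>R 2 *\<^sub>R (x - x0))
         (%x. 2 * n * (2 * (n + 1) - n) * inverse (W x ^ Suc N))"
        unfolding W_def n_def N_def by (rule wl_mono[OF wl_inverse_power_norm opS[unfolded N_def]]) auto
      have w2: "wl ?S bb (%x. A *\<^sub>R ((- n * inverse (W x ^ Suc N)) *\<^sub>R 2 *\<^sub>R (x - x0) - 0))
         (%x. A * (2 * n * (2 * (n + 1) - n) * inverse (W x ^ Suc N) - 0))"
        unfolding bb_def by (rule wl_cmult[OF wl_diff[OF w1 wl_mono[OF wl_const opS]]]) auto
      note w3 = wl_diff[OF w2 wu]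
      have mx: "bb z - u z <= bb y - u y" if "z \<in> ball y \<delta>" for z
      proof -
        have zy: "norm (z - y) < \<delta>" using that by (simp add: dist_norm norm_minus_commute)
        have "norm (z - x0) <= 2 * R"
          using norm_triangle_ineq[of "z - y" "y - x0"] zy unfolding \<delta>_def s_def by simp
        moreover have "k0 <= norm (z - x0)"
          using norm_triangle_ineq[of "y - z" "z - x0"] zy unfolding \<delta>_def s_def by (simp add: norm_minus_commute)
        ultimately have "z \<in> ?Ann" by (simp add: dist_norm norm_minus_commute)
        from y(2)[OF this] show ?thesis by simp
      qed
      define I where "I = inverse (W y ^ Suc N)"
      have Iw: "I > 0" unfolding I_def using AnnW(1)[OF y(1)] by simp
      have l1: "A * (2 * n * (2 * (n + 1) - n) * inverse (W y ^ Suc N) - 0) - F y <= 0"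
        by (rule wl_local_max[OF w3 yS \<delta>]) (rule mx)
      have g1: "A *\<^sub>R ((- n * inverse (W y ^ Suc N)) *\<^sub>R 2 *\<^sub>R (y - x0) - 0) - V y = 0"
        by (rule GDERIV_local_max_zero[OF wlD(2)[OF w3 yS] \<delta>]) (rule mx)
      have "V y = (- (2 * A * n * I)) *\<^sub>R (y - x0)" using g1 unfolding I_def by (simp add: mult_ac)
      then have nV: "norm (V y) = 2 * A * n * I * s" using A n Iw unfolding s_def by (simp add: abs_mult)
      have ub: "u y <= A * I * s^2"
      proof -
        have "bb y <= A * inverse (W y ^ N)" unfolding bb_def using A E by (intro mult_left_mono) auto
        also have "inverse (W y ^ N) = I * s^2"
          unfolding I_def s_def W_def[symmetric] using AnnW(1)[OF y(1)] by (simp add: field_simps)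
        finally show ?thesis using neg by (simp add: mult_ac)
      qed
      \<comment> \<open>At the minimum the gradient of \<open>u\<close> is that of the barrier and
        \<open>u\<close> lies below the barrier, so the lower-order terms are bounded by small
        multiples of the barrier's own Laplacian.\<close>
      have "A * I * (2 * n * (n + 2)) <= F y" using l1 unfolding I_def by (simp add: algebra_simps)
      also have "... <= b1 * norm (V y) + b2 * u y" using F[OF Ann3[OF y(1)]] by linarith
      also have "... <= b1 * (2 * A * n * I * s) + b2 * (A * I * s^2)"
        unfolding nV by (rule add_mono[OF order_refl mult_left_mono[OF ub b(2)]])
      also have "... = A * I * (2 * n * (b1 * s) + b2 * s^2)" by (simp add: algebra_simps)
      finally have "2 * n * (n + 2) <= 2 * n * (b1 * s) + b2 * s^2"
        using A Iw by (simp add: mult_le_cancel_left)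
      moreover have "b1 * s <= 1"
      proof -
        have "b1 * s <= b1 * (2 * R)" using s b by (intro mult_left_mono) auto
        then show ?thesis using b by linarith
      qed
      moreover have "b2 * s^2 <= 2"
      proof -
        have "s^2 <= (2 * R)^2" using s k0 by (intro power_mono) auto
        then have "b2 * s^2 <= b2 * (2 * R)^2" using b by (intro mult_left_mono) auto
        then show ?thesis using b by (simp add: power_mult_distrib)
      qed
      moreover have "2 * n * (b1 * s) <= 2 * n * 1" using \<open>b1 * s <= 1\<close> n by (intro mult_left_mono) auto
      ultimately have "2 * n * (n + 2) <= 2 * n + 2" by linarith
      moreover have "2 * n * (n + 2) >= 2 * n * 3" using n by (intro mult_left_mono) auto
      ultimately show False using n by linarith
    qed
    then have "u c >= bb c" using y(2)[OF cAnn'] by linarith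
    moreover have "bb c >= A * (inverse (R ^ (2 * N)) / 2)"
    proof -
      have "W c <= R^2" unfolding W_def using nx0 by (intro power_mono) (auto simp: norm_minus_commute)
      then have "inverse (R\<^sup>2 ^ N) <= inverse (W c ^ N)"
        using AnnW(1)[OF cAnn'] by (intro le_imp_inverse_le power_mono) auto
      moreover have "E <= inverse (R\<^sup>2 ^ N) / 2"
      proof -
        have "(2::real) <= 4 ^ N" using power_increasing[OF N1, of "4::real"] by simp
        then have "2 * (R^2) ^ N <= 4 ^ N * (R^2) ^ N" by (intro mult_right_mono) auto
        then show ?thesis unfolding E_def using R by (simp add: power_mult_distrib field_simps)
      qed
      ultimately have "inverse (R\<^sup>2 ^ N) / 2 <= inverse (W c ^ N) - E" by linarith
      then show ?thesis unfolding bb_def using A by (simp add: power_mult)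
    qed
    ultimately have "A * (inverse (R ^ (2 * N)) / 2) <= u c" by linarith
    then have "A <= 2 * R ^ (2 * N) * u c" using R by (simp add: field_simps)
    moreover have "A = (u x0 / 2) * (\<kappa> ^ (2 * N) * d0 ^ (2 * N))"
      unfolding A_def k0_def by (simp add: power_mult[symmetric] power_mult_distrib)
    ultimately have "\<kappa> ^ (2 * N) * G <= 4 * R ^ (2 * N) * u c" unfolding G_def by (simp add: mult_ac)
    then have "Q ^ (2 * N) * (\<kappa> ^ (2 * N) * G) <= Q ^ (2 * N) * (4 * R ^ (2 * N) * u c)"
      using Q8 by (intro mult_left_mono) auto
    moreover have "Q ^ (2 * N) * (\<kappa> ^ (2 * N) * G) = (\<kappa> * Q) ^ (2 * N) * G"
      unfolding power_mult_distrib by (simp only: mult_ac)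
    ultimately have "(\<kappa> * Q) ^ (2 * N) * G <= Q ^ (2 * N) * (4 * R ^ (2 * N) * u c)" by (simp only:)
    then show ?thesis unfolding \<kappa>(3) by (simp add: mult_ac)
  qed
  have x3: "x \<in> cball c (3 * R)" using x R by (intro in3) simp
  have "(R / 2) ^ (2 * N) * u x <= d x ^ (2 * N) * u x"
    using x R pos[OF x3] unfolding d_def by (intro mult_right_mono power_mono) auto
  also have "... <= G" unfolding G_def d0_def by (rule x0(2)) (use x R in \<open>simp add: dist_norm norm_minus_commute\<close>)
  finally have "(R / 2) ^ (2 * N) * u x <= 4 * Q ^ (2 * N) * R ^ (2 * N) * u c" using main by linarith
  then have "R ^ (2 * N) * u x <= R ^ (2 * N) * (4 * (2 * Q) ^ (2 * N) * u c)"
    by (simp add: power_divide power_mult_distrib field_simps)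
  then have "u x <= 4 * (2 * Q) ^ (2 * N) * u c" using R by (simp add: mult_le_cancel_left)
  then show ?thesis unfolding Q_def n_def N_def .
qed

text \<open>The normalised midpoint \<open>m\<close> satisfies |x - m|^2 <= |x - y|^2 / 2, and
  likewise for \<open>y\<close>. Passing through it squares the constant and enlarges the admissible
  distance by sqrt 2. Antipodal points have no such midpoint.\<close>

lemma harnack_sphere_step:
  fixes u :: "'a::euclidean_space => real" and C \<delta> r :: real
  assumes C: "0 < C" and step: "!!x y. norm x = r ==> norm y = r ==> x + y ~= 0 ==> norm (x - y) <= \<delta> * r ==> u x <= C * u y"
    and xy: "norm x = r" "norm y = r" "x + y ~= 0" "norm (x - y) <= (sqrt 2 * \<delta>) * r" and r: "0 < r"
  shows "u x <= C^2 * u y"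
proof -
  define s where "s = norm (x + y)"
  have s: "s > 0" using xy unfolding s_def by simp
  define m where "m = (r / s) *\<^sub>R (x + y)"
  have nm: "norm m = r" unfolding m_def using s r by (simp add: s_def[symmetric])
  have xx: "x \<bullet> x = r^2" "y \<bullet> y = r^2" using xy by (metis power2_norm_eq_inner)+
  have s2: "s^2 = 2 * r^2 + 2 * (x \<bullet> y)"
    unfolding s_def power2_norm_eq_inner by (simp add: inner_add_left inner_add_right xx inner_commute)
  have d2: "(norm (x - y))^2 = (2 * r - s) * (2 * r + s)"
    using s2 unfolding power2_norm_eq_inner
    by (simp add: inner_diff_left inner_diff_right xx inner_commute algebra_simps power2_eq_square)
  have half: "(norm (z - m))^2 <= (norm (x - y))^2 / 2" if z: "z = x \<or> z = y" for z
  proof -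
    have zm: "z \<bullet> (x + y) = s^2 / 2" using z s2 by (auto simp: inner_add_right xx inner_commute)
    have "z \<bullet> m = r * s / 2" unfolding m_def inner_scaleR_right zm using s by (simp add: power2_eq_square)
    moreover have "z \<bullet> z = r^2" "m \<bullet> m = r^2" using z xx nm by (auto simp: power2_norm_eq_inner[symmetric])
    ultimately have "(norm (z - m))^2 = r * (2 * r - s)"
      unfolding power2_norm_eq_inner
      by (simp add: inner_diff_left inner_diff_right inner_commute algebra_simps power2_eq_square)
    moreover have "2 * r - s >= 0" using norm_triangle_ineq[of x y] xy unfolding s_def by simp
    then have "(2 * r - s) * (2 * r) <= (2 * r - s) * (2 * r + s)" using s by (intro mult_left_mono) auto
    ultimately show ?thesis unfolding d2 by (simp add: algebra_simps)
  qed
  have near: "norm (z - m) <= \<delta> * r" if z: "z = x \<or> z = y" for z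
  proof -
    have "0 <= (sqrt 2 * \<delta>) * r" using xy(4) norm_ge_zero order_trans by blast
    then have dr: "0 <= \<delta> * r" using zero_le_mult_iff by (simp add: mult.assoc zero_le_mult_iff)
    have "(norm (x - y))^2 <= ((sqrt 2 * \<delta>) * r)^2" using xy(4) by (intro power_mono) auto
    then have "(norm (z - m))^2 <= (\<delta> * r)^2" using half[OF z] by (simp add: power_mult_distrib)
    then show ?thesis using dr by (rule power2_le_imp_le)
  qed
  have zm: "z + m ~= 0" if z: "z = x \<or> z = y" for z
  proof
    assume "z + m = 0"
    then have "z \<bullet> (z + m) = 0" by simp
    moreover have "z \<bullet> m >= 0"
    proof -
      have zm: "z \<bullet> (x + y) = s^2 / 2" using z s2 by (auto simp: inner_add_right xx inner_commute)
      have "z \<bullet> m = (r / s) * (s^2 / 2)" unfolding m_def inner_scaleR_right zm ..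
      then show ?thesis using s r by simp
    qed
    moreover have "z \<bullet> z > 0" using z xx r by auto
    ultimately show False by (simp add: inner_add_right)
  qed
  have "u x <= C * u m" by (rule step) (use xy nm zm near in auto)
  moreover have "u m <= C * u y"
    by (rule step) (use xy nm zm[of y] near[of y] in \<open>auto simp: norm_minus_commute add.commute\<close>)
  then have "C * u m <= C * (C * u y)" using C by (intro mult_left_mono) auto
  ultimately show ?thesis by (simp add: power2_eq_square)
qed

text \<open>Iterated steps reach the distance 2 r and hence all pairs except antipodal ones. Those
  are joined through a point orthogonal to the first, which exists in dimension at least 2.\<close>

lemma harnack_sphere:
  fixes \<delta> C :: real
  assumes \<delta>: "0 < \<delta>" and C: "0 < C" and dim: "DIM('a::euclidean_space) >= 2"
  shows "\<exists>C'>0. \<forall>(u :: 'a => real) r. r > 0 -->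
    (\<forall>x y. norm x = r --> norm y = r --> norm (x - y) <= \<delta> * r --> u x <= C * u y) -->
    (\<forall>x y. norm x = r --> norm y = r --> u x <= C' * u y)"
proof -
  have "\<exists>k. 2 / \<delta> < sqrt 2 ^ k" by (rule real_arch_pow) simp
  then obtain k where k: "2 < sqrt 2 ^ k * \<delta>" using \<delta> by (auto simp: field_simps)
  define D where "D j = C ^ (2 ^ j)" for j :: nat
  have D: "D j > 0" "D (Suc j) = (D j)^2" for j unfolding D_def using C by (auto simp: power_mult[symmetric] mult.commute)
  show ?thesis
  proof (intro exI[of _ "D k * D k"] conjI allI impI)
    show "D k * D k > 0" using D by simp
    fix u :: "'a => real" and r :: real and x y :: 'a
    assume r: "r > 0" and st: "\<forall>x y. norm x = r --> norm y = r --> norm (x - y) <= \<delta> * r --> u x <= C * u y"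
      and xy: "norm x = r" "norm y = r"
    have ind: "u x <= D j * u y" if "norm x = r" "norm y = r" "x + y ~= 0" "norm (x - y) <= (sqrt 2 ^ j * \<delta>) * r" for j and x y :: 'a
      using that
    proof (induction j arbitrary: x y)
      case 0 then show ?case using st unfolding D_def by simp
    next
      case (Suc j)
      show ?case unfolding D(2)
        by (rule harnack_sphere_step[where \<delta>="sqrt 2 ^ j * \<delta>", OF D(1) Suc.IH Suc.prems(1,2,3) _ r])
          (use Suc.prems(4) in \<open>simp_all add: mult.assoc\<close>)
    qed
    have far: "norm (x - y) <= (sqrt 2 ^ k * \<delta>) * r" if "norm x = r" "norm y = r" for x y :: 'a
    proof -
      have "norm (x - y) <= 2 * r" using norm_triangle_ineq4[of x y] that by simp
      also have "... <= (sqrt 2 ^ k * \<delta>) * r" using k r by (intro mult_right_mono) auto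
      finally show ?thesis .
    qed
    obtain z0 where z0: "z0 ~= 0" "orthogonal x z0" using orthogonal_to_vector_exists[OF dim] by blast
    define z where "z = (r / norm z0) *\<^sub>R z0"
    have z: "norm z = r" "x \<bullet> z = 0" using z0 r unfolding z_def by (auto simp: orthogonal_def)
    have xx: "x \<bullet> x = r^2" "z \<bullet> z = r^2" using xy z by (metis power2_norm_eq_inner)+
    have "x + z ~= 0"
    proof
      assume "x + z = 0"
      then have "x \<bullet> (x + z) = 0" by simp
      then show False using xx z r by (simp add: inner_add_right)
    qed
    then have 1: "u x <= D k * u z" using ind xy z far by blast
    show "u x <= D k * D k * u y"
    proof (cases "z + y = 0")
      case False
      then have "u z <= D k * u y" using ind xy z far by blast
      then have "D k * u z <= D k * (D k * u y)" using D by (intro mult_left_mono) (auto simp: less_imp_le)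
      then show ?thesis using 1 by (simp add: mult_ac)
    next
      case True
      then have y: "y = - z" by (simp add: add_eq_0_iff)
      have a1: "x + y ~= 0"
      proof
        assume "x + y = 0"
        then have "x \<bullet> (x + y) = 0" by simp
        then show False using xx z r y by (simp add: inner_diff_right)
      qed
      have 3: "u x <= D k * u y" using ind xy a1 far by blast
      have "y + y ~= 0"
      proof
        assume "y + y = 0"
        then have "2 *\<^sub>R y = 0" by (simp add: scaleR_2)
        then show False using xy r by simp
      qed
      \<comment> \<open>\<open>u\<close> is not assumed positive, so the extra factor
        \<open>D k\<close> is inserted by comparing \<open>y\<close> with itself.\<close>
      then have 4: "u y <= D k * u y" using ind[of y y] xy far[of y y] by blast
      have "D k * u y <= D k * (D k * u y)" using 4 D by (intro mult_left_mono) (auto simp: less_imp_le)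
      then show ?thesis using 3 by (simp add: mult_ac)
    qed
  qed
qed

text \<open>The Keller--Osserman bound turns the absorption into a multiple of u / |x|^2, so the
  Laplacian is controlled linearly by the gradient and by \<open>u\<close>. On balls of radius
  comparable to |x| the local estimates hold with scale invariant constants.\<close>

lemma solution_harnack:
  fixes q \<tau> \<rho> lam \<theta> :: real
  assumes q: "q > 1" and \<tau>: "0 <= \<tau>" "\<tau> < 1" and dim: "DIM('a::euclidean_space) >= 2"
  shows "\<exists>C>0. \<forall>(u :: 'a => real) V. (\<forall>x\<in>-{0}. u x > 0) --> wl (-{0}) u V (sol_lap q \<tau> \<rho> lam \<theta> u V) -->
     (\<forall>x y. x ~= 0 --> norm x = norm y --> u x <= C * u y) \<and> (\<forall>x. x ~= 0 --> norm x * norm (V x) <= C * u x)"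
proof -
  obtain C0 where C0: "!!(u :: 'a => real) V x. (\<forall>x\<in>-{0}. u x > 0) ==> wl (-{0}) u V (sol_lap q \<tau> \<rho> lam \<theta> u V) ==>
     x ~= 0 ==> u x powr (q - 1) * norm x powr (\<theta> + 2) <= C0"
    using keller_osserman[OF q \<tau>, where ?'a='a] by blast
  define C1 where "C1 = max C0 0"
  define B where "B = \<bar>real DIM('a) - 2 + 2 * \<rho>\<bar> + \<bar>lam\<bar>"
  have BC: "B >= 0" "C1 >= 0" "C0 <= C1" unfolding B_def C1_def by auto
  \<comment> \<open>Keeps the ball of radius \<open>3 * \<eta> * r\<close> away from the origin and
    makes \<open>b1 * R\<close> and \<open>b2 * R^2\<close> at most 1/2 below.\<close>
  define \<eta> where "\<eta> = 1 / (6 + 4 * B + 8 * (C1 + B))"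
  have den: "6 + 4 * B + 8 * (C1 + B) >= 6" using BC by simp
  then have dp: "6 + 4 * B + 8 * (C1 + B) > 0" by linarith
  have \<eta>: "\<eta> > 0" "\<eta> <= 1/6" "\<eta> * (4 * B) <= 1" "\<eta> * (8 * (C1 + B)) <= 1"
    unfolding \<eta>_def using BC dp by (simp_all add: field_simps)
  define CH where "CH = 4 * (2 * ((2 * real DIM('a) + 4) * 4 * 4 ^ DIM('a))) ^ (2 * DIM('a))"
  have CH: "CH > 0" unfolding CH_def by (simp add: add_nonneg_pos)
  obtain C2 where C2: "C2 > 0" "!!(u :: 'a => real) r. r > 0 ==>
    (\<forall>x y. norm x = r --> norm y = r --> norm (x - y) <= (\<eta> / 2) * r --> u x <= CH * u y) ==>
    (\<forall>x y. norm x = r --> norm y = r --> u x <= C2 * u y)"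
    using harnack_sphere[of "\<eta> / 2" CH, OF _ CH dim] \<eta> by force
  define C3 where "C3 = (2 * real DIM('a) + 4) * CH * 2 / \<eta>"
  have C3: "C3 > 0" unfolding C3_def using CH \<eta> by (simp add: add_nonneg_pos)
  show ?thesis
  proof (intro exI[of _ "C2 + C3"] conjI allI impI)
    show "C2 + C3 > 0" using C2 C3 by simp
    fix u :: "'a => real" and V
    assume pos': "\<forall>x\<in>-{0}. u x > 0" and w: "wl (-{0}) u V (sol_lap q \<tau> \<rho> lam \<theta> u V)"
    have pos: "u x > 0" if "x ~= 0" for x using pos' that by auto
    define F where "F = sol_lap q \<tau> \<rho> lam \<theta> u V"
    have w: "wl (-{0}) u V F" using w unfolding F_def .
    have Fb: "\<bar>F x\<bar> <= B * (norm (V x) / norm x) + (C1 + B) * (u x / (norm x)^2)" if x: "x ~= 0" for x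
    proof -
      have "norm x powr \<theta> * u x powr q = (u x powr (q - 1) * norm x powr (\<theta> + 2)) * (u x / (norm x)^2)"
        using x pos[OF x] by (simp add: powr_diff powr_add)
      also have "... <= C1 * (u x / (norm x)^2)"
        using C0[OF pos' w[unfolded F_def] x] BC(3) pos[OF x] by (intro mult_right_mono) auto
      finally have s: "norm x powr \<theta> * u x powr q <= C1 * (u x / (norm x)^2)" .
      have "norm x powr \<theta> * u x powr q >= 0" by simp
      then have "\<bar>F x\<bar> <= norm x powr \<theta> * u x powr q + \<bar>sol_drift \<rho> lam \<tau> u V x\<bar>"
        unfolding F_def sol_lap_def by linarith
      also have "... <= C1 * (u x / (norm x)^2) + B * (norm (V x) / norm x + u x / (norm x)^2)"
        unfolding B_def by (rule add_mono[OF s sol_drift_bound[where u=u and x=x, OF x pos[OF x] \<tau>]])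
      finally show ?thesis by (simp add: algebra_simps add_divide_distrib)
    qed
    have loc: "(\<forall>x. norm (x - c) <= \<eta> * norm c / 2 --> u x <= CH * u c) \<and> norm c * norm (V c) <= C3 * u c" if c: "c ~= 0" for c
    proof -
      define r where "r = norm c"
      have r: "r > 0" using c unfolding r_def by simp
      define R where "R = \<eta> * r"
      have R: "R > 0" "3 * R <= r / 2" using \<eta> r unfolding R_def by auto
      have big: "norm x >= r / 2" if "x \<in> cball c (3 * R)" for x
        using that R norm_triangle_ineq2[of c x] unfolding r_def by (auto simp: dist_norm)
      have nz: "x ~= 0" if "x \<in> cball c (3 * R)" for x using big[OF that] r by auto
      define b1 where "b1 = 2 * B / r"
      define b2 where "b2 = 4 * (C1 + B) / r^2"
      have b: "0 <= b1" "0 <= b2" unfolding b1_def b2_def using BC r by auto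
      have b1R: "b1 * R <= 1/2" unfolding b1_def R_def using \<eta> r by (simp add: field_simps)
      have b2R: "b2 * R^2 <= 1/2"
      proof -
        have "b2 * R^2 = \<eta> * (4 * (C1 + B) * \<eta>)" unfolding b2_def R_def using r by (simp add: power2_eq_square field_simps)
        also have "... <= 1 * (1/2)" using \<eta> BC by (intro mult_mono) (auto simp: algebra_simps)
        finally show ?thesis by simp
      qed
      have FF: "\<bar>F x\<bar> <= b1 * norm (V x) + b2 * u x" if x: "x \<in> cball c (3 * R)" for x
      proof -
        have nx: "norm x > 0" using nz[OF x] by simp
        have "norm (V x) / norm x <= norm (V x) / (r / 2)"
          by (rule divide_left_mono) (use big[OF x] r nx in auto)
        moreover have "u x / (norm x)^2 <= u x / (r / 2)^2"
          by (rule divide_left_mono) (use big[OF x] r nx pos[OF nz[OF x]] in \<open>auto intro!: power_mono\<close>)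
        ultimately have "B * (norm (V x) / norm x) + (C1 + B) * (u x / (norm x)^2)
           <= B * (norm (V x) / (r / 2)) + (C1 + B) * (u x / (r / 2)^2)"
          using BC by (intro add_mono mult_left_mono) auto
        also have "... = b1 * norm (V x) + b2 * u x" unfolding b1_def b2_def by (simp add: power2_eq_square algebra_simps)
        finally show ?thesis using Fb[OF nz[OF x]] by linarith
      qed
      have sub: "cball c (3 * R) \<subseteq> -{0}"
      proof
        show "x \<in> -{0}" if "x \<in> cball c (3 * R)" for x using nz[OF that] by simp
      qed
      have H: "u x <= CH * u c" if "norm (x - c) <= R / 2" for x
        unfolding CH_def by (rule harnack_local[OF w sub R(1) pos[OF nz] FF b b1R b2R that])
      define M where "M = CH * u c"
      have M: "M > 0" unfolding M_def using CH pos[OF c] by simp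
      define L where "L = (2 * real DIM('a) + 4) * (M / (R / 2))"
      have inb: "x \<in> cball c (3 * R)" "norm (x - c) <= R / 2" if "x \<in> cball c (R / 2)" for x
        using that R by (auto simp: dist_norm norm_minus_commute)
      have lip: "u c - u y <= L * norm (y - c)" if "norm (y - c) <= R / 2 / 4" for y
        unfolding L_def
      proof (rule lipschitz_estimate[OF w _ _ M _ _ _ _ _ that, where ?b1.0=b1 and ?b2.0=b2])
        show "cball c (R / 2) \<subseteq> -{0}" using sub inb by blast
        show "u x - u y <= M" if "x \<in> cball c (R / 2)" "y \<in> cball c (R / 2)" for x y
          using H[OF inb(2)[OF that(1)]] pos[OF nz[OF inb(1)[OF that(2)]]] unfolding M_def by simp
        show "\<bar>F x\<bar> <= b1 * norm (V x) + b2 * M" if "x \<in> cball c (R / 2)" for x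
          using FF[OF inb(1)[OF that]] mult_left_mono[OF H[OF inb(2)[OF that]] b(2)] unfolding M_def by linarith
        have "b1 * (R / 2) <= b1 * R" using b R by (intro mult_left_mono) auto
        then show "b1 * (R / 2) <= 1" using b1R by linarith
        have "b2 * (R / 2)^2 <= b2 * R^2" using b R by (intro mult_left_mono power_mono) auto
        then show "b2 * (R / 2)^2 <= 1" using b2R by linarith
      qed (use R b in auto)
      \<comment> \<open>The Lipschitz estimate is one-sided: it limits how far \<open>u\<close>
        drops below \<open>u c\<close>. It is therefore applied on the ray opposite to the
        gradient.\<close>
      have "norm (V c) <= L"
      proof (rule ccontr)
        assume "\<not> norm (V c) <= L"
        then have VL: "norm (V c) > L" by simp
        have L0: "L > 0" unfolding L_def using M R by (simp add: add_nonneg_pos)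
        define e where "e = (1 / norm (V c)) *\<^sub>R V c"
        have ne: "norm e = 1" "e \<bullet> V c = norm (V c)"
          unfolding e_def using VL L0 by (auto simp: power2_norm_eq_inner[symmetric] power2_eq_square)
        have "DERIV (%t. u (c + t *\<^sub>R e)) 0 :> e \<bullet> V c"
        proof -
          have "(u has_derivative (%h. h \<bullet> V c)) (at (c + 0 *\<^sub>R e))"
            using wlD(2)[OF w, of c] c by (simp add: gderiv_def)
          moreover have "((%s. c + s *\<^sub>R e) has_derivative (%s. s *\<^sub>R e)) (at (0::real))"
            by (auto intro!: derivative_eq_intros)
          ultimately have "((%s. u (c + s *\<^sub>R e)) has_derivative (%s. (s *\<^sub>R e) \<bullet> V c)) (at 0)"
            by (rule has_derivative_compose[rotated])
          then show ?thesis by (simp add: has_field_derivative_def mult_commute_abs)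
        qed
        then have "DERIV (%t. u (c + t *\<^sub>R e) - L * t) 0 :> (norm (V c) - L)"
          using ne by (auto intro!: derivative_eq_intros)
        from has_real_derivative_pos_inc_left[OF this] VL
        obtain d where d: "d > 0" "!!h. h > 0 ==> 0 - h \<in> UNIV ==> h < d ==> u (c + (0 - h) *\<^sub>R e) - L * (0 - h) < u (c + 0 *\<^sub>R e) - L * 0"
          by auto
        define h where "h = min (d / 2) (R / 8)"
        have h: "h > 0" "h < d" "h <= R / 8" using d R unfolding h_def by (auto simp: min_def)
        have "u (c - h *\<^sub>R e) + L * h < u c" using d(2)[of h] h by simp
        moreover have "u c - u (c - h *\<^sub>R e) <= L * norm (c - h *\<^sub>R e - c)"
          by (rule lip) (use h ne in simp)
        ultimately show False using h ne by simp
      qed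
      then have "norm c * norm (V c) <= r * L" using r by (simp add: r_def)
      also have "r * L = C3 * u c" unfolding L_def C3_def M_def R_def using r \<eta> by (simp add: field_simps)
      finally show ?thesis using H unfolding R_def r_def by auto
    qed
    show "u x <= (C2 + C3) * u y" if x: "x ~= 0" and xy: "norm x = norm y" for x y
    proof -
      define r where "r = norm x"
      have r: "r > 0" using x unfolding r_def by simp
      have y: "y ~= 0" using x xy by auto
      have "\<forall>x y. norm x = r --> norm y = r --> norm (x - y) <= (\<eta> / 2) * r --> u x <= CH * u y"
      proof (intro allI impI)
        fix x y :: 'a assume a: "norm x = r" "norm y = r" "norm (x - y) <= (\<eta> / 2) * r"
        then have "y ~= 0" using r by auto
        from loc[OF this] a show "u x <= CH * u y" by simp
      qed
      from C2(2)[OF r this] have "u x <= C2 * u y" using xy unfolding r_def by simp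
      also have "... <= (C2 + C3) * u y" using pos[OF y] C3 by (intro mult_right_mono) auto
      finally show ?thesis .
    qed
    show "norm x * norm (V x) <= (C2 + C3) * u x" if x: "x ~= 0" for x
    proof -
      have "norm x * norm (V x) <= C3 * u x" using loc[OF x] by simp
      also have "... <= (C2 + C3) * u x" using pos[OF x] C2 by (intro mult_right_mono) auto
      finally show ?thesis .
    qed
  qed
qed

section \<open>Radial symmetry\<close>

text \<open>Differentiate along the great circle that leaves \<open>x\<close> in the direction of
  \<open>t\<close>.\<close>

lemma sphere_max_tangential:
  fixes f :: "'a::euclidean_space => real"
  assumes G: "GDERIV f x :> G" and x: "x ~= 0" and mx: "!!y. norm y = norm x ==> f y <= f x"
    and t: "t \<bullet> x = 0"
  shows "G \<bullet> t = 0"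
proof (cases "t = 0")
  case False
  define r where "r = norm x"
  define e where "e = (r / norm t) *\<^sub>R t"
  have ne: "norm e = r" "e \<bullet> x = 0" using False t unfolding e_def r_def by auto
  let ?c = "%a. cos a *\<^sub>R x + sin a *\<^sub>R e"
  have nc: "norm (?c a) = r" for a
  proof -
    have "(norm (?c a))^2 = (cos a)^2 * r^2 + (sin a)^2 * r^2"
    proof -
      have "x \<bullet> x = r^2" "e \<bullet> e = r^2" using ne by (auto simp: power2_norm_eq_inner[symmetric] r_def)
      then show ?thesis unfolding power2_norm_eq_inner using ne
        by (simp add: inner_add_left inner_add_right inner_commute power2_eq_square algebra_simps)
    qed
    then have "(norm (?c a))^2 = r^2" by (simp add: distrib_right[symmetric])
    then show ?thesis using r_def by (simp add: power2_eq_iff_nonneg)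
  qed
  have "(?c has_derivative (%h. h *\<^sub>R e)) (at 0)"
    by (auto intro!: derivative_eq_intros)
  moreover have "(f has_derivative (%h. h \<bullet> G)) (at (?c 0))" using G by (simp add: gderiv_def)
  ultimately have "((%a. f (?c a)) has_derivative (%h. (h *\<^sub>R e) \<bullet> G)) (at 0)"
    by (rule has_derivative_compose)
  then have D: "DERIV (%a. f (?c a)) 0 :> e \<bullet> G"
    by (simp add: has_field_derivative_def mult_commute_abs)
  have "f (?c a) <= f (?c 0)" for a using mx[of "?c a"] nc[of a] by (simp add: r_def)
  then have "e \<bullet> G = 0"
    by (intro DERIV_local_max[OF D, of 1]) auto
  then show ?thesis using False x unfolding e_def r_def by (simp add: inner_commute)
qed simp

lemma wl_inverse_norm:
  "wl (-{0}) (%x::'a::euclidean_space. 1 / norm x) (%x. (- (1 / norm x ^ 3)) *\<^sub>R x)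
     (%x. (3 - real DIM('a)) / norm x ^ 3)"
proof -
  let ?w = "%x::'a. (norm (x - 0))^2"
  have pos: "?w x > 0" if "x \<in> -{0}" for x using that by auto
  have w: "wl (-{0}) ?w (%x. 2 *\<^sub>R (x - 0)) (%x. 2 * real DIM('a))"
    by (rule wl_mono[OF wl_norm_square]) auto
  have d: "DERIV (%y. k * y powr a) y :> (k * a) * y powr (a - 1)" if "y > 0" for y k a :: real
    using DERIV_cmult[OF has_real_derivative_powr[OF that, of a], of k] by (simp add: mult.assoc)
  have "wl (-{0}) (%x. 1 * ?w x powr (-1/2)) (%x. ((1 * (-1/2)) * ?w x powr (-1/2 - 1)) *\<^sub>R 2 *\<^sub>R (x - 0))
     (%x. ((1 * (-1/2)) * ?w x powr (-1/2 - 1)) * (2 * real DIM('a)) +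
       ((1 * (-1/2) * (-1/2 - 1)) * ?w x powr (-1/2 - 1 - 1)) * (norm (2 *\<^sub>R (x - 0)))^2)"
  proof (rule wl_compose[OF w, where g="%y. 1 * y powr (-1/2)"
        and g'="%y. (1 * (-1/2)) * y powr (-1/2 - 1)"
        and g''="%y. (1 * (-1/2) * (-1/2 - 1)) * y powr (-1/2 - 1 - 1)"])
    show "continuous_on (-{0}) (%x. (1 * (-1/2) * (-1/2 - 1)) * ?w x powr (-1/2 - 1 - 1))"
      by (intro continuous_intros) auto
  qed (rule d[OF pos], assumption)+
  then show ?thesis
  proof (rule wl_cong)
    fix x :: 'a assume "x \<in> -{0}"
    then have r: "norm x > 0" by simp
    have e: "?w x powr a = norm x powr (2 * a)" for a
      using r by (simp add: powr_powr flip: powr_numeral)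
    have e1: "?w x powr (-1/2) = 1 / norm x" unfolding e using r by (simp add: powr_minus_divide)
    have e3: "?w x powr (-1/2 - 1) = 1 / norm x ^ 3" unfolding e using r by (simp add: powr_minus_divide)
    have e5: "?w x powr (-1/2 - 1 - 1) = 1 / norm x ^ 5" unfolding e using r by (simp add: powr_minus_divide)
    show "1 / norm x = 1 * ?w x powr (-1/2)" using e1 by simp
    show "(- (1 / norm x ^ 3)) *\<^sub>R x = ((1 * (-1/2)) * ?w x powr (-1/2 - 1)) *\<^sub>R 2 *\<^sub>R (x - 0)"
      unfolding e3 by simp
    have "norm x ^ 5 = norm x ^ 3 * (norm x)^2" by (simp add: power_add[symmetric])
    then show "(3 - real DIM('a)) / norm x ^ 3 = ((1 * (-1/2)) * ?w x powr (-1/2 - 1)) * (2 * real DIM('a)) +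
       ((1 * (-1/2) * (-1/2 - 1)) * ?w x powr (-1/2 - 1 - 1)) * (norm (2 *\<^sub>R (x - 0)))^2"
      unfolding e3 e5 using r by (simp add: field_simps)
  qed
qed

text \<open>The cosine of the angle with \<open>e\<close> is a spherical harmonic of degree one,
  whence the factor dimension minus one; being homogeneous of degree 0, it has a tangential
  gradient.\<close>

lemma wl_direction_cosine:
  assumes e: "norm (e::'a::euclidean_space) = 1"
  shows "wl (-{0}) (%x. (x \<bullet> e) / norm x) (%x. (1 / norm x) *\<^sub>R e - ((x \<bullet> e) / norm x ^ 3) *\<^sub>R x)
     (%x. - (real DIM('a) - 1) * (x \<bullet> e) / norm x ^ 3)"
    and "x ~= 0 ==> (norm ((1 / norm x) *\<^sub>R e - ((x \<bullet> e) / norm x ^ 3) *\<^sub>R x))^2 = (1 - ((x \<bullet> e) / norm x)^2) / (norm x)^2"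
    and "x ~= 0 ==> x \<bullet> ((1 / norm x) *\<^sub>R e - ((x \<bullet> e) / norm x ^ 3) *\<^sub>R x) = 0"
proof -
  have w: "wl (-{0}) (%x. x \<bullet> e) (%x. e) (%x. 0)"
    by (rule wl_mono[OF wl_inner]) auto
  show "wl (-{0}) (%x. (x \<bullet> e) / norm x) (%x. (1 / norm x) *\<^sub>R e - ((x \<bullet> e) / norm x ^ 3) *\<^sub>R x)
     (%x. - (real DIM('a) - 1) * (x \<bullet> e) / norm x ^ 3)"
  proof (rule wl_cong[OF wl_mult[OF w wl_inverse_norm]])
    fix x :: 'a assume "x \<in> -{0}"
    then have r: "norm x > 0" by simp
    show "- (real DIM('a) - 1) * (x \<bullet> e) / norm x ^ 3 = (x \<bullet> e) * ((3 - real DIM('a)) / norm x ^ 3)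
      + 1 / norm x * 0 + 2 * (e \<bullet> (- (1 / norm x ^ 3)) *\<^sub>R x)"
      using r by (simp add: inner_commute field_simps)
  qed auto
  assume x: "x ~= 0"
  define r where "r = norm x"
  have r: "r > 0" using x unfolding r_def by simp
  have ee: "e \<bullet> e = 1" using e by (simp add: norm_eq_1)
  have xx: "x \<bullet> x = r^2" unfolding r_def by (simp add: power2_norm_eq_inner)
  show "x \<bullet> ((1 / norm x) *\<^sub>R e - ((x \<bullet> e) / norm x ^ 3) *\<^sub>R x) = 0"
    unfolding r_def[symmetric] using r by (simp add: inner_diff_right xx power2_eq_square power3_eq_cube)
  show "(norm ((1 / norm x) *\<^sub>R e - ((x \<bullet> e) / norm x ^ 3) *\<^sub>R x))^2 = (1 - ((x \<bullet> e) / norm x)^2) / (norm x)^2"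
    unfolding r_def[symmetric] power2_norm_eq_inner using r
    by (simp add: inner_diff_right inner_diff_left xx ee inner_commute[of e x] field_simps power2_eq_square power3_eq_cube)
qed

text \<open>At w = |x|^2 this is ln ((1 + w)^2 / w), which is infinite both at the origin and at
  infinity, while |x| times its gradient and |x|^2 times its Laplacian stay bounded.\<close>

definition log_weight :: "real => real" where
  "log_weight w = 2 * ln (1 + w) - ln w"

lemma log_weight_ge: "0 < w ==> \<bar>ln w\<bar> <= log_weight w"
proof -
  assume w: "0 < w"
  have "0 <= ln (1 + w)" "ln w <= ln (1 + w)" using w by simp_all
  then show ?thesis unfolding log_weight_def by linarith
qed

lemma wl_log_weight:
  "wl (-{0}) (%x::'a::euclidean_space. log_weight ((norm x)^2))
     (%x. (2 / (1 + (norm x)^2) - 1 / (norm x)^2) *\<^sub>R 2 *\<^sub>R x)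
     (%x. (2 / (1 + (norm x)^2) - 1 / (norm x)^2) * (2 * real DIM('a)) +
       (1 / ((norm x)^2)^2 - 2 / (1 + (norm x)^2)^2) * (norm (2 *\<^sub>R x))^2)"
proof -
  have w: "wl (-{0}) (%x::'a. (norm x)^2) (%x. 2 *\<^sub>R x) (%x. 2 * real DIM('a))"
    using wl_mono[OF wl_norm_square[of "0::'a"], of "-{0}"] by (simp add: open_Compl)
  show ?thesis
  proof (rule wl_compose[OF w, where g'="%w. 2 / (1 + w) - 1 / w" and g''="%w. 1 / w^2 - 2 / (1 + w)^2"])
    fix x :: 'a assume "x \<in> -{0}"
    then have p: "(norm x)^2 > 0" by simp
    have p1: "1 + (norm x)^2 > 0" "1 + (norm x)^2 ~= 0" using p by linarith+
    show "DERIV log_weight ((norm x)^2) :> 2 / (1 + (norm x)^2) - 1 / (norm x)^2"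
      unfolding log_weight_def using p p1 by (auto intro!: derivative_eq_intros)
    show "DERIV (%w. 2 / (1 + w) - 1 / w) ((norm x)^2) :> 1 / ((norm x)^2)^2 - 2 / (1 + (norm x)^2)^2"
    proof -
      define y where "y = (norm x)^2"
      have "((%w. 2 / (1 + w) - 1 / w) has_real_derivative
          (0 * (1 + y) - 2 * (0 + 1)) / ((1 + y) * (1 + y)) - (0 * y - 1 * 1) / (y * y)) (at y)"
        using p p1 unfolding y_def by (intro DERIV_diff DERIV_divide DERIV_add DERIV_const DERIV_ident) auto
      then show ?thesis unfolding y_def[symmetric] by (simp add: power2_eq_square)
    qed
  next
    have "1 + (norm x)^2 ~= 0" for x :: 'a by (smt (verit) zero_le_power2)
    then show "continuous_on (-{0}) (%x::'a. 1 / ((norm x)^2)^2 - 2 / (1 + (norm x)^2)^2)"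
      by (intro continuous_intros) auto
  qed
qed

text \<open>Multiplied by \<open>|x|\<^sup>2\<close>, the equation for \<open>ln u\<close> only involves the scale invariant quantities
  \<open>x \<bullet> p\<close> and \<open>|x| |p|\<close>, where \<open>p\<close> is the gradient of \<open>ln u\<close>.\<close>

lemma norm_square_log_lap:
  fixes u :: "'a::euclidean_space => real"
  assumes x: "x ~= 0" and u: "0 < u x" and p: "p = (1 / u x) *\<^sub>R V x" and \<tau>: "\<tau> < 1"
  shows "(norm x)^2 * (sol_lap q \<tau> \<rho> lam \<theta> u V x / u x - (norm p)^2)
    = norm x powr (\<theta> + 2) * u x powr (q - 1) + (real DIM('a) - 2 + 2 * \<rho>) * (x \<bullet> p)
      - lam * ((norm x * norm p)^2) powr ((1 - \<tau>) / 2) - (norm x * norm p)^2"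
proof -
  define r where "r = norm x"
  have r: "r > 0" using x unfolding r_def by simp
  have V: "V x = u x *\<^sub>R p" using u unfolding p by simp
  have nV: "norm (V x) = u x * norm p" unfolding V using u by simp
  have "u x powr \<tau> * (u x * norm p) powr (1 - \<tau>) = (u x powr \<tau> * u x powr (1 - \<tau>)) * norm p powr (1 - \<tau>)"
    using u by (simp add: powr_mult)
  also have "u x powr \<tau> * u x powr (1 - \<tau>) = u x" using u by (simp add: powr_add[symmetric])
  finally have e1: "u x powr \<tau> * norm (V x) powr (1 - \<tau>) = u x * norm p powr (1 - \<tau>)" unfolding nV .
  have e2: "r^2 * (norm p powr (1 - \<tau>) / r powr (1 + \<tau>)) = (r * norm p) powr (1 - \<tau>)"
  proof -
    have "r powr (1 - \<tau>) * r powr (1 + \<tau>) = r powr 2" using r by (simp add: powr_add[symmetric])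
    then have "r powr (1 - \<tau>) * r powr (1 + \<tau>) = r^2" using r by simp
    then show ?thesis using r by (simp add: powr_mult field_simps)
  qed
  have e3: "((r * norm p)^2) powr ((1 - \<tau>) / 2) = (r * norm p) powr (1 - \<tau>)"
  proof (cases "norm p = 0")
    case False
    then have "r * norm p > 0" using r by simp
    then have "(r * norm p)^2 = (r * norm p) powr 2" by simp
    moreover have "2 * ((1 - \<tau>) / 2) = 1 - \<tau>" by simp
    ultimately show ?thesis by (simp only: powr_powr)
  qed (use \<tau> in simp)
  have e4: "r powr \<theta> * u x powr q / u x = r powr \<theta> * u x powr (q - 1)"
    using u by (simp add: powr_diff)
  have e5: "r^2 * (r powr \<theta>) = r powr (\<theta> + 2)" using r by (simp add: powr_add mult.commute)
  have "sol_lap q \<tau> \<rho> lam \<theta> u V x / u x = r powr \<theta> * u x powr (q - 1)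
      + (real DIM('a) - 2 + 2 * \<rho>) * ((x \<bullet> p) / r^2) - lam * (norm p powr (1 - \<tau>) / r powr (1 + \<tau>))"
    unfolding sol_lap_def sol_drift_def e1 r_def[symmetric] e4[symmetric] using u
    by (simp add: V diff_divide_distrib add_divide_distrib algebra_simps)
  then have "r^2 * (sol_lap q \<tau> \<rho> lam \<theta> u V x / u x) = (r^2 * r powr \<theta>) * u x powr (q - 1)
      + (real DIM('a) - 2 + 2 * \<rho>) * (x \<bullet> p) - lam * (r^2 * (norm p powr (1 - \<tau>) / r powr (1 + \<tau>)))"
  proof -
    have "r^2 * (a + k * (s / r^2) - l * M) = r^2 * a + k * s - l * (r^2 * M)" for a k s l M
      using r by (simp add: field_simps)
    then show ?thesis by (simp only: \<open>sol_lap q \<tau> \<rho> lam \<theta> u V x / u x = _\<close> mult.assoc)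
  qed
  then show ?thesis unfolding e2 e3 e5 r_def[symmetric] by (simp add: algebra_simps power_mult_distrib)
qed

text \<open>Modulo radial vectors, \<open>P\<close> is - A y and \<open>Q\<close> is A x. The angle
  between \<open>x\<close> and \<open>y\<close> is the same seen from either point, so the
  tangential parts have equal length.\<close>

lemma equal_tangential_gradients:
  fixes x y P Q :: "'a::real_inner"
  assumes xy: "x \<bullet> x = R" "y \<bullet> y = R" and R: "R > 0"
    and P: "!!t. t \<bullet> x = 0 ==> (P + A *\<^sub>R y) \<bullet> t = 0"
    and Q: "!!t. t \<bullet> y = 0 ==> (Q - A *\<^sub>R x) \<bullet> t = 0"
  shows "R * (P \<bullet> P) - R * (Q \<bullet> Q) = (x \<bullet> P)^2 - (y \<bullet> Q)^2"
proof -
  have par: "Z = ((Z \<bullet> z) / R) *\<^sub>R z" if z: "z \<bullet> z = R" and Z: "!!t. t \<bullet> z = 0 ==> Z \<bullet> t = 0" for Z z :: 'a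
  proof -
    define t where "t = Z - ((Z \<bullet> z) / R) *\<^sub>R z"
    have tz: "t \<bullet> z = 0" unfolding t_def using z R by (simp add: inner_diff_left)
    have "t \<bullet> t = Z \<bullet> t - ((Z \<bullet> z) / R) * (z \<bullet> t)" unfolding t_def by (simp add: inner_diff_left)
    also have "... = 0" using Z[OF tz] tz by (simp add: inner_commute)
    finally show ?thesis unfolding t_def by simp
  qed
  define k where "k = ((P + A *\<^sub>R y) \<bullet> x) / R"
  define l where "l = ((Q - A *\<^sub>R x) \<bullet> y) / R"
  define c where "c = x \<bullet> y"
  have "P + A *\<^sub>R y = k *\<^sub>R x" unfolding k_def by (rule par[OF xy(1) P])
  then have P': "P = k *\<^sub>R x - A *\<^sub>R y" by (simp add: eq_diff_eq)
  have "Q - A *\<^sub>R x = l *\<^sub>R y" unfolding l_def by (rule par[OF xy(2) Q])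
  then have Q': "Q = l *\<^sub>R y + A *\<^sub>R x" by (simp add: diff_eq_eq)
  have yx: "y \<bullet> x = c" unfolding c_def by (simp add: inner_commute)
  have a: "P \<bullet> P = k^2 * R - 2 * k * A * c + A^2 * R" "x \<bullet> P = k * R - A * c"
    unfolding P' by (simp_all add: inner_diff_left inner_diff_right xy yx c_def[symmetric] power2_eq_square algebra_simps)
  have 1: "R * (P \<bullet> P) = A^2 * (R^2 - c^2) + (x \<bullet> P)^2"
    unfolding a by (simp add: power2_eq_square algebra_simps)
  have b: "Q \<bullet> Q = l^2 * R + 2 * l * A * c + A^2 * R" "y \<bullet> Q = l * R + A * c"
    unfolding Q' by (simp_all add: inner_add_left inner_add_right xy yx c_def[symmetric] power2_eq_square algebra_simps)
  have "R * (Q \<bullet> Q) = A^2 * (R^2 - c^2) + (y \<bullet> Q)^2"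
    unfolding b by (simp add: power2_eq_square algebra_simps)
  with 1 show ?thesis by simp
qed

text \<open>Doubling of variables on spheres. If \<open>x\<close>, \<open>y\<close> maximise \<open>ln u x - ln u y\<close> minus a function of the angle,
  the gradients of \<open>ln u\<close> at both points have the same tangential length, so the gradient terms of the equation
  cancel; no Lipschitz condition on them is needed. The logarithmic weight makes the maximum exist and only
  perturbs the radial derivatives.\<close>

lemma solution_radial:
  fixes u :: "'a::euclidean_space => real"
  assumes q: "q > 1" and \<tau>: "0 <= \<tau>" "\<tau> < 1" and dim: "DIM('a) >= 2"
    and pos: "!!x. x ~= 0 ==> u x > 0" and w: "wl (-{0}) u V (sol_lap q \<tau> \<rho> lam \<theta> u V)"
    and x: "x ~= 0" "norm x = norm y"
  shows "u x = u y"
proof -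
  have pos': "\<forall>x\<in>-{0}. u x > 0" using pos by auto
  obtain C where C: "C > 0" "!!x y. x ~= 0 ==> norm x = norm y ==> u x <= C * u y"
      "!!x. x ~= 0 ==> norm x * norm (V x) <= C * u x"
  proof -
    obtain C where C: "C > 0" and H: "\<forall>(u :: 'a => real) V. (\<forall>x\<in>-{0}. u x > 0) --> wl (-{0}) u V (sol_lap q \<tau> \<rho> lam \<theta> u V) -->
       (\<forall>x y. x ~= 0 --> norm x = norm y --> u x <= C * u y) \<and> (\<forall>x. x ~= 0 --> norm x * norm (V x) <= C * u x)"
      using solution_harnack[OF q \<tau> dim, of \<rho> lam \<theta>] by (elim exE conjE)
    from H[rule_format, OF pos'[rule_format] w] C that show thesis by simp
  qed
  define n where "n = real DIM('a)"
  have n: "n >= 2" using dim unfolding n_def by simp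
  define v where "v x = ln (u x)" for x
  define p where "p x = (1 / u x) *\<^sub>R V x" for x
  define F where "F x = sol_lap q \<tau> \<rho> lam \<theta> u V x / u x - (norm (p x))^2" for x
  have wv: "wl (-{0}) v p F"
    unfolding v_def p_def F_def by (rule wl_ln[OF w]) (use pos in auto)
  have pb: "norm x * norm (p x) <= C" if "x ~= 0" for x
    using C(3)[OF that] pos[OF that] unfolding p_def by (simp add: field_simps)
  define Pr where "Pr = {z :: 'a \<times> 'a. fst z ~= 0 \<and> norm (fst z) = norm (snd z)}"
  have vb: "v x - v y <= ln C" if "x ~= 0" "norm x = norm y" for x y
  proof -
    have y: "y ~= 0" using that by auto
    have "ln (u x) <= ln (C * u y)" using C(1) C(2)[OF that] pos[OF that(1)] pos[OF y] by simp
    then show ?thesis unfolding v_def using C(1) pos[OF y] by (simp add: ln_mult)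
  qed
  \<comment> \<open>It is applied to the sine of half the angle. Values between 1 and 2 keep the
    quotient \<open>Rt\<close> bounded; slope and concavity together keep the Laplacian of the
    penalty below a negative constant at every angle.\<close>
  define \<phi> where "\<phi> a = 1 + a - a^2 / 4" for a :: real
  have \<phi>b: "1 <= \<phi> a" "\<phi> a <= 2" if "0 <= a" "a <= 1" for a
  proof -
    have "a^2 <= a" using that by (simp add: power2_eq_square mult_left_le)
    then show "1 <= \<phi> a" using that unfolding \<phi>_def by simp
    show "\<phi> a <= 2" using that zero_le_power2[of a] unfolding \<phi>_def by linarith
  qed
  define \<alpha> where "\<alpha> z = norm (fst z - snd z) / (2 * norm (fst z))" for z :: "'a \<times> 'a"
  have \<alpha>b: "0 <= \<alpha> z" "\<alpha> z <= 1" if "z \<in> Pr" for z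
  proof -
    have n: "norm (fst z) > 0" "norm (snd z) = norm (fst z)" using that unfolding Pr_def by auto
    show "0 <= \<alpha> z" unfolding \<alpha>_def by simp
    have "norm (fst z - snd z) <= 1 * (2 * norm (fst z))"
      using norm_triangle_ineq4[of "fst z" "snd z"] n(2) by simp
    then show "\<alpha> z <= 1" unfolding \<alpha>_def using n(1) by (subst divide_le_eq) simp
  qed
  define Rt where "Rt z = (v (fst z) - v (snd z)) / \<phi> (\<alpha> z)" for z
  have \<phi>z: "1 <= \<phi> (\<alpha> z)" "\<phi> (\<alpha> z) <= 2" if "z \<in> Pr" for z using \<phi>b \<alpha>b[OF that] by auto
  define S where "S = Sup (Rt ` Pr)"
  \<comment> \<open>This is what the Harnack inequality on spheres is for: without it the supremum
    might be infinite.\<close>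
  have bdd: "bdd_above (Rt ` Pr)"
  proof (rule bdd_aboveI2[where M="\<bar>ln C\<bar>"])
    fix z assume z: "z \<in> Pr"
    have "v (fst z) - v (snd z) <= \<bar>ln C\<bar> * 1" using vb[of "fst z" "snd z"] z unfolding Pr_def by auto
    also have "... <= \<bar>ln C\<bar> * \<phi> (\<alpha> z)" using \<phi>z[OF z] by (intro mult_left_mono) auto
    finally show "Rt z <= \<bar>ln C\<bar>" unfolding Rt_def using \<phi>z[OF z] by (simp add: divide_le_eq)
  qed
  have S_ub: "v (fst z) - v (snd z) <= S * \<phi> (\<alpha> z)" if z: "z \<in> Pr" for z
  proof -
    have "Rt z <= S" unfolding S_def by (rule cSup_upper[OF imageI[OF z] bdd])
    then show ?thesis unfolding Rt_def using \<phi>z[OF z] by (simp add: divide_le_eq)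
  qed
  have "S <= 0"
  proof (rule ccontr)
    assume "\<not> S <= 0"
    then have S: "S > 0" by simp
    define k where "k = n - 2 + 2 * \<rho>"
    define h where "h X = lam * X powr ((1 - \<tau>) / 2)" for X :: real
    \<comment> \<open>For \<tau> > 0 the gradient term is not Lipschitz at 0. Its two arguments will
      differ by O(\<epsilon>) only, so a modulus of continuity is enough.\<close>
    have "uniformly_continuous_on {0..C^2} h"
      unfolding h_def using \<tau> by (intro compact_uniformly_continuous continuous_intros continuous_on_powr') auto
    moreover have "S / 16 > 0" using S by simp
    ultimately obtain \<delta>1 where \<delta>1: "\<delta>1 > 0" "!!X Y. X \<in> {0..C^2} ==> Y \<in> {0..C^2} ==> \<bar>Y - X\<bar> < \<delta>1 ==> \<bar>h Y - h X\<bar> < S / 16"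
      unfolding uniformly_continuous_on_def dist_real_def by blast
    obtain z1 where z1: "z1 \<in> Pr" "Rt z1 > S - S / 8"
    proof -
      have "Pr ~= {}" using x unfolding Pr_def by auto
      then show ?thesis using less_cSup_iff[of "Rt ` Pr" "S - S / 8"] bdd S that unfolding S_def by auto
    qed
    define g where "g x = log_weight ((norm x)^2)" for x :: 'a
    have g: "g x >= 0" "\<bar>ln ((norm x)^2)\<bar> <= g x" if "x ~= 0" for x
      using log_weight_ge[of "(norm x)^2"] that unfolding g_def by auto
    \<comment> \<open>\<open>\<epsilon> * K\<close> collects the errors due to the weight: its
      Laplacian (\<open>4 + 2 * n\<close>), the drift (\<open>2 * \<bar>k\<bar>\<close>) and the
      difference of the squared gradients (\<open>4 * C\<close>).\<close>
    define K where "K = 4 + 2 * n + 2 * \<bar>k\<bar> + 4 * C"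
    have K: "K > 0" unfolding K_def using n C by simp
    define \<epsilon> where "\<epsilon> = min (S / (8 * K)) (min (\<delta>1 / (8 * C)) (S / (4 * (1 + g (fst z1)))))"
    have z1n: "fst z1 ~= 0" using z1 unfolding Pr_def by simp
    have g1: "1 + g (fst z1) > 0" using g(1)[OF z1n] by simp
    have \<epsilon>: "\<epsilon> > 0" "\<epsilon> * K <= S / 8" "4 * C * \<epsilon> < \<delta>1" "\<epsilon> * g (fst z1) <= S / 4"
    proof -
      show "\<epsilon> > 0" unfolding \<epsilon>_def using S K \<delta>1 C g1 by simp
      have "\<epsilon> <= S / (8 * K)" unfolding \<epsilon>_def by simp
      then show "\<epsilon> * K <= S / 8" using K by (simp add: field_simps)
      have "\<epsilon> <= \<delta>1 / (8 * C)" unfolding \<epsilon>_def by simp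
      then have "8 * C * \<epsilon> <= \<delta>1" using C by (simp add: field_simps)
      then show "4 * C * \<epsilon> < \<delta>1" using \<delta>1 by simp
      have "\<epsilon> <= S / (4 * (1 + g (fst z1)))" unfolding \<epsilon>_def by simp
      then have "\<epsilon> * (1 + g (fst z1)) <= S / 4" using g1 by (simp add: field_simps)
      then show "\<epsilon> * g (fst z1) <= S / 4" using \<open>\<epsilon> > 0\<close> by (simp add: algebra_simps)
    qed
    define T where "T z = v (fst z) - v (snd z) - S * \<phi> (\<alpha> z) - \<epsilon> * g (fst z)" for z
    have T1: "T z1 >= - (S / 2)"
    proof -
      have "(S - S / 8) * \<phi> (\<alpha> z1) <= v (fst z1) - v (snd z1)"
        using z1 \<phi>z[OF z1(1)] unfolding Rt_def by (simp add: less_divide_eq)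
      moreover have "S / 8 * \<phi> (\<alpha> z1) <= S / 8 * 2" using \<phi>z[OF z1(1)] S by (intro mult_left_mono) auto
      ultimately show ?thesis unfolding T_def using \<epsilon>(4) by (simp add: algebra_simps)
    qed
    define G where "G = S / (2 * \<epsilon>)"
    define Q where "Q = {z :: 'a \<times> 'a. norm (fst z) = norm (snd z) \<and> exp (- G / 2) <= norm (fst z) \<and> norm (fst z) <= exp (G / 2)}"
    have QPr: "z \<in> Pr" if "z \<in> Q" for z
    proof -
      have "exp (- G / 2) <= norm (fst z)" using that unfolding Q_def by simp
      then have "norm (fst z) > 0" by (rule less_le_trans[OF exp_gt_zero])
      then show ?thesis using that unfolding Q_def Pr_def by auto
    qed
    \<comment> \<open>The weight confines pairs with \<open>T\<close> not too negative to a closed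
      annulus, so the maximum over all pairs of equal norm is attained.\<close>
    have out: "z \<in> Q" if z: "z \<in> Pr" "T z >= - (S / 2)" for z
    proof -
      have nz: "fst z ~= 0" using z unfolding Pr_def by simp
      have "\<epsilon> * g (fst z) <= S / 2" using S_ub[OF z(1)] z(2) unfolding T_def by linarith
      then have "g (fst z) <= G" unfolding G_def using \<epsilon> by (simp add: field_simps)
      then have "\<bar>ln ((norm (fst z))^2)\<bar> <= G" using g(2)[OF nz] by linarith
      then have l: "\<bar>2 * ln (norm (fst z))\<bar> <= G" using nz by (simp add: ln_realpow)
      have "- G / 2 <= ln (norm (fst z))" "ln (norm (fst z)) <= G / 2" using l by linarith+
      then have "exp (- G / 2) <= exp (ln (norm (fst z)))" "exp (ln (norm (fst z))) <= exp (G / 2)" by simp_all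
      then have "exp (- G / 2) <= norm (fst z)" "norm (fst z) <= exp (G / 2)" using nz by simp_all
      then show ?thesis using z unfolding Q_def Pr_def by auto
    qed
    have cQ: "compact Q"
    proof -
      have "closed Q" unfolding Q_def by (intro closed_Collect_conj closed_Collect_le closed_Collect_eq continuous_intros)
      moreover have "bounded Q"
      proof (rule bounded_subset[OF bounded_Times[OF bounded_cball bounded_cball]])
        show "Q \<subseteq> cball 0 (exp (G / 2)) \<times> cball 0 (exp (G / 2))" unfolding Q_def by auto
      qed
      ultimately show ?thesis by (simp add: compact_eq_bounded_closed)
    qed
    have Qnz: "fst z ~= 0" "snd z ~= 0" if "z \<in> Q" for z using QPr[OF that] unfolding Pr_def by auto
    have cT: "continuous_on Q T"
    proof -
      have cv: "continuous_on (-{0}) v" by (rule wl_cont[OF wv])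
      have cg: "continuous_on (-{0}) g" unfolding g_def by (rule wl_cont[OF wl_log_weight])
      have f: "continuous_on Q fst" "continuous_on Q snd" by (intro continuous_intros)+
      have sub: "fst ` Q \<subseteq> -{0}" "snd ` Q \<subseteq> -{0}" using Qnz by auto
      note 1 = continuous_on_compose2[OF cv f(1) sub(1)] continuous_on_compose2[OF cv f(2) sub(2)]
        continuous_on_compose2[OF cg f(1) sub(1)]
      have 2: "continuous_on Q \<alpha>" unfolding \<alpha>_def by (intro continuous_intros) (use Qnz in auto)
      show ?thesis unfolding T_def \<phi>_def by (intro continuous_intros 1 2) auto
    qed
    obtain z where z: "z \<in> Q" "!!z'. z' \<in> Q ==> T z' <= T z"
      using continuous_attains_sup[OF cQ _ cT] out[OF z1(1) T1] by blast
    have Tz: "T z >= - (S / 2)" using z(2)[OF out[OF z1(1) T1]] T1 by linarith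
    have mxT: "T z' <= T z" if "z' \<in> Pr" for z'
      using out[OF that] z(2)[of z'] Tz by linarith
    define a b where "a = fst z" and "b = snd z"
    have zab: "z = (a, b)" unfolding a_def b_def by simp
    have ab: "a ~= 0" "b ~= 0" "norm a = norm b" using QPr[OF z(1)] unfolding Pr_def a_def b_def by auto
    have zPr: "(a, b) \<in> Pr" using QPr[OF z(1)] zab by simp
    define r where "r = norm a"
    have r: "r > 0" using ab unfolding r_def by simp
    have nb: "norm b = r" using ab unfolding r_def by simp
    have vab: "v a - v b >= S / 2"
    proof -
      have "S * 1 <= S * \<phi> (\<alpha> z)" using \<phi>z[OF QPr[OF z(1)]] S by (intro mult_left_mono) auto
      moreover have "\<epsilon> * g a >= 0" using g(1)[OF ab(1)] \<epsilon> by simp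
      ultimately show ?thesis using Tz unfolding T_def a_def b_def by linarith
    qed
    have abne: "a ~= b" using vab S by auto
    have uab: "u b < u a"
    proof -
      have "ln (u b) < ln (u a)" using vab S unfolding v_def by linarith
      then show ?thesis using pos[OF ab(1)] pos[OF ab(2)] by simp
    qed
    define d where "d = norm (a - b)"
    have d: "d > 0" using abne unfolding d_def by simp
    have d\<phi>: "DERIV \<phi> t :> (1 - t / 2)" for t
      unfolding \<phi>_def by (auto intro!: derivative_eq_intros)
    define A where "A = S * (1 - d / (2 * r) / 2) / (2 * r) / d"
    have gn: "GDERIV (%\<xi>. S * \<phi> (norm (\<xi> - c) / (2 * r))) \<xi> :> (S * (1 - norm (\<xi> - c) / (2 * r) / 2) / (2 * r) / norm (\<xi> - c)) *\<^sub>R (\<xi> - c)"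
      if "\<xi> ~= c" for \<xi> c :: 'a
    proof -
      have "(norm has_derivative (%h. h \<bullet> sgn (\<xi> - c))) (at (\<xi> - c))"
        using GDERIV_norm[of "\<xi> - c"] that by (simp add: gderiv_def)
      moreover have "((%x. x - c) has_derivative (%h. h)) (at \<xi>)"
        using has_derivative_diff[OF has_derivative_ident has_derivative_const, of c "at \<xi>"] by simp
      ultimately have gn: "GDERIV (%x. norm (x - c)) \<xi> :> sgn (\<xi> - c)"
        unfolding gderiv_def by (rule has_derivative_compose[rotated])
      have "DERIV (%t. S * \<phi> (t / (2 * r))) (norm (\<xi> - c)) :> S * ((1 - norm (\<xi> - c) / (2 * r) / 2) * (1 / (2 * r)))"
        by (intro DERIV_cmult DERIV_chain2[OF d\<phi>]) (use r in \<open>auto intro!: derivative_eq_intros\<close>)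
      from GDERIV_DERIV_compose[OF gn this] show ?thesis by (simp add: sgn_div_norm field_simps)
    qed
    have tanx: "(p a + A *\<^sub>R b) \<bullet> t = 0" if t: "t \<bullet> a = 0" for t
    proof -
      have G: "GDERIV (%\<xi>. v \<xi> - S * \<phi> (norm (\<xi> - b) / (2 * r))) a :> p a - A *\<^sub>R (a - b)"
        unfolding A_def d_def by (rule GDERIV_diff[OF wlD(2)[OF wv] gn]) (use ab abne in auto)
      have "(p a - A *\<^sub>R (a - b)) \<bullet> t = 0"
      proof (rule sphere_max_tangential[OF G ab(1) _ t])
        fix \<xi> :: 'a assume xi: "norm \<xi> = norm a"
        then have "(\<xi>, b) \<in> Pr" using ab unfolding Pr_def by auto
        from mxT[OF this] show "v \<xi> - S * \<phi> (norm (\<xi> - b) / (2 * r)) <= v a - S * \<phi> (norm (a - b) / (2 * r))"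
          unfolding T_def zab \<alpha>_def g_def by (simp add: xi r_def)
      qed
      moreover have "(p a - A *\<^sub>R (a - b)) \<bullet> t = (p a + A *\<^sub>R b) \<bullet> t - A * (a \<bullet> t)"
        by (simp add: inner_diff_left inner_add_left algebra_simps)
      ultimately show ?thesis using t by (simp add: inner_commute[of a])
    qed
    have tany: "(p b - A *\<^sub>R a) \<bullet> t = 0" if t: "t \<bullet> b = 0" for t
    proof -
      have G: "GDERIV (%\<xi>. - v \<xi> - S * \<phi> (norm (\<xi> - a) / (2 * r))) b :> - p b - A *\<^sub>R (b - a)"
        unfolding A_def d_def norm_minus_commute[of a b]
        by (rule GDERIV_diff[OF GDERIV_minus[OF wlD(2)[OF wv]] gn]) (use ab abne in auto)
      have "(- p b - A *\<^sub>R (b - a)) \<bullet> t = 0"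
      proof (rule sphere_max_tangential[OF G ab(2) _ t])
        fix \<xi> :: 'a assume xi: "norm \<xi> = norm b"
        then have "(a, \<xi>) \<in> Pr" using ab unfolding Pr_def by auto
        from mxT[OF this] show "- v \<xi> - S * \<phi> (norm (\<xi> - a) / (2 * r)) <= - v b - S * \<phi> (norm (b - a) / (2 * r))"
          unfolding T_def zab \<alpha>_def g_def by (simp add: xi r_def norm_minus_commute)
      qed
      moreover have "(- p b - A *\<^sub>R (b - a)) \<bullet> t = - ((p b - A *\<^sub>R a) \<bullet> t) - A * (b \<bullet> t)"
        by (simp add: inner_diff_left algebra_simps)
      ultimately show ?thesis using t by (simp add: inner_commute[of b])
    qed
    define s s' where "s = a \<bullet> p a" and "s' = b \<bullet> p b"
    define X X' where "X = (norm a * norm (p a))^2" and "X' = (norm b * norm (p b))^2"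
    have XX: "X - X' = s^2 - s'^2"
    proof -
      have "r^2 * (p a \<bullet> p a) - r^2 * (p b \<bullet> p b) = (a \<bullet> p a)^2 - (b \<bullet> p b)^2"
        by (rule equal_tangential_gradients[where A=A]) (use tanx tany r nb in \<open>auto simp: r_def power2_norm_eq_inner[symmetric]\<close>)
      then show ?thesis unfolding X_def X'_def s_def s'_def
        by (simp add: power_mult_distrib power2_norm_eq_inner[symmetric] r_def ab(3)[symmetric])
    qed
    have sC: "\<bar>s\<bar> <= C" "\<bar>s'\<bar> <= C"
      unfolding s_def s'_def using Cauchy_Schwarz_ineq2[of a "p a"] Cauchy_Schwarz_ineq2[of b "p b"] pb[OF ab(1)] pb[OF ab(2)] by linarith+
    have XC: "X \<in> {0..C^2}" "X' \<in> {0..C^2}"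
      unfolding X_def X'_def using pb[OF ab(1)] pb[OF ab(2)] by (auto intro!: power_mono)
    define e where "e = (1 / norm (a - b)) *\<^sub>R (a - b)"
    define m where "m = (1/2) *\<^sub>R (a + b)"
    note sw = bisector_reflection_swaps[OF abne e_def m_def]
    \<comment> \<open>The bisecting hyperplane of two points of equal norm contains the origin, so
      the reflection preserves spheres and the pairs (\<xi>, f \<xi>) stay admissible.\<close>
    have me: "m \<bullet> e = 0"
    proof -
      have "(a + b) \<bullet> (a - b) = (norm a)^2 - (norm b)^2"
        by (simp add: inner_add_left inner_diff_right power2_norm_eq_inner inner_commute[of b a])
      then show ?thesis unfolding m_def e_def using ab(3) by simp
    qed
    define f where "f = reflection e"
    note orth = reflection_orthogonal[OF sw(1), folded f_def]
    have fa: "f a = b" using sw(2) me unfolding f_def by simp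
    have nf: "norm (f \<xi>) = norm \<xi>" for \<xi> using orth(1) by (simp add: orthogonal_transformation)
    have f0: "f \<xi> = 0 \<longleftrightarrow> \<xi> = 0" for \<xi> using nf[of \<xi>] by (metis norm_eq_zero)
    have wvf: "wl (-{0}) (%\<xi>. v (f \<xi>)) (%\<xi>. f (p (f \<xi>))) (%\<xi>. F (f \<xi>))"
    proof -
      have "(%\<xi>. 0 + f \<xi>) -` (-{0}) = -{0}" using f0 by auto
      then show ?thesis using wl_isometry[OF wv orth, of 0] by simp
    qed
    define c where "c \<xi> = (\<xi> \<bullet> e) / norm \<xi>" for \<xi>
    define Vc where "Vc \<xi> = (1 / norm \<xi>) *\<^sub>R e - ((\<xi> \<bullet> e) / norm \<xi> ^ 3) *\<^sub>R \<xi>" for \<xi>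
    have wc: "wl (-{0}) c Vc (%\<xi>. - (n - 1) * (\<xi> \<bullet> e) / norm \<xi> ^ 3)"
      unfolding c_def Vc_def n_def by (rule wl_direction_cosine(1)[OF sw(1)])
    have w\<phi>: "wl (-{0}) (%\<xi>. \<phi> (c \<xi>)) (%\<xi>. (1 - c \<xi> / 2) *\<^sub>R Vc \<xi>)
       (%\<xi>. (1 - c \<xi> / 2) * (- (n - 1) * (\<xi> \<bullet> e) / norm \<xi> ^ 3) + (- 1/2) * (norm (Vc \<xi>))^2)"
      by (rule wl_compose[OF wc, where g''="%_. - 1/2"]) (auto intro: d\<phi> intro!: derivative_eq_intros)
    define g1 where "g1 \<xi> = 2 / (1 + (norm \<xi>)^2) - 1 / (norm \<xi>)^2" for \<xi> :: 'a
    define Fg where "Fg \<xi> = g1 \<xi> * (2 * n) + (1 / ((norm \<xi>)^2)^2 - 2 / (1 + (norm \<xi>)^2)^2) * (norm (2 *\<^sub>R \<xi>))^2" for \<xi> :: 'a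
    have wg: "wl (-{0}) g (%\<xi>. g1 \<xi> *\<^sub>R 2 *\<^sub>R \<xi>) Fg"
      unfolding g_def g1_def Fg_def n_def by (rule wl_log_weight)
    note wH = wl_diff[OF wl_diff[OF wv wvf] wl_add[OF wl_cmult[OF w\<phi>, of S] wl_cmult[OF wg, of \<epsilon>]]]
    have aS: "a \<in> -{0}" using ab by simp
    have ae: "a \<bullet> e = d / 2" using sw(3) me unfolding d_def by (simp add: inner_diff_left)
    have ca: "c a = d / (2 * r)" unfolding c_def r_def[symmetric] ae by simp
    have ca01: "0 < c a" "c a <= 1"
    proof -
      show "0 < c a" unfolding ca using d r by simp
      show "c a <= 1" using \<alpha>b(2)[OF zPr] unfolding ca \<alpha>_def d_def r_def by simp
    qed
    have opn: "open {\<xi> \<in> -{0}. 0 < c \<xi>}"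
    proof -
      have "open (-{0} \<inter> c -` {0<..})" by (rule continuous_open_preimage[OF wl_cont[OF wc]]) auto
      moreover have "-{0} \<inter> c -` {0<..} = {\<xi> \<in> -{0}. 0 < c \<xi>}" by auto
      ultimately show ?thesis by simp
    qed
    have "a \<in> {\<xi> \<in> -{0}. 0 < c \<xi>}" using aS ca01 by simp
    then obtain \<delta> where \<delta>: "\<delta> > 0" "ball a \<delta> \<subseteq> {\<xi> \<in> -{0}. 0 < c \<xi>}"
      using openE[OF opn] by blast
    have mxw: "v \<xi> - v (f \<xi>) - (S * \<phi> (c \<xi>) + \<epsilon> * g \<xi>) <= v a - v (f a) - (S * \<phi> (c a) + \<epsilon> * g a)"
      if "\<xi> \<in> ball a \<delta>" for \<xi>
    proof -
      have "\<xi> \<in> {\<xi> \<in> -{0}. 0 < c \<xi>}" using that \<delta>(2) by blast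
      then have xi: "\<xi> ~= 0" "0 < c \<xi>" by auto
      have pr: "(\<xi>, f \<xi>) \<in> Pr" using xi nf unfolding Pr_def by simp
      have "\<xi> - f \<xi> = (2 * (\<xi> \<bullet> e)) *\<^sub>R e" unfolding f_def reflection_def by simp
      then have "norm (\<xi> - f \<xi>) = \<bar>2 * (\<xi> \<bullet> e)\<bar>" using sw(1) by simp
      moreover have "\<xi> \<bullet> e > 0" using xi unfolding c_def by (simp add: zero_less_divide_iff)
      ultimately have "\<alpha> (\<xi>, f \<xi>) = c \<xi>" unfolding \<alpha>_def c_def using xi by (simp add: field_simps)
      moreover have "\<alpha> (a, b) = c a" unfolding ca \<alpha>_def d_def r_def by simp
      ultimately show ?thesis using mxT[OF pr] unfolding T_def zab fa by simp
    qed
    have lap: "F a - F b - (S * ((1 - c a / 2) * (- (n - 1) * (a \<bullet> e) / norm a ^ 3) + (- 1/2) * (norm (Vc a))^2) + \<epsilon> * Fg a) <= 0"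
      using wl_local_max[OF wH aS \<delta>(1) mxw] unfolding fa .
    have grd: "p a - f (p b) - (S *\<^sub>R (1 - c a / 2) *\<^sub>R Vc a + \<epsilon> *\<^sub>R g1 a *\<^sub>R 2 *\<^sub>R a) = 0"
      using GDERIV_local_max_zero[OF wlD(2)[OF wH aS] \<delta>(1) mxw] unfolding fa .
    define W where "W = r^2"
    have W: "W > 0" unfolding W_def using r by simp
    have g1W: "\<bar>W * g1 a\<bar> <= 1"
    proof -
      have "W * g1 a = 2 * (W / (1 + W)) - 1" unfolding g1_def r_def[symmetric] W_def[symmetric] using W by (simp add: right_diff_distrib)
      moreover have "0 <= W / (1 + W)" "W / (1 + W) <= 1" using W by simp_all
      ultimately show ?thesis by linarith
    qed
    \<comment> \<open>The radial component of the vanishing gradient: the penalty is tangential, so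
      only the weight separates the radial derivatives at the two points.\<close>
    have ss: "\<bar>s - s'\<bar> <= 2 * \<epsilon>"
    proof -
      have "f a \<bullet> f (f (p b)) = a \<bullet> f (p b)" using orth(1) unfolding orthogonal_transformation_def by blast
      then have "a \<bullet> f (p b) = s'" unfolding s'_def orth(2) fa ..
      moreover have "a \<bullet> Vc a = 0" unfolding Vc_def by (rule wl_direction_cosine(3)[OF sw(1) ab(1)])
      moreover have "a \<bullet> (p a - f (p b) - (S *\<^sub>R (1 - c a / 2) *\<^sub>R Vc a + \<epsilon> *\<^sub>R g1 a *\<^sub>R 2 *\<^sub>R a)) = 0"
        unfolding grd by simp
      moreover have "a \<bullet> a = W" unfolding W_def r_def by (simp add: power2_norm_eq_inner)
      ultimately have "s - s' = 2 * \<epsilon> * (W * g1 a)"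
        by (simp add: inner_diff_right inner_add_right s_def)
      then have "\<bar>s - s'\<bar> = 2 * \<epsilon> * \<bar>W * g1 a\<bar>" using \<epsilon> by (simp add: abs_mult)
      also have "... <= 2 * \<epsilon> * 1" using g1W \<epsilon> by (intro mult_left_mono) auto
      finally show ?thesis by simp
    qed
    have XXb: "\<bar>X - X'\<bar> <= 4 * C * \<epsilon>"
    proof -
      have "\<bar>X - X'\<bar> = \<bar>s + s'\<bar> * \<bar>s - s'\<bar>" unfolding XX abs_mult[symmetric] by (simp add: power2_eq_square algebra_simps)
      also have "... <= (2 * C) * (2 * \<epsilon>)" by (rule mult_mono) (use sC ss C in linarith)+
      finally show ?thesis by simp
    qed
    have hX: "\<bar>h X - h X'\<bar> < S / 16"
      by (rule \<delta>1(2)[OF XC(2) XC(1)]) (use XXb \<epsilon> in linarith)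
    \<comment> \<open>The power of |x| is the same at both points, so the absorption terms are
      ordered by \<open>u b < u a\<close>; all other differences are small.\<close>
    have low: "W * (F a - F b) >= - 2 * \<bar>k\<bar> * \<epsilon> - S / 16 - 4 * C * \<epsilon>"
    proof -
      have Fa: "W * F a = norm a powr (\<theta> + 2) * u a powr (q - 1) + k * s - h X - X"
        unfolding W_def r_def F_def norm_square_log_lap[where x=a and u=u and V=V and p="p a", OF ab(1) pos[OF ab(1)] p_def \<tau>(2)] h_def X_def s_def k_def n_def by simp
      have Fb: "W * F b = norm a powr (\<theta> + 2) * u b powr (q - 1) + k * s' - h X' - X'"
        unfolding W_def nb[symmetric] F_def norm_square_log_lap[where x=b and u=u and V=V and p="p b", OF ab(2) pos[OF ab(2)] p_def \<tau>(2)] h_def X'_def s'_def k_def n_def ab(3) by simp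
      have "u b powr (q - 1) <= u a powr (q - 1)"
        by (rule powr_mono2) (use q uab pos[OF ab(2)] in auto)
      then have 1: "norm a powr (\<theta> + 2) * u b powr (q - 1) <= norm a powr (\<theta> + 2) * u a powr (q - 1)"
        by (rule mult_left_mono) simp
      have "\<bar>k * (s - s')\<bar> <= \<bar>k\<bar> * (2 * \<epsilon>)" unfolding abs_mult using ss by (rule mult_left_mono) simp
      then have 2: "k * s - k * s' >= - 2 * \<bar>k\<bar> * \<epsilon>" by (simp add: algebra_simps abs_le_iff)
      have "W * (F a - F b) = W * F a - W * F b" by (simp add: algebra_simps)
      then show ?thesis using 1 2 hX XXb unfolding Fa Fb by linarith
    qed
    have up: "W * (F a - F b) <= - S / 2 + \<epsilon> * (4 + 2 * n)"
    proof -
      define t where "t = c a"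
      have "W * ((1 - t / 2) * (- (n - 1) * (a \<bullet> e) / norm a ^ 3) + (- 1/2) * (norm (Vc a))^2)
          = - (n - 1) * (t - t^2 / 2) - 1/2 * (1 - t^2)"
      proof -
        have A1: "W * ((a \<bullet> e) / norm a ^ 3) = t" unfolding t_def c_def W_def r_def using ab(1) by (simp add: power2_eq_square power3_eq_cube)
        have A2: "W * (norm (Vc a))^2 = 1 - t^2"
          unfolding Vc_def wl_direction_cosine(2)[OF sw(1) ab(1)] t_def c_def W_def r_def using ab(1) by simp
        have A3: "W * ((1 - t / 2) * (- (n - 1) * (a \<bullet> e) / norm a ^ 3) + (- 1/2) * (norm (Vc a))^2)
            = - (n - 1) * (1 - t / 2) * (W * ((a \<bullet> e) / norm a ^ 3)) - 1/2 * (W * (norm (Vc a))^2)"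
          by (simp add: algebra_simps diff_divide_distrib add_divide_distrib)
        show ?thesis unfolding A3 A1 A2 by (simp add: algebra_simps power2_eq_square)
      qed
      \<comment> \<open>As n >= 2, the slope contributes at most - t + t^2 / 2 and the concavity -
        (1 - t^2) / 2; together this is - 1/2 - t + t^2, where t^2 <= t.\<close>
      also have "... <= - (1/2)"
      proof -
        have t: "0 < t" "t <= 1" using ca01 unfolding t_def by auto
        have tt: "t^2 <= t" using t by (simp add: power2_eq_square mult_left_le)
        define Y where "Y = t - t^2 / 2"
        have Y: "1 * Y <= (n - 1) * Y" using n tt t unfolding Y_def by (intro mult_right_mono) auto
        have e: "- (n - 1) * Y = - ((n - 1) * Y)" by (rule mult_minus_left)
        define Z where "Z = (n - 1) * Y"
        have "Y <= Z" using Y unfolding Z_def by (simp only: mult_1)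
        then have "- Z - 1/2 * (1 - t^2) <= - (1/2)" using tt Y_def by argo
        then show ?thesis unfolding Y_def[symmetric] e Z_def .
      qed
      finally have 1: "S * (W * ((1 - t / 2) * (- (n - 1) * (a \<bullet> e) / norm a ^ 3) + (- 1/2) * (norm (Vc a))^2)) <= S * (- (1/2))"
        using S by (intro mult_left_mono) auto
      have "W * Fg a <= 4 + 2 * n"
      proof -
        have "W * Fg a = (W * g1 a) * (2 * n) + 4 * (1 - 2 * (W / (1 + W))^2)"
          unfolding Fg_def norm_scaleR power_mult_distrib r_def[symmetric] W_def[symmetric] using W
          by (simp add: algebra_simps power_divide power2_eq_square)
        also have "... <= 1 * (2 * n) + 4 * 1"
          using g1W n by (intro add_mono mult_right_mono mult_left_mono) auto
        finally show ?thesis by simp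
      qed
      then have 2: "\<epsilon> * (W * Fg a) <= \<epsilon> * (4 + 2 * n)" using \<epsilon> by (intro mult_left_mono) auto
      have "W * (F a - F b) <= W * (S * ((1 - c a / 2) * (- (n - 1) * (a \<bullet> e) / norm a ^ 3) + (- 1/2) * (norm (Vc a))^2) + \<epsilon> * Fg a)"
        using lap W by (intro mult_left_mono) auto
      also have "... = S * (W * ((1 - t / 2) * (- (n - 1) * (a \<bullet> e) / norm a ^ 3) + (- 1/2) * (norm (Vc a))^2)) + \<epsilon> * (W * Fg a)"
        unfolding t_def by (simp add: algebra_simps)
      finally show ?thesis using 1 2 by linarith
    qed
    have "\<epsilon> * K = \<epsilon> * (4 + 2 * n) + 2 * \<bar>k\<bar> * \<epsilon> + 4 * C * \<epsilon>" unfolding K_def by (simp add: algebra_simps)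
    then show False using low up \<epsilon>(2) S by linarith
  qed
  moreover have le: "v x <= v y" if "x ~= 0" "norm x = norm y" for x y
  proof -
    have z: "(x, y) \<in> Pr" using that unfolding Pr_def by simp
    have "S * \<phi> (\<alpha> (x, y)) <= 0" using \<open>S <= 0\<close> \<phi>z[OF z] by (intro mult_nonpos_nonneg) auto
    then show ?thesis using S_ub[OF z] by simp
  qed
  have y: "y ~= 0" using x by auto
  have "v x = v y" using le[OF x] le[OF y x(2)[symmetric]] by simp
  then show ?thesis unfolding v_def using pos[OF x(1)] pos[OF y] by simp
qed

section \<open>The equation in logarithmic coordinates\<close>

text \<open>The hypotheses say z'' = \<Phi> in the viscosity sense. Subtracting a second
  antiderivative \<open>K\<close> of \<open>\<Phi>\<close> leaves \<open>E\<close> with E'' = 0 in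
  that sense, and comparison with chords perturbed by a parabola shows that \<open>E\<close> is
  affine.\<close>

lemma viscosity_imp_C2:
  fixes z p \<Phi> :: "real => real"
  assumes dz: "!!t. DERIV z t :> p t" and c\<Phi>: "continuous_on UNIV \<Phi>"
    and up: "!!k k' k'' t0 d. [|!!t. DERIV k t :> k' t; !!t. DERIV k' t :> k'' t;
       continuous_on UNIV k''; d > 0; !!t. \<bar>t - t0\<bar> < d ==> z t - k t <= z t0 - k t0|] ==> \<Phi> t0 <= k'' t0"
    and dn: "!!k k' k'' t0 d. [|!!t. DERIV k t :> k' t; !!t. DERIV k' t :> k'' t;
       continuous_on UNIV k''; d > 0; !!t. \<bar>t - t0\<bar> < d ==> z t0 - k t0 <= z t - k t|] ==> k'' t0 <= \<Phi> t0"
  shows "DERIV p t :> \<Phi> t"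
proof -
  have anti: "\<exists>G. \<forall>t. DERIV G t :> g t" if "!!t. isCont g t" for g :: "real => real"
    using einterval_antiderivative[of "-\<infinity>" "\<infinity>" g] that
    by (auto simp: has_real_derivative_iff_has_vector_derivative)
  obtain K1 where K1: "!!t. DERIV K1 t :> \<Phi> t"
    using anti[of \<Phi>] c\<Phi> by (auto simp: continuous_on_eq_continuous_at)
  obtain K where K: "!!t. DERIV K t :> K1 t"
    using anti[of K1] K1 DERIV_isCont by blast
  define E where "E t = z t - K t" for t
  have dE: "DERIV E t :> p t - K1 t" for t
    unfolding E_def by (intro DERIV_diff dz K)
  have cE: "continuous_on S E" for S by (intro continuous_at_imp_continuous_on ballI DERIV_isCont[OF dE])
  have lin: "E t = E a + (E b - E a) / (b - a) * (t - a)" if ab: "a < b" and t: "a < t" "t < b" for a b t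
  proof -
    define m where "m = (E b - E a) / (b - a)"
    define l where "l t = E a + m * (t - a)" for t
    define c where "c = (b - a)^2 + 1"
    have c: "c > 0" "c ~= 0" "(b - a)^2 <= c" unfolding c_def using zero_le_power2[of "b - a"] by linarith+
    have lab: "l a = E a" "l b = E b" unfolding l_def m_def using ab by auto
    define Q where "Q s = (s - a) * (b - s)" for s
    have Q1: "0 <= Q s" "Q s <= (b - a)^2" if "a <= s" "s <= b" for s
      unfolding Q_def power2_eq_square using that by (auto intro!: mult_mono)
    have dk: "DERIV (%t. K t + l t + \<epsilon> * Q t) t :> (K1 t + m + \<epsilon> * (b + a - 2 * t))" for \<epsilon> t
      unfolding l_def Q_def by (auto intro!: derivative_eq_intros K simp: algebra_simps)
    have dk': "DERIV (%t. K1 t + m + \<epsilon> * (b + a - 2 * t)) t :> (\<Phi> t - 2 * \<epsilon>)" for \<epsilon> t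
      by (auto intro!: derivative_eq_intros K1)
    have ck: "continuous_on UNIV (%t. \<Phi> t - 2 * \<epsilon>)" for \<epsilon> by (intro continuous_intros c\<Phi>)
    have "\<not> E t - l t > 0"
    proof
      assume pos: "E t - l t > 0"
      define \<epsilon> where "\<epsilon> = (E t - l t) / (2 * c)"
      have \<epsilon>: "\<epsilon> > 0" unfolding \<epsilon>_def using pos c by simp
      have "\<epsilon> * Q t <= \<epsilon> * c" using \<epsilon> Q1[of t] t c by (intro mult_left_mono) auto
      also have "... = (E t - l t) / 2" unfolding \<epsilon>_def using c by simp
      finally have wt: "E t - l t - \<epsilon> * Q t > 0" using pos by argo
      obtain t0 where t0: "t0 \<in> {a..b}" "!!s. s \<in> {a..b} ==> E s - l s - \<epsilon> * Q s <= E t0 - l t0 - \<epsilon> * Q t0"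
        using continuous_attains_sup[of "{a..b}" "%s. E s - l s - \<epsilon> * Q s"] ab
        unfolding l_def Q_def by (force intro!: continuous_intros cE)
      have "E t0 - l t0 - \<epsilon> * Q t0 > 0" using t0(2)[of t] wt t by simp
      then have "t0 ~= a" "t0 ~= b" using lab unfolding Q_def by auto
      then have in0: "a < t0" "t0 < b" using t0(1) by auto
      \<comment> \<open>The touching function is \<open>K\<close> plus the chord plus the concave
        parabola \<open>\<epsilon> * Q\<close>; its second derivative lies strictly below
        \<open>\<Phi>\<close>.\<close>
      have "\<Phi> t0 <= \<Phi> t0 - 2 * \<epsilon>"
      proof (rule up[OF dk dk' ck, where d="min (t0 - a) (b - t0)"])
        fix s assume "\<bar>s - t0\<bar> < min (t0 - a) (b - t0)"
        then have "s \<in> {a..b}" by auto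
        from t0(2)[OF this] show "z s - (K s + l s + \<epsilon> * Q s) <= z t0 - (K t0 + l t0 + \<epsilon> * Q t0)"
          unfolding E_def by linarith
      qed (use in0 in auto)
      then show False using \<epsilon> by simp
    qed
    moreover have "\<not> E t - l t < 0"
    proof
      assume neg: "E t - l t < 0"
      define \<epsilon> where "\<epsilon> = (E t - l t) / (2 * c)"
      have \<epsilon>: "\<epsilon> < 0" unfolding \<epsilon>_def using neg c by (simp add: divide_neg_pos)
      have "\<epsilon> * c <= \<epsilon> * Q t" using \<epsilon> Q1[of t] t c by (intro mult_left_mono_neg) auto
      moreover have "\<epsilon> * c = (E t - l t) / 2" unfolding \<epsilon>_def using c by simp
      ultimately have wt: "E t - l t - \<epsilon> * Q t < 0" using neg by argo
      obtain t0 where t0: "t0 \<in> {a..b}" "!!s. s \<in> {a..b} ==> E t0 - l t0 - \<epsilon> * Q t0 <= E s - l s - \<epsilon> * Q s"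
        using continuous_attains_inf[of "{a..b}" "%s. E s - l s - \<epsilon> * Q s"] ab
        unfolding l_def Q_def by (force intro!: continuous_intros cE)
      have "E t0 - l t0 - \<epsilon> * Q t0 < 0" using t0(2)[of t] wt t by simp
      then have "t0 ~= a" "t0 ~= b" using lab unfolding Q_def by auto
      then have in0: "a < t0" "t0 < b" using t0(1) by auto
      have "\<Phi> t0 - 2 * \<epsilon> <= \<Phi> t0"
      proof (rule dn[OF dk dk' ck, where d="min (t0 - a) (b - t0)"])
        fix s assume "\<bar>s - t0\<bar> < min (t0 - a) (b - t0)"
        then have "s \<in> {a..b}" by auto
        from t0(2)[OF this] show "z t0 - (K t0 + l t0 + \<epsilon> * Q t0) <= z s - (K s + l s + \<epsilon> * Q s)"
          unfolding E_def by linarith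
      qed (use in0 in auto)
      then show False using \<epsilon> by simp
    qed
    ultimately show ?thesis unfolding l_def m_def by linarith
  qed
  have const: "p s - K1 s = p 0 - K1 0" for s
  proof -
    define a b where "a = min s 0 - 1" and "b = max s 0 + 1"
    have ab: "a < b" "a < s" "s < b" "a < 0" "0 < b" unfolding a_def b_def by auto
    have "p r - K1 r = (E b - E a) / (b - a)" if "a < r" "r < b" for r
    proof -
      have "DERIV (%t. E a + (E b - E a) / (b - a) * (t - a)) r :> 0 + (E b - E a) / (b - a) * (1 - 0)"
        by (intro DERIV_add DERIV_const DERIV_cmult DERIV_diff DERIV_ident)
      then have "DERIV (%t. E a + (E b - E a) / (b - a) * (t - a)) r :> (E b - E a) / (b - a)" by simp
      then have "DERIV E r :> (E b - E a) / (b - a)"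
        by (rule has_field_derivative_transform_within_open[where S="{a<..<b}"]) (use that lin[OF ab(1)] in auto)
      then show ?thesis using dE DERIV_unique by blast
    qed
    then show ?thesis using ab by simp
  qed
  have "p s = K1 s + (p 0 - K1 0)" for s using const[of s] by argo
  then have "p = (%s. K1 s + (p 0 - K1 0))" by (rule ext)
  moreover have "DERIV (%s. K1 s + (p 0 - K1 0)) t :> \<Phi> t + 0"
    by (intro DERIV_add K1 DERIV_const)
  ultimately show ?thesis by simp
qed

lemma wl_ln_norm:
  "wl (-{0}) (%x::'a::euclidean_space. ln (norm x)) (%x. (1 / (norm x)^2) *\<^sub>R x)
     (%x. (real DIM('a) - 2) / (norm x)^2)"
proof -
  have w: "wl (-{0}) (%x::'a. (norm (x - 0))^2) (%x. 2 *\<^sub>R (x - 0)) (%x. 2 * real DIM('a))"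
    by (rule wl_mono[OF wl_norm_square]) auto
  have pos: "(norm (x - 0))^2 > 0" if "x \<in> -{0}" for x :: 'a using that by simp
  have "wl (-{0}) (%x::'a. 1/2 * ln ((norm (x - 0))^2)) (%x. (1 / 2) *\<^sub>R ((1 / (norm (x - 0))^2) *\<^sub>R 2 *\<^sub>R (x - 0)))
     (%x. 1/2 * (1 / (norm (x - 0))^2 * (2 * real DIM('a)) + (- (1 / ((norm (x - 0))^2)^2)) * (norm (2 *\<^sub>R (x - 0)))^2))"
  proof (rule wl_cmult[OF wl_compose[OF w, where g=ln and g'="%y. 1 / y" and g''="%y. - (1 / y^2)"]])
    fix x :: 'a assume "x \<in> -{0}"
    note p = pos[OF this]
    show "DERIV ln ((norm (x - 0))^2) :> 1 / (norm (x - 0))^2"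
      using p by (auto intro!: derivative_eq_intros)
    define y where "y = (norm (x - 0))^2"
    show "DERIV (%y. 1 / y) ((norm (x - 0))^2) :> - (1 / ((norm (x - 0))^2)^2)"
      using p unfolding y_def[symmetric] by (auto intro!: derivative_eq_intros simp: power2_eq_square divide_simps)
  next
    show "continuous_on (-{0}) (%x::'a. - (1 / ((norm (x - 0))^2)^2))"
      by (intro continuous_intros) auto
  qed
  then show ?thesis
  proof (rule wl_cong)
    fix x :: 'a assume "x \<in> -{0}"
    then have n: "norm x > 0" by simp
    show "ln (norm x) = 1/2 * ln ((norm (x - 0))^2)" using n by (simp add: ln_realpow)
    show "(real DIM('a) - 2) / (norm x)^2 = 1/2 * (1 / (norm (x - 0))^2 * (2 * real DIM('a)) + (- (1 / ((norm (x - 0))^2)^2)) * (norm (2 *\<^sub>R (x - 0)))^2)"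
      using n by (simp add: power_mult_distrib field_simps power2_eq_square)
  qed auto
qed

lemma wl_function_of_ln_norm:
  assumes k: "!!t. DERIV k t :> k' t" "!!t. DERIV k' t :> k'' t" "continuous_on UNIV k''"
  shows "wl (-{0}) (%x::'a::euclidean_space. k (ln (norm x))) (%x. (k' (ln (norm x)) / (norm x)^2) *\<^sub>R x)
     (%x. (k'' (ln (norm x)) + (real DIM('a) - 2) * k' (ln (norm x))) / (norm x)^2)"
proof -
  have c: "continuous_on (-{0}) (%x::'a. k'' (ln (norm x)))"
    by (rule continuous_on_compose2[OF k(3)]) (auto intro!: continuous_intros)
  show ?thesis
  proof (rule wl_cong[OF wl_compose[OF wl_ln_norm, where g=k and g'=k' and g''=k'']])
    fix x :: 'a assume "x \<in> -{0}"
    then have n: "norm x > 0" by simp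
    have "(norm ((1 / (norm x)^2) *\<^sub>R x))^2 = 1 / (norm x)^2"
      using n by (simp add: power_mult_distrib power_divide power2_eq_square)
    then show "(k'' (ln (norm x)) + (real DIM('a) - 2) * k' (ln (norm x))) / (norm x)^2 =
      k' (ln (norm x)) * ((real DIM('a) - 2) / (norm x)^2) + k'' (ln (norm x)) * (norm ((1 / (norm x)^2) *\<^sub>R x))^2"
      by (simp add: add_divide_distrib diff_divide_distrib algebra_simps)
  qed (use k c in auto)
qed

text \<open>For a radial gradient, \<open>x \<bullet> p\<close> and |x| |p| reduce to
  \<open>P - beta q \<theta>\<close> and its modulus, so the terms free of the dimension assemble to
  \<open>f_fun\<close>. The exponent \<open>beta q \<theta>\<close> is the one for which the power
  of |x| in the absorption disappears.\<close>

lemma radial_log_lap: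
  fixes u :: "'a::euclidean_space => real"
  assumes q: "q > 1" and x: "x ~= 0" and u: "0 < u x" and p: "p = (1 / u x) *\<^sub>R V x" and \<tau>: "\<tau> < 1"
    and s: "p = ((P - beta q \<theta>) / (norm x)^2) *\<^sub>R x"
    and z: "z = ln (u x) + beta q \<theta> * ln (norm x)"
  shows "(norm x)^2 * (sol_lap q \<tau> \<rho> lam \<theta> u V x / u x - (norm p)^2)
    = exp ((q - 1) * z) - f_fun lam \<tau> \<rho> (beta q \<theta> - P) + (real DIM('a) - 2) * (P - beta q \<theta>)"
proof -
  define b where "b = beta q \<theta>"
  have n: "norm x > 0" using x by simp
  have xp: "x \<bullet> p = P - b" unfolding s b_def[symmetric] using n by (simp add: power2_norm_eq_inner[symmetric])
  have np: "(norm x * norm p)^2 = (P - b)^2"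
    unfolding s b_def[symmetric] using n by (simp add: power_mult_distrib power_divide power2_eq_square field_simps)
  have bq: "b * (q - 1) = \<theta> + 2" unfolding b_def beta_def using q by simp
  have src: "norm x powr (\<theta> + 2) * u x powr (q - 1) = exp ((q - 1) * z)"
  proof -
    have "norm x powr (\<theta> + 2) * u x powr (q - 1) = exp ((\<theta> + 2) * ln (norm x) + (q - 1) * ln (u x))"
      using n u by (simp add: powr_def exp_add)
    also have "(\<theta> + 2) * ln (norm x) + (q - 1) * ln (u x) = (q - 1) * z"
      unfolding z b_def[symmetric] bq[symmetric] by (simp add: algebra_simps)
    finally show ?thesis .
  qed
  have pw: "((P - b)^2) powr ((1 - \<tau>) / 2) = \<bar>b - P\<bar> powr (1 - \<tau>)"
  proof (cases "P = b")
    case False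
    then have p0: "\<bar>b - P\<bar> > 0" by simp
    have "(P - b)^2 = \<bar>b - P\<bar> powr 2" using p0 by (simp add: power2_commute)
    moreover have "2 * ((1 - \<tau>) / 2) = 1 - \<tau>" by simp
    ultimately show ?thesis by (simp only: powr_powr)
  qed (use \<tau> in simp)
  show ?thesis
    unfolding norm_square_log_lap[where x=x and u=u and V=V and p=p, OF x u p \<tau>] src xp np pw
    unfolding f_fun_def b_def[symmetric] by (simp add: power2_eq_square algebra_simps)
qed

text \<open>A radial \<open>C\<^sup>1\<close> weak solution is a viscosity solution of the ordinary differential equation satisfied by
  \<open>\<zeta> t = ln u + \<beta> t\<close>, where \<open>t = ln |x|\<close>, hence a classical one.\<close>

lemma solution_to_ode:
  fixes u :: "'a::euclidean_space => real"
  assumes q: "q > 1" and \<tau>: "0 <= \<tau>" "\<tau> < 1" and dim: "DIM('a) >= 2"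
    and u: "u \<in> positive_solutions q \<tau> \<rho> lam \<theta>"
  obtains z p B where "!!x. x ~= 0 ==> u x = exp (z (ln (norm x)) - beta q \<theta> * ln (norm x))"
    "!!t. DERIV z t :> p t"
    "!!t. DERIV p t :> exp ((q - 1) * z t) - f_fun lam \<tau> \<rho> (beta q \<theta> - p t)"
    "!!t. z t <= B" "!!t. \<bar>p t\<bar> <= B"
proof -
  obtain V where pos': "\<forall>x\<in>-{0}. u x > 0" and w: "wl (-{0}) u V (sol_lap q \<tau> \<rho> lam \<theta> u V)"
    using u positive_solutions_iff[OF \<tau>(2)] by blast
  have pos: "u x > 0" if "x ~= 0" for x using pos' that by auto
  obtain C1 where C1: "!!x. x ~= 0 ==> norm x * norm (V x) <= C1 * u x" "C1 > 0"
  proof -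
    obtain C where C: "C > 0" and H: "\<forall>(u :: 'a => real) V. (\<forall>x\<in>-{0}. u x > 0) --> wl (-{0}) u V (sol_lap q \<tau> \<rho> lam \<theta> u V) -->
       (\<forall>x y. x ~= 0 --> norm x = norm y --> u x <= C * u y) \<and> (\<forall>x. x ~= 0 --> norm x * norm (V x) <= C * u x)"
      using solution_harnack[OF q \<tau> dim, of \<rho> lam \<theta>] by (elim exE conjE)
    have "\<forall>x. x ~= 0 --> norm x * norm (V x) <= C * u x"
      by (rule conjunct2[OF H[rule_format, OF pos'[rule_format] w]])
    with C that[of C] show thesis by blast
  qed
  obtain C0 where C0: "!!x. x ~= 0 ==> u x powr (q - 1) * norm x powr (\<theta> + 2) <= C0"
  proof -
    obtain C where H: "\<forall>(u :: 'a => real) V x. (\<forall>x\<in>-{0}. u x > 0) --> wl (-{0}) u V (sol_lap q \<tau> \<rho> lam \<theta> u V) -->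
       x ~= 0 --> u x powr (q - 1) * norm x powr (\<theta> + 2) <= C"
      using keller_osserman[OF q \<tau>, of \<rho> lam \<theta>] by (elim exE)
    show thesis by (rule that[of C]) (rule H[rule_format, OF pos'[rule_format] w])
  qed
  have rad: "u x = u y" if "x ~= 0" "norm x = norm y" for x y
    by (rule solution_radial[OF q \<tau> dim pos w that])
  define b where "b = beta q \<theta>"
  have bq: "b * (q - 1) = \<theta> + 2" unfolding b_def beta_def using q by simp
  have bqt: "b * (q * t) = \<theta> * t + (b * t + t * 2)" for t
  proof -
    have "b * (q - 1) * t = (\<theta> + 2) * t" using bq by simp
    then show ?thesis by (simp add: algebra_simps)
  qed
  define v where "v x = ln (u x)" for x
  define P where "P x = (1 / u x) *\<^sub>R V x" for x
  define F where "F x = sol_lap q \<tau> \<rho> lam \<theta> u V x / u x - (norm (P x))^2" for x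
  have wv: "wl (-{0}) v P F"
    unfolding v_def P_def F_def by (rule wl_ln[OF w]) (use pos in auto)
  obtain e :: 'a where e: "norm e = 1" using norm_Basis nonempty_Basis by blast
  have ee: "e \<bullet> e = 1" using e by (simp add: norm_eq_1)
  define z where "z t = v (exp t *\<^sub>R e) + b * t" for t
  define p where "p t = (exp t *\<^sub>R e) \<bullet> P (exp t *\<^sub>R e) + b" for t
  have ne: "norm (exp t *\<^sub>R e) = exp t" "exp t *\<^sub>R e ~= 0" for t using e by auto
  have vz: "v x = z (ln (norm x)) - b * ln (norm x)" if "x ~= 0" for x
  proof -
    have "u x = u (exp (ln (norm x)) *\<^sub>R e)" by (rule rad[OF that]) (use that ne in simp)
    then show ?thesis unfolding z_def v_def by simp
  qed
  have dz: "DERIV z t :> p t" for t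
  proof -
    have "(v has_derivative (%h. h \<bullet> P (exp t *\<^sub>R e))) (at (exp t *\<^sub>R e))"
      using wlD(2)[OF wv, of "exp t *\<^sub>R e"] ne by (simp add: gderiv_def)
    moreover have "((%t. exp t *\<^sub>R e) has_derivative (%h. (h * exp t) *\<^sub>R e)) (at t)"
      by (auto intro!: derivative_eq_intros)
    ultimately have "((%t. v (exp t *\<^sub>R e)) has_derivative (%h. ((h * exp t) *\<^sub>R e) \<bullet> P (exp t *\<^sub>R e))) (at t)"
      by (rule has_derivative_compose[rotated])
    moreover have "(%h. ((h * exp t) *\<^sub>R e) \<bullet> P (exp t *\<^sub>R e)) = (*) ((exp t *\<^sub>R e) \<bullet> P (exp t *\<^sub>R e))"
      by (auto simp: fun_eq_iff)
    ultimately have "DERIV (%t. v (exp t *\<^sub>R e)) t :> (exp t *\<^sub>R e) \<bullet> P (exp t *\<^sub>R e)"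
      unfolding has_field_derivative_def by (simp only:)
    then show ?thesis unfolding z_def p_def by (auto intro!: derivative_eq_intros)
  qed
  \<comment> \<open>By radial symmetry every point is a maximum on its sphere, so the gradient has
    no tangential part.\<close>
  have Prad: "P x = ((p (ln (norm x)) - b) / (norm x)^2) *\<^sub>R x" if x: "x = exp t *\<^sub>R e" for x t
  proof -
    have x0: "x ~= 0" "norm x = exp t" using ne x by auto
    define c where "c = (P x \<bullet> x) / (norm x)^2"
    define T where "T = P x - c *\<^sub>R x"
    have xx: "x \<bullet> x = (norm x)^2" by (simp add: power2_norm_eq_inner)
    have Tx: "T \<bullet> x = 0" unfolding T_def c_def using x0 by (simp add: inner_diff_left xx)
    have "P x \<bullet> T = 0"
    proof (rule sphere_max_tangential[OF _ x0(1) _ Tx])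
      show "GDERIV v x :> P x" using wlD(2)[OF wv] x0 by simp
      show "v y <= v x" if "norm y = norm x" for y using rad[of x y] x0 that unfolding v_def by simp
    qed
    then have "T \<bullet> T = 0" using Tx unfolding T_def[of] by (simp add: inner_diff_left inner_diff_right inner_commute)
    then have "P x = c *\<^sub>R x" unfolding T_def by simp
    moreover have "P x \<bullet> x = p (ln (norm x)) - b" unfolding p_def x0(2) using x by (simp add: inner_commute)
    ultimately show ?thesis unfolding c_def by simp
  qed
  define \<Phi> where "\<Phi> t = exp ((q - 1) * z t) - f_fun lam \<tau> \<rho> (b - p t)" for t
  have lapF: "exp t * exp t * F (exp t *\<^sub>R e) = \<Phi> t + (real DIM('a) - 2) * (p t - b)" for t
  proof -
    define x where "x = exp t *\<^sub>R e"
    have x0: "x ~= 0" "norm x = exp t" using ne x_def by auto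
    have "(norm x)^2 * (sol_lap q \<tau> \<rho> lam \<theta> u V x / u x - (norm (P x))^2)
      = exp ((q - 1) * z t) - f_fun lam \<tau> \<rho> (beta q \<theta> - p t) + (real DIM('a) - 2) * (p t - beta q \<theta>)"
    proof (rule radial_log_lap[where x=x and u=u and V=V and p="P x", OF q x0(1) pos[OF x0(1)] P_def \<tau>(2)])
      show "P x = ((p t - beta q \<theta>) / (norm x)^2) *\<^sub>R x" using Prad[OF x_def] x0 unfolding b_def by simp
      show "z t = ln (u x) + beta q \<theta> * ln (norm x)" unfolding z_def v_def x_def[symmetric] b_def x0(2) by simp
    qed
    then show ?thesis unfolding F_def \<Phi>_def b_def x_def[symmetric] x0(2) by (simp add: power2_eq_square)
  qed
  have cp: "continuous_on UNIV p"
    unfolding p_def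
    by (intro continuous_intros continuous_on_compose2[OF wlD(3)[OF wv]]) (use ne in auto)
  have cz: "continuous_on UNIV z" by (intro continuous_at_imp_continuous_on ballI DERIV_isCont[OF dz])
  have c\<Phi>: "continuous_on UNIV \<Phi>"
  proof -
    have "continuous_on UNIV (%t. \<bar>b - p t\<bar> powr (1 - \<tau>))"
      using \<tau> by (intro continuous_on_powr' continuous_intros cp) auto
    then show ?thesis unfolding \<Phi>_def f_fun_def
      by (intro continuous_on_diff continuous_on_add continuous_on_mult continuous_on_exp continuous_on_const cz cp)
  qed
  \<comment> \<open>\<open>\<sigma>\<close> treats touching from above and from below together. At
    the touching point the slopes agree, so the first-order terms carrying the dimension
    cancel.\<close>
  have vis: "\<sigma> * (\<Phi> t0 - k'' t0) <= 0"
    if k: "!!t. DERIV k t :> k' t" "!!t. DERIV k' t :> k'' t" "continuous_on UNIV k''"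
      and d: "d > 0" and mx: "!!t. \<bar>t - t0\<bar> < d ==> \<sigma> * (z t - k t) <= \<sigma> * (z t0 - k t0)" and \<sigma>: "\<sigma> = 1 \<or> \<sigma> = -1"
    for k k' k'' t0 d \<sigma>
  proof -
    define x0 where "x0 = exp t0 *\<^sub>R e"
    have x0: "x0 ~= 0" "norm x0 = exp t0" using ne x0_def by auto
    have kt: "DERIV (%t. k t - b * t) t :> (k' t - b)" for t
      by (auto intro!: derivative_eq_intros k)
    have kt': "DERIV (%t. k' t - b) t :> k'' t" for t
      by (auto intro!: derivative_eq_intros k)
    note wk = wl_function_of_ln_norm[OF kt kt' k(3), where ?'a='a]
    note wH = wl_cmult[OF wl_diff[OF wv wk], of \<sigma>]
    obtain r where r: "r > 0" "!!x. dist x x0 < r ==> x ~= 0 \<and> \<bar>ln (norm x) - t0\<bar> < d"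
    proof -
      have "((%x. ln (norm x)) \<longlongrightarrow> ln (norm x0)) (at x0)" using x0 by (intro tendsto_intros) auto
      then have "eventually (%x. dist (ln (norm x)) t0 < d) (at x0)" using d x0 by (auto dest: tendstoD)
      then obtain r1 where r1: "r1 > 0" "!!x. x ~= x0 ==> dist x x0 < r1 ==> dist (ln (norm x)) t0 < d"
        unfolding eventually_at by auto
      show thesis
      proof (rule that[of "min r1 (norm x0)"])
        show "min r1 (norm x0) > 0" using r1 x0 by simp
        fix x assume "dist x x0 < min r1 (norm x0)"
        then show "x ~= 0 \<and> \<bar>ln (norm x) - t0\<bar> < d"
          using r1(2)[of x] x0 d by (cases "x = x0") (auto simp: dist_real_def)
      qed
    qed
    have mxx: "\<sigma> * (v x - (k (ln (norm x)) - b * ln (norm x))) <= \<sigma> * (v x0 - (k (ln (norm x0)) - b * ln (norm x0)))"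
      if "x \<in> ball x0 r" for x
    proof -
      have x: "x ~= 0" "\<bar>ln (norm x) - t0\<bar> < d" using r(2)[of x] that by (auto simp: dist_commute)
      from mx[OF x(2)] show ?thesis unfolding vz[OF x(1)] vz[OF x0(1)] using x0 by simp
    qed
    have "\<sigma> * (F x0 - (k'' (ln (norm x0)) + (real DIM('a) - 2) * (k' (ln (norm x0)) - b)) / (norm x0)^2) <= 0"
      by (rule wl_local_max[OF wH _ r(1) mxx]) (use x0 in auto)
    then have "\<sigma> * ((exp t0 * exp t0) * (F x0 - (k'' t0 + (real DIM('a) - 2) * (k' t0 - b)) / (exp t0 * exp t0))) <= 0"
      unfolding x0(2) using \<sigma> by (auto simp: power2_eq_square mult_le_0_iff)
    then have ineq: "\<sigma> * (\<Phi> t0 + (real DIM('a) - 2) * (p t0 - b) - (k'' t0 + (real DIM('a) - 2) * (k' t0 - b))) <= 0"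
      using lapF[of t0] unfolding x0_def[symmetric] by (simp add: right_diff_distrib)
    have "DERIV (%t. \<sigma> * (z t - k t)) t0 :> \<sigma> * (p t0 - k' t0)"
      by (intro DERIV_cmult DERIV_diff dz k)
    then have "\<sigma> * (p t0 - k' t0) = 0"
      by (rule DERIV_local_max[OF _ d]) (use mx in \<open>auto simp: abs_minus_commute\<close>)
    then have "p t0 = k' t0" using \<sigma> by auto
    then show ?thesis using ineq \<sigma> by auto
  qed
  have up: "\<Phi> t0 <= k'' t0"
    if k: "!!t. DERIV k t :> k' t" "!!t. DERIV k' t :> k'' t" "continuous_on UNIV k''" "d > 0"
      and mx: "!!t. \<bar>t - t0\<bar> < d ==> z t - k t <= z t0 - k t0" for k k' k'' t0 d
  proof -
    have "1 * (\<Phi> t0 - k'' t0) <= 0"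
    proof (rule vis[OF k])
      show "1 * (z t - k t) <= 1 * (z t0 - k t0)" if "\<bar>t - t0\<bar> < d" for t using mx[OF that] by simp
    qed simp
    then show ?thesis by simp
  qed
  have dn: "k'' t0 <= \<Phi> t0"
    if k: "!!t. DERIV k t :> k' t" "!!t. DERIV k' t :> k'' t" "continuous_on UNIV k''" "d > 0"
      and mx: "!!t. \<bar>t - t0\<bar> < d ==> z t0 - k t0 <= z t - k t" for k k' k'' t0 d
  proof -
    have "(-1) * (\<Phi> t0 - k'' t0) <= 0"
    proof (rule vis[OF k])
      show "(-1) * (z t - k t) <= (-1) * (z t0 - k t0)" if "\<bar>t - t0\<bar> < d" for t using mx[OF that] by simp
    qed simp
    then show ?thesis by simp
  qed
  have dp: "DERIV p t :> \<Phi> t" for t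
    by (rule viscosity_imp_C2[where z=z and p=p and \<Phi>=\<Phi>, OF dz c\<Phi>], rule up, assumption+, rule dn, assumption+)
  define B where "B = max (\<bar>ln (max C0 1)\<bar> / (q - 1)) (C1 + \<bar>b\<bar>)"
  show thesis
  proof (rule that[of z p B])
    show "u x = exp (z (ln (norm x)) - beta q \<theta> * ln (norm x))" if "x ~= 0" for x
      using vz[OF that] pos[OF that] unfolding v_def b_def by (metis exp_ln)
    show "DERIV p t :> exp ((q - 1) * z t) - f_fun lam \<tau> \<rho> (beta q \<theta> - p t)" for t
      using dp[of t] unfolding \<Phi>_def b_def .
    show "\<bar>p t\<bar> <= B" for t
    proof -
      have "\<bar>(exp t *\<^sub>R e) \<bullet> P (exp t *\<^sub>R e)\<bar> <= norm (exp t *\<^sub>R e) * norm (P (exp t *\<^sub>R e))" by (rule Cauchy_Schwarz_ineq2)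
      also have "... <= C1"
        using C1(1)[OF ne(2)[of t]] pos[OF ne(2)[of t]] unfolding P_def by (simp add: field_simps)
      finally show ?thesis unfolding p_def B_def by linarith
    qed
    show "z t <= B" for t
    proof -
      have "exp ((q - 1) * z t) = u (exp t *\<^sub>R e) powr (q - 1) * exp t powr (\<theta> + 2)"
        unfolding z_def v_def using pos[OF ne(2)[of t]] bqt[of t] by (simp add: powr_def exp_add[symmetric] algebra_simps)
      also have "... <= C0" using C0[OF ne(2)[of t]] ne(1)[of t] by simp
      finally have "exp ((q - 1) * z t) <= max C0 1" by simp
      then have "(q - 1) * z t <= ln (max C0 1)" by (subst ln_ge_iff) auto
      then have "z t <= ln (max C0 1) / (q - 1)" using q by (simp add: field_simps)
      also have "... <= \<bar>ln (max C0 1)\<bar> / (q - 1)" using q by (intro divide_right_mono) auto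
      finally show ?thesis unfolding B_def by simp
    qed
  qed (rule dz)
qed

lemma ode_to_solution:
  assumes q: "q > 1" and \<tau>: "\<tau> < 1"
    and dz: "!!t. DERIV z t :> p t"
    and dp: "!!t. DERIV p t :> exp ((q - 1) * z t) - f_fun lam \<tau> \<rho> (beta q \<theta> - p t)"
  shows "restrict (%x::'a::euclidean_space. exp (z (ln (norm x)) - beta q \<theta> * ln (norm x))) (-{0}) \<in> positive_solutions q \<tau> \<rho> lam \<theta>"
proof -
  define b where "b = beta q \<theta>"
  define \<Phi> where "\<Phi> t = exp ((q - 1) * z t) - f_fun lam \<tau> \<rho> (b - p t)" for t
  define u where "u = restrict (%x::'a. exp (z (ln (norm x)) - b * ln (norm x))) (-{0})"
  have u: "u x = exp (z (ln (norm x)) - b * ln (norm x))" if "x ~= 0" for x using that unfolding u_def by simp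
  have cz: "continuous_on UNIV z" by (intro continuous_at_imp_continuous_on ballI DERIV_isCont[OF dz])
  have cp: "continuous_on UNIV p" by (intro continuous_at_imp_continuous_on ballI DERIV_isCont[OF dp])
  have c\<Phi>: "continuous_on UNIV \<Phi>"
  proof -
    have "continuous_on UNIV (%t. \<bar>b - p t\<bar> powr (1 - \<tau>))"
      using \<tau> by (intro continuous_on_powr' continuous_intros cp) auto
    then show ?thesis unfolding \<Phi>_def f_fun_def
      by (intro continuous_on_diff continuous_on_add continuous_on_mult continuous_on_exp continuous_on_const cz cp)
  qed
  have d1: "DERIV (%t. z t - b * t) t :> (p t - b)" for t
    by (auto intro!: derivative_eq_intros dz)
  have d2: "DERIV (%t. p t - b) t :> \<Phi> t" for t
    using dp[of t] unfolding \<Phi>_def b_def by (auto intro!: derivative_eq_intros)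
  note wv = wl_function_of_ln_norm[OF d1 d2 c\<Phi>, where ?'a='a]
  define P where "P x = ((p (ln (norm x)) - b) / (norm x)^2) *\<^sub>R x" for x :: 'a
  define V where "V x = u x *\<^sub>R P x" for x
  have "wl (-{0}) (%x. exp (z (ln (norm x)) - b * ln (norm x))) (%x. exp (z (ln (norm x)) - b * ln (norm x)) *\<^sub>R P x)
    (%x. exp (z (ln (norm x)) - b * ln (norm x)) * ((\<Phi> (ln (norm x)) + (real DIM('a) - 2) * (p (ln (norm x)) - b)) / (norm x)^2)
      + exp (z (ln (norm x)) - b * ln (norm x)) * (norm (P x))^2)"
    unfolding P_def
    by (rule wl_compose[OF wv, where g=exp and g'=exp and g''=exp])
      (auto intro!: derivative_eq_intros continuous_on_exp wl_cont[OF wv])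
  then have "wl (-{0}) u V (sol_lap q \<tau> \<rho> lam \<theta> u V)"
  proof (rule wl_cong)
    fix x :: 'a assume "x \<in> -{0}"
    then have x: "x ~= 0" by simp
    then have n: "norm x > 0" by simp
    show ux: "u x = exp (z (ln (norm x)) - b * ln (norm x))" by (rule u[OF x])
    show "V x = exp (z (ln (norm x)) - b * ln (norm x)) *\<^sub>R P x" unfolding V_def ux ..
    have up: "u x > 0" unfolding ux by simp
    have "P x = (1 / u x) *\<^sub>R V x" unfolding V_def using up by simp
    then have "(norm x)^2 * (sol_lap q \<tau> \<rho> lam \<theta> u V x / u x - (norm (P x))^2)
      = exp ((q - 1) * z (ln (norm x))) - f_fun lam \<tau> \<rho> (beta q \<theta> - p (ln (norm x))) + (real DIM('a) - 2) * (p (ln (norm x)) - beta q \<theta>)"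
      by (rule radial_log_lap[where x=x and u=u and V=V and p="P x", OF q x up _ \<tau>]) (use P_def b_def ux in simp_all)
    then have "sol_lap q \<tau> \<rho> lam \<theta> u V x / u x - (norm (P x))^2 = (\<Phi> (ln (norm x)) + (real DIM('a) - 2) * (p (ln (norm x)) - b)) / (norm x)^2"
      unfolding \<Phi>_def b_def[symmetric] using n by (simp add: field_simps)
    then show "sol_lap q \<tau> \<rho> lam \<theta> u V x = exp (z (ln (norm x)) - b * ln (norm x)) * ((\<Phi> (ln (norm x)) + (real DIM('a) - 2) * (p (ln (norm x)) - b)) / (norm x)^2)
      + exp (z (ln (norm x)) - b * ln (norm x)) * (norm (P x))^2"
      unfolding ux[symmetric] using up by (simp add: field_simps)
  qed
  then have "u \<in> positive_solutions q \<tau> \<rho> lam \<theta>"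
    unfolding positive_solutions_iff[OF \<tau>] using u unfolding u_def by auto
  then show ?thesis unfolding u_def b_def .
qed

section \<open>Compactness and existence for ordinary differential equations\<close>

text \<open>Covers Euler polygons (step functions with mesh \<open>h\<close>) as well as exact solutions (\<open>h = 0\<close>).\<close>

definition approx_sol :: "('a::euclidean_space => 'a) => real => real => (real => 'a) => bool" where
  "approx_sol H M h X \<longleftrightarrow> (\<forall>s t v \<epsilon>. s <= t --> norm v <= M --> 0 <= \<epsilon> -->
     (\<forall>r\<in>{s - h..t}. norm (H (X r) - v) <= \<epsilon>) --> norm (X t - X s - (t - s) *\<^sub>R v) <= \<epsilon> * (t - s + h) + M * h)"

lemma approx_solD:
  assumes "approx_sol H M h X" "s <= t" "norm v <= M" "0 <= \<epsilon>" "!!r. s - h <= r ==> r <= t ==> norm (H (X r) - v) <= \<epsilon>"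
  shows "norm (X t - X s - (t - s) *\<^sub>R v) <= \<epsilon> * (t - s + h) + M * h"
  using assms unfolding approx_sol_def by auto

lemma approx_sol_lipschitz:
  assumes a: "approx_sol H M h X" and M: "!!x. norm (H x) <= M" and h: "0 <= h"
  shows "norm (X t - X s) <= M * \<bar>t - s\<bar> + 2 * M * h"
proof -
  have M0: "M >= 0" using M norm_ge_zero order_trans by blast
  have le: "norm (X t - X s) <= M * (t - s) + 2 * M * h" if "s <= t" for s t
    using approx_solD[OF a that, of 0 M] M M0 by (simp add: algebra_simps)
  show ?thesis
    using le[of s t] le[of t s] by (cases "s <= t") (auto simp: norm_minus_commute)
qed

text \<open>A subsequence converges on the rationals, and everywhere by equicontinuity up to the
  vanishing error 2 M h. The defining inequality of \<open>approx_sol\<close> survives pointwise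
  limits and yields the derivative.\<close>

lemma ode_compactness:
  fixes H :: "'a::euclidean_space => 'a"
  assumes cH: "continuous_on UNIV H" and M: "!!x. norm (H x) <= M"
    and a: "!!n. approx_sol H M (h n) (X n)" and h: "!!n. 0 <= h n" "!!n. h n <= 1" "h \<longlonglongrightarrow> 0"
    and X0: "!!n. norm (X n 0) <= M0"
  obtains k Y where "strict_mono (k :: nat => nat)" "!!t. (%n. X (k n) t) \<longlonglongrightarrow> Y t"
    "!!t. (Y has_vector_derivative H (Y t)) (at t)"
proof -
  have Mn: "M >= 0" using M norm_ge_zero order_trans by blast
  have M0: "M0 >= 0" using X0 norm_ge_zero order_trans by blast
  have lip: "norm (X n t - X n s) <= M * \<bar>t - s\<bar> + 2 * M * h n" for n s t
    by (rule approx_sol_lipschitz[OF a M h(1)])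
  \<comment> \<open>The functions grow at most linearly in \<open>t\<close>; dividing by
    \<open>1 + \<bar>t\<bar>\<close> gives the bound uniform in \<open>t\<close> that the selection
    theorem requires.\<close>
  let ?f = "%n t. (1 / (1 + \<bar>t\<bar>)) *\<^sub>R X n t"
  have bnd: "norm (?f n t) <= M0 + 2 * M" for n t
  proof -
    have "norm (X n t) <= norm (X n 0) + norm (X n t - X n 0)" using norm_triangle_ineq[of "X n 0" "X n t - X n 0"] by simp
    also have "... <= M0 + (M * \<bar>t\<bar> + 2 * M * h n)" using X0[of n] lip[of n t 0] by simp
    also have "2 * M * h n <= 2 * M * 1" using h(2)[of n] Mn by (intro mult_left_mono) auto
    finally have 1: "norm (X n t) <= M0 + 2 * M + M * \<bar>t\<bar>" by simp
    also have "... <= (M0 + 2 * M) * (1 + \<bar>t\<bar>)" using M0 Mn mult_nonneg_nonneg[of M0 "\<bar>t\<bar>"] mult_nonneg_nonneg[of M "\<bar>t\<bar>"] by (simp add: algebra_simps)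
    finally show ?thesis by (simp add: divide_le_eq)
  qed
  obtain k where k: "strict_mono (k :: nat => nat)" "!!t. t \<in> \<rat> ==> \<exists>l. (%n. ?f (k n) t) \<longlonglongrightarrow> l"
    by (rule function_convergent_subsequence[OF countable_rat, where f="?f" and M="M0 + 2 * M"]) (use bnd in auto)
  have hk: "(%n. h (k n)) \<longlonglongrightarrow> 0" using LIMSEQ_subseq_LIMSEQ[OF h(3) k(1)] by (simp add: o_def)
  have convQ: "convergent (%n. X (k n) t)" if tQ: "t \<in> \<rat>" for t
  proof -
    obtain l where "(%n. ?f (k n) t) \<longlonglongrightarrow> l" using k(2)[OF tQ] by blast
    then have "(%n. (1 + \<bar>t\<bar>) *\<^sub>R ?f (k n) t) \<longlonglongrightarrow> (1 + \<bar>t\<bar>) *\<^sub>R l" by (intro tendsto_intros)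
    moreover have "1 + \<bar>t\<bar> ~= 0" by linarith
    then have "(1 + \<bar>t\<bar>) *\<^sub>R ?f (k n) t = X (k n) t" for n by simp
    ultimately show ?thesis unfolding convergent_def by auto
  qed
  have conv: "convergent (%n. X (k n) t)" for t
  proof -
    have "Cauchy (%n. X (k n) t)"
    proof (rule CauchyI)
      fix e :: real assume e: "e > 0"
      define \<delta> where "\<delta> = e / (8 * (M + 1))"
      have \<delta>: "\<delta> > 0" "M * \<delta> <= e / 8" unfolding \<delta>_def using e Mn by (auto simp: field_simps)
      obtain r where r: "r \<in> \<rat>" "t < r" "r < t + \<delta>" using Rats_dense_in_real[of t "t + \<delta>"] \<delta> by auto
      have "Cauchy (%n. X (k n) r)" using convQ[OF r(1)] by (rule convergent_Cauchy)
      then obtain N1 where N1: "!!m n. m >= N1 ==> n >= N1 ==> norm (X (k m) r - X (k n) r) < e / 4"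
        using CauchyD[of _ "e / 4"] e by (metis zero_less_divide_iff zero_less_numeral)
      have "eventually (%n. h (k n) < \<delta>) sequentially" using hk \<delta> by (auto dest: order_tendstoD(2))
      then obtain N2 where N2: "!!n. n >= N2 ==> h (k n) < \<delta>" unfolding eventually_sequentially by blast
      have near: "norm (X (k n) t - X (k n) r) <= 3 * e / 8" if "n >= N2" for n
      proof -
        have "norm (X (k n) t - X (k n) r) <= M * \<bar>t - r\<bar> + 2 * M * h (k n)" by (rule lip)
        also have "... <= M * \<delta> + 2 * (M * \<delta>)"
          using r N2[OF that] Mn by (intro add_mono) (auto intro!: mult_left_mono)
        also have "... <= 3 * e / 8" using \<delta> by linarith
        finally show ?thesis .
      qed
      show "\<exists>N. \<forall>m\<ge>N. \<forall>n\<ge>N. norm (X (k m) t - X (k n) t) < e"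
      proof (intro exI[of _ "max N1 N2"] allI impI)
        fix m n assume mn: "m >= max N1 N2" "n >= max N1 N2"
        have "norm (X (k m) t - X (k n) t) <= norm (X (k m) t - X (k m) r) + norm (X (k m) r - X (k n) r) + norm (X (k n) r - X (k n) t)"
          using norm_triangle_ineq[of "X (k m) t - X (k m) r" "X (k m) r - X (k n) r"]
            norm_triangle_ineq[of "X (k m) t - X (k n) r" "X (k n) r - X (k n) t"] by simp
        then show "norm (X (k m) t - X (k n) t) < e"
          using near[of m] near[of n] N1[of m n] mn by (simp add: norm_minus_commute)
      qed
    qed
    then show ?thesis by (rule Cauchy_convergent)
  qed
  define Y where "Y t = lim (%n. X (k n) t)" for t
  have Y: "(%n. X (k n) t) \<longlonglongrightarrow> Y t" for t
    unfolding Y_def using conv[of t] by (simp add: convergent_LIMSEQ_iff)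
  have der: "(Y has_vector_derivative H (Y t)) (at t)" for t
  proof -
    define v where "v = H (Y t)"
    have v: "norm v <= M" unfolding v_def by (rule M)
    have est: "\<exists>d>0. \<forall>s. \<bar>s - t\<bar> < d --> norm (Y s - Y t - (s - t) *\<^sub>R v) <= \<epsilon> * \<bar>s - t\<bar>" if \<epsilon>: "\<epsilon> > 0" for \<epsilon>
    proof -
      have "isCont H (Y t)" using cH by (simp add: continuous_on_eq_continuous_at)
      then obtain \<delta> where \<delta>: "\<delta> > 0" "!!y. dist y (Y t) < \<delta> ==> dist (H y) (H (Y t)) < \<epsilon>"
        unfolding continuous_at_eps_delta using \<epsilon> by blast
      define \<eta> where "\<eta> = \<delta> / (8 * (M + 1))"
      have \<eta>: "\<eta> > 0" "M * \<eta> <= \<delta> / 8" unfolding \<eta>_def using \<delta> Mn by (auto simp: field_simps)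
      show ?thesis
      proof (intro exI[of _ \<eta>] conjI allI impI)
        show "\<eta> > 0" by (rule \<eta>)
        fix s assume s: "\<bar>s - t\<bar> < \<eta>"
        define lo hi where "lo = min s t" and "hi = max s t"
        have lohi: "lo <= hi" "hi - lo = \<bar>s - t\<bar>" unfolding lo_def hi_def by auto
        have ev1: "eventually (%n. h (k n) < \<eta>) sequentially" using hk \<eta> by (auto dest: order_tendstoD(2))
        have ev2: "eventually (%n. dist (X (k n) t) (Y t) < \<delta> / 4) sequentially"
          using tendstoD[OF Y[of t], of "\<delta> / 4"] \<delta> by simp
        have ev: "eventually (%n. norm (X (k n) hi - X (k n) lo - (hi - lo) *\<^sub>R v) <= \<epsilon> * (hi - lo + h (k n)) + M * h (k n)) sequentially"
          using ev1 ev2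
        proof eventually_elim
          case (elim n)
          show ?case
          proof (rule approx_solD[OF a lohi(1) v])
            fix r assume r: "lo - h (k n) <= r" "r <= hi"
            have "\<bar>r - t\<bar> <= 2 * \<eta>" using r s elim(1) unfolding lo_def hi_def by (auto simp: min_def max_def split: if_splits)
            then have "M * \<bar>r - t\<bar> <= M * (2 * \<eta>)" using Mn by (intro mult_left_mono)
            moreover have "2 * M * h (k n) <= 2 * M * \<eta>" using elim(1) Mn by (intro mult_left_mono) auto
            ultimately have "norm (X (k n) r - X (k n) t) <= 4 * (M * \<eta>)" using lip[of "k n" r t] by linarith
            then have "dist (X (k n) r) (X (k n) t) <= \<delta> / 2" using \<eta> by (simp add: dist_norm)
            then have "dist (X (k n) r) (Y t) < \<delta>" using elim(2) \<delta>(1) dist_triangle[of "X (k n) r" "Y t" "X (k n) t"] by linarith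
            from \<delta>(2)[OF this] show "norm (H (X (k n) r) - v) <= \<epsilon>" unfolding v_def by (simp add: dist_norm)
          qed (use \<epsilon> in simp)
        qed
        have l1: "(%n. norm (X (k n) hi - X (k n) lo - (hi - lo) *\<^sub>R v)) \<longlonglongrightarrow> norm (Y hi - Y lo - (hi - lo) *\<^sub>R v)"
          by (intro tendsto_intros Y)
        have l2: "(%n. \<epsilon> * (hi - lo + h (k n)) + M * h (k n)) \<longlonglongrightarrow> \<epsilon> * (hi - lo + 0) + M * 0"
          by (intro tendsto_intros hk)
        have "norm (Y hi - Y lo - (hi - lo) *\<^sub>R v) <= \<epsilon> * (hi - lo + 0) + M * 0"
          by (rule tendsto_le[OF sequentially_bot l2 l1 ev])
        then have "norm (Y hi - Y lo - (hi - lo) *\<^sub>R v) <= \<epsilon> * \<bar>s - t\<bar>" using lohi by simp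
        moreover have "norm (Y hi - Y lo - (hi - lo) *\<^sub>R v) = norm (Y s - Y t - (s - t) *\<^sub>R v)"
        proof (cases "s <= t")
          case True
          have "Y hi - Y lo - (hi - lo) *\<^sub>R v = - (Y s - Y t - (s - t) *\<^sub>R v)"
            unfolding lo_def hi_def using True by (simp add: algebra_simps)
          then show ?thesis by (metis norm_minus_cancel)
        qed (simp add: lo_def hi_def)
        ultimately show "norm (Y s - Y t - (s - t) *\<^sub>R v) <= \<epsilon> * \<bar>s - t\<bar>" by simp
      qed
    qed
    show ?thesis unfolding has_vector_derivative_def has_derivative_at_alt v_def[symmetric]
    proof (intro conjI allI impI)
      show "bounded_linear (%x. x *\<^sub>R v)" by (rule bounded_linear_scaleR_left)
      fix e :: real assume "0 < e"
      from est[OF this] show "\<exists>d>0. \<forall>y. norm (y - t) < d --> norm (Y y - Y t - (y - t) *\<^sub>R v) <= e * norm (y - t)" by simp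
    qed
  qed
  show thesis using that k(1) Y der by blast
qed

lemma exact_approx_sol:
  fixes X :: "real => 'a::euclidean_space"
  assumes "!!t. (X has_vector_derivative H (X t)) (at t)"
  shows "approx_sol H M 0 X"
  unfolding approx_sol_def
proof (intro allI impI)
  fix s t :: real and v :: 'a and \<epsilon> :: real
  assume st: "s <= t" and \<epsilon>: "0 <= \<epsilon>" and b: "\<forall>r\<in>{s - 0..t}. norm (H (X r) - v) <= \<epsilon>"
  have "norm ((X t - t *\<^sub>R v) - (X s - s *\<^sub>R v)) <= \<epsilon> * norm (t - s)"
  proof (rule differentiable_bound[where S="{s..t}" and f'="%r h. h *\<^sub>R (H (X r) - v)"])
    fix r assume r: "r \<in> {s..t}"
    have "((%r. r *\<^sub>R v) has_vector_derivative v) (at r)"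
      unfolding has_vector_derivative_def by (rule bounded_linear_imp_has_derivative[OF bounded_linear_scaleR_left])
    from has_vector_derivative_at_within[OF has_vector_derivative_diff[OF assms this]]
    have "((%r. X r - r *\<^sub>R v) has_vector_derivative H (X r) - v) (at r within {s..t})" .
    then show "((%r. X r - r *\<^sub>R v) has_derivative (%h. h *\<^sub>R (H (X r) - v))) (at r within {s..t})"
      by (simp add: has_vector_derivative_def)
    show "onorm (%h. h *\<^sub>R (H (X r) - v)) <= \<epsilon>"
      by (rule onorm_bound) (use b r \<epsilon> in \<open>auto simp: mult.commute[of \<epsilon>] intro!: mult_left_mono\<close>)
  qed (use st in auto)
  then show "norm (X t - X s - (t - s) *\<^sub>R v) <= \<epsilon> * (t - s + 0) + M * 0"
    using st by (simp add: algebra_simps)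
qed

fun euler_fwd :: "('a::real_vector => 'a) => real => 'a => nat => 'a" where
  "euler_fwd H h x 0 = x"
| "euler_fwd H h x (Suc k) = euler_fwd H h x k + h *\<^sub>R H (euler_fwd H h x k)"

text \<open>Integer indices let one step function cover both time directions, so
  \<open>peano\<close> yields solutions on the whole line at once.\<close>

definition euler :: "('a::real_vector => 'a) => real => 'a => int => 'a" where
  "euler H h x k = (if 0 <= k then euler_fwd H h x (nat k) else euler_fwd H (- h) x (nat (- k)))"

text \<open>Left of zero the scheme runs backwards, so there the increment uses the slope at the
  right end of the step.\<close>

lemma euler_step:
  "euler H h x (k + 1) - euler H h x k = h *\<^sub>R H (euler H h x k) \<or>
   euler H h x (k + 1) - euler H h x k = h *\<^sub>R H (euler H h x (k + 1))"
proof (cases "0 <= k")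
  case True
  then have "nat (k + 1) = Suc (nat k)" by simp
  then show ?thesis using True by (simp add: euler_def)
next
  case False
  then have e: "nat (- k) = Suc (nat (- (k + 1)))" by simp
  have "euler H h x k = euler H h x (k + 1) + (- h) *\<^sub>R H (euler H h x (k + 1))"
  proof (cases "k = -1")
    case True then show ?thesis by (simp add: euler_def)
  next
    case F: False
    then have "\<not> 0 <= k + 1" using False by simp
    then show ?thesis using False by (simp add: euler_def e)
  qed
  then show ?thesis by simp
qed

lemma euler_approx_sol:
  fixes H :: "'a::euclidean_space => 'a"
  assumes h: "h > 0"
  shows "approx_sol H M h (%t. euler H h x \<lfloor>t / h\<rfloor>)"
  unfolding approx_sol_def
proof (intro allI impI)
  fix s t :: real and v :: 'a and \<epsilon> :: real
  let ?e = "euler H h x"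
  assume st: "s <= t" and v: "norm v <= M" and \<epsilon>: "0 <= \<epsilon>"
    and b: "\<forall>r\<in>{s - h..t}. norm (H (?e \<lfloor>r / h\<rfloor>) - v) <= \<epsilon>"
  define i j where "i = \<lfloor>s / h\<rfloor>" and "j = \<lfloor>t / h\<rfloor>"
  have ij: "i <= j" unfolding i_def j_def using st h by (intro floor_mono divide_right_mono) auto
  \<comment> \<open>The grid point below \<open>s\<close> may precede \<open>s\<close> by up to
    \<open>h\<close>, which is why the interval in \<open>approx_sol\<close> starts at
    \<open>s - h\<close>.\<close>
  have bk: "norm (H (?e k) - v) <= \<epsilon>" if "i <= k" "k <= j" for k
  proof -
    have "s / h - 1 <= of_int k" using that(1) unfolding i_def by linarith
    then have "s - h <= h * of_int k" using h by (simp add: field_simps)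
    moreover have "of_int k <= t / h" using that(2) unfolding j_def by (simp add: le_floor_iff)
    then have "h * of_int k <= t" using h by (simp add: field_simps)
    ultimately have "norm (H (?e \<lfloor>h * of_int k / h\<rfloor>) - v) <= \<epsilon>" by (intro bspec[OF b]) simp
    then show ?thesis using h by simp
  qed
  have ind: "norm (?e k - ?e i - (of_int (k - i) * h) *\<^sub>R v) <= of_int (k - i) * h * \<epsilon>" if "i <= k" "k <= j" for k
    using that
  proof (induction k rule: int_ge_induct)
    case base then show ?case by simp
  next
    case (step k)
    have "\<exists>w. norm (w - v) <= \<epsilon> \<and> ?e (k + 1) - ?e k = h *\<^sub>R w"
      using euler_step[of H h x k] bk[of k] bk[of "k + 1"] step by auto
    then obtain w where w: "norm (w - v) <= \<epsilon>" "?e (k + 1) - ?e k = h *\<^sub>R w" by blast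
    let ?A = "?e k - ?e i - (of_int (k - i) * h) *\<^sub>R v"
    have e1: "?e (k + 1) = ?e k + h *\<^sub>R w" using w(2) by (simp add: diff_eq_eq add.commute)
    have eq: "?e (k + 1) - ?e i - (of_int (k + 1 - i) * h) *\<^sub>R v = ?A + h *\<^sub>R (w - v)"
      unfolding e1 by (simp add: algebra_simps)
    have "norm (?A + h *\<^sub>R (w - v)) <= norm ?A + norm (h *\<^sub>R (w - v))" by (rule norm_triangle_ineq)
    also have "... <= of_int (k - i) * h * \<epsilon> + h * \<epsilon>"
    proof (rule add_mono)
      show "norm ?A <= of_int (k - i) * h * \<epsilon>" using step by simp
      show "norm (h *\<^sub>R (w - v)) <= h * \<epsilon>" using mult_left_mono[OF w(1), of h] h by simp
    qed
    finally have "norm (?e (k + 1) - ?e i - (of_int (k + 1 - i) * h) *\<^sub>R v) <= of_int (k - i) * h * \<epsilon> + h * \<epsilon>"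
      unfolding eq .
    then show ?case by (simp add: algebra_simps)
  qed
  define a where "a = of_int (j - i) * h"
  have a: "\<bar>a - (t - s)\<bar> <= h" "a >= 0"
  proof -
    have "of_int i <= s / h" "s / h < of_int i + 1" "of_int j <= t / h" "t / h < of_int j + 1" unfolding i_def j_def by linarith+
    then have "of_int i * h <= s" "s < of_int i * h + h" "of_int j * h <= t" "t < of_int j * h + h"
      using h by (simp_all add: field_simps)
    then show "\<bar>a - (t - s)\<bar> <= h" unfolding a_def by (simp add: algebra_simps abs_le_iff)
    show "a >= 0" unfolding a_def using ij h by simp
  qed
  have eq: "?e j - ?e i - (t - s) *\<^sub>R v = (?e j - ?e i - a *\<^sub>R v) + (a - (t - s)) *\<^sub>R v" by (simp add: algebra_simps)
  have ia: "norm (?e j - ?e i - a *\<^sub>R v) <= a * \<epsilon>" unfolding a_def by (rule ind[OF ij order_refl])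
  have "norm (?e j - ?e i - (t - s) *\<^sub>R v) <= norm (?e j - ?e i - a *\<^sub>R v) + norm ((a - (t - s)) *\<^sub>R v)"
    unfolding eq by (rule norm_triangle_ineq)
  also have "... <= a * \<epsilon> + \<bar>a - (t - s)\<bar> * norm v" using ia by simp
  also have "... <= (t - s + h) * \<epsilon> + h * M"
    using a v \<epsilon> h by (intro add_mono mult_mono) auto
  finally show "norm (?e \<lfloor>t / h\<rfloor> - ?e \<lfloor>s / h\<rfloor> - (t - s) *\<^sub>R v) <= \<epsilon> * (t - s + h) + M * h"
    unfolding i_def j_def by (simp add: mult.commute)
qed

lemma peano:
  fixes H :: "'a::euclidean_space => 'a"
  assumes cH: "continuous_on UNIV H" and M: "!!x. norm (H x) <= M"
  obtains X where "X 0 = x0" "!!t. (X has_vector_derivative H (X t)) (at t)"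
proof -
  define h where "h n = 1 / real (Suc n)" for n
  have h: "0 < h n" "h n <= 1" for n unfolding h_def by auto
  have h0: "h \<longlonglongrightarrow> 0" unfolding h_def by (rule LIMSEQ_Suc[OF lim_1_over_n])
  define X where "X n t = euler H (h n) x0 \<lfloor>t / h n\<rfloor>" for n t
  have X0: "X n 0 = x0" for n unfolding X_def by (simp add: euler_def)
  have ap: "approx_sol H M (h n) (X n)" for n
    using euler_approx_sol[OF h(1), of H M n x0] unfolding X_def .
  obtain k Y where k: "strict_mono (k :: nat => nat)" "!!t. (%n. X (k n) t) \<longlonglongrightarrow> Y t"
    "!!t. (Y has_vector_derivative H (Y t)) (at t)"
    by (rule ode_compactness[OF cH M ap less_imp_le[OF h(1)] h(2) h0, of "norm x0"]) (use X0 in auto)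
  have "Y 0 = x0" using k(2)[of 0] X0 LIMSEQ_unique tendsto_const by fastforce
  with k(3) that show thesis by blast
qed

section \<open>Bounded solutions of the autonomous equation\<close>

text \<open>The level \<open>c\<close> can only be crossed downwards. After leaving it downwards, a
  first return would have a nonnegative derivative.\<close>

lemma less_if_neg_deriv_at_level:
  fixes f f' :: "real => real"
  assumes d: "!!t. a <= t ==> t <= b ==> DERIV f t :> f' t"
    and neg: "!!t. a <= t ==> t <= b ==> f t = c ==> f' t < 0"
    and fa: "f a <= c" and ab: "a < b"
  shows "f b < c"
proof (rule ccontr)
  assume fb: "\<not> f b < c"
  have cont: "isCont f t" if "a <= t" "t <= b" for t using d[OF that] by (rule DERIV_isCont)
  have "\<exists>a'. a < a' \<and> a' < b \<and> f a' < c"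
  proof (cases "f a = c")
    case True
    then have "f' a < 0" using neg[of a] ab by simp
    from has_real_derivative_neg_dec_right[OF d[of a] this] ab
    obtain e where e: "e > 0" "!!h. h > 0 ==> h < e ==> f (a + h) < f a" by auto
    define h where "h = min (e / 2) ((b - a) / 2)"
    have h: "h > 0" "h < e" "h < b - a" using e ab unfolding h_def by (auto simp: min_def)
    show ?thesis by (rule exI[of _ "a + h"]) (use h e(2)[of h] True in auto)
  next
    case False
    then have "f a < c" using fa by simp
    then have "eventually (%t. f t < c) (at a)"
      using cont[of a] ab unfolding isCont_def by (auto dest: order_tendstoD(2))
    then obtain e where e: "e > 0" "!!t. t ~= a ==> dist t a < e ==> f t < c" unfolding eventually_at by auto
    define h where "h = min (e / 2) ((b - a) / 2)"
    have h: "h > 0" "h < e" "h < b - a" using e ab unfolding h_def by (auto simp: min_def)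
    show ?thesis by (rule exI[of _ "a + h"]) (use h e(2)[of "a + h"] in \<open>auto simp: dist_real_def\<close>)
  qed
  then obtain a' where a': "a < a'" "a' < b" "f a' < c" by blast
  define A where "A = {a'..b} \<inter> f -` {c..}"
  have cf: "continuous_on {a'..b} f" using a' by (intro continuous_at_imp_continuous_on ballI cont) auto
  have clA: "closed A" unfolding A_def by (rule continuous_closed_preimage[OF cf]) auto
  have bA: "b \<in> A" using a' fb unfolding A_def by auto
  define s where "s = Inf A"
  have bdd: "bdd_below A" unfolding A_def by (auto intro: bdd_belowI[of _ a'])
  have sA: "s \<in> A" unfolding s_def by (rule closed_contains_Inf[OF _ bdd clA]) (use bA in auto)
  then have s: "a' <= s" "s <= b" "c <= f s" unfolding A_def by auto
  have sa: "a' < s" using s a' by (cases "a' = s") auto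
  have below: "f t < c" if "a' <= t" "t < s" for t
  proof (rule ccontr)
    assume "\<not> f t < c"
    then have "t \<in> A" using that s unfolding A_def by auto
    then have "s <= t" unfolding s_def by (rule cInf_lower[OF _ bdd])
    then show False using that by simp
  qed
  have "f s <= c"
  proof (rule ccontr)
    assume "\<not> f s <= c"
    then have fs: "f s > c" by simp
    have "(f \<longlongrightarrow> f s) (at s)" using cont[of s] s a' unfolding isCont_def by simp
    from order_tendstoD(1)[OF this fs] have "eventually (%t. f t > c) (at s)" .
    then obtain e where e: "e > 0" "!!t. t ~= s ==> dist t s < e ==> f t > c" unfolding eventually_at by auto
    define h where "h = min (e / 2) (s - a')"
    have h: "h > 0" "h < e" "h <= s - a'" using e sa unfolding h_def by (auto simp: min_def)
    have "f (s - h) > c" using e(2)[of "s - h"] h by (simp add: dist_real_def)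
    moreover have "f (s - h) < c" using below[of "s - h"] h by simp
    ultimately show False by simp
  qed
  then have "f s = c" using s by simp
  then have "f' s < 0" using neg[of s] s a' by simp
  from has_real_derivative_neg_dec_left[OF d[of s] this] s a'
  obtain e where e: "e > 0" "!!h. h > 0 ==> h < e ==> f (s - h) > f s" by auto
  define h where "h = min (e / 2) (s - a')"
  have h: "h > 0" "h < e" "h <= s - a'" using e sa unfolding h_def by (auto simp: min_def)
  show False using e(2)[of h] below[of "s - h"] h \<open>f s = c\<close> by simp
qed

lemma second_derivative_at_max:
  fixes w w' :: "real => real"
  assumes d: "!!t. DERIV w t :> w' t" and d2: "DERIV w' t0 :> m"
    and r: "r > 0" and mx: "!!t. \<bar>t - t0\<bar> < r ==> w t <= w t0"
  shows "w' t0 = 0" "m <= 0"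
proof -
  show z: "w' t0 = 0"
    by (rule DERIV_local_max[OF d r]) (use mx in \<open>auto simp: abs_minus_commute\<close>)
  show "m <= 0"
  proof (rule ccontr)
    assume "\<not> m <= 0"
    then have "m > 0" by simp
    from has_real_derivative_pos_inc_right[OF d2 this]
    obtain e where e: "e > 0" "!!h. h > 0 ==> h < e ==> w' (t0 + h) > 0" using z by auto
    define h where "h = min (e / 2) (r / 2)"
    have h: "h > 0" "h < e" "h < r" using e r unfolding h_def by (auto simp: min_def)
    obtain x where x: "t0 < x" "x < t0 + h" "w (t0 + h) - w t0 = (t0 + h - t0) * w' x"
      using MVT2[of t0 "t0 + h" w w'] d h by auto
    have "w' x > 0" using e(2)[of "x - t0"] x h by simp
    then have "w (t0 + h) > w t0" using x h by (simp add: algebra_simps)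
    then show False using mx[of "t0 + h"] h by simp
  qed
qed

lemma attains_max_if_limits_below:
  fixes w :: "real => real"
  assumes c: "continuous_on UNIV w" and l: "(w \<longlongrightarrow> L1) at_bot" "(w \<longlongrightarrow> L2) at_top" "L1 < w t1" "L2 < w t1"
  obtains t0 where "!!t. w t <= w t0"
proof -
  obtain a where a: "!!t. t <= a ==> w t < w t1"
    using order_tendstoD(2)[OF l(1,3)] unfolding eventually_at_bot_linorder by blast
  obtain b where b: "!!t. t >= b ==> w t < w t1"
    using order_tendstoD(2)[OF l(2,4)] unfolding eventually_at_top_linorder by blast
  have t1: "a < t1" "t1 < b" using a[of t1] b[of t1] by (meson less_irrefl not_le)+
  obtain t0 where t0: "t0 \<in> {a..b}" "!!t. t \<in> {a..b} ==> w t <= w t0"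
    using continuous_attains_sup[of "{a..b}" w] continuous_on_subset[OF c, of "{a..b}"] t1 by force
  have "w t <= w t0" for t
    using a[of t] b[of t] t0(2)[of t] t0(2)[of t1] t1 by (cases "t <= a"; cases "b <= t") auto
  then show thesis using that by blast
qed

lemma DERIV_bound_imp_increment:
  fixes f f' :: "real => real"
  assumes "a <= b" "!!t. a <= t ==> t <= b ==> DERIV f t :> f' t"
    "!!t. a <= t ==> t <= b ==> c <= f' t"
  shows "c * (b - a) <= f b - f a"
proof -
  have "(%t. f t - c * t) a <= (%t. f t - c * t) b"
  proof (rule DERIV_nonneg_imp_nondecreasing[OF assms(1)])
    fix t assume t: "a <= t" "t <= b"
    have "DERIV (%t. f t - c * t) t :> f' t - c"
      using assms(2)[OF t] by (auto intro!: derivative_eq_intros)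
    then show "\<exists>y. DERIV (%t. f t - c * t) t :> y \<and> 0 <= y" using assms(3)[OF t] by auto
  qed
  then show ?thesis by (simp add: algebra_simps)
qed

lemma gronwall_forward:
  fixes E E' :: "real => real"
  assumes st: "s <= t" and d: "!!x. s <= x ==> x <= t ==> DERIV E x :> E' x"
    and b: "!!x. s <= x ==> x <= t ==> E' x <= K * E x"
  shows "E t <= E s * exp (K * (t - s))"
proof -
  have "0 * (t - s) <= - (E t * exp (- K * t)) - (- (E s * exp (- K * s)))"
  proof (rule DERIV_bound_imp_increment[where f'="%x. - ((E' x - K * E x) * exp (- K * x))", OF st])
    fix x assume x: "s <= x" "x <= t"
    show "DERIV (%t. - (E t * exp (- K * t))) x :> - ((E' x - K * E x) * exp (- K * x))"
      using d[OF x] by (auto intro!: derivative_eq_intros simp: algebra_simps)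
    show "0 <= - ((E' x - K * E x) * exp (- K * x))" using b[OF x] by (simp add: mult_nonpos_nonneg)
  qed
  then have "E t * exp (- K * t) * exp (K * t) <= E s * exp (- K * s) * exp (K * t)" by (intro mult_right_mono) auto
  then show ?thesis by (simp add: mult.assoc exp_add[symmetric] algebra_simps)
qed

lemma gronwall:
  fixes E E' :: "real => real"
  assumes d: "!!x. \<bar>x - s\<bar> <= \<bar>t - s\<bar> ==> DERIV E x :> E' x"
    and b: "!!x. \<bar>x - s\<bar> <= \<bar>t - s\<bar> ==> \<bar>E' x\<bar> <= K * E x"
  shows "E t <= E s * exp (K * \<bar>t - s\<bar>)"
proof (cases "s <= t")
  case True
  have "E t <= E s * exp (K * (t - s))"
    by (rule gronwall_forward[OF True d]) (use b True in \<open>auto intro: order_trans[OF abs_ge_self]\<close>)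
  then show ?thesis using True by simp
next
  case False
  then have st: "- s <= - t" by simp
  have "E (- (- t)) <= E (- (- s)) * exp (K * (- t - - s))"
  proof (rule gronwall_forward[where E="%x. E (- x)" and E'="%x. - E' (- x)", OF st])
    fix x assume "- s <= x" "x <= - t"
    then have x: "\<bar>- x - s\<bar> <= \<bar>t - s\<bar>" by simp
    show "DERIV (%x. E (- x)) x :> - E' (- x)" using d[OF x] DERIV_mirror[of E "E' (- x)" x] by simp
    show "- E' (- x) <= K * E (- x)" using b[OF x] by simp
  qed
  then show ?thesis using False by simp
qed

text \<open>Bounds the derivative of x^2 + y^2 along x' = y, y' = D, in the form needed for
  Gronwall's inequality.\<close>

lemma energy_derivative_le:
  fixes x y D a b :: real
  assumes D: "\<bar>D\<bar> <= a * \<bar>x\<bar> + b * \<bar>y\<bar>" and ab: "0 <= a" "0 <= b"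
  shows "\<bar>2 * (x * y) + 2 * (y * D)\<bar> <= (1 + a + 2 * b) * (x^2 + y^2)"
proof -
  have "\<bar>2 * (x * y) + 2 * (y * D)\<bar> <= 2 * (\<bar>x\<bar> * \<bar>y\<bar>) + 2 * (\<bar>y\<bar> * \<bar>D\<bar>)"
    by (rule order_trans[OF abs_triangle_ineq]) (simp add: abs_mult)
  also have "... <= 2 * (\<bar>x\<bar> * \<bar>y\<bar>) + 2 * (\<bar>y\<bar> * (a * \<bar>x\<bar> + b * \<bar>y\<bar>))"
    by (intro add_left_mono mult_left_mono D) auto
  also have "... = (2 * (\<bar>x\<bar> * \<bar>y\<bar>)) * (1 + a) + 2 * b * (\<bar>y\<bar> * \<bar>y\<bar>)" by (simp add: algebra_simps)
  also have "... <= (x^2 + y^2) * (1 + a) + 2 * b * (x^2 + y^2)"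
  proof (rule add_mono)
    have "0 <= (\<bar>x\<bar> - \<bar>y\<bar>)^2" by simp
    then have "2 * (\<bar>x\<bar> * \<bar>y\<bar>) <= x^2 + y^2" by (simp add: power2_eq_square algebra_simps)
    then show "(2 * (\<bar>x\<bar> * \<bar>y\<bar>)) * (1 + a) <= (x^2 + y^2) * (1 + a)" using ab by (intro mult_right_mono) auto
    show "2 * b * (\<bar>y\<bar> * \<bar>y\<bar>) <= 2 * b * (x^2 + y^2)" using ab by (intro mult_left_mono) (auto simp: power2_eq_square)
  qed
  finally show ?thesis by (simp add: algebra_simps)
qed

lemma exp_lipschitz_nonpos:
  fixes a b :: real
  assumes "a <= 0" "b <= 0" shows "\<bar>exp a - exp b\<bar> <= \<bar>a - b\<bar>"
proof -
  have *: "exp b - exp a <= b - a" if "a <= b" "b <= 0" for a b :: real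
  proof -
    have "exp b * (1 + (a - b)) <= exp b * exp (a - b)" by (intro mult_left_mono exp_ge_add_one_self) simp
    then have "exp b - exp a <= exp b * (b - a)" by (simp add: exp_diff algebra_simps)
    also have "... <= 1 * (b - a)" using that by (intro mult_right_mono) auto
    finally show ?thesis by simp
  qed
  show ?thesis
  proof (cases "a <= b")
    case True then show ?thesis using *[OF True] assms by simp
  next
    case False
    then have ba: "b <= a" by simp
    then show ?thesis using *[OF ba] assms by simp
  qed
qed

text \<open>The Lipschitz bound is centred at slope 0 because the intended \<open>F\<close> may be
  only Hoelder continuous elsewhere; it controls departures from the zero solution.\<close>

locale autonomous_ode =
  fixes \<kappa> :: real and F :: "real => real"
  assumes \<kappa>: "\<kappa> > 0" and F0: "F 0 > 0" and contF: "!!x. isCont F x"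
    and F_lip: "!!B. \<exists>C. \<forall>x. \<bar>x\<bar> <= B --> \<bar>F x - F 0\<bar> <= C * \<bar>x\<bar>"
begin

definition sol :: "(real => real) => (real => real) => bool" where
  "sol z p \<longleftrightarrow> (\<forall>t. DERIV z t :> p t \<and>
     DERIV p t :> F 0 * exp (\<kappa> * z t) - F (p t))"

lemma solD:
  assumes "sol z p"
  shows "DERIV z t :> p t" "DERIV p t :> F 0 * exp (\<kappa> * z t) - F (p t)"
  using assms unfolding sol_def by auto

lemma sol_cont: "sol z p ==> continuous_on S z" "sol z p ==> continuous_on S p"
  by (intro continuous_at_imp_continuous_on ballI DERIV_isCont[OF solD(1)], assumption)
     (intro continuous_at_imp_continuous_on ballI DERIV_isCont[OF solD(2)], assumption)

lemma sol_shift: "sol z p ==> sol (%t. z (t + s)) (%t. p (t + s))"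
  unfolding sol_def by (auto simp: DERIV_shift[symmetric])

text \<open>Time reversal mirrors \<open>F\<close>, so each statement about one end of the line
  yields one about the other.\<close>

lemma autonomous_ode_reverse: "autonomous_ode \<kappa> (%x. F (- x))"
proof
  show "isCont (%x. F (- x)) x" for x
    using isCont_o2[where f="%x. - x" and g=F and a=x] contF[of "- x"] by simp
  fix B
  obtain C where C: "!!x. \<bar>x\<bar> <= B ==> \<bar>F x - F 0\<bar> <= C * \<bar>x\<bar>" using F_lip by blast
  show "\<exists>C. \<forall>x. \<bar>x\<bar> <= B --> \<bar>F (- x) - F (- 0)\<bar> <= C * \<bar>x\<bar>"
    using C[of "- x" for x] by (intro exI[of _ C]) simp
qed (use \<kappa> F0 in auto)

lemma sol_reverse:
  assumes "sol z p" shows "autonomous_ode.sol \<kappa> (%x. F (- x)) (%t. z (- t)) (%t. - p (- t))"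
proof -
  have "DERIV (%t. z (- t)) t :> - p (- t)" for t
    using DERIV_mirror[of z "p (- t)" t] solD(1)[OF assms, of "- t"] by simp
  moreover have "DERIV (%t. - p (- t)) t :> F 0 * exp (\<kappa> * z (- t)) - F (p (- t))" for t
  proof -
    have "DERIV (%t. p (- t)) t :> - (F 0 * exp (\<kappa> * z (- t)) - F (p (- t)))"
      using DERIV_mirror[of p "F 0 * exp (\<kappa> * z (- t)) - F (p (- t))" t] solD(2)[OF assms, of "- t"] by simp
    from DERIV_minus[OF this] show ?thesis by simp
  qed
  ultimately show ?thesis
    unfolding autonomous_ode.sol_def[OF autonomous_ode_reverse] by simp
qed

text \<open>At a maximum of the difference the slopes agree, so the terms in \<open>F\<close> cancel
  however irregular \<open>F\<close> is, and the monotonicity of the exponential decides.\<close>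

lemma comparison_local:
  assumes s: "sol z1 p1" "sol z2 p2" and r: "r > 0"
    and mx: "!!t. \<bar>t - t0\<bar> < r ==> z1 t - z2 t <= z1 t0 - z2 t0"
  shows "z1 t0 <= z2 t0"
proof -
  have d: "DERIV (%t. z1 t - z2 t) t :> p1 t - p2 t" for t
    by (intro DERIV_diff solD(1) s)
  have d2: "DERIV (%t. p1 t - p2 t) t0 :> (F 0 * exp (\<kappa> * z1 t0) - F (p1 t0)) - (F 0 * exp (\<kappa> * z2 t0) - F (p2 t0))"
    by (intro DERIV_diff solD(2) s)
  have "p1 t0 - p2 t0 = 0" by (rule second_derivative_at_max(1)[OF d d2 r mx])
  moreover have "(F 0 * exp (\<kappa> * z1 t0) - F (p1 t0)) - (F 0 * exp (\<kappa> * z2 t0) - F (p2 t0)) <= 0"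
    by (rule second_derivative_at_max(2)[OF d d2 r mx])
  ultimately have "F 0 * exp (\<kappa> * z1 t0) <= F 0 * exp (\<kappa> * z2 t0)" by simp
  then show ?thesis using F0 \<kappa> by simp
qed

lemma comparison:
  assumes s: "sol z1 p1" "sol z2 p2" and l: "((%t. z1 t - z2 t) \<longlongrightarrow> L1) at_bot" "((%t. z1 t - z2 t) \<longlongrightarrow> L2) at_top"
    and c: "L1 <= c" "L2 <= c" "0 <= c"
  shows "z1 t - z2 t <= c"
proof (rule ccontr)
  assume a: "\<not> z1 t - z2 t <= c"
  obtain t0 where t0: "!!t. z1 t - z2 t <= z1 t0 - z2 t0"
    by (rule attains_max_if_limits_below[of "%t. z1 t - z2 t", OF _ l, of t])
      (use a c in \<open>auto intro!: continuous_intros sol_cont[OF s(1)] sol_cont[OF s(2)]\<close>)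
  have "z1 t0 <= z2 t0" by (rule comparison_local[OF s zero_less_one]) (rule t0)
  then show False using t0[of t] a c by simp
qed

text \<open>The supremum need not be attained. The penalty \<epsilon> ln (1 + t^2) forces a maximum,
  where the slope is O(\<epsilon>); there \<open>F (p t0)\<close> is close to \<open>F 0\<close> and
  too small to balance the source.\<close>

lemma sol_nonpos:
  assumes s: "sol z p" and B: "!!t. z t <= B"
  shows "z t <= 0"
proof (rule ccontr)
  assume "\<not> z t <= 0"
  then have S: "z t > 0" by simp
  define S where "S = z t"
  have S: "S > 0" using S unfolding S_def .
  define \<eta> where "\<eta> = F 0 * exp (\<kappa> * (S / 2)) - F 0"
  have \<eta>: "\<eta> > 0" unfolding \<eta>_def using F0 \<kappa> S by simp
  obtain \<delta> where \<delta>: "\<delta> > 0" "!!x. \<bar>x\<bar> < \<delta> ==> \<bar>F x - F 0\<bar> < \<eta> / 2"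
    using contF[of 0] \<eta> unfolding continuous_at_eps_delta dist_real_def by (metis diff_zero half_gt_zero)
  define g where "g t = ln (1 + t^2)" for t :: real
  have pos: "1 + t^2 > 0" for t :: real by (simp add: add_pos_nonneg)
  have g0: "g t >= 0" for t unfolding g_def by simp
  define \<epsilon> where "\<epsilon> = min (\<delta> / 2) (min (\<eta> / 8) (S / (2 * (1 + g t))))"
  have gt: "1 + g t > 0" using g0[of t] by simp
  have \<epsilon>: "\<epsilon> > 0" "\<epsilon> < \<delta>" "\<epsilon> <= \<eta> / 8" "\<epsilon> * g t <= S / 2"
  proof -
    show e0: "\<epsilon> > 0" unfolding \<epsilon>_def using \<delta> \<eta> S gt by simp
    have "\<epsilon> <= \<delta> / 2" unfolding \<epsilon>_def by (rule min.cobounded1)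
    then show "\<epsilon> < \<delta>" using \<delta> by simp
    show "\<epsilon> <= \<eta> / 8" unfolding \<epsilon>_def by (rule min.coboundedI2, rule min.cobounded1)
    have "\<epsilon> <= S / (2 * (1 + g t))" unfolding \<epsilon>_def by simp
    then have "\<epsilon> * (1 + g t) <= S / 2" using gt by (simp add: field_simps)
    then show "\<epsilon> * g t <= S / 2" using e0 by (simp add: algebra_simps)
  qed
  have dg: "DERIV g t :> 2 * t / (1 + t^2)" for t
    unfolding g_def using pos[of t] by (auto intro!: derivative_eq_intros)
  have dg2: "DERIV (%t. 2 * t / (1 + t^2)) t :> (2 * (1 + t^2) - 2 * t * (2 * t)) / (1 + t^2)^2" for t :: real
    using pos[of t] by (auto intro!: derivative_eq_intros simp: power2_eq_square)
  have b1: "\<bar>2 * t / (1 + t^2)\<bar> <= 1" for t :: real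
  proof -
    have "0 <= (1 - \<bar>t\<bar>)^2" by simp
    then have "2 * \<bar>t\<bar> <= 1 + t^2" by (simp add: power2_eq_square algebra_simps)
    then show ?thesis using pos[of t] by (simp add: abs_mult)
  qed
  have b2: "(2 * (1 + t^2) - 2 * t * (2 * t)) / (1 + t^2)^2 <= 2" for t :: real
  proof -
    have "0 <= t^2 + t^2 * t^2" by simp
    then have "1 + t^2 <= (1 + t^2)^2" by (simp add: power2_eq_square algebra_simps)
    moreover have "0 <= 2 * t * (2 * t)" by simp
    moreover have "2 * a - y <= 2 * w" if "a <= w" "0 <= y" for a w y :: real using that by linarith
    ultimately have "2 * (1 + t^2) - 2 * t * (2 * t) <= 2 * (1 + t^2)^2" by blast
    then show ?thesis using pos[of t] by (simp add: divide_le_eq)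
  qed
  define w where "w t = z t - \<epsilon> * g t" for t
  have cw: "continuous_on A w" for A
    unfolding w_def by (intro continuous_intros sol_cont[OF s] continuous_at_imp_continuous_on ballI DERIV_isCont[OF dg])
  define R where "R = sqrt (exp (\<bar>B\<bar> / \<epsilon>)) + \<bar>t\<bar>"
  have out: "w r < w t" if "\<bar>r\<bar> > R" for r
  proof -
    have "sqrt (exp (\<bar>B\<bar> / \<epsilon>)) < \<bar>r\<bar>" using that unfolding R_def by simp
    then have "exp (\<bar>B\<bar> / \<epsilon>) < r^2" using real_less_rsqrt[of "exp (\<bar>B\<bar> / \<epsilon>)"] by (metis abs_ge_zero power2_abs real_sqrt_less_iff real_sqrt_abs)
    then have "\<bar>B\<bar> / \<epsilon> < ln (r^2)" by (metis exp_gt_zero exp_less_cancel_iff exp_ln less_trans)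
    also have "... <= g r" unfolding g_def using \<open>exp (\<bar>B\<bar> / \<epsilon>) < r^2\<close> exp_gt_zero[of "\<bar>B\<bar> / \<epsilon>"] by (subst ln_le_cancel_iff) linarith+
    finally have "\<bar>B\<bar> < \<epsilon> * g r" using \<epsilon> by (simp add: divide_less_eq mult.commute)
    then have "w r < 0" using B[of r] unfolding w_def by linarith
    moreover have "w t >= S / 2" unfolding w_def using \<epsilon> S_def by linarith
    ultimately show ?thesis using S by linarith
  qed
  have R: "\<bar>t\<bar> <= R" unfolding R_def by simp
  obtain t0 where t0: "t0 \<in> {-R..R}" "!!r. r \<in> {-R..R} ==> w r <= w t0"
    using continuous_attains_sup[of "{-R..R}" w] cw R by force
  have mx: "w r <= w t0" for r
  proof (cases "\<bar>r\<bar> <= R")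
    case True then show ?thesis using t0(2)[of r] by (auto simp: abs_le_iff)
  next
    case False
    then have "w r < w t" using out by simp
    also have "w t <= w t0" using t0(2)[of t] R by (auto simp: abs_le_iff)
    finally show ?thesis by simp
  qed
  have dw: "DERIV w t :> p t - \<epsilon> * (2 * t / (1 + t^2))" for t
    unfolding w_def by (intro DERIV_diff DERIV_cmult solD(1)[OF s] dg)
  have dw2: "((%t. p t - \<epsilon> * (2 * t / (1 + t^2))) has_real_derivative
      (F 0 * exp (\<kappa> * z t0) - F (p t0)) - \<epsilon> * ((2 * (1 + t0^2) - 2 * t0 * (2 * t0)) / (1 + t0^2)^2)) (at t0)"
    by (intro DERIV_diff DERIV_cmult solD(2)[OF s] dg2)
  have p0: "p t0 = \<epsilon> * (2 * t0 / (1 + t0^2))"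
    using second_derivative_at_max(1)[OF dw dw2 zero_less_one] mx by simp
  have "(F 0 * exp (\<kappa> * z t0) - F (p t0)) - \<epsilon> * ((2 * (1 + t0^2) - 2 * t0 * (2 * t0)) / (1 + t0^2)^2) <= 0"
    by (rule second_derivative_at_max(2)[OF dw dw2 zero_less_one]) (rule mx)
  moreover have "\<epsilon> * ((2 * (1 + t0^2) - 2 * t0 * (2 * t0)) / (1 + t0^2)^2) <= \<epsilon> * 2"
    using b2 \<epsilon> by (intro mult_left_mono) auto
  ultimately have 1: "F 0 * exp (\<kappa> * z t0) <= F (p t0) + \<eta> / 4" using \<epsilon> by linarith
  have "\<bar>p t0\<bar> = \<epsilon> * \<bar>2 * t0 / (1 + t0^2)\<bar>" unfolding p0 using \<epsilon> by (simp add: abs_mult)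
  also have "... <= \<epsilon> * 1" using b1 \<epsilon> by (intro mult_left_mono) auto
  finally have "\<bar>F (p t0) - F 0\<bar> < \<eta> / 2" using \<delta>(2) \<epsilon> by simp
  moreover have "z t0 >= S / 2"
  proof -
    have "w t0 >= S / 2" using mx[of t] \<epsilon>(4) unfolding w_def S_def by linarith
    moreover have "\<epsilon> * g t0 >= 0" using \<epsilon> g0 by simp
    ultimately show ?thesis unfolding w_def by linarith
  qed
  then have "F 0 * exp (\<kappa> * (S / 2)) <= F 0 * exp (\<kappa> * z t0)" using F0 \<kappa> by simp
  moreover have "F 0 * exp (\<kappa> * (S / 2)) = \<eta> + F 0" unfolding \<eta>_def by simp
      ultimately show False using 1 \<eta> by linarith
qed

text \<open>Gronwall's inequality around the zero solution, in both time directions. It gives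
  uniqueness of the zero solution and a lower bound for the time in which a small solution becomes
  large.\<close>

lemma sol_energy_growth:
  "\<exists>C\<ge>0. \<forall>z p. sol z p --> (\<forall>t. \<bar>p t\<bar> <= B) --> (\<forall>t. z t <= 0) -->
     (\<forall>s t. (z t)^2 + (p t)^2 <= ((z s)^2 + (p s)^2) * exp (C * \<bar>t - s\<bar>))"
proof -
  obtain C1' where C1': "!!x. \<bar>x\<bar> <= B ==> \<bar>F x - F 0\<bar> <= C1' * \<bar>x\<bar>" using F_lip by blast
  define C1 where "C1 = \<bar>C1'\<bar>"
  have C1: "\<bar>F x - F 0\<bar> <= C1 * \<bar>x\<bar>" if "\<bar>x\<bar> <= B" for x
    using C1'[OF that] mult_right_mono[of C1' C1 "\<bar>x\<bar>"] unfolding C1_def by linarith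
  have a: "0 <= F 0 * \<kappa>" "0 <= C1" unfolding C1_def using F0 \<kappa> by simp_all
  show ?thesis
  proof (intro exI[of _ "1 + F 0 * \<kappa> + 2 * C1"] conjI allI impI)
    show "1 + F 0 * \<kappa> + 2 * C1 >= 0" using a by simp
    fix z p and s t :: real
    assume so: "sol z p" and pB: "\<forall>t. \<bar>p t\<bar> <= B" and zn: "\<forall>t. z t <= 0"
    show "(z t)^2 + (p t)^2 <= ((z s)^2 + (p s)^2) * exp ((1 + F 0 * \<kappa> + 2 * C1) * \<bar>t - s\<bar>)"
    proof (rule gronwall[where E="%t. (z t)^2 + (p t)^2"])
      fix x
      show "DERIV (%t. (z t)^2 + (p t)^2) x :> 2 * (z x * p x) + 2 * (p x * (F 0 * exp (\<kappa> * z x) - F (p x)))"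
        by (auto intro!: derivative_eq_intros solD[OF so])
      have "\<bar>exp (\<kappa> * z x) - exp 0\<bar> <= \<bar>\<kappa> * z x - 0\<bar>"
        by (rule exp_lipschitz_nonpos) (use zn \<kappa> in \<open>auto simp: mult_nonneg_nonpos\<close>)
      then have "F 0 * \<bar>exp (\<kappa> * z x) - 1\<bar> <= F 0 * \<bar>\<kappa> * z x\<bar>" using F0 by (intro mult_left_mono) auto
      then have "\<bar>F 0 * (exp (\<kappa> * z x) - 1)\<bar> <= F 0 * \<kappa> * \<bar>z x\<bar>" using F0 \<kappa> by (simp add: abs_mult)
      moreover have "F 0 * exp (\<kappa> * z x) - F (p x) = F 0 * (exp (\<kappa> * z x) - 1) - (F (p x) - F 0)" by (simp add: algebra_simps)
      ultimately have "\<bar>F 0 * exp (\<kappa> * z x) - F (p x)\<bar> <= F 0 * \<kappa> * \<bar>z x\<bar> + C1 * \<bar>p x\<bar>"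
        using C1[of "p x"] pB[rule_format, of x] by linarith
      from energy_derivative_le[OF this a]
      show "\<bar>2 * (z x * p x) + 2 * (p x * (F 0 * exp (\<kappa> * z x) - F (p x)))\<bar> <= (1 + F 0 * \<kappa> + 2 * C1) * ((z x)^2 + (p x)^2)" .
    qed
  qed
qed

lemma sol_zero_unique:
  assumes s: "sol z p" and B: "!!t. \<bar>p t\<bar> <= B" and n: "!!t. z t <= 0" and t1: "z t1 = 0"
  shows "z t = 0"
proof -
  obtain C where C: "\<forall>z p. sol z p --> (\<forall>t. \<bar>p t\<bar> <= B) --> (\<forall>t. z t <= 0) -->
     (\<forall>s t. (z t)^2 + (p t)^2 <= ((z s)^2 + (p s)^2) * exp (C * \<bar>t - s\<bar>))"
    using sol_energy_growth[of B] by (elim exE conjE)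
  have "p t1 = 0"
    by (rule DERIV_local_max[OF solD(1)[OF s] zero_less_one]) (use n t1 in auto)
  then have "(z t)^2 + (p t)^2 <= 0" using C[rule_format, OF s B n, of t t1] t1 by simp
  then show ?thesis by (simp add: sum_power2_le_zero_iff)
qed

text \<open>If \<open>z\<close> hardly moved, \<open>- z\<close> minus a small parabola would have
  an interior maximum with small slope. There z'' is close to
  \<open>F 0 * (exp (\<kappa> * z r) - 1)\<close>, which is bounded away from 0 below level
  \<open>- c\<close>, contradicting the maximum. The gain \<delta> is uniform over all
  solutions.\<close>

lemma no_flat:
  assumes c: "c > 0"
  shows "\<exists>\<delta>>0. \<forall>z p t. sol z p --> (\<forall>s. \<bar>s - t\<bar> <= 1 --> z s <= - c) --> (\<exists>s. \<bar>s - t\<bar> <= 1 \<and> \<bar>z s - z t\<bar> >= \<delta>)"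
proof -
  define \<eta> where "\<eta> = F 0 - F 0 * exp (\<kappa> * (- c))"
  have \<eta>: "\<eta> > 0" unfolding \<eta>_def using F0 \<kappa> c by simp
  obtain d where d: "d > 0" "!!x. \<bar>x\<bar> < d ==> \<bar>F x - F 0\<bar> < \<eta> / 2"
    using contF[of 0] \<eta> unfolding continuous_at_eps_delta dist_real_def by (metis diff_zero half_gt_zero)
  define \<delta> where "\<delta> = min (d / 4) (\<eta> / 8)"
  have \<delta>: "\<delta> > 0" "2 * \<delta> < d" "4 * \<delta> < \<eta>" unfolding \<delta>_def using d \<eta> by (auto simp: min_def)
  show ?thesis
  proof (rule exI[of _ \<delta>], intro conjI allI impI)
    show "\<delta> > 0" by (rule \<delta>)
    fix z p and t :: real
    assume s: "sol z p" and zc: "\<forall>s. \<bar>s - t\<bar> <= 1 --> z s <= - c"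
    show "\<exists>s. \<bar>s - t\<bar> <= 1 \<and> \<bar>z s - z t\<bar> >= \<delta>"
    proof (rule ccontr)
      assume "\<not> ?thesis"
      then have near: "\<bar>z s - z t\<bar> < \<delta>" if "\<bar>s - t\<bar> <= 1" for s using that by force
      define w where "w r = - z r - \<delta> * (r - t)^2" for r
      have cw: "continuous_on {t - 1..t + 1} w" unfolding w_def by (intro continuous_intros sol_cont[OF s])
      obtain r where r: "r \<in> {t - 1..t + 1}" "!!s. s \<in> {t - 1..t + 1} ==> w s <= w r"
        using continuous_attains_sup[of "{t - 1..t + 1}" w] cw by force
      have "w t <= w r" using r(2)[of t] by simp
      then have "\<delta> * (r - t)^2 <= z t - z r" unfolding w_def by simp
      also have "... < \<delta>" using near[of r] r(1) by (auto simp: abs_le_iff)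
      finally have "\<bar>r - t\<bar> < 1" using \<delta> by (simp add: abs_square_less_1)
      then have rin: "t - 1 < r" "r < t + 1" by auto
      define e where "e = min (r - (t - 1)) (t + 1 - r)"
      have e: "e > 0" using rin unfolding e_def by simp
      have mx: "w s <= w r" if "\<bar>s - r\<bar> < e" for s using r(2)[of s] that unfolding e_def by (auto simp: abs_less_iff)
      have dw: "DERIV w x :> - p x - \<delta> * (2 * (x - t))" for x
        unfolding w_def by (auto intro!: derivative_eq_intros solD(1)[OF s])
      have dw2: "DERIV (%x. - p x - \<delta> * (2 * (x - t))) r :> - (F 0 * exp (\<kappa> * z r) - F (p r)) - \<delta> * 2"
        by (auto intro!: derivative_eq_intros solD(2)[OF s])
      have pr: "- p r - \<delta> * (2 * (r - t)) = 0" by (rule second_derivative_at_max(1)[OF dw dw2 e mx])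
      have "\<bar>p r\<bar> = 2 * \<delta> * \<bar>r - t\<bar>"
      proof -
        have "p r = - (2 * \<delta> * (r - t))" using pr by (simp add: algebra_simps)
        then show ?thesis using \<delta> by (simp add: abs_mult)
      qed
      also have "... <= 2 * \<delta> * 1" using \<open>\<bar>r - t\<bar> < 1\<close> \<delta> by (intro mult_left_mono) auto
      finally have "\<bar>F (p r) - F 0\<bar> < \<eta> / 2" using d(2) \<delta> by simp
      moreover have "- (F 0 * exp (\<kappa> * z r) - F (p r)) - \<delta> * 2 <= 0"
        by (rule second_derivative_at_max(2)[OF dw dw2 e mx])
      moreover have "F 0 * exp (\<kappa> * z r) <= F 0 - \<eta>"
      proof -
        have "z r <= - c" using zc r(1) by (auto simp: abs_le_iff)
        then have "exp (\<kappa> * z r) <= exp (\<kappa> * (- c))" using \<kappa> by (subst exp_le_cancel_iff, intro mult_left_mono) auto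
        then have "F 0 * exp (\<kappa> * z r) <= F 0 * exp (\<kappa> * (- c))" using F0 by (intro mult_left_mono) auto
        then show ?thesis unfolding \<eta>_def by linarith
      qed
      ultimately show False using \<delta> by linarith
    qed
  qed
qed

lemma sol_mono_on:
  assumes s: "sol z p" and "a <= b" "!!t. a <= t ==> t <= b ==> p t >= 0" shows "z a <= z b"
  using DERIV_bound_imp_increment[OF assms(2) solD(1)[OF s], of 0] assms(3) by simp

lemma monotone_gain:
  assumes c: "c > 0"
  shows "\<exists>\<delta>>0. \<forall>z p t. sol z p --> (\<forall>s. \<bar>s - t\<bar> <= 1 --> z s <= - c \<and> 0 <= p s) --> z (t + 1) - z (t - 1) >= \<delta>"
proof -
  obtain \<delta> where \<delta>: "\<delta> > 0" and H: "\<forall>z p t. sol z p --> (\<forall>s. \<bar>s - t\<bar> <= 1 --> z s <= - c) --> (\<exists>s. \<bar>s - t\<bar> <= 1 \<and> \<bar>z s - z t\<bar> >= \<delta>)"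
    using no_flat[OF c] by (elim exE conjE)
  show ?thesis
  proof (intro exI[of _ \<delta>] conjI allI impI)
    fix z p and t :: real
    assume s: "sol z p" and a: "\<forall>s. \<bar>s - t\<bar> <= 1 --> z s <= - c \<and> 0 <= p s"
    obtain r where r: "\<bar>r - t\<bar> <= 1" "\<bar>z r - z t\<bar> >= \<delta>" using H[rule_format, OF s, of t] a by blast
    have "z (t - 1) <= z x \<and> z x <= z (t + 1)" if "\<bar>x - t\<bar> <= 1" for x
      using sol_mono_on[OF s, of "t - 1" x] sol_mono_on[OF s, of x "t + 1"] a that by (auto simp: abs_le_iff)
    from this[of r] this[of t] r show "z (t + 1) - z (t - 1) >= \<delta>" by (simp add: abs_if split: if_splits)
  qed (rule \<delta>)
qed

lemma increasing_at_bot: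
  assumes s: "sol z p" and neg: "!!t. z t < 0" and p: "!!t. t <= t0 ==> p t >= 0"
  shows "filterlim z at_bot at_bot"
proof -
  have mono: "z a <= z b" if "a <= b" "b <= t0" for a b
    by (rule sol_mono_on[OF s that(1)]) (use p that in auto)
  have nz: "0 < - z t0" using neg[of t0] by simp
  obtain \<delta> where \<delta>: "\<delta> > 0" and H: "\<forall>y r t. sol y r --> (\<forall>s. \<bar>s - t\<bar> <= 1 --> y s <= - (- z t0) \<and> 0 <= r s) --> y (t + 1) - y (t - 1) >= \<delta>"
    using monotone_gain[OF nz] by (elim exE conjE)
  have step: "z (t - 2) <= z t - \<delta>" if t: "t <= t0" for t
  proof -
    have "z (t - 1 + 1) - z (t - 1 - 1) >= \<delta>"
    proof (rule H[rule_format, OF s])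
      fix x assume "\<bar>x - (t - 1)\<bar> <= 1"
      then have "x <= t0" using t by (simp add: abs_le_iff)
      then show "z x <= - (- z t0) \<and> 0 <= p x" using mono p by simp
    qed
    then show ?thesis by simp
  qed
  have it: "z (t0 - 2 * real k) <= z t0 - real k * \<delta>" for k
  proof (induction k)
    case (Suc k)
    have "z (t0 - 2 * real k - 2) <= z (t0 - 2 * real k) - \<delta>" by (rule step) simp
    then show ?case using Suc by (simp add: algebra_simps)
  qed simp
  show ?thesis unfolding filterlim_at_bot
  proof
    fix Z
    obtain k :: nat where k: "(z t0 - Z) / \<delta> <= real k" using real_arch_simple by blast
    then have "z t0 - real k * \<delta> <= Z" using \<delta> by (simp add: field_simps)
    then have "z t <= Z" if "t <= t0 - 2 * real k" for t using mono[OF that] it[of k] by simp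
    then show "eventually (%t. z t <= Z) at_bot" unfolding eventually_at_bot_linorder by blast
  qed
qed

lemma increasing_at_top:
  assumes s: "sol z p" and neg: "!!t. z t < 0" and p: "!!t. t0 <= t ==> p t >= 0"
  shows "(z \<longlongrightarrow> 0) at_top"
proof -
  have mono: "z a <= z b" if "t0 <= a" "a <= b" for a b
    by (rule sol_mono_on[OF s that(2)]) (use p that in auto)
  have ex: "\<exists>T\<ge>t0. z T > - c" if c: "c > 0" for c
  proof (rule ccontr)
    assume "\<not> (\<exists>T\<ge>t0. z T > - c)"
    then have zc: "z t <= - c" if "t0 <= t" for t using that by force
    obtain \<delta> where \<delta>: "\<delta> > 0" and H: "\<forall>z p t. sol z p --> (\<forall>s. \<bar>s - t\<bar> <= 1 --> z s <= - c \<and> 0 <= p s) --> z (t + 1) - z (t - 1) >= \<delta>"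
      using monotone_gain[OF c] by (elim exE conjE)
    have step: "z (t + 2) >= z t + \<delta>" if t: "t0 <= t" for t
    proof -
      have "z (t + 1 + 1) - z (t + 1 - 1) >= \<delta>"
        by (rule H[rule_format, OF s]) (use t zc p in \<open>auto simp: abs_le_iff\<close>)
      then show ?thesis by (simp add: add.commute)
    qed
    have it: "z (t0 + 2 * real k) >= z t0 + real k * \<delta>" for k
    proof (induction k)
      case (Suc k)
      have "z (t0 + 2 * real k + 2) >= z (t0 + 2 * real k) + \<delta>" by (rule step) simp
      then show ?case using Suc by (simp add: algebra_simps)
    qed simp
    obtain k :: nat where k: "(- z t0) / \<delta> <= real k" using real_arch_simple by blast
    then have "z t0 + real k * \<delta> >= 0" using \<delta> by (simp add: field_simps)
    then show False using it[of k] neg[of "t0 + 2 * real k"] by linarith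
  qed
  show ?thesis
  proof (rule tendstoI)
    fix e :: real assume "e > 0"
    from ex[OF this] obtain T where T: "T >= t0" "z T > - e" by blast
    have "dist (z t) 0 < e" if "T <= t" for t
      using mono[OF T(1) that] T(2) neg[of t] by (simp add: dist_real_def)
    then show "eventually (%t. dist (z t) 0 < e) at_top" unfolding eventually_at_top_linorder by blast
  qed
qed

text \<open>Where the slope vanishes, \<open>z < 0\<close> makes z'' negative, so the slope changes
  sign at most once, and only from positive to negative.\<close>

lemma sol_sign_cases:
  assumes s: "sol z p" and neg: "!!t. z t < 0"
  shows "(\<forall>t. p t > 0) \<or> (\<forall>t. p t < 0) \<or> (\<exists>t0. (\<forall>t<t0. p t > 0) \<and> (\<forall>t>t0. p t < 0))"
proof (cases "\<exists>t0. p t0 = 0")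
  case True
  then obtain t0 where t0: "p t0 = 0" by blast
  have d0: "F 0 * exp (\<kappa> * z t) - F (p t) < 0" if "p t = 0" for t
    using neg[of t] F0 \<kappa> that by (simp add: mult_pos_neg)
  have lt: "p b < 0" if "p a <= 0" "a < b" for a b
    by (rule less_if_neg_deriv_at_level[OF solD(2)[OF s] d0 that])
  have "p t < 0" if "t > t0" for t using lt[of t0 t] t0 that by simp
  moreover have "p t > 0" if "t < t0" for t using lt[of t t0] t0 that by (metis less_irrefl not_le)
  ultimately show ?thesis by blast
next
  case False
  have "(\<forall>t. p t > 0) \<or> (\<forall>t. p t < 0)"
  proof (rule ccontr)
    assume "\<not> ?thesis"
    then obtain a b where ab: "p a < 0" "p b > 0" using False by (metis linorder_neqE_linordered_idom)
    have "connected (p ` UNIV)" by (rule connected_continuous_image[OF sol_cont(2)[OF s] connected_UNIV])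
    then have "0 \<in> p ` UNIV" using ab connectedD_interval[of "p ` UNIV" "p a" "p b" 0] by auto
    then show False using False by auto
  qed
  then show ?thesis by blast
qed

text \<open>At slope \<open>P\<close> the second derivative is positive, so a slope that reaches
  \<open>P\<close> once exceeds it ever after and \<open>z\<close> becomes unbounded above.\<close>

lemma sol_slope_less:
  assumes s: "sol z p" and B: "!!t. z t <= B" and P: "P > 0" "F P <= 0"
  shows "p t < P"
proof (rule ccontr)
  assume a: "\<not> p t < P"
  have gt: "p b > P" if "b > t" for b
  proof -
    have "- p b < - P"
    proof (rule less_if_neg_deriv_at_level[where f="%t. - p t" and f'="%t. - (F 0 * exp (\<kappa> * z t) - F (p t))" and a=t])
      show "DERIV (%t. - p t) r :> - (F 0 * exp (\<kappa> * z r) - F (p r))" for r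
        by (intro DERIV_minus solD(2)[OF s])
      show "- (F 0 * exp (\<kappa> * z r) - F (p r)) < 0" if "- p r = - P" for r
      proof -
        have "F 0 * exp (\<kappa> * z r) > 0" using F0 by simp
        then show ?thesis using that P by simp
      qed
    qed (use a that in auto)
    then show ?thesis by simp
  qed
  define b where "b = t + (\<bar>B - z t\<bar> + 1) / P"
  have b: "b > t" unfolding b_def using P by simp
  have "P * (b - t) <= z b - z t"
    by (rule DERIV_bound_imp_increment[OF less_imp_le[OF b] solD(1)[OF s]]) (use gt a in \<open>metis less_imp_le not_le order_le_less\<close>)
  moreover have "P * (b - t) = \<bar>B - z t\<bar> + 1" unfolding b_def using P by simp
  ultimately show False using B[of b] by linarith
qed

text \<open>Far to the left the exponential is negligible. A slope at most \<open>P - e\<close> then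
  decreases forward in time at a rate bounded below and remains in that range; starting early
  enough, it would be negative at the fixed time \<open>T\<close>.\<close>

lemma slope_tendsto_root:
  assumes s: "sol z p" and z: "filterlim z at_bot at_bot" and p: "!!t. t <= t0 ==> 0 < p t \<and> p t < P"
    and F: "!!x. 0 <= x ==> x < P ==> F x > 0" and P: "P > 0"
  shows "(p \<longlongrightarrow> P) at_bot"
proof (rule tendstoI)
  fix e' :: real assume e': "e' > 0"
  define e where "e = min e' P"
  have e: "0 < e" "e <= P" "e <= e'" unfolding e_def using e' P by auto
  obtain x0 where x0: "x0 \<in> {0..P - e}" "!!x. x \<in> {0..P - e} ==> F x0 <= F x"
    using continuous_attains_inf[of "{0..P - e}" F] e contF by (force intro!: continuous_at_imp_continuous_on)
  define c where "c = F x0"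
  have c: "c > 0" unfolding c_def using F x0(1) e by auto
  obtain T0 where T0: "!!t. t <= T0 ==> z t <= ln (c / (2 * F 0)) / \<kappa>"
    using z unfolding filterlim_at_bot eventually_at_bot_linorder by blast
  define T where "T = min T0 t0"
  have d: "F 0 * exp (\<kappa> * z t) - F (p t) <= - c / 2" if "t <= T" "p t <= P - e" for t
  proof -
    have "\<kappa> * z t <= ln (c / (2 * F 0))" using T0[of t] that \<kappa> unfolding T_def by (simp add: field_simps)
    then have "exp (\<kappa> * z t) <= c / (2 * F 0)" using c F0 by (metis divide_pos_pos exp_le_cancel_iff exp_ln mult_pos_pos zero_less_numeral)
    then have "F 0 * exp (\<kappa> * z t) <= c / 2" using F0 by (simp add: field_simps)
    moreover have "c <= F (p t)" unfolding c_def using x0(2)[of "p t"] p[of t] that unfolding T_def by auto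
    ultimately show ?thesis by simp
  qed
  have big: "p t > P - e" if t: "t < T - 2 * P / c" for t
  proof (rule ccontr)
    assume "\<not> p t > P - e"
    then have a: "p t <= P - e" by simp
    have tT: "t < T" using t c P by (smt (verit) divide_pos_pos)
    have le: "p r <= P - e" if "t <= r" "r <= T" for r
    proof (cases "r = t")
      case False
      have "p r < P - e"
      proof (rule less_if_neg_deriv_at_level[OF solD(2)[OF s] _ a])
        fix x assume x: "t <= x" "x <= r" "p x = P - e"
        then show "F 0 * exp (\<kappa> * z x) - F (p x) < 0" using d[of x] that c by auto
      qed (use that False in auto)
      then show ?thesis by simp
    qed (use a in simp)
    have "(c / 2) * (T - t) <= - p T - (- p t)"
      by (rule DERIV_bound_imp_increment[OF less_imp_le[OF tT] DERIV_minus[OF solD(2)[OF s]]]) (use d le in force)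
    moreover have "(c / 2) * (T - t) > P" using t c by (simp add: field_simps)
    ultimately show False using p[of T] p[of t] tT unfolding T_def by auto
  qed
  show "eventually (%t. dist (p t) P < e') at_bot"
    unfolding eventually_at_bot_linorder
  proof (intro exI[of _ "min (T - 2 * P / c - 1) t0"] allI impI)
    fix t assume "t <= min (T - 2 * P / c - 1) t0"
    then show "dist (p t) P < e'" using big[of t] p[of t] e by (auto simp: dist_real_def)
  qed
qed

text \<open>Without a root of \<open>F\<close> at nonpositive slopes nothing stops the descent: the
  derivative of the slope is eventually below a negative constant.\<close>

lemma not_decreasing_at_top:
  assumes s: "sol z p" and z: "filterlim z at_bot at_top" and p: "!!t. t0 <= t ==> p t <= 0" and B: "!!t. \<bar>p t\<bar> <= B"
    and F: "!!x. x <= 0 ==> F x > 0"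
  shows False
proof -
  have B0: "B >= 0" using B[of 0] by linarith
  obtain x0 where x0: "x0 \<in> {-B..0}" "!!x. x \<in> {-B..0} ==> F x0 <= F x"
    using continuous_attains_inf[of "{-B..0}" F] B0 contF by (force intro!: continuous_at_imp_continuous_on)
  define c where "c = F x0"
  have c: "c > 0" unfolding c_def using F x0(1) by auto
  obtain T0 where T0: "!!t. t >= T0 ==> z t <= ln (c / (2 * F 0)) / \<kappa>"
    using z unfolding filterlim_at_bot eventually_at_top_linorder by blast
  define T where "T = max T0 t0"
  have d: "c / 2 <= - (F 0 * exp (\<kappa> * z t) - F (p t))" if "t >= T" for t
  proof -
    have "\<kappa> * z t <= ln (c / (2 * F 0))" using T0[of t] that \<kappa> unfolding T_def by (simp add: field_simps)
    then have "exp (\<kappa> * z t) <= c / (2 * F 0)" using c F0 by (metis divide_pos_pos exp_le_cancel_iff exp_ln mult_pos_pos zero_less_numeral)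
    then have "F 0 * exp (\<kappa> * z t) <= c / 2" using F0 by (simp add: field_simps)
    moreover have "c <= F (p t)" unfolding c_def using x0(2)[of "p t"] p[of t] B[of t] that unfolding T_def by auto
    ultimately show ?thesis by simp
  qed
  define b where "b = T + (2 * B + 1) * 2 / c"
  have b: "T <= b" unfolding b_def using c B0 by simp
  have "(c / 2) * (b - T) <= - p b - (- p T)"
    by (rule DERIV_bound_imp_increment[OF b DERIV_minus[OF solD(2)[OF s]]]) (use d in auto)
  moreover have "(c / 2) * (b - T) = 2 * B + 1" unfolding b_def using c by simp
  ultimately show False using B[of b] B[of T] by linarith
qed

end

section \<open>Asymptotics of decaying ends\<close>

lemma mono_bounded_converges_at_bot:
  fixes f :: "real => real"
  assumes mono: "!!s t. s <= t ==> t <= t0 ==> f s <= f t" and bd: "!!t. t <= t0 ==> K <= f t"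
  obtains L where "(f \<longlongrightarrow> L) at_bot"
proof -
  define L where "L = Inf (f ` {..t0})"
  have bb: "bdd_below (f ` {..t0})" using bd by (auto intro: bdd_belowI[of _ K])
  have "(f \<longlongrightarrow> L) at_bot"
  proof (rule tendstoI)
    fix e :: real assume e: "e > 0"
    have "\<not> (\<forall>y\<in>f ` {..t0}. L + e <= y)"
      using cInf_greatest[of "f ` {..t0}" "L + e"] e unfolding L_def by auto
    then obtain T where T: "T <= t0" "f T < L + e" by auto
    have "dist (f t) L < e" if "t <= T" for t
    proof -
      have "L <= f t" unfolding L_def using that T by (intro cInf_lower[OF _ bb]) auto
      then show ?thesis using mono[OF that T(1)] T(2) by (simp add: dist_real_def)
    qed
    then show "eventually (%t. dist (f t) L < e) at_bot" unfolding eventually_at_bot_linorder by blast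
  qed
  then show thesis by (rule that)
qed

text \<open>\<open>D\<close> and \<open>D - W\<close> are nondecreasing and bounded below, so both
  converge. The derivative of \<open>D\<close> plays the part of an integrable majorant without any
  integral being formed.\<close>

lemma converges_at_bot_if_dominated:
  fixes W D :: "real => real"
  assumes dW: "!!t. t <= t0 ==> DERIV W t :> W' t"
    and dD: "!!t. t <= t0 ==> DERIV D t :> D' t"
    and le: "!!t. t <= t0 ==> \<bar>W' t\<bar> <= D' t" and D0: "!!t. t <= t0 ==> 0 <= D t"
  obtains L where "(W \<longlongrightarrow> L) at_bot"
proof -
  have md: "D s <= D t" and mw: "D s - W s <= D t - W t" and mw2: "D s + W s <= D t + W t" if "s <= t" "t <= t0" for s t
  proof -
    have "0 * (t - s) <= D t - D s"
    proof (rule DERIV_bound_imp_increment[OF that(1) dD])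
      show "0 <= D' r" if "s <= r" "r <= t" for r using le[of r] that \<open>t <= t0\<close> by linarith
    qed (use that in auto)
    then show "D s <= D t" by simp
    have "0 * (t - s) <= (%r. D r - W r) t - (%r. D r - W r) s"
      by (rule DERIV_bound_imp_increment[where f'="%r. D' r - W' r", OF that(1)]) (use that le in \<open>force intro: DERIV_diff dD dW simp: abs_le_iff\<close>)+
    then show "D s - W s <= D t - W t" by simp
    have "0 * (t - s) <= (%r. D r + W r) t - (%r. D r + W r) s"
    proof (rule DERIV_bound_imp_increment[where f'="%r. D' r + W' r", OF that(1)])
      fix r assume r: "s <= r" "r <= t"
      then show "DERIV (%r. D r + W r) r :> D' r + W' r" using that by (intro DERIV_add dD dW) auto
      show "0 <= D' r + W' r" using le[of r] r that by linarith
    qed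
    then show "D s + W s <= D t + W t" by simp
  qed
  obtain L1 where L1: "(D \<longlongrightarrow> L1) at_bot" by (rule mono_bounded_converges_at_bot[of t0 D 0]) (use md D0 in auto)
  obtain L2 where L2: "((%t. D t - W t) \<longlongrightarrow> L2) at_bot"
  proof (rule mono_bounded_converges_at_bot[of t0 "%t. D t - W t" "- D t0 - W t0"])
    show "- D t0 - W t0 <= D t - W t" if "t <= t0" for t using mw2[of t t0] D0[OF that] that by simp
  qed (use mw in auto)
  have "((%t. D t - (D t - W t)) \<longlongrightarrow> L1 - L2) at_bot" by (intro tendsto_diff L1 L2)
  then show thesis by (intro that) simp
qed

lemma average_tendsto_at_bot:
  fixes h :: "real => real"
  assumes d: "!!t. t <= t0 ==> DERIV h t :> h' t" and l: "(h' \<longlongrightarrow> k) at_bot"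
  shows "((%t. h t / t) \<longlongrightarrow> k) at_bot"
proof (rule tendstoI)
  fix e :: real assume e: "e > 0"
  obtain T1 where T1: "!!t. t <= T1 ==> dist (h' t) k < e / 2"
    using tendstoD[OF l, of "e / 2"] e unfolding eventually_at_bot_linorder by auto
  define T where "T = min (min t0 T1) (- 1)"
  have T: "T <= t0" "T <= T1" "T <= -1" unfolding T_def by auto
  define C where "C = \<bar>h T - k * T\<bar> + e / 2 * \<bar>T\<bar>"
  have C: "C >= 0" unfolding C_def using e by simp
  have bound: "\<bar>h t - k * t\<bar> <= C + e / 2 * \<bar>t\<bar>" if t: "t <= T" for t
  proof -
    have g: "DERIV (%t. h t - k * t) r :> h' r - k" if "r <= T" for r
      using d[of r] that T by (auto intro!: derivative_eq_intros)
    have g2: "DERIV (%t. - (h t - k * t)) r :> - (h' r - k)" if "r <= T" for r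
      by (rule DERIV_minus[OF g[OF that]])
    have a: "- (e / 2) <= h' r - k" "- (e / 2) <= - (h' r - k)" if "r <= T" for r
      using T1[of r] that T unfolding dist_real_def by linarith+
    have "- (e / 2) * (T - t) <= (h T - k * T) - (h t - k * t)"
      by (rule DERIV_bound_imp_increment[OF t g]) (use a(1) in blast)+
    moreover have "- (e / 2) * (T - t) <= - (h T - k * T) - (- (h t - k * t))"
      by (rule DERIV_bound_imp_increment[OF t g2]) (use a(2) in blast)+
    moreover have "(e / 2) * (T - t) <= (e / 2) * \<bar>t\<bar>" using e t T by (intro mult_left_mono) auto
    moreover have "0 <= e / 2 * \<bar>T\<bar>" using e by simp
    ultimately show ?thesis unfolding C_def by linarith
  qed
  define T2 where "T2 = min T (- (2 * C / e + 1))"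
  have "dist (h t / t) k < e" if t: "t <= T2" for t
  proof -
    have tt: "t <= T" "t < - (2 * C / e)" "t < 0" using t T unfolding T2_def by auto
    have "C < e / 2 * \<bar>t\<bar>" using tt e by (simp add: field_simps)
    then have "\<bar>h t - k * t\<bar> < e * \<bar>t\<bar>" using bound[OF tt(1)] by linarith
    then have "\<bar>h t - k * t\<bar> / \<bar>t\<bar> < e" using tt by (subst pos_divide_less_eq) auto
    moreover have "h t / t - k = (h t - k * t) / t" using tt by (simp add: field_simps)
    ultimately show ?thesis unfolding dist_real_def by (simp only: abs_divide)
  qed
  then show "eventually (%t. dist (h t / t) k < e) at_bot" unfolding eventually_at_bot_linorder by blast
qed

context autonomous_ode
begin

text \<open>\<open>P - p\<close> is at most F(p) / c, and F(p) is the source \<open>y\<close> minus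
  the derivative of the slope. In the majorant the multiple of \<open>y\<close> absorbs the source,
  because y' is at least \<kappa> (P / 2) y near the end.\<close>

lemma simple_root_asymptotics:
  assumes s: "sol z p" and z: "filterlim z at_bot at_bot" and p: "!!t. t <= t0 ==> 0 < p t \<and> p t < P"
    and P: "P > 0" and c: "c > 0" and F: "!!x. 0 <= x ==> x < P ==> c * (P - x) <= F x"
  obtains L where "((%t. z t - P * t) \<longlongrightarrow> L) at_bot"
proof -
  have "(p \<longlongrightarrow> P) at_bot"
  proof (rule slope_tendsto_root[OF s z p _ P])
    fix x assume x: "0 <= x" "x < P"
    then have "0 < c * (P - x)" using c by simp
    then show "0 < F x" using F[OF x] by linarith
  qed
  then obtain t1' where t1': "!!t. t <= t1' ==> p t > P / 2"
    using order_tendstoD(1)[of p P at_bot "P / 2"] P unfolding eventually_at_bot_linorder by auto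
  define t1 where "t1 = min t0 t1'"
  have t1: "0 < p t" "p t < P" "P / 2 < p t" if "t <= t1" for t using p[of t] t1'[of t] that unfolding t1_def by auto
  define y where "y t = F 0 * exp (\<kappa> * z t)" for t
  have y0: "y t > 0" for t unfolding y_def using F0 by simp
  have dy: "DERIV y t :> \<kappa> * p t * y t" for t
    unfolding y_def by (auto intro!: derivative_eq_intros solD(1)[OF s])
  define M where "M = 2 / (c * P * \<kappa>)"
  have M: "M * (\<kappa> * (P / 2)) = 1 / c" "M > 0" unfolding M_def using c P \<kappa> by auto
  show thesis
  proof (rule converges_at_bot_if_dominated[where W="%t. z t - P * t" and W'="%t. p t - P"
        and D="%t. (P - p t) / c + M * y t" and D'="%t. (F (p t) - y t) / c + M * (\<kappa> * p t * y t)", OF _ _ _ _ that])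
    fix t assume t: "t <= t1"
    show "DERIV (%t. z t - P * t) t :> p t - P"
      by (auto intro!: derivative_eq_intros solD(1)[OF s])
    have "DERIV (%t. (P - p t) / c + M * y t) t :> (0 - (y t - F (p t))) / c + M * (\<kappa> * p t * y t)"
      unfolding y_def by (intro DERIV_add DERIV_cdivide DERIV_diff DERIV_const DERIV_cmult solD(2)[OF s] dy[unfolded y_def])
    then show "DERIV (%t. (P - p t) / c + M * y t) t :> (F (p t) - y t) / c + M * (\<kappa> * p t * y t)"
      by simp
    show "0 <= (P - p t) / c + M * y t" using t1[OF t] c M y0[of t] by simp
    have "M * (\<kappa> * (P / 2)) * y t <= M * (\<kappa> * p t) * y t"
      using M \<kappa> t1[OF t] y0[of t] by (intro mult_right_mono mult_left_mono) auto
    then have "y t / c <= M * (\<kappa> * p t * y t)" unfolding M(1) by (simp add: mult.assoc)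
    moreover have "P - p t <= F (p t) / c" using F[of "p t"] t1[OF t] c by (simp add: field_simps)
    ultimately show "\<bar>p t - P\<bar> <= (F (p t) - y t) / c + M * (\<kappa> * p t * y t)"
      using t1[OF t] by (simp add: diff_divide_distrib)
  qed
qed

text \<open>\<open>x = P - p\<close> satisfies x' = k x^2 up to smaller terms, so it behaves like -
  1 / (k t), and integration produces the logarithm. To obtain a limit and not only the leading
  order, \<open>z - P t\<close> is first combined with (1 / k) ln x, which removes the nonintegrable
  term; the limit of t x(t) is inserted afterwards.\<close>

lemma double_root_asymptotics:
  assumes s: "sol z p" and z: "filterlim z at_bot at_bot" and p: "!!t. t <= t0 ==> 0 < p t \<and> p t < P"
    and P: "P > 0" and k: "k > 0" and Fpos: "!!x. 0 <= x ==> x < P ==> F x > 0" and C: "C > 0"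
    and F: "!!x. 0 <= x ==> x < P ==> \<bar>F x - k * (P - x)^2\<bar> <= C * (P - x) ^ 3"
  obtains L where "((%t. z t - (P * t + (1 / k) * ln (- t))) \<longlongrightarrow> L) at_bot"
proof -
  have pP: "(p \<longlongrightarrow> P) at_bot" by (rule slope_tendsto_root[OF s z p Fpos P])
  define x where "x t = P - p t" for t
  have x0: "(x \<longlongrightarrow> 0) at_bot" unfolding x_def using tendsto_diff[OF tendsto_const pP, of P] by simp
  \<comment> \<open>The three bounds ensure that p is at least P / 2, that the cubic error is at
    most half of the quadratic term, and that 2 F(p) is at most \<mu> x.\<close>
  define \<epsilon> where "\<epsilon> = min (P / 2) (min (k / (2 * C)) (\<kappa> * P / (12 * k)))"
  have \<epsilon>: "\<epsilon> > 0" "\<epsilon> <= P / 2" "\<epsilon> <= k / (2 * C)" "\<epsilon> <= \<kappa> * P / (12 * k)"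
    unfolding \<epsilon>_def using P k C \<kappa> by auto
  obtain t1' where t1': "!!t. t <= t1' ==> x t < \<epsilon>"
    using order_tendstoD(2)[OF x0 \<epsilon>(1)] unfolding eventually_at_bot_linorder by auto
  define t1 where "t1 = min t0 t1'"
  have t1: "0 < x t" "x t < P" "x t <= P / 2" "x t <= k / (2 * C)" "x t <= \<kappa> * P / (12 * k)" "0 <= p t" "P / 2 <= p t" if "t <= t1" for t
    using p[of t] t1'[of t] that \<epsilon> unfolding t1_def x_def by auto
  define y where "y t = F 0 * exp (\<kappa> * z t)" for t
  have y0: "y t > 0" for t unfolding y_def using F0 by simp
  have dy: "DERIV y t :> \<kappa> * p t * y t" for t
    unfolding y_def by (auto intro!: derivative_eq_intros solD(1)[OF s])
  have dx: "DERIV x t :> F (p t) - y t" for t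
  proof -
    have "DERIV x t :> 0 - (F 0 * exp (\<kappa> * z t) - F (p t))"
      unfolding x_def by (intro DERIV_diff DERIV_const solD(2)[OF s])
    then show ?thesis unfolding y_def by simp
  qed
  have Fx: "\<bar>F (p t) - k * (x t)^2\<bar> <= C * x t ^ 3" and Fl: "k / 2 * (x t)^2 <= F (p t)" and Fu: "F (p t) <= 3 * k / 2 * (x t)^2" if "t <= t1" for t
  proof -
    note u = t1[OF that]
    show a: "\<bar>F (p t) - k * (x t)^2\<bar> <= C * x t ^ 3" using F[of "p t"] u unfolding x_def by auto
    have "C * x t <= k / 2" using u(4) C by (simp add: field_simps)
    then have "C * x t * (x t)^2 <= k / 2 * (x t)^2" by (rule mult_right_mono) simp
    then have "C * x t ^ 3 <= k / 2 * (x t)^2" by (simp add: power2_eq_square power3_eq_cube mult.assoc)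
    moreover have "3 * k / 2 * (x t)^2 = k * (x t)^2 + k / 2 * (x t)^2" "k * (x t)^2 = k / 2 * (x t)^2 + k / 2 * (x t)^2" by (simp_all add: field_simps)
    ultimately show "k / 2 * (x t)^2 <= F (p t)" "F (p t) <= 3 * k / 2 * (x t)^2" using a by linarith+
  qed
  \<comment> \<open>The source decays exponentially, \<open>x\<close> only like 1 / |t|. The
    quotient makes this quantitative: v' >= \<mu> v forces exponential decay towards
    -\<infinity>.\<close>
  define v where "v t = y t / (x t)^2" for t
  define v' where "v' t = ((\<kappa> * p t * y t) * (x t)^2 - y t * (2 * x t * (F (p t) - y t))) / ((x t)^2)^2" for t
  define \<mu> where "\<mu> = \<kappa> * P / 4"
  have \<mu>: "\<mu> > 0" unfolding \<mu>_def using \<kappa> P by simp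
  have v0: "v t > 0" if "t <= t1" for t unfolding v_def using y0[of t] t1[OF that] by simp
  have dv: "DERIV v t :> v' t" if "t <= t1" for t
    unfolding v_def v'_def using t1[OF that] by (auto intro!: derivative_eq_intros dy dx simp: power2_eq_square)
  have v'_ge: "\<mu> * v t <= v' t" if "t <= t1" for t
  proof -
    note u = t1[OF that]
    have "3 * k * (x t) <= \<mu>" unfolding \<mu>_def using u(5) k by (simp add: field_simps)
    then have "3 * k * (x t) * x t <= \<mu> * x t" by (rule mult_right_mono) (use u in simp)
    then have a: "2 * F (p t) <= \<mu> * x t" using Fu[OF that] by (simp add: power2_eq_square)
    have "\<kappa> * (P / 2) * x t <= \<kappa> * p t * x t" using u \<kappa> by (intro mult_right_mono mult_left_mono) auto
    then have b: "2 * \<mu> * x t <= \<kappa> * p t * x t" unfolding \<mu>_def by (simp add: mult_ac)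
    have "\<mu> * x t <= \<kappa> * p t * x t - 2 * (F (p t) - y t)" using a b y0[of t] by simp
    then have "\<mu> * x t * (y t * x t) <= (\<kappa> * p t * x t - 2 * (F (p t) - y t)) * (y t * x t)"
      by (rule mult_right_mono) (use u y0[of t] in simp)
    then have "(\<mu> * v t) * ((x t)^2)^2 <= (\<kappa> * p t * y t) * (x t)^2 - y t * (2 * x t * (F (p t) - y t))"
      unfolding v_def using u by (simp add: power2_eq_square algebra_simps)
    then show ?thesis unfolding v'_def using u by (simp add: pos_le_divide_eq)
  qed
  have v_lim: "(v \<longlongrightarrow> 0) at_bot"
  proof -
    have le: "v t <= v t1 * exp (\<mu> * (t - t1))" if t: "t <= t1" for t
    proof -
      have "0 * (t1 - t) <= (%t. v t * exp (- \<mu> * t)) t1 - (%t. v t * exp (- \<mu> * t)) t"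
      proof (rule DERIV_bound_imp_increment[where f'="%t. (v' t - \<mu> * v t) * exp (- \<mu> * t)", OF t])
        fix r assume r: "t <= r" "r <= t1"
        show "DERIV (%t. v t * exp (- \<mu> * t)) r :> (v' r - \<mu> * v r) * exp (- \<mu> * r)"
          using dv[OF r(2)] by (auto intro!: derivative_eq_intros simp: algebra_simps)
        show "0 <= (v' r - \<mu> * v r) * exp (- \<mu> * r)" using v'_ge[OF r(2)] by simp
      qed
      then have "v t * exp (- \<mu> * t) * exp (\<mu> * t) <= v t1 * exp (- \<mu> * t1) * exp (\<mu> * t)" by (intro mult_right_mono) auto
      then show ?thesis by (simp add: mult.assoc exp_add[symmetric] algebra_simps)
    qed
    have e: "((%t. v t1 * exp (\<mu> * (t - t1))) \<longlongrightarrow> 0) at_bot"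
    proof -
      have "filterlim (%t. \<mu> * (t - t1)) at_bot at_bot"
      proof (rule filterlim_tendsto_pos_mult_at_bot[OF tendsto_const \<mu>])
        show "filterlim (%t. t - t1) at_bot at_bot"
          unfolding filterlim_at_bot eventually_at_bot_linorder
          by (intro allI, rule_tac x="Z + t1" in exI) auto
      qed
      then have "((%t. exp (\<mu> * (t - t1))) \<longlongrightarrow> 0) at_bot" by (rule filterlim_compose[OF exp_at_bot])
      then show ?thesis using tendsto_mult_right_zero by blast
    qed
    show ?thesis
      by (rule tendsto_sandwich[OF _ _ tendsto_const e]; unfold eventually_at_bot_linorder)
        (use v0 le less_imp_le in blast)+
  qed
  define W where "W t = z t - P * t + (1 / k) * ln (x t)" for t
  define W' where "W' t = p t - P + (1 / k) * ((F (p t) - y t) / x t)" for t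
  define M where "M = 2 / (P * \<kappa>)"
  have M: "M * (\<kappa> * (P / 2)) = 1" "M > 0" unfolding M_def using P \<kappa> by auto
  \<comment> \<open>The first part dominates the cubic error of \<open>F\<close>, the second the
    source divided by \<open>x\<close>.\<close>
  define D where "D t = (2 * C / k^2) * (x t + M * y t) + (P / (k * \<mu>)) * v t" for t
  define D' where "D' t = (2 * C / k^2) * ((F (p t) - y t) + M * (\<kappa> * p t * y t)) + (P / (k * \<mu>)) * v' t" for t
  obtain L where L: "(W \<longlongrightarrow> L) at_bot"
  proof (rule converges_at_bot_if_dominated[of t1 W W' D D'])
    fix t assume t: "t <= t1"
    note u = t1[OF t]
    show "DERIV W t :> W' t"
      unfolding W_def W'_def using u by (auto intro!: derivative_eq_intros solD(1)[OF s] dx)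
    show "DERIV D t :> D' t"
      unfolding D_def D'_def by (intro DERIV_add DERIV_cmult dx dy dv t)
    show "0 <= D t" unfolding D_def using u y0[of t] v0[OF t] C M k P \<mu> by simp
    have "M * (\<kappa> * (P / 2)) * y t <= M * (\<kappa> * p t) * y t"
      using M \<kappa> u y0[of t] by (intro mult_right_mono mult_left_mono) auto
    then have "y t <= M * (\<kappa> * p t * y t)" unfolding M(1) by (simp add: mult.assoc)
    then have "k / 2 * (x t)^2 <= (F (p t) - y t) + M * (\<kappa> * p t * y t)" using Fl[OF t] by linarith
    then have "(2 * C / k^2) * (k / 2 * (x t)^2) <= (2 * C / k^2) * ((F (p t) - y t) + M * (\<kappa> * p t * y t))"
      by (rule mult_left_mono) (use C in simp)
    then have a: "C / k * (x t)^2 <= (2 * C / k^2) * ((F (p t) - y t) + M * (\<kappa> * p t * y t))"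
      using k by (simp add: power2_eq_square)
    have "(P / (k * \<mu>)) * (\<mu> * v t) <= (P / (k * \<mu>)) * v' t" using v'_ge[OF t] P k \<mu> by (intro mult_left_mono) auto
    then have b1: "P / k * v t <= (P / (k * \<mu>)) * v' t" using \<mu> by simp
    have "x t * v t <= P * v t" using u v0[OF t] by (intro mult_right_mono) auto
    then have "(1 / k) * (x t * v t) <= (1 / k) * (P * v t)" using k by (intro mult_left_mono) auto
    moreover have "x t * v t = y t / x t" unfolding v_def using u by (simp add: power2_eq_square)
    ultimately have b: "(1 / k) * (y t / x t) <= (P / (k * \<mu>)) * v' t" using b1 by simp
    have "W' t = - x t + (1 / k) * ((F (p t) - y t) / x t)" unfolding W'_def x_def by simp
    also have "... = (1 / k) * ((F (p t) - k * (x t)^2) / x t) - (1 / k) * (y t / x t)"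
      using u k by (simp add: diff_divide_distrib power2_eq_square right_diff_distrib)
    finally have "W' t = (1 / k) * ((F (p t) - k * (x t)^2) / x t) - (1 / k) * (y t / x t)" .
    then have "\<bar>W' t\<bar> <= \<bar>(1 / k) * ((F (p t) - k * (x t)^2) / x t)\<bar> + \<bar>(1 / k) * (y t / x t)\<bar>" by linarith
    also have "\<bar>(1 / k) * ((F (p t) - k * (x t)^2) / x t)\<bar> = (1 / k) * (\<bar>F (p t) - k * (x t)^2\<bar> / x t)"
      using k u by (simp add: abs_mult)
    also have "... <= (1 / k) * (C * x t ^ 3 / x t)" using Fx[OF t] k u by (intro mult_left_mono divide_right_mono) auto
    also have "... = C / k * (x t)^2" using u by (simp add: power2_eq_square power3_eq_cube)
    also have "\<bar>(1 / k) * (y t / x t)\<bar> = (1 / k) * (y t / x t)" using k u y0[of t] by simp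
    finally show "\<bar>W' t\<bar> <= D' t" unfolding D'_def using a b by linarith
  qed
  define h' where "h' t = - ((F (p t) - y t) / (x t)^2)" for t
  have dh: "DERIV (%t. 1 / x t) t :> h' t" if "t <= t1" for t
    unfolding h'_def using t1[OF that] by (auto intro!: derivative_eq_intros dx simp: power2_eq_square minus_divide_left)
  have "((%t. F (p t) / (x t)^2) \<longlongrightarrow> k) at_bot"
  proof (rule LIM_zero_cancel, rule Lim_null_comparison[OF _ tendsto_mult_right_zero[OF x0, of C]])
    have "norm (F (p t) / (x t)^2 - k) <= C * x t" if "t <= t1" for t
    proof -
      note u = t1[OF that]
      have "F (p t) / (x t)^2 - k = (F (p t) - k * (x t)^2) / (x t)^2" using u by (simp add: field_simps)
      then have "norm (F (p t) / (x t)^2 - k) = \<bar>F (p t) - k * (x t)^2\<bar> / (x t)^2" by simp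
      also have "... <= C * x t ^ 3 / (x t)^2" by (rule divide_right_mono[OF Fx[OF that]]) simp
      also have "... = C * x t" using u by (simp add: power2_eq_square power3_eq_cube)
      finally show ?thesis .
    qed
    then show "eventually (%t. norm (F (p t) / (x t)^2 - k) <= C * x t) at_bot" unfolding eventually_at_bot_linorder by blast
  qed
  then have "((%t. - (F (p t) / (x t)^2 - v t)) \<longlongrightarrow> - (k - 0)) at_bot" by (intro tendsto_intros v_lim)
  then have "(h' \<longlongrightarrow> - k) at_bot" unfolding h'_def v_def by (simp add: diff_divide_distrib)
  then have "((%t. (1 / x t) / t) \<longlongrightarrow> - k) at_bot" by (intro average_tendsto_at_bot[of t1 "%t. 1 / x t" h' "- k"] dh)
  then have "((%t. - ((1 / x t) / t)) \<longlongrightarrow> - (- k)) at_bot" by (rule tendsto_minus)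
  then have "((%t. ln (- ((1 / x t) / t))) \<longlongrightarrow> ln (- (- k))) at_bot" by (rule tendsto_ln) (use k in simp)
  then have "((%t. W t + (1 / k) * ln (- ((1 / x t) / t))) \<longlongrightarrow> L + (1 / k) * ln (- (- k))) at_bot"
    by (intro tendsto_add L tendsto_mult tendsto_const)
  moreover have "eventually (%t. W t + (1 / k) * ln (- ((1 / x t) / t)) = z t - (P * t + (1 / k) * ln (- t))) at_bot"
    unfolding eventually_at_bot_linorder
  proof (intro exI[of _ "min t1 (-1)"] allI impI)
    fix t assume "t <= min t1 (-1)"
    then have t: "t <= t1" "t < 0" by auto
    have "- ((1 / x t) / t) = inverse (x t * (- t))" by (simp add: divide_inverse)
    moreover have "ln (inverse (x t * (- t))) = - ln (x t * (- t))" by (rule ln_inverse)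
    moreover have "ln (x t * (- t)) = ln (x t) + ln (- t)" using t1(1)[OF t(1)] t(2) by (intro ln_mult_pos) auto
    ultimately have "ln (- ((1 / x t) / t)) = - (ln (x t) + ln (- t))" by (simp only:)
    then show "W t + (1 / k) * ln (- ((1 / x t) / t)) = z t - (P * t + (1 / k) * ln (- t))"
      unfolding W_def by (simp only:) (simp add: algebra_simps)
  qed
  ultimately have "((%t. z t - (P * t + (1 / k) * ln (- t))) \<longlongrightarrow> L + (1 / k) * ln (- (- k))) at_bot"
    by (rule Lim_transform_eventually)
  then show thesis by (rule that)
qed

text \<open>An interface hiding the difference between simple and double roots. The condition on
  translations of \<open>A\<close> is what makes every value of the limit attainable by a time
  shift.\<close>

definition end_ok :: "real => (real => real) => bool" where
  "end_ok P A \<longleftrightarrow> P > 0 \<and> F P = 0 \<and> (\<forall>x. 0 <= x \<and> x < P --> F x > 0) \<and>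
     (\<forall>s. ((%t. A (t + s) - A t) \<longlongrightarrow> P * s) at_bot) \<and>
     (\<forall>z p t0. sol z p --> filterlim z at_bot at_bot --> (\<forall>t\<le>t0. 0 < p t \<and> p t < P) -->
        (\<exists>L. ((%t. z t - A t) \<longlongrightarrow> L) at_bot))"

lemma end_okD:
  assumes "end_ok P A"
  shows "P > 0" "F P = 0" "!!x. 0 <= x ==> x < P ==> F x > 0" "((%t. A (t + s) - A t) \<longlongrightarrow> P * s) at_bot"
    "!!z p t0. sol z p ==> filterlim z at_bot at_bot ==> (!!t. t <= t0 ==> 0 < p t \<and> p t < P) ==>
        \<exists>L. ((%t. z t - A t) \<longlongrightarrow> L) at_bot"
proof -
  note d = assms[unfolded end_ok_def]
  show "P > 0" "F P = 0" "!!x. 0 <= x ==> x < P ==> F x > 0" "((%t. A (t + s) - A t) \<longlongrightarrow> P * s) at_bot"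
    using d by auto
  show "\<exists>L. ((%t. z t - A t) \<longlongrightarrow> L) at_bot"
    if "sol z p" "filterlim z at_bot at_bot" "!!t. t <= t0 ==> 0 < p t \<and> p t < P" for z p t0
    using d that by blast
qed

lemma ln_shift_at_bot: "((%t. ln (- (t + s)) - ln (- t)) \<longlongrightarrow> 0) at_bot" for s :: real
proof -
  have "((%t::real. ln (1 + s / t)) \<longlongrightarrow> ln (1 + 0)) at_bot"
    by (intro tendsto_ln tendsto_add tendsto_const) (auto intro!: tendsto_divide_0 filterlim_at_bot_imp_at_infinity filterlim_ident)
  moreover have "eventually (%t. ln (1 + s / t) = ln (- (t + s)) - ln (- t)) at_bot"
    unfolding eventually_at_bot_linorder
  proof (intro exI[of _ "- \<bar>s\<bar> - 1"] allI impI)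
    fix t assume "t <= - \<bar>s\<bar> - 1"
    then have t: "t < 0" "t + s < 0" by auto
    have "ln (- (t + s)) - ln (- t) = ln (- (t + s) / (- t))" using t by (subst ln_div) auto
    also have "- (t + s) / (- t) = 1 + s / t" using t by (simp add: field_simps)
    finally show "ln (1 + s / t) = ln (- (t + s)) - ln (- t)" by simp
  qed
  ultimately show ?thesis using Lim_transform_eventually by fastforce
qed

text \<open>The vanishing logarithmic term gives simple and double roots ends of the same
  shape.\<close>

lemma end_ok_simple:
  assumes "P > 0" "c > 0" "F P = 0" "!!x. 0 <= x ==> x < P ==> c * (P - x) <= F x"
  shows "end_ok P (%t. P * t + 0 * ln (- t))"
  unfolding end_ok_def
proof (intro conjI allI impI assms(1,3))
  fix x assume "0 <= x \<and> x < P"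
  then have "0 < c * (P - x)" "c * (P - x) <= F x" using assms by auto
  then show "0 < F x" by linarith
next
  show "((%t. P * (t + s) + 0 * ln (- (t + s)) - (P * t + 0 * ln (- t))) \<longlongrightarrow> P * s) at_bot" for s
    by (simp add: algebra_simps)
next
  fix z p t0 assume a: "sol z p" "filterlim z at_bot at_bot" "\<forall>t\<le>t0. 0 < p t \<and> p t < P"
  obtain L where "((%t. z t - P * t) \<longlongrightarrow> L) at_bot"
    by (rule simple_root_asymptotics[OF a(1,2) a(3)[rule_format] assms(1,2,4)])
  then show "\<exists>L. ((%t. z t - (P * t + 0 * ln (- t))) \<longlongrightarrow> L) at_bot" by auto
qed

lemma end_ok_double:
  assumes "P > 0" "k > 0" "C > 0" "F P = 0" "!!x. 0 <= x ==> x < P ==> F x > 0"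
    and F: "!!x. 0 <= x ==> x < P ==> \<bar>F x - k * (P - x)^2\<bar> <= C * (P - x) ^ 3"
  shows "end_ok P (%t. P * t + (1 / k) * ln (- t))"
  unfolding end_ok_def
proof (intro conjI allI impI assms(1,4))
  show "0 < F x" if "0 <= x \<and> x < P" for x using assms(5) that by blast
next
  fix s
  have "((%t. P * s + (1 / k) * (ln (- (t + s)) - ln (- t))) \<longlongrightarrow> P * s + (1 / k) * 0) at_bot"
    by (intro tendsto_intros ln_shift_at_bot)
  then show "((%t. P * (t + s) + 1 / k * ln (- (t + s)) - (P * t + 1 / k * ln (- t))) \<longlongrightarrow> P * s) at_bot"
    by (simp add: algebra_simps diff_divide_distrib)
next
  fix z p t0 assume a: "sol z p" "filterlim z at_bot at_bot" "\<forall>t\<le>t0. 0 < p t \<and> p t < P"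
  obtain L where "((%t. z t - (P * t + (1 / k) * ln (- t))) \<longlongrightarrow> L) at_bot"
    by (rule double_root_asymptotics[OF a(1,2) a(3)[rule_format] assms(1,2,5,3) F])
  then show "\<exists>L. ((%t. z t - (P * t + 1 / k * ln (- t))) \<longlongrightarrow> L) at_bot" by blast
qed

lemma end_shift:
  assumes e: "end_ok P A" and l: "((%t. z t - A t) \<longlongrightarrow> L) at_bot"
  shows "((%t. z (t + s) - A t) \<longlongrightarrow> L + P * s) at_bot"
proof -
  have "filterlim (%t::real. t + s) at_bot at_bot"
    unfolding filterlim_at_bot eventually_at_bot_linorder by (intro allI, rule_tac x="Z - s" in exI) auto
  from filterlim_compose[OF l this] have "((%t. z (t + s) - A (t + s)) \<longlongrightarrow> L) at_bot" .
  from tendsto_add[OF this end_okD(4)[OF e, of s]] show ?thesis by (simp add: algebra_simps)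
qed

lemma sol_neg_or_zero:
  assumes s: "sol z p" and B: "!!t. z t <= B" "!!t. \<bar>p t\<bar> <= B"
  shows "(\<forall>t. z t = 0) \<or> (\<forall>t. z t < 0)"
proof (cases "\<exists>t. z t = 0")
  case True
  then obtain t0 where t0: "z t0 = 0" by blast
  have np: "z t <= 0" for t by (rule sol_nonpos[OF s B(1)])
  have "z t = 0" for t by (rule sol_zero_unique[OF s B(2) np t0])
  then show ?thesis by blast
next
  case False
  then show ?thesis using sol_nonpos[OF s B(1)] by (metis less_le)
qed

lemma increasing_end:
  assumes s: "sol z p" and n: "!!t. z t < 0" and e: "end_ok P A" and p: "!!t. t < t0 ==> p t > 0"
  shows "\<exists>L. ((%t. z t - A t) \<longlongrightarrow> L) at_bot"
proof (rule end_okD(5)[OF e s, of "t0 - 1"])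
  show "filterlim z at_bot at_bot" by (rule increasing_at_bot[OF s n, of "t0 - 1"]) (use p in \<open>auto intro: less_imp_le\<close>)
  show "0 < p t \<and> p t < P" if "t <= t0 - 1" for t
    using p[of t] that sol_slope_less[OF s less_imp_le[OF n] end_okD(1)[OF e]] end_okD(2)[OF e] by auto
qed

end

section \<open>Solutions with prescribed ends\<close>

context autonomous_ode
begin

definition clamp :: "real => real => real => real" where "clamp a b x = max a (min b x)"

text \<open>A bounded field gives global solutions and permits the compactness argument; on the
  solutions of interest neither the clamping of the slope nor the cut-off of \<open>z\<close> is
  active.\<close>

lemma clamped_field:
  fixes a b c :: real
  assumes ab: "a <= b"
  defines "H \<equiv> %X :: real \<times> real. (clamp a b (snd X), F 0 * exp (\<kappa> * min (fst X) c) - F (clamp a b (snd X)))"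
  shows "continuous_on UNIV H" "\<exists>M. \<forall>X. norm (H X) <= M"
proof -
  have cF: "continuous_on S F" for S by (intro continuous_at_imp_continuous_on ballI contF)
  have cc: "continuous_on UNIV (%X :: real \<times> real. clamp a b (snd X))"
    unfolding clamp_def by (intro continuous_on_max continuous_on_min continuous_on_const continuous_on_snd continuous_on_id)
  show "continuous_on UNIV H"
    unfolding H_def
    by (intro continuous_on_Pair cc continuous_on_diff continuous_on_mult continuous_on_const continuous_on_exp continuous_on_min
        continuous_on_fst continuous_on_id continuous_on_compose2[OF cF[of UNIV] cc] subset_UNIV)
  have "compact (F ` {a..b})" by (intro compact_continuous_image cF) simp
  then obtain K where K: "!!x. x \<in> {a..b} ==> \<bar>F x\<bar> <= K" using compact_imp_bounded bounded_iff by (metis imageI real_norm_def)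
  have cl: "clamp a b x \<in> {a..b}" for x unfolding clamp_def using ab by auto
  show "\<exists>M. \<forall>X. norm (H X) <= M"
  proof (intro exI allI)
    fix X :: "real \<times> real"
    have "norm (H X) <= \<bar>clamp a b (snd X)\<bar> + \<bar>F 0 * exp (\<kappa> * min (fst X) c) - F (clamp a b (snd X))\<bar>"
      unfolding H_def norm_Pair by (simp add: sqrt_sum_squares_le_sum_abs)
    moreover have "\<bar>clamp a b (snd X)\<bar> <= \<bar>a\<bar> + \<bar>b\<bar>" using cl[of "snd X"] by auto
    moreover have "\<bar>F 0 * exp (\<kappa> * min (fst X) c)\<bar> <= F 0 * exp (\<kappa> * c)" using F0 \<kappa> by (simp add: abs_mult)
    ultimately show "norm (H X) <= \<bar>a\<bar> + \<bar>b\<bar> + F 0 * exp (\<kappa> * c) + K" using K[OF cl[of "snd X"]] by linarith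
  qed
qed

lemma has_vector_derivative_Pair_iff:
  fixes X :: "real => real \<times> real"
  shows "(X has_vector_derivative (a, b)) (at t) \<longleftrightarrow>
     DERIV (%t. fst (X t)) t :> a \<and> DERIV (%t. snd (X t)) t :> b"
proof
  assume a: "(X has_vector_derivative (a, b)) (at t)"
  from bounded_linear.has_vector_derivative[OF bounded_linear_fst a] bounded_linear.has_vector_derivative[OF bounded_linear_snd a]
  show "DERIV (%t. fst (X t)) t :> a \<and> DERIV (%t. snd (X t)) t :> b"
    by (simp add: has_real_derivative_iff_has_vector_derivative)
next
  assume "DERIV (%t. fst (X t)) t :> a \<and> DERIV (%t. snd (X t)) t :> b"
  then show "(X has_vector_derivative (a, b)) (at t)"
    using has_vector_derivative_Pair[of "%t. fst (X t)" a t UNIV "%t. snd (X t)" b]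
    by (simp add: has_real_derivative_iff_has_vector_derivative)
qed

text \<open>The clamped equation has global solutions; a sign argument shows that the clamping is not active.\<close>

lemma peaked_solution_exists:
  assumes P: "P > 0" "F P = 0" "P' > 0" "F (- P') = 0" and m: "m > 0"
  obtains z p where "sol z p" "z 0 = - m" "p 0 = 0" "!!t. - P' < p t \<and> p t < P" "!!t. t < 0 ==> p t > 0"
    "!!t. t > 0 ==> p t < 0" "!!t. z t <= - m"
proof -
  let ?cl = "clamp (- P') P"
  define H where "H X = (?cl (snd X), F 0 * exp (\<kappa> * min (fst X) (- m)) - F (?cl (snd X)))" for X :: "real \<times> real"
  have ab: "- P' <= P" using P by simp
  have cH: "continuous_on UNIV H" unfolding H_def by (rule clamped_field(1)[OF ab])
  obtain M where M: "!!X. norm (H X) <= M" unfolding H_def using clamped_field(2)[OF ab] by blast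
  obtain X where X: "X 0 = (- m, 0)" "!!t. (X has_vector_derivative H (X t)) (at t)" using peano[OF cH M, of "(- m, 0)"] by blast
  define z where "z t = fst (X t)" for t
  define p where "p t = snd (X t)" for t
  have z0: "z 0 = - m" and p0: "p 0 = 0" unfolding z_def p_def using X(1) by auto
  have "DERIV (%t. fst (X t)) t :> ?cl (p t) \<and>
      DERIV (%t. snd (X t)) t :> F 0 * exp (\<kappa> * min (z t) (- m)) - F (?cl (p t))" for t
    using X(2)[of t] unfolding H_def has_vector_derivative_Pair_iff p_def z_def .
  then have dz: "DERIV z t :> ?cl (p t)"
    and dp: "DERIV p t :> F 0 * exp (\<kappa> * min (z t) (- m)) - F (?cl (p t))" for t
    unfolding z_def[abs_def] p_def[abs_def] by auto
  have cl: "?cl x = x" if "- P' <= x" "x <= P" for x unfolding clamp_def using that by auto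
  have clP: "?cl P = P" "?cl (- P') = - P'" "?cl 0 = 0" using P by (auto intro: cl)
  have lev0: "F 0 * exp (\<kappa> * min (z t) (- m)) - F (?cl (p t)) < 0" if "p t = 0" for t
  proof -
    have "\<kappa> * min (z t) (- m) < 0" using \<kappa> m by (intro mult_pos_neg) auto
    then show ?thesis using that clP F0 by simp
  qed
  have posE: "F 0 * exp (\<kappa> * min (z t) (- m)) > 0" for t using F0 by simp
  have neg: "p t < 0" if "t > 0" for t
    by (rule less_if_neg_deriv_at_level[OF dp lev0 _ that]) (simp_all add: p0)
  have pos: "p t > 0" if "t < 0" for t
  proof (rule ccontr)
    assume "\<not> p t > 0"
    then have "p 0 < 0" by (intro less_if_neg_deriv_at_level[OF dp lev0 _ that]) simp_all
    then show False using p0 by simp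
  qed
  \<comment> \<open>At slope \<open>P\<close> the clamped field still points upwards, so a slope
    that reached \<open>P\<close> before time 0 could not be 0 at time 0.\<close>
  have ltP: "p t < P" for t
  proof (cases "t < 0")
    case True
    show ?thesis
    proof (rule ccontr)
      assume "\<not> p t < P"
      then have "- p 0 < - P"
        by (intro less_if_neg_deriv_at_level[where f="%t. - p t", OF DERIV_minus[OF dp] _ _ True]) (use clP P posE in auto)
      then show False using p0 P by simp
    qed
  next
    case False
    then show ?thesis using neg[of t] p0 P by (cases "t = 0") auto
  qed
  have gtP: "- P' < p t" for t
  proof (cases "t > 0")
    case True
    show ?thesis
    proof (rule ccontr)
      assume a: "\<not> - P' < p t"
      have d: "DERIV (%s. p (- s)) s :> - (F 0 * exp (\<kappa> * min (z (- s)) (- m)) - F (?cl (p (- s))))" for s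
        using DERIV_mirror[of p "F 0 * exp (\<kappa> * min (z (- s)) (- m)) - F (?cl (p (- s)))" s] dp[of "- s"] by simp
      have nt: "- t < 0" using True by simp
      have "p (- 0) < - P'"
        by (rule less_if_neg_deriv_at_level[where f="%s. p (- s)", OF d _ _ nt]) (use clP P posE a in auto)
      then show False using p0 P by simp
    qed
  next
    case False
    then show ?thesis using pos[of t] p0 P by (cases "t = 0") auto
  qed
  have clp: "?cl (p t) = p t" for t using ltP[of t] gtP[of t] by (intro cl) auto
  have zm: "z t <= - m" for t
  proof (cases "t <= 0")
    case True
    have "0 * (0 - t) <= z 0 - z t"
    proof (rule DERIV_bound_imp_increment[OF True dz])
      fix r :: real assume "r <= 0"
      then show "0 <= ?cl (p r)" using pos[of r] p0 clp[of r] by (cases "r = 0") auto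
    qed
    then show ?thesis using z0 by simp
  next
    case False
    then have t: "0 <= t" by simp
    have "0 * (t - 0) <= - z t - (- z 0)"
    proof (rule DERIV_bound_imp_increment[OF t DERIV_minus[OF dz]])
      fix r :: real assume "0 <= r"
      then show "0 <= - ?cl (p r)" using neg[of r] p0 clp[of r] by (cases "r = 0") auto
    qed
    then show ?thesis using z0 by simp
  qed
  have "sol z p"
    unfolding sol_def using dz dp zm by (auto simp: clp min_absorb1)
  then show thesis by (intro that[of z p] z0 p0 conjI ltP gtP pos neg zm)
qed

text \<open>Given the bounds on the slopes and the sign of \<open>z\<close>, each solution also
  solves a clamped equation, whose field is bounded.\<close>

lemma sol_compactness:
  fixes z p :: "nat => real => real"
  assumes s: "!!n. sol (z n) (p n)" and n: "!!n t. z n t <= 0" and b: "!!n t. a <= p n t \<and> p n t <= b" and M0: "!!n. \<bar>z n 0\<bar> <= M0"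
  obtains k z' p' where "strict_mono (k :: nat => nat)" "!!t. (%n. z (k n) t) \<longlonglongrightarrow> z' t" "!!t. (%n. p (k n) t) \<longlonglongrightarrow> p' t"
    "sol z' p'"
proof -
  define H where "H X = (clamp a b (snd X), F 0 * exp (\<kappa> * min (fst X) 0) - F (clamp a b (snd X)))" for X :: "real \<times> real"
  have ab: "a <= b" using b[of 0 0] by simp
  have cH: "continuous_on UNIV H" unfolding H_def by (rule clamped_field(1)[OF ab])
  obtain M where M: "!!X. norm (H X) <= M" unfolding H_def using clamped_field(2)[OF ab] by blast
  define X where "X n t = (z n t, p n t)" for n t
  have Hx: "H (x, y) = (y, F 0 * exp (\<kappa> * x) - F y)" if "x <= 0" "a <= y" "y <= b" for x y
    unfolding H_def clamp_def using that by (simp add: min_absorb1 min_absorb2 max_absorb2)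
  have "(X n has_vector_derivative H (X n t)) (at t)" for n t
    unfolding X_def Hx[OF n[of n t] conjunct1[OF b[of n t]] conjunct2[OF b[of n t]]] has_vector_derivative_Pair_iff
    using solD[OF s[of n]] by simp
  then have ap: "approx_sol H M 0 (X n)" for n by (intro exact_approx_sol)
  have X0: "norm (X n 0) <= M0 + (\<bar>a\<bar> + \<bar>b\<bar>)" for n
  proof -
    have "norm (X n 0) <= \<bar>z n 0\<bar> + \<bar>p n 0\<bar>" unfolding X_def norm_Pair by (simp add: sqrt_sum_squares_le_sum_abs)
    then show ?thesis using M0[of n] b[of n 0] by linarith
  qed
  obtain k Y where k: "strict_mono (k :: nat => nat)" and Y: "!!t. (%n. X (k n) t) \<longlonglongrightarrow> Y t"
    and dY: "!!t. (Y has_vector_derivative H (Y t)) (at t)"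
    by (rule ode_compactness[where h="%_. 0" and X=X, OF cH M ap _ _ _ X0]) auto
  have lz: "(%n. z (k n) t) \<longlonglongrightarrow> fst (Y t)" and lp: "(%n. p (k n) t) \<longlonglongrightarrow> snd (Y t)" for t
    using tendsto_fst[OF Y[of t]] tendsto_snd[OF Y[of t]] unfolding X_def by auto
  have "fst (Y t) <= 0" for t by (rule LIMSEQ_le_const2[OF lz]) (use n in auto)
  moreover have "a <= snd (Y t)" for t by (rule LIMSEQ_le_const[OF lp]) (use b in auto)
  moreover have "snd (Y t) <= b" for t by (rule LIMSEQ_le_const2[OF lp]) (use b in auto)
  ultimately have "H (Y t) = (snd (Y t), F 0 * exp (\<kappa> * fst (Y t)) - F (snd (Y t)))" for t
    using Hx[of "fst (Y t)" "snd (Y t)"] by simp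
  then have "sol (%t. fst (Y t)) (%t. snd (Y t))"
    unfolding sol_def using dY by (metis has_vector_derivative_Pair_iff)
  then show thesis using that[OF k lz lp] by blast
qed

text \<open>The set of times where both solutions agree with their slopes is closed, and open by
  Gronwall's inequality. The Lipschitz condition is local and inside the open slope range: at an end
  of the range, where the gradient of \<open>u\<close> may vanish, it can fail.\<close>

lemma sol_unique:
  assumes s: "sol z1 p1" "sol z2 p2" and n: "!!t. z1 t <= 0" "!!t. z2 t <= 0"
    and ab: "!!t. a < p1 t \<and> p1 t < b"
    and lip: "!!x. a < x ==> x < b ==> \<exists>d>0. \<exists>C. \<forall>y y'. \<bar>y - x\<bar> < d --> \<bar>y' - x\<bar> < d --> \<bar>F y - F y'\<bar> <= C * \<bar>y - y'\<bar>"
    and i: "z1 t1 = z2 t1" "p1 t1 = p2 t1"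
  shows "z1 t = z2 t"
proof -
  define S where "S = {t. z1 t = z2 t} \<inter> {t. p1 t = p2 t}"
  have "closed S" unfolding S_def
    by (intro closed_Int closed_Collect_eq sol_cont[OF s(1)] sol_cont[OF s(2)])
  moreover have "open S"
    unfolding open_dist
  proof
    fix t0 assume "t0 \<in> S"
    then have t0: "z1 t0 = z2 t0" "p1 t0 = p2 t0" unfolding S_def by auto
    obtain d C where d: "d > 0" and C: "!!y y'. \<bar>y - p1 t0\<bar> < d ==> \<bar>y' - p1 t0\<bar> < d ==> \<bar>F y - F y'\<bar> <= C * \<bar>y - y'\<bar>"
      using lip[of "p1 t0"] ab[of t0] by blast
    have c: "isCont p1 t0" "isCont p2 t0" using DERIV_isCont solD(2) s by blast+
    obtain r1 where r1: "r1 > 0" "!!t. \<bar>t - t0\<bar> < r1 ==> \<bar>p1 t - p1 t0\<bar> < d"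
      using c(1) d unfolding continuous_at_eps_delta dist_real_def by blast
    obtain r2 where r2: "r2 > 0" "!!t. \<bar>t - t0\<bar> < r2 ==> \<bar>p2 t - p2 t0\<bar> < d"
      using c(2) d unfolding continuous_at_eps_delta dist_real_def by blast
    define r where "r = min r1 r2"
    have r: "r > 0" unfolding r_def using r1 r2 by simp
    define E where "E t = (z1 t - z2 t)^2 + (p1 t - p2 t)^2" for t
    define D where "D t = (F 0 * exp (\<kappa> * z1 t) - F (p1 t)) - (F 0 * exp (\<kappa> * z2 t) - F (p2 t))" for t
    define E' where "E' t = 2 * ((z1 t - z2 t) * (p1 t - p2 t)) + 2 * ((p1 t - p2 t) * D t)" for t
    define K where "K = 1 + F 0 * \<kappa> + 2 * \<bar>C\<bar>"
    have dE: "DERIV E t :> E' t" for t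
      unfolding E_def E'_def D_def by (auto intro!: derivative_eq_intros solD[OF s(1)] solD[OF s(2)] simp: algebra_simps)
    have bE: "\<bar>E' t\<bar> <= K * E t" if t: "\<bar>t - t0\<bar> < r" for t
    proof -
      have "\<bar>exp (\<kappa> * z1 t) - exp (\<kappa> * z2 t)\<bar> <= \<bar>\<kappa> * z1 t - \<kappa> * z2 t\<bar>"
        by (rule exp_lipschitz_nonpos) (use n \<kappa> in \<open>auto simp: mult_nonneg_nonpos\<close>)
      also have "... = \<kappa> * \<bar>z1 t - z2 t\<bar>" using \<kappa> by (simp add: abs_mult right_diff_distrib[symmetric])
      finally have "F 0 * \<bar>exp (\<kappa> * z1 t) - exp (\<kappa> * z2 t)\<bar> <= F 0 * (\<kappa> * \<bar>z1 t - z2 t\<bar>)" using F0 by (intro mult_left_mono) auto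
      then have a: "\<bar>F 0 * exp (\<kappa> * z1 t) - F 0 * exp (\<kappa> * z2 t)\<bar> <= F 0 * \<kappa> * \<bar>z1 t - z2 t\<bar>"
        using F0 by (simp add: right_diff_distrib[symmetric] abs_mult)
      have "\<bar>F (p1 t) - F (p2 t)\<bar> <= C * \<bar>p1 t - p2 t\<bar>"
        by (rule C) (use r1(2)[of t] r2(2)[of t] t t0 in \<open>auto simp: r_def\<close>)
      also have "... <= \<bar>C\<bar> * \<bar>p1 t - p2 t\<bar>" by (intro mult_right_mono) auto
      finally have "\<bar>D t\<bar> <= F 0 * \<kappa> * \<bar>z1 t - z2 t\<bar> + \<bar>C\<bar> * \<bar>p1 t - p2 t\<bar>" unfolding D_def using a by linarith
      then show ?thesis unfolding E_def E'_def K_def by (rule energy_derivative_le) (use F0 \<kappa> in auto)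
    qed
    have "E t = 0" if t: "\<bar>t - t0\<bar> < r" for t
    proof -
      have "E t <= E t0 * exp (K * \<bar>t - t0\<bar>)" by (rule gronwall[OF dE bE]) (use t in simp)
      then have "E t <= 0" unfolding E_def[of t0] t0 by simp
      moreover have "0 <= E t" unfolding E_def by simp
      ultimately show ?thesis by simp
    qed
    then have "t \<in> S" if t: "\<bar>t - t0\<bar> < r" for t using t unfolding E_def S_def by (simp add: add_nonneg_eq_0_iff)
    then show "\<exists>e>0. \<forall>y. dist y t0 < e --> y \<in> S" using r unfolding dist_real_def by blast
  qed
  moreover have "t1 \<in> S" using i unfolding S_def by simp
  ultimately have "S = UNIV" using clopen[of S] by auto
  then show ?thesis unfolding S_def by auto
qed

end

context autonomous_ode
begin

section \<open>Existence and classification with one decaying end\<close>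

lemma sol_limit_at_bot:
  assumes e: "end_ok P A" and l: "(A \<longlongrightarrow> l) at_bot" shows False
proof -
  have "filterlim (%t::real. t + 1) at_bot at_bot"
    unfolding filterlim_at_bot eventually_at_bot_linorder by (intro allI, rule_tac x="Z - 1" in exI) auto
  from tendsto_diff[OF filterlim_compose[OF l this] l] have "((%t. A (t + 1) - A t) \<longlongrightarrow> 0) at_bot" by simp
  from tendsto_unique[OF trivial_limit_at_bot_linorder this end_okD(4)[OF e, of 1]] end_okD(1)[OF e]
  show False by simp
qed

text \<open>Normalising the value at time 0 keeps the limit of the peaked solutions from being
  trivial, and the energy estimate sends their peaks to +\<infinity>, so no decreasing part
  remains.\<close>

lemma increasing_solution_exists:
  assumes P: "P > 0" "F P = 0"
  obtains z p where "sol z p" "!!t. z t < 0" "!!t. 0 < p t \<and> p t < P"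
proof -
  \<comment> \<open>Peaked solutions require roots on both sides of 0, but \<open>F\<close> may have
    none at negative slopes. There it is replaced by an affine function with root -1; the limit has
    nonnegative slope and solves the original equation.\<close>
  define G where "G x = (if 0 <= x then F x else F 0 * (1 + x))" for x
  have G0: "G 0 = F 0" unfolding G_def by simp
  interpret G: autonomous_ode \<kappa> G
  proof
    show "isCont G x" for x
    proof -
      have "continuous_on ({0..} \<union> {..0}) G"
        unfolding G_def
        by (rule continuous_on_If[where s="{0..}" and t="{..0}", simplified]) 
           (auto intro!: continuous_intros continuous_at_imp_continuous_on contF)
      moreover have "{0..} \<union> {..0} = (UNIV :: real set)" by auto
      ultimately show ?thesis by (simp add: continuous_on_eq_continuous_at)
    qed
    fix B
    obtain C where C: "!!x. \<bar>x\<bar> <= B ==> \<bar>F x - F 0\<bar> <= C * \<bar>x\<bar>" using F_lip by blast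
    have "\<bar>G x - G 0\<bar> <= max C (F 0) * \<bar>x\<bar>" if "\<bar>x\<bar> <= B" for x
    proof (cases "0 <= x")
      case True
      then have "\<bar>G x - G 0\<bar> <= C * \<bar>x\<bar>" unfolding G_def using C[OF that] by simp
      also have "... <= max C (F 0) * \<bar>x\<bar>" by (intro mult_right_mono) auto
      finally show ?thesis .
    next
      case False
      then have "\<bar>G x - G 0\<bar> = F 0 * \<bar>x\<bar>" unfolding G_def using F0 by (simp add: algebra_simps abs_mult)
      also have "... <= max C (F 0) * \<bar>x\<bar>" by (intro mult_right_mono) auto
      finally show ?thesis .
    qed
    then show "\<exists>C. \<forall>x. \<bar>x\<bar> <= B --> \<bar>G x - G 0\<bar> <= C * \<bar>x\<bar>" by blast
  qed (use \<kappa> F0 G0 in auto)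
  have GP: "G P = 0" "G (- 1) = 0" unfolding G_def using P by auto
  \<comment> \<open>The \<open>+ 2\<close> puts every maximal value strictly above -1, so each
    solution takes the value -1 before its peak.\<close>
  define m where "m n = 1 / real (n + 2)" for n :: nat
  have m: "0 < m n" "m n < 1" for n unfolding m_def by auto
  have "\<exists>y q T. G.sol y q \<and> (\<forall>t. y t < 0) \<and> (\<forall>t. - 1 < q t \<and> q t < P) \<and> y 0 = - 1 \<and> T > 0 \<and> (\<forall>t<T. q t > 0) \<and> y T = - m n \<and> q T = 0" for n
  proof -
    obtain z p where zp: "G.sol z p" "z 0 = - m n" "p 0 = 0" "!!t. - 1 < p t \<and> p t < P" "!!t. t < 0 ==> p t > 0"
      "!!t. t > 0 ==> p t < 0" "!!t. z t <= - m n"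
      using G.peaked_solution_exists[OF P(1) GP(1) zero_less_one GP(2) m(1)[of n]] by blast
    have zn: "z t < 0" for t using zp(7)[of t] m(1)[of n] by linarith
    have "filterlim z at_bot at_bot" by (rule G.increasing_at_bot[OF zp(1) zn, of "- 1"]) (use zp(5) in \<open>auto intro: less_imp_le\<close>)
    then obtain t1 where t1: "!!t. t <= t1 ==> z t <= - 1" unfolding filterlim_at_bot eventually_at_bot_linorder by blast
    have "\<exists>t\<ge>min t1 0. t <= 0 \<and> z t = - 1"
      by (rule IVT') (use t1 zp(2) m[of n] in \<open>auto intro: G.sol_cont[OF zp(1)]\<close>)
    then obtain t2 where t2: "t2 <= 0" "z t2 = - 1" by blast
    have t2n: "t2 < 0" using t2 zp(2) m[of n] by (cases "t2 = 0") auto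
    show ?thesis
      by (rule exI[of _ "%t. z (t + t2)"], rule exI[of _ "%t. p (t + t2)"], rule exI[of _ "- t2"])
        (use G.sol_shift[OF zp(1), of t2] zn zp t2 t2n in auto)
  qed
  then obtain y q T where y: "!!n. G.sol (y n) (q n)" "!!n t. y n t < 0" "!!n t. - 1 < q n t \<and> q n t < P" "!!n. y n 0 = - 1"
    "!!n. T n > 0" "!!n t. t < T n ==> q n t > 0" "!!n. y n (T n) = - m n" "!!n. q n (T n) = 0" by metis
  have mlim: "m \<longlonglongrightarrow> 0" unfolding m_def using LIMSEQ_ignore_initial_segment[OF lim_1_over_n, of 2] by simp
  \<comment> \<open>The energy is \<open>(m n)^2\<close> at the peak and at least 1 at time 0, so
    the time between them tends to infinity as \<open>m n\<close> tends to 0.\<close>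
  have big: "eventually (%n. t < T n) sequentially" for t
  proof -
    obtain C where C: "C >= 0" "!!z p s t. G.sol z p ==> (\<forall>t. \<bar>p t\<bar> <= max 1 P) ==> (\<forall>t. z t <= 0) ==>
        (z t)^2 + (p t)^2 <= ((z s)^2 + (p s)^2) * exp (C * \<bar>t - s\<bar>)"
      using G.sol_energy_growth[of "max 1 P"] by blast
    have "(%n. (m n)^2 * exp (C * \<bar>t\<bar>)) \<longlonglongrightarrow> 0^2 * exp (C * \<bar>t\<bar>)" by (intro tendsto_intros mlim)
    then have "eventually (%n. (m n)^2 * exp (C * \<bar>t\<bar>) < 1) sequentially" by (rule order_tendstoD(2)) simp
    then show ?thesis
    proof (rule eventually_mono)
      fix n assume a: "(m n)^2 * exp (C * \<bar>t\<bar>) < 1"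
      have "\<forall>t. \<bar>q n t\<bar> <= max 1 P" using y(3)[of n] by (auto simp: abs_le_iff) (smt (verit, best))+
      then have "(y n 0)^2 + (q n 0)^2 <= ((y n (T n))^2 + (q n (T n))^2) * exp (C * \<bar>0 - T n\<bar>)"
        using y(2)[of n] by (intro C(2)[OF y(1)]) (auto intro: less_imp_le)
      then have "1 + (q n 0)^2 <= (m n)^2 * exp (C * T n)" using y(4,5,7,8)[of n] by simp
      then have "1 <= (m n)^2 * exp (C * T n)" using zero_le_power2[of "q n 0"] by linarith
      then have "(m n)^2 * exp (C * \<bar>t\<bar>) < (m n)^2 * exp (C * T n)" using a by linarith
      then have "C * \<bar>t\<bar> < C * T n" using m(1)[of n] by simp
      then have "\<bar>t\<bar> < T n" using C(1) by (simp add: mult_less_cancel_left)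
      then show "t < T n" by simp
    qed
  qed
  have y0: "y n t <= 0" for n t using y(2)[of n t] by simp
  have qb: "- 1 <= q n t \<and> q n t <= P" for n t using y(3)[of n t] by simp
  have y1: "\<bar>y n 0\<bar> <= 1" for n using y(4)[of n] by simp
  obtain k z p where k: "strict_mono (k :: nat => nat)" and lz: "!!t. (%n. y (k n) t) \<longlonglongrightarrow> z t" and lp: "!!t. (%n. q (k n) t) \<longlonglongrightarrow> p t"
    and s: "G.sol z p"
    using G.sol_compactness[of y q, OF y(1) y0 qb y1] by blast
  have z0: "z 0 = - 1" using LIMSEQ_unique[OF lz[of 0]] y(4) by simp
  have zn: "z t <= 0" for t by (rule LIMSEQ_le_const2[OF lz]) (use y0 in auto)
  have pn: "0 <= p t" for t
  proof (rule tendsto_lowerbound[OF lp])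
    have "eventually (%n. t < T (k n)) sequentially"
      using filterlim_subseq[OF k] big[of t] unfolding filterlim_iff by blast
    then show "eventually (%n. 0 <= q (k n) t) sequentially" by (rule eventually_mono) (use y(6) less_imp_le in blast)
  qed simp
  have "G (p t) = F (p t)" for t unfolding G_def using pn[of t] by simp
  then have sF: "sol z p" using s unfolding G.sol_def sol_def G0 by simp
  have pb: "p t <= P" for t by (rule LIMSEQ_le_const2[OF lp]) (use qb in auto)
  have "(\<forall>t. z t = 0) \<or> (\<forall>t. z t < 0)"
    by (rule sol_neg_or_zero[OF sF, of P]) (use zn pn pb P in \<open>auto intro: order_trans[of _ 0]\<close>)
  then have zneg: "z t < 0" for t using z0 by (metis zero_neq_neg_one)
  have "0 < p t" for t
    using sol_sign_cases[OF sF zneg]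
  proof (elim disjE exE conjE)
    assume "\<forall>t. p t < 0" then show ?thesis using pn[of 0] by (simp add: not_le[symmetric])
  next
    fix t0 assume "\<forall>t>t0. p t < 0" then have "p (t0 + 1) < 0" by simp
    then show ?thesis using pn[of "t0 + 1"] by linarith
  qed auto
  moreover have "p t < P" for t by (rule sol_slope_less[OF sF zn P(1)]) (use P in simp)
  ultimately show thesis using that[OF sF zneg] by blast
qed

lemma end_increasing_exists:
  assumes e: "end_ok P A"
  obtains z p where "sol z p" "!!t. z t <= 0" "!!t. 0 < p t \<and> p t < P" "((%t. z t - A t) \<longlongrightarrow> L) at_bot" "(z \<longlongrightarrow> 0) at_top"
proof -
  obtain z p where s: "sol z p" and n: "!!t. z t < 0" and p: "!!t. 0 < p t \<and> p t < P"
    using increasing_solution_exists[OF end_okD(1,2)[OF e]] by blast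
  obtain L0 where L0: "((%t. z t - A t) \<longlongrightarrow> L0) at_bot" using increasing_end[OF s n e, of 0] p by blast
  have top: "(z \<longlongrightarrow> 0) at_top" by (rule increasing_at_top[OF s n, of 0]) (use p in \<open>auto intro: less_imp_le\<close>)
  define a where "a = (L - L0) / P"
  have a: "L0 + P * a = L" unfolding a_def using end_okD(1)[OF e] by simp
  have "filterlim (%t::real. t + a) at_top at_top"
    unfolding filterlim_at_top eventually_at_top_linorder by (intro allI, rule_tac x="Z - a" in exI) auto
  from filterlim_compose[OF top this] have "((%t. z (t + a)) \<longlongrightarrow> 0) at_top" .
  moreover have "((%t. z (t + a) - A t) \<longlongrightarrow> L) at_bot" using end_shift[OF e L0, of a] unfolding a .
  ultimately show thesis using that[OF sol_shift[OF s]] n p less_imp_le by blast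
qed

text \<open>With vanishing limits this is uniqueness; in general it is stability in the supremum
  norm with respect to the behaviour at the ends, as needed in \<open>peaked_limit\<close>.\<close>

lemma two_sided_comparison:
  assumes s: "sol z1 p1" "sol z2 p2" and l: "((%t. z1 t - z2 t) \<longlongrightarrow> a) at_bot" "((%t. z1 t - z2 t) \<longlongrightarrow> b) at_top"
    and c: "\<bar>a\<bar> <= c" "\<bar>b\<bar> <= c"
  shows "\<bar>z1 t - z2 t\<bar> <= c"
proof -
  have "z1 t - z2 t <= c" by (rule comparison[OF s l]) (use c in auto)
  moreover have "z2 t - z1 t <= c"
    by (rule comparison[OF s(2,1), of "- a" "- b"]) (use tendsto_minus[OF l(1)] tendsto_minus[OF l(2)] c in auto)
  ultimately show ?thesis by simp
qed

text \<open>A decreasing tail would tend to -\<infinity>, which \<open>not_decreasing_at_top\<close>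
  excludes; among the sign patterns only the increasing one is left.\<close>

lemma sol_cases_one_end:
  assumes s: "sol z p" and B: "!!t. z t <= B" "!!t. \<bar>p t\<bar> <= B" and e: "end_ok P A" and F: "!!x. x <= 0 ==> F x > 0"
  shows "(\<forall>t. z t = 0) \<or> (\<exists>L. ((%t. z t - A t) \<longlongrightarrow> L) at_bot) \<and> (z \<longlongrightarrow> 0) at_top"
proof (cases "\<forall>t. z t = 0")
  case False
  then have n: "z t < 0" for t using sol_neg_or_zero[OF s B] by blast
  have no: False if "!!t. t0 < t ==> p t < 0" for t0
  proof (rule not_decreasing_at_top[OF s _ _ B(2) F])
    show "p t <= 0" if "t0 + 1 <= t" for t using that \<open>!!t. t0 < t ==> p t < 0\<close>[of t] by simp
    interpret R: autonomous_ode \<kappa> "%x. F (- x)" by (rule autonomous_ode_reverse)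
    have "filterlim (%t. z (- t)) at_bot at_bot"
    proof (rule R.increasing_at_bot[OF sol_reverse[OF s], of "- t0 - 1"])
      show "0 <= - p (- t)" if "t <= - t0 - 1" for t using \<open>!!t. t0 < t ==> p t < 0\<close>[of "- t"] that by simp
    qed (rule n)
    then show "filterlim z at_bot at_top" by (simp add: filterlim_at_top_mirror)
  qed
  have p: "0 < p t" for t
    using sol_sign_cases[OF s n] no by blast
  have "\<exists>L. ((%t. z t - A t) \<longlongrightarrow> L) at_bot" by (rule increasing_end[OF s n e, of 0]) (rule p)
  moreover have "(z \<longlongrightarrow> 0) at_top" by (rule increasing_at_top[OF s n, of 0]) (use p less_imp_le in blast)
  ultimately show ?thesis by blast
qed simp

end

text \<open>The Lipschitz condition is imposed on exactly the open interval to which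
  \<open>slope_bounds\<close> confines the slopes of nonpositive solutions.\<close>

locale two_ends = autonomous_ode +
  fixes P A P' A'
  assumes e: "end_ok P A" and e': "autonomous_ode.end_ok \<kappa> (%x. F (- x)) P' A'"
    and lip: "!!x. - P' < x ==> x < P ==> \<exists>d>0. \<exists>C. \<forall>y y'. \<bar>y - x\<bar> < d --> \<bar>y' - x\<bar> < d --> \<bar>F y - F y'\<bar> <= C * \<bar>y - y'\<bar>"
begin

sublocale R: autonomous_ode \<kappa> "%x. F (- x)" by (rule autonomous_ode_reverse)

lemma P: "P > 0" "F P = 0" "P' > 0" "F (- P') = 0"
  using end_okD(1,2)[OF e] R.end_okD(1,2)[OF e'] by auto

lemma decreasing_end:
  assumes s: "sol z p" and n: "!!t. z t < 0" and p: "!!t. t0 < t ==> p t < 0"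
  shows "\<exists>M. ((%t. z t - A' (- t)) \<longlongrightarrow> M) at_top"
proof -
  have "\<exists>M. ((%t. z (- t) - A' t) \<longlongrightarrow> M) at_bot"
    by (rule R.increasing_end[OF sol_reverse[OF s] n e', of "- t0"]) (use p in simp)
  then show ?thesis by (simp add: filterlim_at_top_mirror)
qed

lemma slope_bounds:
  assumes s: "sol z p" and n: "!!t. z t <= 0"
  shows "- P' < p t \<and> p t < P"
proof -
  have "p t < P" by (rule sol_slope_less[OF s n P(1)]) (use P in simp)
  moreover have "- p (- (- t)) < P'" by (rule R.sol_slope_less[OF sol_reverse[OF s] n P(3)]) (use P in simp)
  ultimately show ?thesis by simp
qed

lemma sol_cases_two_ends:
  assumes s: "sol z p" and B: "!!t. z t <= B" "!!t. \<bar>p t\<bar> <= B"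
  shows "(\<forall>t. z t = 0) \<or> (\<exists>L. ((%t. z t - A t) \<longlongrightarrow> L) at_bot) \<and> (z \<longlongrightarrow> 0) at_top \<or>
    (z \<longlongrightarrow> 0) at_bot \<and> (\<exists>M. ((%t. z t - A' (- t)) \<longlongrightarrow> M) at_top) \<or>
    (\<exists>L. ((%t. z t - A t) \<longlongrightarrow> L) at_bot) \<and> (\<exists>M. ((%t. z t - A' (- t)) \<longlongrightarrow> M) at_top)"
proof (cases "\<forall>t. z t = 0")
  case False
  then have n: "z t < 0" for t using sol_neg_or_zero[OF s B] by blast
  from sol_sign_cases[OF s n] consider "!!t. p t > 0" | "!!t. p t < 0" | t0 where "!!t. t < t0 ==> p t > 0" "!!t. t > t0 ==> p t < 0"
    by blast
  then show ?thesis
  proof cases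
    case 1
    then show ?thesis using increasing_end[OF s n e, of 0] increasing_at_top[OF s n, of 0] less_imp_le by blast
  next
    case 2
    have "((%t. z (- t)) \<longlongrightarrow> 0) at_top"
      by (rule R.increasing_at_top[OF sol_reverse[OF s] n, of 0]) (use 2 less_imp_le in auto)
    then have "(z \<longlongrightarrow> 0) at_bot" by (simp add: filterlim_at_bot_mirror)
    then show ?thesis using decreasing_end[OF s n, of 0] 2 by blast
  next
    case 3
    then show ?thesis using increasing_end[OF s n e, of t0] decreasing_end[OF s n, of t0] by blast
  qed
qed simp

lemma end_decreasing_exists:
  obtains z p where "sol z p" "!!t. z t <= 0" "!!t. - P' < p t \<and> p t < 0" "(z \<longlongrightarrow> 0) at_bot" "((%t. z t - A' (- t)) \<longlongrightarrow> M) at_top"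
proof -
  obtain z p where zp: "R.sol z p" "!!t. z t <= 0" "!!t. 0 < p t \<and> p t < P'" "((%t. z t - A' t) \<longlongrightarrow> M) at_bot" "(z \<longlongrightarrow> 0) at_top"
    using R.end_increasing_exists[OF e', where L=M] by blast
  have s: "sol (%t. z (- t)) (%t. - p (- t))" using R.sol_reverse[OF zp(1)] by simp
  show thesis
  proof (rule that[OF s])
    show "z (- t) <= 0" for t by (rule zp)
    show "- P' < - p (- t) \<and> - p (- t) < 0" for t using zp(3)[of "- t"] by simp
    show "((%t. z (- t)) \<longlongrightarrow> 0) at_bot" using zp(5) by (simp add: filterlim_at_top_mirror)
    show "((%t. z (- t) - A' (- t)) \<longlongrightarrow> M) at_top" using zp(4) by (simp add: filterlim_at_bot_mirror)
  qed
qed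

text \<open>A translation by \<open>s\<close> adds \<open>P * s\<close> to \<open>L\<close> and
  subtracts \<open>P' * s\<close> from \<open>M\<close>, so P' L + P M is the translation invariant
  that labels the solution.\<close>

definition peaked :: "(real => real) => real => real => real => bool" where
  "peaked z m L M \<longleftrightarrow> m > 0 \<and> (\<exists>p. sol z p \<and> (\<exists>t0. z t0 = - m \<and> p t0 = 0) \<and> (\<forall>t. z t <= - m) \<and> (\<forall>t. - P' < p t \<and> p t < P)) \<and>
     ((%t. z t - A t) \<longlongrightarrow> L) at_bot \<and> ((%t. z t - A' (- t)) \<longlongrightarrow> M) at_top"

lemma peaked_exists:
  assumes m: "m > 0" obtains z L M where "peaked z m L M"
proof -
  obtain z p where zp: "sol z p" "z 0 = - m" "p 0 = 0" "!!t. - P' < p t \<and> p t < P" "!!t. t < 0 ==> p t > 0"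
    "!!t. t > 0 ==> p t < 0" "!!t. z t <= - m"
    using peaked_solution_exists[OF P m] by blast
  have n: "z t < 0" for t using zp(7)[of t] m by linarith
  obtain L where "((%t. z t - A t) \<longlongrightarrow> L) at_bot" using increasing_end[OF zp(1) n e, of 0] zp(5) by blast
  moreover obtain M where "((%t. z t - A' (- t)) \<longlongrightarrow> M) at_top" using decreasing_end[OF zp(1) n, of 0] zp(6) by blast
  ultimately have "peaked z m L M" unfolding peaked_def using m zp(1-4,7) by blast
  then show thesis by (rule that)
qed

lemma peaked_shift:
  assumes "peaked z m L M" shows "peaked (%t. z (t + s)) m (L + P * s) (M - P' * s)"
proof -
  obtain p t0 where p: "m > 0" "sol z p" "z t0 = - m" "p t0 = 0" "\<forall>t. z t <= - m" "\<forall>t. - P' < p t \<and> p t < P"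
    and L: "((%t. z t - A t) \<longlongrightarrow> L) at_bot" and M: "((%t. z t - A' (- t)) \<longlongrightarrow> M) at_top"
    using assms unfolding peaked_def by blast
  have "((%t. z (- t) - A' t) \<longlongrightarrow> M) at_bot" using M by (simp add: filterlim_at_top_mirror)
  from R.end_shift[OF e', of "%t. z (- t)", OF this, of "- s"]
  have "((%t. z (- t + s) - A' t) \<longlongrightarrow> M - P' * s) at_bot" by (simp add: algebra_simps)
  then have "((%t. z (t + s) - A' (- t)) \<longlongrightarrow> M - P' * s) at_top" by (simp add: filterlim_at_top_mirror)
  moreover have "\<exists>p. sol (%t. z (t + s)) p \<and> (\<exists>t0. z (t0 + s) = - m \<and> p t0 = 0) \<and> (\<forall>t. z (t + s) <= - m) \<and> (\<forall>t. - P' < p t \<and> p t < P)"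
    by (rule exI[of _ "%t. p (t + s)"]) (use p sol_shift[OF p(2), of s] in \<open>auto intro!: exI[of _ "t0 - s"]\<close>)
  ultimately show ?thesis unfolding peaked_def using p(1) end_shift[OF e L, of s] by blast
qed

lemma peaked_diff:
  assumes "peaked z1 m1 L1 M1" "peaked z2 m2 L2 M2"
  shows "((%t. z1 t - z2 t) \<longlongrightarrow> L1 - L2) at_bot" "((%t. z1 t - z2 t) \<longlongrightarrow> M1 - M2) at_top"
proof -
  have "((%t. (z1 t - A t) - (z2 t - A t)) \<longlongrightarrow> L1 - L2) at_bot" "((%t. (z1 t - A' (- t)) - (z2 t - A' (- t))) \<longlongrightarrow> M1 - M2) at_top"
    by (intro tendsto_diff; use assms in \<open>simp add: peaked_def\<close>)+
  then show "((%t. z1 t - z2 t) \<longlongrightarrow> L1 - L2) at_bot" "((%t. z1 t - z2 t) \<longlongrightarrow> M1 - M2) at_top" by simp_all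
qed

text \<open>With both limits of each solution equal, one number orders the solutions pointwise by
  comparison. If the maximal values coincide, the smaller solution touches the larger at its peak,
  where both slopes vanish, and Cauchy uniqueness applies.\<close>

lemma peaked_mono:
  assumes a: "peaked z1 m1 a1 a1" "peaked z2 m2 a2 a2" and le: "a1 <= a2"
  shows "m2 <= m1" "m1 = m2 ==> a1 = a2"
proof -
  obtain p1 t1 where p1: "sol z1 p1" "z1 t1 = - m1" "p1 t1 = 0" "\<forall>t. z1 t <= - m1" "\<forall>t. - P' < p1 t \<and> p1 t < P" "m1 > 0"
    using a(1) unfolding peaked_def by blast
  obtain p2 t2 where p2: "sol z2 p2" "z2 t2 = - m2" "p2 t2 = 0" "\<forall>t. z2 t <= - m2" "m2 > 0"
    using a(2) unfolding peaked_def by blast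
  have z12: "z1 t - z2 t <= 0" for t by (rule comparison[OF p1(1) p2(1) peaked_diff[OF a]]) (use le in auto)
  have "- m1 <= - m2" using z12[of t1] p1(2) p2(4)[rule_format, of t1] by linarith
  then show "m2 <= m1" by simp
  assume m: "m1 = m2"
  then have eq1: "z1 t1 = z2 t1" using z12[of t1] p1(2) p2(4)[rule_format, of t1] by linarith
  have "p2 t1 = 0"
    by (rule DERIV_local_max[OF solD(1)[OF p2(1)] zero_less_one]) (use eq1 m p1(2) p2(4) in auto)
  then have eqp: "p1 t1 = p2 t1" using p1(3) by simp
  have n: "z1 t <= 0" "z2 t <= 0" for t
    using p1(4)[rule_format, of t] p1(6) p2(4)[rule_format, of t] p2(5) by linarith+
  have "z1 t = z2 t" for t
    by (rule sol_unique[where a="- P'" and b=P, OF p1(1) p2(1) n p1(5)[rule_format] lip eq1 eqp])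
  then have "((%t::real. 0::real) \<longlongrightarrow> a1 - a2) at_bot" using peaked_diff(1)[OF a] by simp
  then have "a1 - a2 = 0" by (rule tendsto_unique[OF trivial_limit_at_bot_linorder, OF _ tendsto_const])
  then show "a1 = a2" by simp
qed

text \<open>The approximating solutions are close uniformly on the whole line by
  \<open>two_sided_comparison\<close>, so their limits at the ends pass over. A zero or monotone
  limit function would tend to 0 at some end, and \<open>A\<close> or \<open>A'\<close> would
  converge there, which \<open>end_ok\<close> forbids.\<close>

lemma peaked_limit:
  assumes a: "!!n. peaked (z n) (m n) (a n) (a n)" and l: "a \<longlonglongrightarrow> c"
  obtains y k where "peaked y k c c"
proof -
  obtain p where p: "!!n. sol (z n) (p n)" "!!n t. - P' < p n t \<and> p n t < P" "!!n t. z n t <= - m n" "!!n. m n > 0"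
    using a unfolding peaked_def by metis
  have zn: "z n t <= 0" for n t using p(3)[of n t] p(4)[of n] by linarith
  have near: "\<bar>z i t - z j t\<bar> <= \<bar>a i - a j\<bar>" for i j t
    by (rule two_sided_comparison[OF p(1) p(1) peaked_diff[OF a a]]) auto
  obtain K where K: "!!n. \<bar>a n\<bar> <= K" using convergent_imp_Bseq[of a] l unfolding convergent_def Bseq_def by (metis real_norm_def)
  have z0: "\<bar>z n 0\<bar> <= \<bar>z 0 0\<bar> + 2 * K" for n using near[of n 0 0] K[of n] K[of 0] by linarith
  have pb: "- P' <= p n t \<and> p n t <= P" for n t using p(2)[of n t] by simp
  obtain k y r where k: "strict_mono (k :: nat => nat)" and y: "!!t. (%n. z (k n) t) \<longlonglongrightarrow> y t" and s: "sol y r"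
    using sol_compactness[of z p, OF p(1) zn pb z0] by metis
  have ny: "\<bar>y t - z i t\<bar> <= \<bar>c - a i\<bar>" for t i
  proof (rule LIMSEQ_le)
    show "(%n. \<bar>z (k n) t - z i t\<bar>) \<longlonglongrightarrow> \<bar>y t - z i t\<bar>" by (intro tendsto_intros y)
    show "(%n. \<bar>a (k n) - a i\<bar>) \<longlonglongrightarrow> \<bar>c - a i\<bar>"
      using LIMSEQ_subseq_LIMSEQ[OF l k] by (intro tendsto_intros) (simp add: o_def)
    show "\<exists>N. \<forall>n\<ge>N. \<bar>z (k n) t - z i t\<bar> <= \<bar>a (k n) - a i\<bar>" using near by blast
  qed
  have lim: "((%t. y t - B t) \<longlongrightarrow> c) G" if "!!n. ((%t. z n t - B t) \<longlongrightarrow> a n) G" for B :: "real => real" and G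
  proof (rule tendstoI)
    fix \<epsilon> :: real assume \<epsilon>: "\<epsilon> > 0"
    obtain i where i: "\<bar>a i - c\<bar> < \<epsilon> / 3"
      using LIMSEQ_D[OF l, of "\<epsilon> / 3"] \<epsilon> by auto
    have "eventually (%t. dist (z i t - B t) (a i) < \<epsilon> / 3) G" using tendstoD[OF that[of i], of "\<epsilon> / 3"] \<epsilon> by simp
    then show "eventually (%t. dist (y t - B t) c < \<epsilon>) G"
    proof (rule eventually_mono)
      fix t assume "dist (z i t - B t) (a i) < \<epsilon> / 3"
      then show "dist (y t - B t) c < \<epsilon>" using ny[of t i] i unfolding dist_real_def by linarith
    qed
  qed
  have L: "((%t. y t - A t) \<longlongrightarrow> c) at_bot" by (rule lim) (use a in \<open>auto simp: peaked_def\<close>)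
  have M: "((%t. y t - A' (- t)) \<longlongrightarrow> c) at_top" by (rule lim) (use a in \<open>auto simp: peaked_def\<close>)
  have noL: "\<not> (y \<longlongrightarrow> 0) at_bot"
  proof
    assume "(y \<longlongrightarrow> 0) at_bot"
    from tendsto_diff[OF this L] have "(A \<longlongrightarrow> 0 - c) at_bot" by simp
    then show False by (rule sol_limit_at_bot[OF e])
  qed
  have noM: "\<not> (y \<longlongrightarrow> 0) at_top"
  proof
    assume "(y \<longlongrightarrow> 0) at_top"
    from tendsto_diff[OF this M] have "((%t. A' (- t)) \<longlongrightarrow> 0 - c) at_top" by simp
    then have "(A' \<longlongrightarrow> 0 - c) at_bot" by (simp add: filterlim_at_bot_mirror)
    then show False by (rule R.sol_limit_at_bot[OF e'])
  qed
  have y0: "y t <= 0" for t by (rule LIMSEQ_le_const2[OF y]) (use zn in auto)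
  note rb = slope_bounds[OF s y0]
  have "(\<forall>t. y t = 0) \<or> (\<forall>t. y t < 0)"
  proof (rule sol_neg_or_zero[OF s, of "max P P'"])
    show "y t <= max P P'" for t using y0[of t] P max.cobounded1[of P P'] by linarith
    show "\<bar>r t\<bar> <= max P P'" for t using rb[of t] max.cobounded1[of P P'] max.cobounded2[of P' P] by linarith
  qed
  moreover have "\<not> (\<forall>t. y t = 0)"
  proof
    assume "\<forall>t. y t = 0"
    then have "y = (%t. 0)" by auto
    then show False using noL by simp
  qed
  ultimately have yn: "y t < 0" for t by blast
  from sol_sign_cases[OF s yn] consider "!!t. r t > 0" | "!!t. r t < 0" | t0 where "!!t. t < t0 ==> r t > 0" "!!t. t > t0 ==> r t < 0"
    by blast
  then show thesis
  proof cases
    case 1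
    then show ?thesis using increasing_at_top[OF s yn, of 0] noM less_imp_le by blast
  next
    case 2
    have "((%t. y (- t)) \<longlongrightarrow> 0) at_top"
      by (rule R.increasing_at_top[OF sol_reverse[OF s] yn, of 0]) (use 2 less_imp_le in auto)
    then show ?thesis using noL by (simp add: filterlim_at_bot_mirror)
  next
    case 3
    have mx: "y t <= y t0" for t
    proof (cases "t <= t0")
      case True
      have "continuous_on {t..t0} y" by (rule sol_cont[OF s])
      show ?thesis
      proof (cases "t = t0")
        case False
        then have lt: "t < t0" using True by simp
        have "y t < y t0"
          by (rule DERIV_pos_imp_increasing_open[OF lt]) (use 3(1) solD(1)[OF s] sol_cont[OF s] in \<open>blast+\<close>)
        then show ?thesis by simp
      qed simp
    next
      case False
      then have lt: "t0 < t" by simp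
      have "y t < y t0"
        by (rule DERIV_neg_imp_decreasing_open[OF lt]) (use 3(2) solD(1)[OF s] sol_cont[OF s] in \<open>blast+\<close>)
      then show ?thesis by simp
    qed
    have "r t0 = 0" by (rule DERIV_local_max[OF solD(1)[OF s] zero_less_one]) (use mx in auto)
    then have "peaked y (- y t0) c c"
      unfolding peaked_def using yn[of t0] s mx rb L M by (auto intro!: exI[of _ r] exI[of _ t0])
    then show ?thesis by (rule that)
  qed
qed

lemma peaked_balanced:
  assumes "peaked z m L M"
  obtains y where "peaked y m ((P' * L + P * M) / (P + P')) ((P' * L + P * M) / (P + P'))"
proof -
  define s where "s = (M - L) / (P + P')"
  have p: "P + P' > 0" using P by simp
  have "L + P * s = (P' * L + P * M) / (P + P')" "M - P' * s = (P' * L + P * M) / (P + P')"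
    unfolding s_def using p by (simp_all add: field_simps)
  then show thesis using peaked_shift[OF assms, of s] that by metis
qed

text \<open>Every \<open>m > 0\<close> occurs, and values depend on \<open>m\<close> monotonically.
  If \<open>c\<close> were missing from the closed set \<open>R\<close>, its neighbours in
  \<open>R\<close> below and above would belong to two different \<open>m\<close>, and an
  intermediate \<open>m\<close> would have no value left.\<close>

lemma peaked_surj:
  obtains z m where "peaked z m c c"
proof -
  define R where "R = {a. \<exists>z m. peaked z m a a}"
  have ex: "\<exists>a z. peaked z m a a" if "m > 0" for m
    using peaked_exists[OF that] peaked_balanced by metis
  have cl: "closed R"
    unfolding closed_sequential_limits
  proof (intro allI impI)
    fix x l assume h: "(\<forall>n. x n \<in> R) \<and> x \<longlonglongrightarrow> l"
    then have "\<forall>n. \<exists>z m. peaked z m (x n) (x n)" unfolding R_def by blast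
    then obtain z m where "!!n. peaked (z n) (m n) (x n) (x n)" by metis
    then obtain y k where "peaked y k l l" using peaked_limit[of z m x l] h by blast
    then show "l \<in> R" unfolding R_def by blast
  qed
  have "c \<in> R"
  proof (rule ccontr)
    assume c: "c \<notin> R"
    define U where "U = R \<inter> {..c}"
    define V where "V = R \<inter> {c..}"
    have UV: "closed U" "closed V" unfolding U_def V_def using cl by auto
    have bU: "bdd_above U" unfolding U_def by (auto intro: bdd_aboveI[of _ c])
    have bV: "bdd_below V" unfolding V_def by (auto intro: bdd_belowI[of _ c])
    have split: "a \<in> U \<or> a \<in> V" if "peaked z m a a" for z m a
      using that unfolding U_def V_def R_def by force
    have supU: "Sup U \<in> U" "!!a. a \<in> U ==> a <= Sup U" if "U ~= {}"
      using closed_contains_Sup[OF that bU UV(1)] cSup_upper[OF _ bU] by auto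
    have infV: "Inf V \<in> V" "!!a. a \<in> V ==> Inf V <= a" if "V ~= {}"
      using closed_contains_Inf[OF that bV UV(2)] cInf_lower[OF _ bV] by auto
    \<comment> \<open>If no value lay below \<open>c\<close>, the least value would be attained for
      some \<open>m\<close>, and \<open>m + 1\<close> would require a smaller one. The other side
      uses \<open>m / 2\<close> in the same way.\<close>
    have U0: "U ~= {}"
    proof
      assume U: "U = {}"
      obtain a0 z0 where "peaked z0 1 a0 a0" using ex[of 1] by auto
      then have V: "V ~= {}" using split U by auto
      obtain z m where zm: "peaked z m (Inf V) (Inf V)" using infV(1)[OF V] unfolding V_def R_def by blast
      have m: "m > 0" using zm unfolding peaked_def by simp
      then obtain a1 z1 where z1: "peaked z1 (m + 1) a1 a1" using ex[of "m + 1"] by auto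
      then have "Inf V <= a1" using split[OF z1] U infV(2)[OF V] by auto
      then show False using peaked_mono(1)[OF zm z1] by simp
    qed
    have V0: "V ~= {}"
    proof
      assume V: "V = {}"
      obtain z m where zm: "peaked z m (Sup U) (Sup U)" using supU(1)[OF U0] unfolding U_def R_def by blast
      have m: "m > 0" using zm unfolding peaked_def by simp
      then obtain a1 z1 where z1: "peaked z1 (m / 2) a1 a1" using ex[of "m / 2"] by auto
      then have "a1 <= Sup U" using split[OF z1] V supU(2)[OF U0] by auto
      then show False using peaked_mono(1)[OF z1 zm] m by simp
    qed
    obtain z1 m1 where z1: "peaked z1 m1 (Sup U) (Sup U)" using supU(1)[OF U0] unfolding U_def R_def by blast
    obtain z2 m2 where z2: "peaked z2 m2 (Inf V) (Inf V)" using infV(1)[OF V0] unfolding V_def R_def by blast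
    have "Sup U <= c" "c <= Inf V" "Sup U ~= c" using supU(1)[OF U0] infV(1)[OF V0] c unfolding U_def V_def by auto
    then have lt: "Sup U < Inf V" by simp
    have m: "m2 <= m1" "m1 ~= m2" using peaked_mono[OF z1 z2 less_imp_le[OF lt]] lt by auto
    have m2: "m2 > 0" using z2 unfolding peaked_def by simp
    define m where "m = (m1 + m2) / 2"
    have mm: "m2 < m" "m < m1" "m > 0" unfolding m_def using m m2 by auto
    obtain a z where z: "peaked z m a a" using ex[OF mm(3)] by auto
    from split[OF z] show False
    proof
      assume "a \<in> U"
      then show False using peaked_mono(1)[OF z z1 supU(2)[OF U0]] mm by simp
    next
      assume "a \<in> V"
      then show False using peaked_mono(1)[OF z2 z infV(2)[OF V0]] mm by simp
    qed
  qed
  then show thesis using that unfolding R_def by blast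
qed

lemma two_ends_exists:
  obtains z p where "sol z p" "!!t. z t <= 0" "!!t. - P' < p t \<and> p t < P"
    "((%t. z t - A t) \<longlongrightarrow> L) at_bot" "((%t. z t - A' (- t)) \<longlongrightarrow> M) at_top"
proof -
  define c where "c = (P' * L + P * M) / (P + P')"
  obtain y m where y: "peaked y m c c" by (rule peaked_surj)
  define s where "s = (L - M) / (P + P')"
  have p: "P + P' > 0" using P by simp
  have "c + P * s = ((P + P') * L) / (P + P')" "c - P' * s = ((P + P') * M) / (P + P')"
    unfolding c_def s_def by (simp_all add: add_divide_distrib[symmetric] diff_divide_distrib[symmetric] algebra_simps)
  then have "c + P * s = L" "c - P' * s = M" using p by simp_all
  then have pk: "peaked (%t. y (t + s)) m L M" using peaked_shift[OF y, of s] by simp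
  then obtain p where p: "m > 0" "sol (%t. y (t + s)) p" "\<forall>t. y (t + s) <= - m" "\<forall>t. - P' < p t \<and> p t < P"
    unfolding peaked_def by blast
  have "y (t + s) <= 0" for t using p(1) p(3)[rule_format, of t] by linarith
  then show thesis using that[OF p(2)] p(4) pk unfolding peaked_def by blast
qed

end

section \<open>Roots of the characteristic function\<close>

lemma powr_reciprocal: "0 < r ==> (1 / r) powr a = r powr (- a)" for r a :: real
  by (simp add: powr_divide powr_minus_divide)

lemma eventually_small_norm: "eventually (%x::'a::real_normed_vector. 0 < norm x \<and> norm x < 1) (at 0)"
  unfolding eventually_at by (intro exI[of _ 1]) auto

lemma eventually_large_norm: "eventually (%x::'a::real_normed_vector. 1 < norm x) at_infinity"
  unfolding eventually_at_infinity by (intro exI[of _ 2]) auto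

text \<open>At a double root this provides the quadratic coefficient and the cubic error that
  \<open>double_root_asymptotics\<close> asks for.\<close>

lemma third_order_taylor:
  fixes f f1 f2 f3 :: "real => real"
  assumes d: "!!t. l <= t ==> t <= r ==> DERIV f t :> f1 t"
    "!!t. l <= t ==> t <= r ==> DERIV f1 t :> f2 t"
    "!!t. l <= t ==> t <= r ==> DERIV f2 t :> f3 t"
    and z: "f S = 0" "f1 S = 0" and b: "!!t. l <= t ==> t <= r ==> \<bar>f3 t\<bar> <= C" and S: "l <= S" "S <= r" and s: "l <= s" "s <= r"
  shows "\<bar>f s - f2 S / 2 * (s - S)^2\<bar> <= C * \<bar>s - S\<bar> ^ 3"
proof (cases "s = S")
  case False
  define D where "D m = (if m = 0 then f else if m = 1 then f1 else if m = 2 then f2 else f3)" for m :: nat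
  have "\<exists>t. (if s < S then s < t \<and> t < S else S < t \<and> t < s) \<and>
      f s = (\<Sum>m<3. (D m S / fact m) * (s - S) ^ m) + (D 3 t / fact 3) * (s - S) ^ 3"
  proof (rule Taylor[where a=l and b=r])
    show "\<forall>m t. m < 3 \<and> l <= t \<and> t <= r --> DERIV (D m) t :> D (Suc m) t"
      unfolding D_def using d by (auto simp: less_Suc_eq numeral_3_eq_3)
  qed (use S s False in \<open>auto simp: D_def\<close>)
  then obtain t where t: "if s < S then s < t \<and> t < S else S < t \<and> t < s"
    and eq: "f s = (\<Sum>m<3. (D m S / fact m) * (s - S) ^ m) + (D 3 t / fact 3) * (s - S) ^ 3" by blast
  have "f s = f2 S / 2 * (s - S)^2 + (f3 t / 6) * (s - S) ^ 3"
    using eq z unfolding D_def by (simp add: numeral_3_eq_3 fact_numeral eval_nat_numeral)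
  then have "\<bar>f s - f2 S / 2 * (s - S)^2\<bar> = \<bar>f3 t\<bar> / 6 * \<bar>s - S\<bar> ^ 3" by (simp add: abs_mult power_abs)
  also have "... <= C * \<bar>s - S\<bar> ^ 3"
  proof (rule mult_right_mono)
    have "\<bar>f3 t\<bar> <= C" by (rule b) (use t S s in \<open>auto split: if_splits\<close>)
    then show "\<bar>f3 t\<bar> / 6 <= C" by linarith
  qed simp
  finally show ?thesis .
qed (simp add: z)

text \<open>The two alternatives are those of a simple and a double root at the end \<open>s0\<close> of \<open>I\<close>; \<open>e\<close> is the resulting exponent
  of the logarithm in the asymptotics.\<close>

definition root_type :: "(real => real) => real set => real => real => bool" where
  "root_type h I s0 e \<longleftrightarrow>
     (e = 0 \<and> (\<exists>c>0. \<forall>s\<in>I. c * \<bar>s - s0\<bar> <= h s)) \<or>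
     (\<exists>k>0. e = 1 / k \<and> (\<forall>s\<in>I. s ~= s0 --> h s > 0) \<and> (\<exists>C>0. \<forall>s\<in>I. \<bar>h s - k * (s - s0)^2\<bar> <= C * \<bar>s - s0\<bar> ^ 3))"

lemma root_type_simple: "c > 0 ==> (!!s. s \<in> I ==> c * \<bar>s - s0\<bar> <= h s) ==> root_type h I s0 0"
  unfolding root_type_def by blast

text \<open>\<open>m\<close> is the substitution from slopes to exponents. It will be \<beta> - x
  for the end at the origin and \<beta> + x for the reversed equation at infinity.\<close>

lemma (in autonomous_ode) end_ok_root:
  assumes P: "P > 0" "F P = 0" and rt: "root_type h I s0 e"
    and m: "!!x. 0 <= x ==> x < P ==> m x \<in> I \<and> \<bar>m x - s0\<bar> = P - x \<and> F x = h (m x)"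
  shows "end_ok P (%t. P * t + e * ln (- t))"
proof -
  from rt consider c where "e = 0" "c > 0" "\<forall>s\<in>I. c * \<bar>s - s0\<bar> <= h s"
    | k C where "k > 0" "e = 1 / k" "\<forall>s\<in>I. s ~= s0 --> h s > 0" "C > 0"
      "\<forall>s\<in>I. \<bar>h s - k * (s - s0)^2\<bar> <= C * \<bar>s - s0\<bar> ^ 3"
    unfolding root_type_def by blast
  then show ?thesis
  proof cases
    case 1
    show ?thesis unfolding 1(1)
      by (rule end_ok_simple[OF P(1) 1(2) P(2)]) (use 1(3) m in metis)
  next
    case 2
    show ?thesis unfolding 2(2)
    proof (rule end_ok_double[OF P(1) 2(1) 2(4) P(2)])
      fix x assume x: "0 <= x" "x < P"
      have "m x ~= s0" using m[OF x] x by auto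
      then show "0 < F x" using 2(3) m[OF x] by metis
      have "(m x - s0)^2 = (P - x)^2" using m[OF x] by (metis power2_abs)
      then show "\<bar>F x - k * (P - x)^2\<bar> <= C * (P - x) ^ 3" using 2(5) m[OF x] by metis
    qed
  qed
qed

locale exponents =
  fixes q \<tau> \<rho> lam \<theta> :: real
  assumes q: "q > 1" and \<tau>: "0 <= \<tau>" "\<tau> < 1" and \<theta>: "\<theta> > - 2" and f\<beta>: "f_fun lam \<tau> \<rho> (beta q \<theta>) > 0"
begin

abbreviation "\<beta> \<equiv> beta q \<theta>"
abbreviation "f \<equiv> f_fun lam \<tau> \<rho>"
abbreviation "g s \<equiv> f_tilde lam \<tau> (- \<rho>) (- s)"
abbreviation "sols \<equiv> positive_solutions q \<tau> \<rho> lam \<theta>"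
abbreviation "U \<equiv> U_sol q \<tau> \<rho> lam \<theta>"
abbreviation "behaves \<equiv> behaviour_at_0 q \<tau> \<rho> lam \<theta>"
abbreviation "is_c0 \<equiv> is_u_c0 q \<tau> \<rho> lam \<theta>"
abbreviation "is_binf \<equiv> is_u_binf q \<tau> \<rho> lam \<theta>"
abbreviation "is_c0b \<equiv> is_u_c0b q \<tau> \<rho> lam \<theta>"
abbreviation "uc0 \<equiv> u_c0 q \<tau> \<rho> lam \<theta>"
abbreviation "ubinf \<equiv> u_binf q \<tau> \<rho> lam \<theta>"
abbreviation "uc0b \<equiv> u_c0b q \<tau> \<rho> lam \<theta>"
abbreviation "low \<equiv> case_N2_low lam \<tau> (- \<rho>) \<beta>"

lemma beta_pos: "\<beta> > 0"
  unfolding beta_def using q \<theta> by simp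

lemmas \<beta> = beta_pos

section \<open>The function \<open>f\<close>, the quotient \<open>g\<close> of \<open>f\<close> by
  its argument, and their derivatives\<close>

lemma f_0: "f 0 = 0" unfolding f_fun_def by simp

lemma g_eq: "g s = s + 2 * \<rho> + lam * s powr (- \<tau>)" unfolding f_tilde_def by simp

text \<open>So the positive roots of \<open>f\<close> are the negatives of the characteristic
  exponents, \<open>f\<beta>\<close> says that \<open>g\<close> is positive at \<beta>, and 0 is
  always a further root of \<open>f\<close>.\<close>

lemma f_eq: "s > 0 ==> f s = s * g s"
proof -
  assume s: "s > 0"
  have "s powr (1 - \<tau>) = s * s powr (- \<tau>)" using s powr_add[of s 1 "- \<tau>"] by simp
  then show ?thesis unfolding f_fun_def g_eq using s by (simp add: algebra_simps)
qed

lemma g_beta: "g \<beta> > 0" using f\<beta> f_eq[OF \<beta>] \<beta> by (simp add: zero_less_mult_iff)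

lemma isCont_f: "isCont f t"
proof -
  have "((%t. t * (t + 2 * \<rho>) + lam * \<bar>t\<bar> powr (1 - \<tau>)) \<longlongrightarrow> t * (t + 2 * \<rho>) + lam * \<bar>t\<bar> powr (1 - \<tau>)) (at t)"
    using \<tau> by (intro tendsto_intros tendsto_powr') auto
  then show ?thesis unfolding isCont_def f_fun_def .
qed

definition f1 where "f1 s = 2 * s + 2 * \<rho> + lam * (1 - \<tau>) * s powr (- \<tau>)"
definition f2 where "f2 s = 2 - lam * (1 - \<tau>) * \<tau> * s powr (- \<tau> - 1)"
definition f3 where "f3 s = lam * (1 - \<tau>) * \<tau> * (\<tau> + 1) * s powr (- \<tau> - 2)"
definition g1 where "g1 s = 1 - lam * \<tau> * s powr (- \<tau> - 1)"

lemma df: "DERIV f s :> f1 s" if s: "s > 0"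
proof -
  have "DERIV (%s. s * (s + 2 * \<rho>) + lam * s powr (1 - \<tau>)) s :> f1 s"
    unfolding f1_def using s by (auto intro!: derivative_eq_intros simp: algebra_simps)
  then show ?thesis
  proof (rule has_field_derivative_transform_within_open[of _ _ _ "{0<..}"])
    show "s * (s + 2 * \<rho>) + lam * s powr (1 - \<tau>) = f s" if "s \<in> {0<..}" for s
      using that unfolding f_fun_def by simp
  qed (use s in auto)
qed

lemma df1: "DERIV f1 s :> f2 s" if s: "s > 0"
  unfolding f1_def f2_def using s by (auto intro!: derivative_eq_intros simp: algebra_simps)

lemma df2: "DERIV f2 s :> f3 s" if s: "s > 0"
  unfolding f2_def f3_def using s by (auto intro!: derivative_eq_intros simp: algebra_simps)

lemma dg: "DERIV g s :> g1 s" if s: "s > 0"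
  unfolding g_eq g1_def using s by (auto intro!: derivative_eq_intros simp: algebra_simps)

lemma continuous_on_g:
  assumes "0 < l" shows "continuous_on {l..r} g"
proof (intro continuous_at_imp_continuous_on ballI)
  show "isCont g x" if "x \<in> {l..r}" for x using that assms by (intro DERIV_isCont[OF dg]) simp
qed

text \<open>Restricted to intervals away from 0, where the power 1 - \<tau> is smooth.\<close>

lemma f_lipschitz:
  assumes "0 < l"
  obtains C where "!!x y. l <= x ==> x <= r ==> l <= y ==> y <= r ==> \<bar>f x - f y\<bar> <= C * \<bar>x - y\<bar>"
proof -
  have "compact (f1 ` {l..r})"
    unfolding f1_def using assms by (intro compact_continuous_image continuous_intros) auto
  then obtain C where C: "!!x. l <= x ==> x <= r ==> \<bar>f1 x\<bar> <= C"
    using compact_imp_bounded bounded_iff by (metis atLeastAtMost_iff imageI real_norm_def)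
  have *: "\<bar>f x - f y\<bar> <= C * \<bar>x - y\<bar>" if xy: "l <= x" "x < y" "y <= r" for x y
  proof -
    have "\<exists>z>x. z < y \<and> f y - f x = (y - x) * f1 z"
      by (rule MVT2[OF xy(2)]) (rule df, use assms xy in simp)
    then obtain z where z: "x < z" "z < y" "f y - f x = (y - x) * f1 z" by blast
    have "\<bar>f x - f y\<bar> = \<bar>f1 z\<bar> * \<bar>x - y\<bar>" using z(3) by (metis abs_minus_commute abs_mult mult.commute)
    also have "... <= C * \<bar>x - y\<bar>" using C[of z] z xy by (intro mult_right_mono) auto
    finally show ?thesis .
  qed
  have "\<bar>f x - f y\<bar> <= C * \<bar>x - y\<bar>" if "l <= x" "x <= r" "l <= y" "y <= r" for x y
    using *[of x y] *[of y x] that by (cases x y rule: linorder_cases) (auto simp: abs_minus_commute)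
  then show thesis by (rule that)
qed

lemma tau_zero_eq:
  assumes "tau_zero lam \<tau>" "s > 0" shows "g s = s + (2 * \<rho> + lam)"
  using assms unfolding tau_zero_def g_eq by auto

lemma root_type_zero:
  assumes c: "c > 0" "!!s. 0 < s ==> s <= \<beta> ==> c <= g s"
  shows "root_type f {0..\<beta>} 0 0"
proof (rule root_type_simple[OF c(1)])
  fix s assume s: "s \<in> {0..\<beta>}"
  show "c * \<bar>s - 0\<bar> <= f s"
  proof (cases "s = 0")
    case False
    then have s0: "s > 0" using s by simp
    then have "c * s <= g s * s" using c(2)[of s] s by (intro mult_right_mono) auto
    then show ?thesis using f_eq[OF s0] s0 by (simp add: mult.commute)
  qed (simp add: f_0)
qed

text \<open>The common form of all prescribed behaviours: constants have s0 = e = 0, the logarithm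
  has s0 = 0 and e = 1, and the critical case of \<open>Psi1\<close> and \<open>Phi2\<close> has e =
  2 / (1 + \<tau>).\<close>

definition profile :: "real => real => real => real" where
  "profile s0 e r = r powr (- s0) * \<bar>ln r\<bar> powr e"

abbreviation like_profile :: "real => real => real => ('a::euclidean_space => real) => bool" where
  "like_profile s e c u \<equiv> behaves c u \<longleftrightarrow> u \<sim>[at 0] (%x. c * profile s e (norm x))"

text \<open>At \<open>r = 1\<close> the logarithmic factor would be 0 powr 0 = 0, hence the
  exclusion.\<close>

lemma profile_0: "0 < r ==> r ~= 1 ==> profile s0 0 r = r powr (- s0)"
  unfolding profile_def by simp

lemma asymp_equiv_small_cong:
  fixes u h1 h2 :: "'a::real_normed_vector => real"
  assumes "!!x::'a. 0 < norm x ==> norm x < 1 ==> h1 x = h2 x"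
  shows "u \<sim>[at 0] h1 \<longleftrightarrow> u \<sim>[at 0] h2"
proof -
  have "eventually (%x. h1 x = h2 x) (at 0)"
    by (rule eventually_mono[OF eventually_small_norm]) (use assms in auto)
  then show ?thesis by (intro asymp_equiv_cong) auto
qed

lemma asymp_equiv_large_cong:
  fixes u h1 h2 :: "'a::real_normed_vector => real"
  assumes "!!x::'a. 1 < norm x ==> h1 x = h2 x"
  shows "u \<sim>[at_infinity] h1 \<longleftrightarrow> u \<sim>[at_infinity] h2"
proof -
  have "eventually (%x. h1 x = h2 x) (at_infinity)"
    by (rule eventually_mono[OF eventually_large_norm]) (use assms in auto)
  then show ?thesis by (intro asymp_equiv_cong) auto
qed

lemma varpi_unique:
  assumes "s0 > 0" "g s0 = 0" "!!s. s > 0 ==> g s = 0 ==> s = s0"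
  shows "varpi1 lam \<tau> (- \<rho>) = - s0"
  unfolding varpi1_def
proof (rule Least_equality)
  show "- s0 < 0 \<and> f_tilde lam \<tau> (- \<rho>) (- s0) = 0" using assms(1,2) by simp
  show "- s0 <= t" if "t < 0 \<and> f_tilde lam \<tau> (- \<rho>) t = 0" for t
    using assms(3)[of "- t"] that by simp
qed

text \<open>Here \<open>g\<close> is affine with slope 1 and constant term \<open>a\<close>. For a >
  0 the relevant root of \<open>f\<close> is the simple root 0, for a = 0 the double root 0 with k =
  1, which is the logarithmic case, and for a < 0 the root - a of \<open>g\<close>.\<close>

lemma left_root_tau_zero:
  assumes tz: "tau_zero lam \<tau>"
  obtains s0 e where "0 <= s0" "s0 < \<beta>" "f s0 = 0" "root_type f {s0..\<beta>} s0 e"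
    "!!c (u::'a::euclidean_space => real). like_profile s0 e c u"
proof -
  define a where "a = 2 * \<rho> + lam"
  have ga: "g s = s + a" if "s > 0" for s using tau_zero_eq[OF tz that] unfolding a_def .
  have nN2: "\<not> case_N2 lam \<tau> (- \<rho>)" using tz unfolding tau_zero_def case_N2_def by auto
  have N1: "case_N1 lam \<tau> (- \<rho>) \<longleftrightarrow> a < 0" using tz unfolding tau_zero_def case_N1_def a_def by auto
  have N0: "case_N0 lam \<tau> (- \<rho>) \<longleftrightarrow> a >= 0" using tz unfolding tau_zero_def case_N0_def a_def by auto
  consider "a > 0" | "a = 0" | "a < 0" by linarith
  then show thesis
  proof cases
    case 1
    have "behaves c u \<longleftrightarrow> u \<sim>[at 0] (%x. c)" for c and u :: "'a => real"
      using nN2 N1 N0 1 unfolding behaviour_at_0_def case_N2_low_def a_def by auto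
    also have "u \<sim>[at 0] (%x. c) \<longleftrightarrow> u \<sim>[at 0] (%x. c * profile 0 0 (norm x))" for c and u :: "'a => real"
      by (rule asymp_equiv_small_cong) (auto simp: profile_0)
    finally have b: "like_profile 0 0 c u" for c and u :: "'a => real" .
    have "root_type f {0..\<beta>} 0 0" by (rule root_type_zero[OF 1]) (use ga in auto)
    then show thesis using that[of 0 0] b \<beta> f_0 by simp
  next
    case 2
    have "behaves c u \<longleftrightarrow> u \<sim>[at 0] (%x. c * ln (1 / norm x))" for c and u :: "'a => real"
      using nN2 N1 N0 2 tz unfolding behaviour_at_0_def case_N2_low_def a_def by auto
    also have "u \<sim>[at 0] (%x. c * ln (1 / norm x)) \<longleftrightarrow> u \<sim>[at 0] (%x. c * profile 0 1 (norm x))" for c and u :: "'a => real"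
      by (rule asymp_equiv_small_cong) (auto simp: profile_def ln_div)
    finally have b: "like_profile 0 1 c u" for c and u :: "'a => real" .
    have fs: "f s = s^2" if "s >= 0" for s
      using that f_eq[of s] ga[of s] 2 f_0 by (cases "s = 0") (auto simp: power2_eq_square)
    have "root_type f {0..\<beta>} 0 1"
      unfolding root_type_def by (rule disjI2, rule exI[of _ 1]) (auto simp: fs intro!: exI[of _ 1])
    then show thesis using that[of 0 1] b \<beta> f_0 by simp
  next
    case 3
    have gs0: "g (- a) = 0" using ga[of "- a"] 3 by simp
    have un: "s = - a" if "s > 0" "g s = 0" for s using ga[OF that(1)] that(2) by simp
    have v: "varpi1 lam \<tau> (- \<rho>) = a" using varpi_unique[of "- a"] 3 gs0 un by auto
    have \<beta>a: "- a < \<beta>" using g_beta ga[OF \<beta>] by simp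
    have "behaves c u \<longleftrightarrow> u \<sim>[at 0] (%x. c * norm x powr a)" for c and u :: "'a => real"
      using nN2 N1 N0 3 \<beta>a unfolding behaviour_at_0_def case_N2_low_def v unfolding a_def by auto
    also have "u \<sim>[at 0] (%x. c * norm x powr a) \<longleftrightarrow> u \<sim>[at 0] (%x. c * profile (- a) 0 (norm x))" for c and u :: "'a => real"
      by (rule asymp_equiv_small_cong) (auto simp: profile_0)
    finally have b: "like_profile (- a) 0 c u" for c and u :: "'a => real" .
    have "root_type f {- a..\<beta>} (- a) 0"
    proof (rule root_type_simple[of "- a"])
      fix s assume "s \<in> {- a..\<beta>}"
      then have s: "s >= - a" "s > 0" using 3 by auto
      have "- a * (s + a) <= s * (s + a)" using s by (intro mult_right_mono) auto
      then show "- a * \<bar>s - - a\<bar> <= f s" using f_eq[OF s(2)] ga[OF s(2)] s by simp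
    qed (use 3 in simp)
    moreover have "f (- a) = 0" using f_eq[of "- a"] gs0 3 by simp
    ultimately show thesis using that[of "- a" 0] b \<beta>a 3 by simp
  qed
qed

lemma small_argument:
  assumes "\<tau> > 0" "K > 0" "r > 0"
  obtains s where "0 < s" "s <= r" "s powr (- \<tau>) >= K"
proof -
  define w where "w = K powr (- 1 / \<tau>)"
  have w: "w > 0" unfolding w_def using assms by simp
  have wK: "w powr (- \<tau>) = K" unfolding w_def powr_powr using assms by simp
  have "min r w powr (- \<tau>) >= w powr (- \<tau>)" using assms w by (intro powr_mono2') auto
  then show thesis using that[of "min r w"] w wK assms by simp
qed

text \<open>For \<open>lam < 0\<close> the function \<open>g\<close> increases with slope at least 1
  and tends to -\<infinity> at 0, so it has a single root, and a simple one.\<close>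

lemma left_root_negative:
  assumes \<tau>0: "\<tau> > 0" and l: "lam < 0"
  obtains s0 where "0 < s0" "s0 < \<beta>" "f s0 = 0" "root_type f {s0..\<beta>} s0 0" "!!s. s >= \<beta> ==> f s > 0"
    "!!c (u::'a::euclidean_space => real). like_profile s0 0 c u"
proof -
  have nt: "\<not> tau_zero lam \<tau>" using \<tau>0 l unfolding tau_zero_def by simp
  have incr: "g y - g x >= y - x" if "0 < x" "x <= y" for x y
  proof -
    have "y powr (- \<tau>) <= x powr (- \<tau>)" using that \<tau> by (intro powr_mono2') auto
    then have "lam * x powr (- \<tau>) <= lam * y powr (- \<tau>)" using l by (intro mult_left_mono_neg) auto
    then show ?thesis unfolding g_eq by linarith
  qed
  have K: "(2 * \<bar>\<rho>\<bar> + \<beta> + 1) / (- lam) > 0" using l \<beta> by (intro divide_pos_pos) auto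
  obtain s where s: "0 < s" "s <= \<beta>" "s powr (- \<tau>) >= (2 * \<bar>\<rho>\<bar> + \<beta> + 1) / (- lam)"
    using small_argument[OF \<tau>0 K \<beta>] by blast
  have "lam * s powr (- \<tau>) <= lam * ((2 * \<bar>\<rho>\<bar> + \<beta> + 1) / (- lam))" using s(3) l by (intro mult_left_mono_neg) auto
  also have "... = - (2 * \<bar>\<rho>\<bar> + \<beta> + 1)" using l by simp
  finally have gs: "g s <= 0" unfolding g_eq using s(2) by linarith
  have "\<exists>t\<ge>s. t <= \<beta> \<and> g t = 0"
    by (rule IVT'[OF gs less_imp_le[OF g_beta] s(2)]) (rule continuous_on_g[OF s(1)])
  then obtain s0 where s0': "s <= s0" "s0 <= \<beta>" "g s0 = 0" by blast
  have s0: "0 < s0" "s0 < \<beta>" using s0' s g_beta by (auto simp: less_le)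
  have un: "t = s0" if "t > 0" "g t = 0" for t
    using incr[of t s0] incr[of s0 t] that s0' s0 by linarith
  have v: "varpi1 lam \<tau> (- \<rho>) = - s0" by (rule varpi_unique[OF s0(1) s0'(3)]) (rule un)
  have N: "case_N1 lam \<tau> (- \<rho>)" "\<not> case_N2 lam \<tau> (- \<rho>)" "\<not> case_N0 lam \<tau> (- \<rho>)"
    using l \<tau>0 \<tau> nt unfolding case_N1_def case_N2_def case_N0_def by auto
  have "behaves c u \<longleftrightarrow> u \<sim>[at 0] (%x. c * norm x powr (- s0))" for c and u :: "'a => real"
    using N nt s0 unfolding behaviour_at_0_def case_N2_low_def v by auto
  also have "u \<sim>[at 0] (%x. c * norm x powr (- s0)) \<longleftrightarrow> u \<sim>[at 0] (%x. c * profile s0 0 (norm x))" for c and u :: "'a => real"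
    by (rule asymp_equiv_small_cong) (auto simp: profile_0)
  finally have b: "like_profile s0 0 c u" for c and u :: "'a => real" .
  have "root_type f {s0..\<beta>} s0 0"
  proof (rule root_type_simple[OF s0(1)])
    fix t assume "t \<in> {s0..\<beta>}"
    then have t: "s0 <= t" "t > 0" using s0 by auto
    have "s0 * (t - s0) <= t * (t - s0)" using t by (intro mult_right_mono) auto
    also have "... <= t * g t" using incr[OF s0(1) t(1)] s0'(3) t by (intro mult_left_mono) auto
    finally show "s0 * \<bar>t - s0\<bar> <= f t" using f_eq[OF t(2)] t by simp
  qed
  moreover have "f t > 0" if "t >= \<beta>" for t
  proof -
    have "g t > 0" using incr[OF \<beta> that] g_beta that by linarith
    then show ?thesis using f_eq[of t] that \<beta> by simp
  qed
  moreover have "f s0 = 0" using f_eq[OF s0(1)] s0' by simp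
  ultimately show thesis using that[OF s0] b by blast
qed

section \<open>Positive \<open>lam\<close> and \<tau>: the convex function \<open>g\<close>\<close>

context
  assumes \<tau>0: "\<tau> > 0" and l: "lam > 0"
begin

text \<open>The minimum point of \<open>g\<close>. The minimal value is 2 (Upsilon + \<rho>), which
  explains why \<open>Upsilon\<close> separates the cases.\<close>

definition sm where "sm = (lam * \<tau>) powr (1 / (\<tau> + 1))"

lemma sm: "sm > 0" unfolding sm_def using \<tau>0 l by simp

lemma sm_powr: "lam * \<tau> * sm powr (- \<tau> - 1) = 1"
proof -
  have "sm powr (- \<tau> - 1) = (lam * \<tau>) powr (- 1)"
  proof -
    have "1 / (\<tau> + 1) * (- \<tau> - 1) = - 1" using \<tau>0 by (simp add: field_simps)
    then show ?thesis unfolding sm_def powr_powr by simp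
  qed
  then show ?thesis using \<tau>0 l by (simp add: powr_minus field_simps)
qed

lemma g_sm: "g sm = 2 * (Upsilon lam \<tau> + \<rho>)"
proof -
  have "sm powr (- \<tau>) = sm powr (- \<tau> - 1) * sm" using sm powr_add[of sm "- \<tau> - 1" 1] by simp
  then have "lam * \<tau> * sm powr (- \<tau>) = sm" using sm_powr by (metis mult.assoc mult_1)
  then have "lam * sm powr (- \<tau>) = sm / \<tau>" using \<tau>0 by (simp add: field_simps)
  then show ?thesis unfolding g_eq Upsilon_def sm_def[symmetric] using \<tau>0 by (simp add: field_simps)
qed

lemma g1_mono: "0 < x ==> x <= y ==> g1 x <= g1 y"
proof -
  assume xy: "0 < x" "x <= y"
  have "y powr (- \<tau> - 1) <= x powr (- \<tau> - 1)" using xy \<tau> by (intro powr_mono2') auto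
  then have "lam * \<tau> * y powr (- \<tau> - 1) <= lam * \<tau> * x powr (- \<tau> - 1)" using l \<tau>0 by (intro mult_left_mono) auto
  then show ?thesis unfolding g1_def by linarith
qed

lemma g1_strict_mono: "0 < x ==> x < y ==> g1 x < g1 y"
proof -
  assume xy: "0 < x" "x < y"
  have "y powr (- \<tau> - 1) < x powr (- \<tau> - 1)" using xy \<tau> by (intro powr_less_mono2_neg) auto
  then have "lam * \<tau> * y powr (- \<tau> - 1) < lam * \<tau> * x powr (- \<tau> - 1)" using l \<tau>0 by (intro mult_strict_left_mono) auto
  then show ?thesis unfolding g1_def by linarith
qed

lemma g1_sm: "g1 sm = 0" unfolding g1_def using sm_powr by simp

lemma g_mean_value:
  assumes "0 < x" "x < y" obtains z where "x < z" "z < y" "g y - g x = (y - x) * g1 z"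
proof -
  have "\<exists>z>x. z < y \<and> g y - g x = (y - x) * g1 z"
    by (rule MVT2[OF assms(2)]) (rule dg, use assms(1) in simp)
  then show thesis using that by blast
qed

lemma g_incr: "sm <= x ==> x < y ==> g x < g y"
proof -
  assume xy: "sm <= x" "x < y"
  then obtain z where z: "x < z" "z < y" "g y - g x = (y - x) * g1 z" using g_mean_value[of x y] sm by auto
  have "g1 z > 0" using g1_strict_mono[of sm z] g1_sm sm z xy by simp
  then have "(y - x) * g1 z > 0" using xy by simp
  then show ?thesis using z(3) by linarith
qed

lemma g_decr: "0 < x ==> x < y ==> y <= sm ==> g y < g x"
proof -
  assume xy: "0 < x" "x < y" "y <= sm"
  then obtain z where z: "x < z" "z < y" "g y - g x = (y - x) * g1 z" using g_mean_value[of x y] by auto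
  have "g1 z < 0" using g1_strict_mono[of z sm] g1_sm z xy by simp
  then have "(y - x) * g1 z < 0" using xy by (simp add: mult_pos_neg)
  then show ?thesis using z(3) by linarith
qed

lemma g_tangent:
  assumes "0 < x" "0 < y" shows "g1 x * (y - x) <= g y - g x"
proof (cases x y rule: linorder_cases)
  case less
  then obtain z where z: "x < z" "z < y" "g y - g x = (y - x) * g1 z" using g_mean_value[of x y] assms by auto
  have "(y - x) * g1 x <= (y - x) * g1 z" using g1_mono[of x z] z assms less by (intro mult_left_mono) auto
  then show ?thesis using z(3) by (simp add: mult.commute)
next
  case greater
  then obtain z where z: "y < z" "z < x" "g x - g y = (x - y) * g1 z" using g_mean_value[of y x] assms by auto
  have "(x - y) * g1 z <= (x - y) * g1 x" using g1_mono[of z x] z assms greater by (intro mult_left_mono) auto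
  then show ?thesis using z(3) by (simp add: algebra_simps)
qed simp

lemma g_min: "s > 0 ==> g sm <= g s"
  using g_tangent[OF sm, of s] g1_sm by simp

lemma not_tau_zero: "\<not> tau_zero lam \<tau>" using \<tau>0 l unfolding tau_zero_def by simp

lemma no_roots:
  assumes u: "- \<rho> < Upsilon lam \<tau>"
  shows "root_type f {0..\<beta>} 0 0" "!!s. s >= \<beta> ==> f s > 0"
    "behaves c (v::'a::euclidean_space => real) \<longleftrightarrow> v \<sim>[at 0] (%x. c * profile 0 0 (norm x))"
    "\<not> low"
proof -
  have pos: "g sm > 0" using g_sm u by simp
  show "root_type f {0..\<beta>} 0 0" by (rule root_type_zero[OF pos]) (use g_min in auto)
  show "f s > 0" if "s >= \<beta>" for s
  proof -
    have s: "s > 0" using that \<beta> by simp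
    have "g s > 0" using pos g_min[OF s] by linarith
    then show ?thesis using f_eq[OF s] s by simp
  qed
  have N: "\<not> case_N1 lam \<tau> (- \<rho>)" "\<not> case_N2 lam \<tau> (- \<rho>)" "case_N0 lam \<tau> (- \<rho>)"
    using l \<tau>0 \<tau> u not_tau_zero unfolding case_N1_def case_N2_def case_N0_def by auto
  then show "\<not> low" unfolding case_N2_low_def by simp
  have "behaves c v \<longleftrightarrow> v \<sim>[at 0] (%x. c)"
    using N not_tau_zero unfolding behaviour_at_0_def case_N2_low_def by auto
  also have "v \<sim>[at 0] (%x. c) \<longleftrightarrow> v \<sim>[at 0] (%x. c * profile 0 0 (norm x))"
    by (rule asymp_equiv_small_cong) (auto simp: profile_0)
  finally show "like_profile 0 0 c v" .
qed

context
  assumes u: "- \<rho> >= Upsilon lam \<tau>"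
begin

lemma g_sm_nonpos: "g sm <= 0" using g_sm u by simp

lemma N2_cases: "case_N2 lam \<tau> (- \<rho>)" "\<not> case_N1 lam \<tau> (- \<rho>)" "\<not> case_N0 lam \<tau> (- \<rho>)"
  using l \<tau>0 \<tau> u not_tau_zero unfolding case_N1_def case_N2_def case_N0_def by auto

lemma upper_root:
  obtains S where "sm <= S" "g S = 0" "!!s. s > 0 ==> g s = 0 ==> s <= S" "varpi1 lam \<tau> (- \<rho>) = - S"
proof -
  define y where "y = sm + 2 * \<bar>\<rho>\<bar>"
  have y: "sm <= y" unfolding y_def by simp
  have gy: "0 <= g y"
  proof -
    have "0 <= lam * y powr (- \<tau>)" using l by simp
    then show ?thesis unfolding g_eq y_def using sm by linarith
  qed
  have "\<exists>t\<ge>sm. t <= y \<and> g t = 0"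
    by (rule IVT'[OF g_sm_nonpos gy y]) (rule continuous_on_g[OF sm])
  then obtain S where S: "sm <= S" "g S = 0" by blast
  have mx: "s <= S" if "s > 0" "g s = 0" for s
  proof (rule ccontr)
    assume "\<not> s <= S"
    then have "g S < g s" by (intro g_incr[OF S(1)]) simp
    then show False using S(2) that(2) by simp
  qed
  have "varpi1 lam \<tau> (- \<rho>) = - S"
    unfolding varpi1_def
  proof (rule Least_equality)
    show "- S < 0 \<and> f_tilde lam \<tau> (- \<rho>) (- S) = 0" using S sm by simp
    show "- S <= t" if "t < 0 \<and> f_tilde lam \<tau> (- \<rho>) t = 0" for t using mx[of "- t"] that by simp
  qed
  then show thesis using that S mx by blast
qed

lemma lower_root:
  obtains S where "0 < S" "S <= sm" "g S = 0" "!!s. s > 0 ==> g s = 0 ==> S <= s" "varpi2 lam \<tau> (- \<rho>) = - S"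
proof -
  have K: "(2 * \<bar>\<rho>\<bar> + 1) / lam > 0" using l by simp
  obtain s where s: "0 < s" "s <= sm" "s powr (- \<tau>) >= (2 * \<bar>\<rho>\<bar> + 1) / lam"
    using small_argument[OF \<tau>0 K sm] by blast
  have gs: "0 <= g s" 
  proof -
    have "2 * \<bar>\<rho>\<bar> + 1 <= lam * s powr (- \<tau>)" using s(3) l by (simp add: field_simps)
    then show ?thesis unfolding g_eq using s by linarith
  qed
  have "\<exists>t\<ge>s. t <= sm \<and> g t = 0"
    by (rule IVT2'[OF g_sm_nonpos gs s(2)]) (rule continuous_on_g[OF s(1)])
  then obtain S where S: "s <= S" "S <= sm" "g S = 0" by blast
  have S0: "0 < S" using S s by simp
  have mn: "S <= t" if "t > 0" "g t = 0" for t
  proof (rule ccontr)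
    assume "\<not> S <= t"
    then have "g S < g t" by (intro g_decr[OF that(1) _ S(2)]) simp
    then show False using S(3) that(2) by simp
  qed
  have "varpi2 lam \<tau> (- \<rho>) = - S"
    unfolding varpi2_def
  proof (rule Greatest_equality)
    show "- S < 0 \<and> f_tilde lam \<tau> (- \<rho>) (- S) = 0" using S S0 by simp
    show "t <= - S" if "t < 0 \<and> f_tilde lam \<tau> (- \<rho>) t = 0" for t using mn[of "- t"] that by simp
  qed
  then show thesis using that S0 S mn by blast
qed

text \<open>\<open>g\<close> is positive at \<beta> and nonpositive at \<open>sm\<close>, so \<beta>
  lies left of the smaller root or right of the larger one; its position relative to
  \<open>sm\<close> tells which.\<close>

lemma N2_low_iff: "low \<longleftrightarrow> \<beta> < sm"
proof -
  obtain S where S: "0 < S" "S <= sm" "g S = 0" "varpi2 lam \<tau> (- \<rho>) = - S" using lower_root by blast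
  have "\<beta> < S" if "\<beta> < sm"
  proof (rule ccontr)
    assume "\<not> \<beta> < S"
    then have "S <= \<beta>" by simp
    then show False using g_decr[of S \<beta>] S that g_beta by (cases "S = \<beta>") auto
  qed
  then show ?thesis unfolding case_N2_low_def using N2_cases S \<beta> by auto
qed

text \<open>At the critical value \<open>f\<close> and \<open>f1\<close> vanish at
  \<open>sm\<close>, while \<open>f2 sm = 1 + \<tau>\<close>. Hence k = (1 + \<tau>) / 2, and 1 / k
  is the exponent of the logarithm in \<open>Psi1\<close> and \<open>Phi2\<close>.\<close>

lemma critical_double_root:
  assumes eq: "- \<rho> = Upsilon lam \<tau>" and lr: "0 < lo" "lo <= sm" "sm <= hi"
    and one: "!!s. s \<in> {lo..hi} ==> s ~= sm ==> f s > 0"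
  shows "root_type f {lo..hi} sm (2 / (1 + \<tau>))"
proof -
  define k where "k = (1 + \<tau>) / 2"
  have k: "k > 0" "2 / (1 + \<tau>) = 1 / k" unfolding k_def using \<tau> by (auto simp: field_simps)
  have g0: "g sm = 0" using g_sm eq by simp
  have f0: "f sm = 0" using f_eq[OF sm] g0 by simp
  have f10: "f1 sm = 0"
  proof -
    have "sm powr (- \<tau>) = sm powr (- \<tau> - 1) * sm" using sm powr_add[of sm "- \<tau> - 1" 1] by simp
    then have e: "lam * \<tau> * sm powr (- \<tau>) = sm" using sm_powr by (metis mult.assoc mult_1)
    have "f1 sm = (sm + 2 * \<rho> + lam * sm powr (- \<tau>)) + (sm - lam * \<tau> * sm powr (- \<tau>))" unfolding f1_def by (simp add: algebra_simps)
    then show ?thesis using g0 e unfolding g_eq by simp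
  qed
  have f20: "f2 sm / 2 = k"
  proof -
    have "f2 sm = 2 - (1 - \<tau>) * (lam * \<tau> * sm powr (- \<tau> - 1))" unfolding f2_def by (simp add: mult_ac)
    then show ?thesis unfolding sm_powr k_def by simp
  qed
  define C where "C = lam * (1 - \<tau>) * \<tau> * (\<tau> + 1) * lo powr (- \<tau> - 2) + 1"
  have c0: "lam * (1 - \<tau>) * \<tau> * (\<tau> + 1) >= 0" using l \<tau> by simp
  have C: "C > 0" unfolding C_def using c0 by (simp add: add_nonneg_pos)
  have f3b: "\<bar>f3 t\<bar> <= C" if "lo <= t" for t
  proof -
    have "t powr (- \<tau> - 2) <= lo powr (- \<tau> - 2)" using that lr \<tau> by (intro powr_mono2') auto
    then have "f3 t <= lam * (1 - \<tau>) * \<tau> * (\<tau> + 1) * lo powr (- \<tau> - 2)" unfolding f3_def by (rule mult_left_mono[OF _ c0])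
    moreover have "f3 t >= 0" unfolding f3_def using c0 by simp
    ultimately show ?thesis unfolding C_def by simp
  qed
  have "\<bar>f s - k * (s - sm)^2\<bar> <= C * \<bar>s - sm\<bar> ^ 3" if "s \<in> {lo..hi}" for s
    using third_order_taylor[of lo hi f f1 f2 f3 sm C s] df df1 df2 f0 f10 f3b lr that f20 by auto
  then show ?thesis unfolding root_type_def using k C one by blast
qed

lemma left_root_upper:
  assumes hi: "sm <= \<beta>"
  obtains s0 e where "0 < s0" "s0 < \<beta>" "f s0 = 0" "root_type f {s0..\<beta>} s0 e" "!!s. s >= \<beta> ==> f s > 0"
    "!!c (v::'a::euclidean_space => real). like_profile s0 e c v"
proof -
  obtain S where S: "sm <= S" "g S = 0" "varpi1 lam \<tau> (- \<rho>) = - S" using upper_root by blast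
  have S0: "S > 0" using S sm by simp
  have S\<beta>: "S < \<beta>"
  proof (rule ccontr)
    assume "\<not> S < \<beta>"
    then show False using g_incr[OF hi, of S] S(2) g_beta by (cases "S = \<beta>") auto
  qed
  define e where "e = (if - \<rho> = Upsilon lam \<tau> then 2 / (1 + \<tau>) else 0)"
  have gpos: "g s > 0" if "s > S" for s using g_incr[OF S(1) that] S(2) by simp
  have fpos: "f s > 0" if "s > S" for s using f_eq[of s] gpos[OF that] that S0 by simp
  have rt: "root_type f {S..\<beta>} S e"
  proof (cases "- \<rho> = Upsilon lam \<tau>")
    case True
    have "S = sm" using g_incr[of sm S] S g_sm True by (cases "S = sm") auto
    then show ?thesis
      using critical_double_root[OF True, of S \<beta>] S0 S\<beta> fpos True unfolding e_def by auto
  next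
    case False
    have "g sm < 0" using g_sm u False by simp
    then have "sm < S" using S by (cases "S = sm") auto
    then have g1S: "g1 S > 0" using g1_strict_mono[of sm S] sm g1_sm by simp
    \<comment> \<open>The convex \<open>g\<close> lies above its tangent at the root, whose slope is
      positive off the critical value; this gives the linear lower bound.\<close>
    have "root_type f {S..\<beta>} S 0"
    proof (rule root_type_simple[of "S * g1 S"])
      fix s assume "s \<in> {S..\<beta>}"
      then have s: "s >= S" "s > 0" using S0 by auto
      have "S * (g1 S * (s - S)) <= s * (g1 S * (s - S))" using s g1S by (intro mult_right_mono) auto
      also have "... <= s * g s" using g_tangent[OF S0 s(2)] S(2) s by (intro mult_left_mono) auto
      finally show "S * g1 S * \<bar>s - S\<bar> <= f s" using f_eq[OF s(2)] s by (simp add: mult.assoc)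
    qed (use S0 g1S in simp)
    then show ?thesis using False unfolding e_def by simp
  qed
  have psi: "Psi1 lam \<tau> (- \<rho>) (1 / r) = profile S e r" if "0 < r" "r < 1" for r
    using that unfolding Psi1_def S(3) e_def profile_def by (simp add: powr_reciprocal ln_div)
  have "behaves c v \<longleftrightarrow> v \<sim>[at 0] (%x. c * Psi1 lam \<tau> (- \<rho>) (1 / norm x))" for c and v :: "'a => real"
    using N2_cases not_tau_zero S\<beta> N2_low_iff hi unfolding behaviour_at_0_def S(3) by auto
  also have "v \<sim>[at 0] (%x. c * Psi1 lam \<tau> (- \<rho>) (1 / norm x)) \<longleftrightarrow> v \<sim>[at 0] (%x. c * profile S e (norm x))" for c and v :: "'a => real"
    by (rule asymp_equiv_small_cong) (simp only: psi)
  finally have b: "like_profile S e c v" for c and v :: "'a => real" .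
  show thesis
    by (rule that[OF S0 S\<beta> _ rt _ b]) (use f_eq[OF S0] S fpos S\<beta> in auto)
qed

text \<open>Here \<beta> lies between the root 0 of \<open>f\<close> and the smaller root of
  \<open>g\<close>, so \<open>F\<close> has roots at slopes of both signs, and decay relative to
  \<open>U\<close> is possible at the origin and at infinity.\<close>

lemma lower_case:
  assumes lo: "\<beta> < sm"
  obtains s2 e where "\<beta> < s2" "f s2 = 0" "root_type f {\<beta>..s2} s2 e" "root_type f {0..\<beta>} 0 0"
    "!!c (v::'a::euclidean_space => real). like_profile 0 0 c v"
    "!!c (v::'a::euclidean_space => real). v \<sim>[at 0] (%x. c) \<longleftrightarrow> v \<sim>[at 0] (%x. c * profile 0 0 (norm x))"
    "!!c (v::'a::euclidean_space => real). v \<sim>[at_infinity] (%x. c * Phi2 lam \<tau> (- \<rho>) (1 / norm x)) \<longleftrightarrow>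
        v \<sim>[at_infinity] (%x. c * profile s2 e (norm x))"
proof -
  obtain S where S: "0 < S" "S <= sm" "g S = 0" "varpi2 lam \<tau> (- \<rho>) = - S" using lower_root by blast
  have low: "low" using N2_low_iff lo by simp
  then have \<beta>S: "\<beta> < S" unfolding case_N2_low_def S(4) by simp
  obtain S1 where S1: "sm <= S1" "varpi1 lam \<tau> (- \<rho>) = - S1" using upper_root by blast
  define e where "e = (if - \<rho> = Upsilon lam \<tau> then 2 / (1 + \<tau>) else 0)"
  have gpos: "g s > 0" if "0 < s" "s < S" for s using g_decr[OF that S(2)] S(3) by simp
  have rt: "root_type f {\<beta>..S} S e"
  proof (cases "- \<rho> = Upsilon lam \<tau>")
    case True
    have "S = sm" using g_decr[of S sm] S g_sm True by (cases "S = sm") auto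
    moreover have "f s > 0" if "s \<in> {\<beta>..S}" "s ~= S" for s
      using gpos[of s] f_eq[of s] that \<beta> by auto
    ultimately show ?thesis
      using critical_double_root[OF True, of \<beta> S] \<beta> \<beta>S True unfolding e_def by auto
  next
    case False
    have "g sm < 0" using g_sm u False by simp
    then have "S < sm" using S by (cases "S = sm") auto
    then have g1S: "g1 S < 0" using g1_strict_mono[of S sm] S g1_sm by simp
    have "root_type f {\<beta>..S} S 0"
    proof (rule root_type_simple[of "\<beta> * (- g1 S)"])
      fix s assume "s \<in> {\<beta>..S}"
      then have s: "s >= \<beta>" "s > 0" "s <= S" using \<beta> by auto
      have h: "- g1 S * (S - s) <= g s" using g_tangent[OF S(1) s(2)] S(3) by (simp add: algebra_simps)
      have "\<beta> * (- g1 S * (S - s)) <= s * (- g1 S * (S - s))" using s g1S by (intro mult_right_mono) (auto simp: mult_nonpos_nonneg)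
      also have "... <= s * g s" using h s by (intro mult_left_mono) auto
      finally show "\<beta> * (- g1 S) * \<bar>s - S\<bar> <= f s" using f_eq[OF s(2)] s by (simp add: mult.assoc)
    qed (use \<beta> g1S in \<open>simp add: mult_pos_neg\<close>)
    then show ?thesis using False unfolding e_def by simp
  qed
  have rt0: "root_type f {0..\<beta>} 0 0"
  proof (rule root_type_zero[OF g_beta])
    show "g \<beta> <= g s" if "0 < s" "s <= \<beta>" for s
      using g_decr[of s \<beta>] that lo by (cases "s = \<beta>") auto
  qed
  have c: "v \<sim>[at 0] (%x. c) \<longleftrightarrow> v \<sim>[at 0] (%x. c * profile 0 0 (norm x))" for c and v :: "'a => real"
    by (rule asymp_equiv_small_cong) (auto simp: profile_0)
  have "behaves c v \<longleftrightarrow> v \<sim>[at 0] (%x. c)" for c and v :: "'a => real"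
    using N2_cases not_tau_zero low S1 lo unfolding behaviour_at_0_def by auto
  then have b: "like_profile 0 0 c v" for c and v :: "'a => real"
    unfolding c .
  have phi: "Phi2 lam \<tau> (- \<rho>) (1 / r) = profile S e r" if "1 < r" for r
    using that unfolding Phi2_def S(4) e_def profile_def by (simp add: powr_reciprocal ln_div)
  have i: "v \<sim>[at_infinity] (%x. c * Phi2 lam \<tau> (- \<rho>) (1 / norm x)) \<longleftrightarrow> v \<sim>[at_infinity] (%x. c * profile S e (norm x))"
    for c and v :: "'a => real"
    by (rule asymp_equiv_large_cong) (simp only: phi)
  show thesis by (rule that[OF \<beta>S _ rt rt0 b c i]) (use f_eq[OF S(1)] S in simp)
qed

end

end

text \<open>The rest of the proof sees the case distinction only through these alternatives: whether
  or not \<open>f\<close> has a root above \<beta>.\<close>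

lemma exponents_cases:
  obtains (one) s0 e where "\<not> low" "0 <= s0" "s0 < \<beta>" "f s0 = 0" "root_type f {s0..\<beta>} s0 e" "!!s. s >= \<beta> ==> f s > 0"
    "!!c (v::'a::euclidean_space => real). like_profile s0 e c v"
  | (two) s2 e where "low" "\<beta> < s2" "f s2 = 0" "root_type f {\<beta>..s2} s2 e" "root_type f {0..\<beta>} 0 0"
    "!!c (v::'a::euclidean_space => real). like_profile 0 0 c v"
    "!!c (v::'a::euclidean_space => real). v \<sim>[at 0] (%x. c) \<longleftrightarrow> v \<sim>[at 0] (%x. c * profile 0 0 (norm x))"
    "!!c (v::'a::euclidean_space => real). v \<sim>[at_infinity] (%x. c * Phi2 lam \<tau> (- \<rho>) (1 / norm x)) \<longleftrightarrow>
        v \<sim>[at_infinity] (%x. c * profile s2 e (norm x))"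
proof (cases "tau_zero lam \<tau>")
  case True
  have nl: "\<not> low" using True unfolding tau_zero_def case_N2_low_def case_N2_def by auto
  have pos: "f s > 0" if "s >= \<beta>" for s
  proof -
    have s: "s > 0" using that \<beta> by simp
    have "g s > 0" using g_beta tau_zero_eq[OF True s] tau_zero_eq[OF True \<beta>] that by linarith
    then show ?thesis using f_eq[OF s] s by simp
  qed
  show thesis by (rule left_root_tau_zero[OF True]) (rule one[OF nl _ _ _ _ pos])
next
  case False
  then have t: "\<tau> > 0" "lam ~= 0" using \<tau> unfolding tau_zero_def by auto
  show thesis
  proof (cases "lam < 0")
    case True
    have nl: "\<not> low" using True unfolding case_N2_low_def case_N2_def by auto
    show thesis by (rule left_root_negative[OF t(1) True]) (rule one[OF nl less_imp_le])
  next
    case False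
    then have l: "lam > 0" using t by simp
    show thesis
    proof (cases "- \<rho> < Upsilon lam \<tau>")
      case True
      show thesis by (rule one[OF no_roots(4)[OF t(1) l True] order_refl \<beta> f_0 no_roots(1,2,3)[OF t(1) l True]])
    next
      case False
      then have u: "- \<rho> >= Upsilon lam \<tau>" by simp
      show thesis
      proof (cases "\<beta> < sm")
        case True
        have low: "low" using N2_low_iff[OF t(1) l u] True by simp
        show thesis by (rule lower_case[OF t(1) l u True]) (rule two[OF low])
      next
        case False
        then have nl: "\<not> low" and hi: "sm <= \<beta>" using N2_low_iff[OF t(1) l u] by simp_all
        show thesis by (rule left_root_upper[OF t(1) l u hi]) (rule one[OF nl less_imp_le])
      qed
    qed
  qed
qed

end

section \<open>Classification\<close>

text \<open>An equality of filters and not only a limit, so that asymptotic statements in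
  \<open>x\<close> and in t = ln |x| are equivalent.\<close>

lemma filtermap_ln_norm_at_0: "filtermap (%x::'a::euclidean_space. ln (norm x)) (at 0) = at_bot"
proof -
  obtain e :: 'a where e: "norm e = 1" using vector_choose_size[of 1] by auto
  show ?thesis
  proof (rule filtermap_fun_inverse[where g="%t. exp t *\<^sub>R e"])
    show "filterlim (%t. exp t *\<^sub>R e) (at 0) at_bot"
      unfolding filterlim_at
    proof
      show "eventually (%t. exp t *\<^sub>R e \<in> UNIV \<and> exp t *\<^sub>R e ~= 0) at_bot" using e by auto
      have "((%t. exp t *\<^sub>R e) \<longlongrightarrow> 0 *\<^sub>R e) at_bot" by (intro tendsto_scaleR exp_at_bot tendsto_const)
      then show "((%t. exp t *\<^sub>R e) \<longlongrightarrow> 0) at_bot" by simp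
    qed
    have "filterlim (norm :: 'a => real) (at_right 0) (at 0)"
      unfolding filterlim_at using tendsto_norm[OF tendsto_ident_at, of "0::'a" UNIV]
      by (auto simp: eventually_at_filter)
    then show "filterlim (%x::'a. ln (norm x)) at_bot (at 0)" by (rule filterlim_compose[OF ln_at_0])
  qed (use e in simp)
qed

lemma filtermap_ln_norm_at_infinity: "filtermap (%x::'a::euclidean_space. ln (norm x)) at_infinity = at_top"
proof -
  obtain e :: 'a where e: "norm e = 1" using vector_choose_size[of 1] by auto
  show ?thesis
  proof (rule filtermap_fun_inverse[where g="%t. exp t *\<^sub>R e"])
    show "filterlim (%t. exp t *\<^sub>R e) at_infinity at_top"
      unfolding filterlim_at_infinity_conv_norm_at_top using e exp_at_top by simp
    show "filterlim (%x::'a. ln (norm x)) at_top at_infinity"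
      by (rule filterlim_compose[OF ln_at_top filterlim_norm_at_top])
  qed (use e in simp)
qed

lemma asymp_equiv_exp_iff:
  fixes a b :: "'b => real"
  shows "(%t. exp (a t)) \<sim>[F] (%t. exp (b t)) \<longleftrightarrow> ((%t. a t - b t) \<longlongrightarrow> 0) F"
proof -
  have "(%t. exp (a t)) \<sim>[F] (%t. exp (b t)) \<longleftrightarrow> ((%t. exp (a t - b t)) \<longlongrightarrow> 1) F"
    unfolding asymp_equiv_def by (simp add: exp_diff)
  also have "... \<longleftrightarrow> ((%t. a t - b t) \<longlongrightarrow> 0) F"
    using tendsto_ln[of "%t. exp (a t - b t)" 1 F] tendsto_exp[of "%t. a t - b t" 0 F] by auto
  finally show ?thesis .
qed

context exponents
begin

section \<open>Radial solutions as trajectories of the autonomous equation\<close>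

definition F :: "real => real" where "F p = f (\<beta> - p)"

lemma isCont_F: "isCont F x"
  unfolding F_def using isCont_o2[where f="%p. \<beta> - p" and g=f and a=x] isCont_f by simp

text \<open>Near slope 0 the argument of \<open>f\<close> stays away from the origin; for |x| >=
  \<beta> / 2 it suffices that \<open>F\<close> is bounded on the interval.\<close>

lemma F_lipschitz: "\<exists>C. \<forall>x. \<bar>x\<bar> <= B --> \<bar>F x - F 0\<bar> <= C * \<bar>x\<bar>"
proof -
  obtain C where C: "!!x y. \<beta> / 2 <= x ==> x <= 3 * \<beta> / 2 ==> \<beta> / 2 <= y ==> y <= 3 * \<beta> / 2 ==> \<bar>f x - f y\<bar> <= C * \<bar>x - y\<bar>"
    using f_lipschitz[of "\<beta> / 2" "3 * \<beta> / 2"] \<beta> by auto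
  have "compact (F ` {- B..B})"
    by (intro compact_continuous_image continuous_at_imp_continuous_on ballI isCont_F) simp
  then obtain K where K: "!!x. x \<in> {- B..B} ==> \<bar>F x\<bar> <= K"
    using compact_imp_bounded bounded_iff by (metis imageI real_norm_def)
  define D where "D = max C (4 * \<bar>K\<bar> / \<beta>)"
  have "\<bar>F x - F 0\<bar> <= D * \<bar>x\<bar>" if x: "\<bar>x\<bar> <= B" for x
  proof (cases "\<bar>x\<bar> <= \<beta> / 2")
    case True
    then have "\<bar>F x - F 0\<bar> <= C * \<bar>\<beta> - x - (\<beta> - 0)\<bar>" unfolding F_def using \<beta> by (intro C) (auto simp: abs_le_iff)
    also have "... <= D * \<bar>x\<bar>" unfolding D_def by (auto intro!: mult_right_mono)
    finally show ?thesis .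
  next
    case False
    have "\<bar>F x - F 0\<bar> <= 2 * \<bar>K\<bar>" using K[of x] K[of 0] x by (auto simp: abs_le_iff)
    also have "... = 4 * \<bar>K\<bar> / \<beta> * (\<beta> / 2)" using \<beta> by simp
    also have "... <= 4 * \<bar>K\<bar> / \<beta> * \<bar>x\<bar>" using False \<beta> by (intro mult_left_mono) auto
    also have "... <= D * \<bar>x\<bar>" unfolding D_def by (intro mult_right_mono) auto
    finally show ?thesis .
  qed
  then show ?thesis by blast
qed

sublocale ode: autonomous_ode "q - 1" F
  by standard (use q f\<beta> isCont_F F_lipschitz in \<open>auto simp: F_def\<close>)

text \<open>Dividing by this constant turns the explicit solution \<open>U\<close> into the zero
  solution of the autonomous equation.\<close>

definition \<Lambda> :: real where "\<Lambda> = f \<beta> powr (1 / (q - 1))"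

lemma \<Lambda>_pos: "\<Lambda> > 0"
  unfolding \<Lambda>_def using f\<beta> by simp

lemma exp_ln_\<Lambda>: "exp ((q - 1) * (z + ln \<Lambda>)) = F 0 * exp ((q - 1) * z)"
proof -
  have "(q - 1) * ln \<Lambda> = ln (f \<beta>)" unfolding \<Lambda>_def using f\<beta> q by (simp add: ln_powr)
  then show ?thesis using f\<beta> by (simp add: distrib_left exp_add F_def)
qed

definition rad :: "(real => real) => 'a::euclidean_space => real" where
  "rad z = restrict (%x. exp (z (ln (norm x)) + ln \<Lambda> - \<beta> * ln (norm x))) (- {0})"

lemma rad_solution:
  assumes "ode.sol z p" shows "(rad z :: 'a::euclidean_space => real) \<in> sols"
proof -
  have "DERIV (%t. z t + ln \<Lambda>) t :> p t" for t
    using ode.solD(1)[OF assms, of t] by (auto intro!: derivative_eq_intros)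
  moreover have "DERIV p t :> exp ((q - 1) * (z t + ln \<Lambda>)) - f (\<beta> - p t)" for t
    using ode.solD(2)[OF assms, of t] unfolding exp_ln_\<Lambda> by (simp add: F_def)
  ultimately show ?thesis unfolding rad_def by (intro ode_to_solution[OF q \<tau>(2)])
qed

lemma solution_rad:
  fixes u :: "'a::euclidean_space => real"
  assumes dim: "DIM('a) >= 2" and u: "u \<in> sols"
  obtains z p B where "u = rad z" "ode.sol z p" "!!t. z t <= B" "!!t. \<bar>p t\<bar> <= B"
proof -
  obtain z p B where zp: "!!x. x ~= 0 ==> u x = exp (z (ln (norm x)) - \<beta> * ln (norm x))"
    "!!t. DERIV z t :> p t"
    "!!t. DERIV p t :> exp ((q - 1) * z t) - f (\<beta> - p t)"
    "!!t. z t <= B" "!!t. \<bar>p t\<bar> <= B"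
    using solution_to_ode[OF q \<tau> dim u] by blast
  have ext: "u \<in> extensional (- {0})" using u unfolding positive_solutions_def by simp
  have "u = rad (%t. z t - ln \<Lambda>)"
  proof
    show "u x = rad (%t. z t - ln \<Lambda>) x" for x
      using zp(1)[of x] extensional_arb[OF ext, of x] unfolding rad_def by (cases "x = 0") auto
  qed
  moreover have "ode.sol (%t. z t - ln \<Lambda>) p"
    unfolding ode.sol_def
  proof (intro allI conjI)
    show "DERIV (%t. z t - ln \<Lambda>) t :> p t" for t
      using zp(2)[of t] by (auto intro!: derivative_eq_intros)
    show "DERIV p t :> F 0 * exp ((q - 1) * (z t - ln \<Lambda>)) - F (p t)" for t
      using zp(3)[of t] exp_ln_\<Lambda>[of "z t - ln \<Lambda>"] by (simp add: F_def)
  qed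
  moreover have "z t - ln \<Lambda> <= B + \<bar>ln \<Lambda>\<bar>" for t using zp(4)[of t] by linarith
  moreover have "\<bar>p t\<bar> <= B + \<bar>ln \<Lambda>\<bar>" for t using zp(5)[of t] by linarith
  ultimately show thesis using that by blast
qed

lemma rad_asymp_equiv:
  assumes F: "filtermap (%x::'a::euclidean_space. ln (norm x)) F1 = F2" and ne: "eventually (%x::'a. x ~= 0) F1"
    and h: "eventually (%x. h x = exp (H (ln (norm x)) - \<beta> * ln (norm x))) F1"
  shows "(rad z :: 'a => real) \<sim>[F1] h \<longleftrightarrow> ((%t. z t - H t) \<longlongrightarrow> - ln \<Lambda>) F2"
proof -
  have r: "eventually (%x::'a. rad z x = exp (z (ln (norm x)) + ln \<Lambda> - \<beta> * ln (norm x))) F1"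
    using ne by (rule eventually_mono) (simp add: rad_def)
  have "(rad z :: 'a => real) \<sim>[F1] h \<longleftrightarrow>
      (%x::'a. exp (z (ln (norm x)) + ln \<Lambda> - \<beta> * ln (norm x))) \<sim>[F1] (%x. exp (H (ln (norm x)) - \<beta> * ln (norm x)))"
    by (rule asymp_equiv_cong[OF r h])
  also have "... \<longleftrightarrow> (%t. exp (z t + ln \<Lambda> - \<beta> * t)) \<sim>[F2] (%t. exp (H t - \<beta> * t))"
    unfolding F[symmetric] asymp_equiv_filtermap_iff ..
  also have "... \<longleftrightarrow> ((%t. (z t + ln \<Lambda> - \<beta> * t) - (H t - \<beta> * t)) \<longlongrightarrow> 0) F2" by (rule asymp_equiv_exp_iff)
  also have "... \<longleftrightarrow> ((%t. z t - H t) \<longlongrightarrow> - ln \<Lambda>) F2"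
    using tendsto_add_const_iff[of "ln \<Lambda>" "%t. z t - H t" "- ln \<Lambda>" F2] by (simp add: algebra_simps)
  finally show ?thesis .
qed

lemma eventually_nonzero: "eventually (%x::'a::euclidean_space. x ~= 0) (at 0)" "eventually (%x::'a::euclidean_space. x ~= 0) at_infinity"
proof -
  show "eventually (%x::'a. x ~= 0) (at 0)" by (simp add: eventually_at_filter)
  show "eventually (%x::'a. x ~= 0) at_infinity" by (rule eventually_mono[OF eventually_large_norm]) auto
qed

lemma U_sol_rad: "(U :: 'a::euclidean_space => real) = rad (%_. 0)"
proof
  fix x :: 'a
  show "U x = rad (%_. 0) x"
  proof (cases "x = 0")
    case False
    have "rad (%_. 0) x = \<Lambda> * exp (- \<beta> * ln (norm x))" using False \<Lambda>_pos by (simp add: rad_def exp_diff exp_minus divide_inverse)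
    then show ?thesis using False unfolding U_sol_def \<Lambda>_def by (simp add: powr_def)
  qed (simp add: U_sol_def rad_def)
qed

lemma zero_sol: "ode.sol (%_. 0) (%_. 0)"
  unfolding ode.sol_def by (auto intro!: derivative_eq_intros)

lemma rad_U_sol_iff:
  "(rad z :: 'a::euclidean_space => real) \<sim>[at 0] U \<longleftrightarrow> (z \<longlongrightarrow> 0) at_bot"
  "(rad z :: 'a::euclidean_space => real) \<sim>[at_infinity] U \<longleftrightarrow> (z \<longlongrightarrow> 0) at_top"
proof -
  have sh: "((%t. z t - ln \<Lambda>) \<longlongrightarrow> - ln \<Lambda>) G \<longleftrightarrow> (z \<longlongrightarrow> 0) G" for G
    using tendsto_add_const_iff[of "- ln \<Lambda>" z 0 G] by simp
  have "eventually (%x. (rad (%_. 0) :: 'a => real) x = exp ((%_. ln \<Lambda>) (ln (norm x)) - \<beta> * ln (norm x))) G"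
    if "eventually (%x::'a. x ~= 0) G" for G
    using that by (rule eventually_mono) (simp add: rad_def)
  note e = this[OF eventually_nonzero(1)] this[OF eventually_nonzero(2)]
  show "(rad z :: 'a => real) \<sim>[at 0] U \<longleftrightarrow> (z \<longlongrightarrow> 0) at_bot"
    unfolding U_sol_rad using rad_asymp_equiv[OF filtermap_ln_norm_at_0 eventually_nonzero(1) e(1), of z] sh by simp
  show "(rad z :: 'a => real) \<sim>[at_infinity] U \<longleftrightarrow> (z \<longlongrightarrow> 0) at_top"
    unfolding U_sol_rad using rad_asymp_equiv[OF filtermap_ln_norm_at_infinity eventually_nonzero(2) e(2), of z] sh by simp
qed

lemma profile_exp:
  assumes "0 < r" "r ~= 1" "c > 0"
  shows "c * profile s e r = exp (ln c + ((\<beta> - s) * ln r + e * ln \<bar>ln r\<bar>) - \<beta> * ln r)"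
proof -
  have "ln r ~= 0" using assms by simp
  then have "c * profile s e r = exp (ln c) * (exp (- s * ln r) * exp (e * ln \<bar>ln r\<bar>))"
    using assms unfolding profile_def powr_def by simp
  then show ?thesis by (simp only: exp_add[symmetric]) (simp add: algebra_simps)
qed

lemma rad_profile_iff:
  assumes c: "c > 0"
  shows "(rad z :: 'a::euclidean_space => real) \<sim>[at 0] (%x. c * profile s e (norm x)) \<longleftrightarrow>
      ((%t. z t - ((\<beta> - s) * t + e * ln (- t))) \<longlongrightarrow> ln c - ln \<Lambda>) at_bot"
    "(rad z :: 'a::euclidean_space => real) \<sim>[at_infinity] (%x. c * profile s e (norm x)) \<longleftrightarrow>
      ((%t. z t - ((s - \<beta>) * - t + e * ln (- (- t)))) \<longlongrightarrow> ln c - ln \<Lambda>) at_top"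
proof -
  have sh: "((%t. z t - (ln c + A t)) \<longlongrightarrow> - ln \<Lambda>) G \<longleftrightarrow> ((%t. z t - A t) \<longlongrightarrow> ln c - ln \<Lambda>) G" for A G
    using tendsto_add_const_iff[of "ln c" "%t. z t - (ln c + A t)" "- ln \<Lambda>" G] by (simp add: algebra_simps)
  have e1: "eventually (%x::'a. c * profile s e (norm x) =
      exp ((%t. ln c + ((\<beta> - s) * t + e * ln (- t))) (ln (norm x)) - \<beta> * ln (norm x))) (at 0)"
  proof (rule eventually_mono[OF eventually_small_norm])
    fix x :: 'a assume x: "0 < norm x \<and> norm x < 1"
    then have "\<bar>ln (norm x)\<bar> = - ln (norm x)" by simp
    then show "c * profile s e (norm x) = exp ((%t. ln c + ((\<beta> - s) * t + e * ln (- t))) (ln (norm x)) - \<beta> * ln (norm x))"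
      using profile_exp[of "norm x" c s e] x c by simp
  qed
  have e2: "eventually (%x::'a. c * profile s e (norm x) =
      exp ((%t. ln c + ((s - \<beta>) * - t + e * ln (- (- t)))) (ln (norm x)) - \<beta> * ln (norm x))) at_infinity"
  proof (rule eventually_mono[OF eventually_large_norm])
    fix x :: 'a assume x: "1 < norm x"
    then have "\<bar>ln (norm x)\<bar> = ln (norm x)" by simp
    moreover have "0 < norm x" "norm x ~= 1" using x by linarith+
    moreover have "(s - \<beta>) * - ln (norm x) = (\<beta> - s) * ln (norm x)" by (simp add: algebra_simps)
    ultimately show "c * profile s e (norm x) = exp ((%t. ln c + ((s - \<beta>) * - t + e * ln (- (- t)))) (ln (norm x)) - \<beta> * ln (norm x))"
      using profile_exp[of "norm x" c s e] c by simp
  qed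
  show "(rad z :: 'a => real) \<sim>[at 0] (%x. c * profile s e (norm x)) \<longleftrightarrow>
      ((%t. z t - ((\<beta> - s) * t + e * ln (- t))) \<longlongrightarrow> ln c - ln \<Lambda>) at_bot"
    using rad_asymp_equiv[OF filtermap_ln_norm_at_0 eventually_nonzero(1) e1, of z] unfolding sh .
  show "(rad z :: 'a => real) \<sim>[at_infinity] (%x. c * profile s e (norm x)) \<longleftrightarrow>
      ((%t. z t - ((s - \<beta>) * - t + e * ln (- (- t)))) \<longlongrightarrow> ln c - ln \<Lambda>) at_top"
    using rad_asymp_equiv[OF filtermap_ln_norm_at_infinity eventually_nonzero(2) e2, of z] unfolding sh .
qed

lemma left_end_ok:
  assumes s: "s0 < \<beta>" "f s0 = 0" and rt: "root_type f {s0..\<beta>} s0 e"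
  shows "ode.end_ok (\<beta> - s0) (%t. (\<beta> - s0) * t + e * ln (- t))"
  by (rule ode.end_ok_root[OF _ _ rt, where m="%x. \<beta> - x"]) (use s in \<open>auto simp: F_def\<close>)

lemma right_end_ok:
  assumes s: "\<beta> < s2" "f s2 = 0" and rt: "root_type f {\<beta>..s2} s2 e"
  shows "autonomous_ode.end_ok (q - 1) (%x. F (- x)) (s2 - \<beta>) (%t. (s2 - \<beta>) * t + e * ln (- t))"
  by (rule autonomous_ode.end_ok_root[OF ode.autonomous_ode_reverse _ _ rt, where m="%x. \<beta> + x"])
    (use s in \<open>auto simp: F_def\<close>)

text \<open>The bound \<open>x < \<beta>\<close> keeps the argument of \<open>f\<close> positive. In
  the two-ended case the left root is 0, so all slopes are below \<beta>.\<close>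

lemma F_locally_lipschitz:
  assumes x: "x < \<beta>"
  shows "\<exists>d>0. \<exists>C. \<forall>y y'. \<bar>y - x\<bar> < d --> \<bar>y' - x\<bar> < d --> \<bar>F y - F y'\<bar> <= C * \<bar>y - y'\<bar>"
proof -
  define d where "d = (\<beta> - x) / 2"
  have d: "d > 0" "0 < \<beta> - x - d" unfolding d_def using x by (auto simp: field_simps)
  obtain C where C: "!!a b. \<beta> - x - d <= a ==> a <= \<beta> - x + d ==> \<beta> - x - d <= b ==> b <= \<beta> - x + d ==> \<bar>f a - f b\<bar> <= C * \<bar>a - b\<bar>"
    using f_lipschitz[OF d(2), of "\<beta> - x + d"] by blast
  have "\<bar>F y - F y'\<bar> <= C * \<bar>y - y'\<bar>" if "\<bar>y - x\<bar> < d" "\<bar>y' - x\<bar> < d" for y y'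
  proof -
    have "\<bar>f (\<beta> - y) - f (\<beta> - y')\<bar> <= C * \<bar>(\<beta> - y) - (\<beta> - y')\<bar>"
      by (rule C) (use that in \<open>auto simp: abs_less_iff\<close>)
    then show ?thesis unfolding F_def by (simp add: abs_minus_commute)
  qed
  then show ?thesis using d(1) by blast
qed

text \<open>Decay at infinity follows from the nonpositivity of \<open>z\<close>, and strict
  monotonicity from slopes below \<beta>, which is a root of \<open>F\<close> because
  \<open>f 0 = 0\<close>.\<close>

lemma solution_profile:
  fixes u :: "'a::euclidean_space => real"
  assumes dim: "DIM('a) >= 2" and u: "u \<in> sols"
  shows "\<exists>g :: real => real. (\<forall>x\<in>-{0}. u x = g (norm x)) \<and> (g \<longlongrightarrow> 0) at_top \<and>
          (\<forall>r>0. \<exists>d<0. DERIV g r :> d)"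
proof -
  obtain z p B where zp: "u = rad z" "ode.sol z p" "!!t. z t <= B" "!!t. \<bar>p t\<bar> <= B"
    using solution_rad[OF dim u] by blast
  define g where "g r = exp (z (ln r) + ln \<Lambda> - \<beta> * ln r)" for r
  have "\<forall>x\<in>-{0}. u x = g (norm x)" unfolding zp(1) rad_def g_def by simp
  moreover have "(g \<longlongrightarrow> 0) at_top"
  proof (rule tendsto_sandwich[OF _ _ tendsto_const])
    have "filterlim (%r::real. \<beta> * ln r) at_top at_top"
      by (rule filterlim_tendsto_pos_mult_at_top[OF tendsto_const \<beta> ln_at_top])
    then have "filterlim (%r. - ln \<Lambda> + \<beta> * ln r) at_top at_top"
      by (rule filterlim_tendsto_add_at_top[OF tendsto_const])
    then have "filterlim (%r. ln \<Lambda> + - (\<beta> * ln r)) at_bot at_top" by (simp add: filterlim_uminus_at_bot)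
    then show "((%r. exp (ln \<Lambda> + - (\<beta> * ln r))) \<longlongrightarrow> 0) at_top" by (rule filterlim_compose[OF exp_at_bot])
    show "eventually (%r. g r <= exp (ln \<Lambda> + - (\<beta> * ln r))) at_top"
      using ode.sol_nonpos[OF zp(2,3)] unfolding g_def by auto
    show "eventually (%r. 0 <= g r) at_top" unfolding g_def by simp
  qed
  moreover have "\<exists>d<0. DERIV g r :> d" if r: "r > 0" for r
  proof (intro exI conjI)
    have dz: "DERIV (%r. z (ln r)) r :> p (ln r) * (1 / r)"
      by (rule DERIV_chain2[OF ode.solD(1)[OF zp(2)]]) (use r in \<open>auto intro!: derivative_eq_intros\<close>)
    show "DERIV g r :> g r * ((p (ln r) - \<beta>) / r)"
      unfolding g_def using r by (auto intro!: derivative_eq_intros dz simp: diff_divide_distrib)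
    have "p (ln r) < \<beta>" by (rule ode.sol_slope_less[OF zp(2,3) \<beta>]) (simp add: F_def f_0)
    moreover have "g r > 0" unfolding g_def by simp
    ultimately show "g r * ((p (ln r) - \<beta>) / r) < 0" using r by (intro mult_pos_neg divide_neg_pos) auto
  qed
  ultimately show ?thesis by blast
qed

text \<open>Two solutions with the same limits relative to \<open>A\<close> and \<open>A'\<close>
  have a difference tending to 0 at both ends and coincide by comparison. An end where the solution
  behaves like \<open>U\<close> is covered by the zero function in place of \<open>A\<close> or
  \<open>A'\<close>.\<close>

lemma unique_rad:
  fixes Q :: "('a::euclidean_space => real) => bool"
  assumes dim: "DIM('a) >= 2"
    and Q: "!!z. Q (rad z) \<longleftrightarrow> (rad z :: 'a => real) \<in> sols \<and>
        ((%t. z t - A t) \<longlongrightarrow> L) at_bot \<and> ((%t. z t - A' t) \<longlongrightarrow> M) at_top"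
    and Qs: "!!u. Q u ==> u \<in> sols"
    and ex: "ode.sol z p" "((%t. z t - A t) \<longlongrightarrow> L) at_bot" "((%t. z t - A' t) \<longlongrightarrow> M) at_top"
  shows "\<exists>!u. Q u"
proof (rule ex_ex1I)
  show "\<exists>u. Q u" using Q[of z] ex rad_solution[OF ex(1)] by blast
  fix u v assume uv: "Q u" "Q v"
  obtain z1 p1 B1 where z1: "u = rad z1" "ode.sol z1 p1" using solution_rad[OF dim Qs[OF uv(1)]] by metis
  obtain z2 p2 B2 where z2: "v = rad z2" "ode.sol z2 p2" using solution_rad[OF dim Qs[OF uv(2)]] by metis
  have "((%t. (z1 t - A t) - (z2 t - A t)) \<longlongrightarrow> L - L) at_bot" "((%t. (z1 t - A' t) - (z2 t - A' t)) \<longlongrightarrow> M - M) at_top"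
    using uv unfolding z1 z2 Q by (intro tendsto_diff; simp)+
  then have l: "((%t. z1 t - z2 t) \<longlongrightarrow> 0) at_bot" "((%t. z1 t - z2 t) \<longlongrightarrow> 0) at_top" by simp_all
  have "\<bar>z1 t - z2 t\<bar> <= 0" for t by (rule ode.two_sided_comparison[OF z1(2) z2(2) l]) auto
  then have "z1 = z2" by (intro ext) simp
  then show "u = v" using z1 z2 by simp
qed

lemma limit_zero_iff: "((%t. z t - (%_. 0) t) \<longlongrightarrow> 0) G \<longleftrightarrow> (z \<longlongrightarrow> 0) G" for z :: "real => real"
  by simp

lemma exp_limit: "ln (exp (L + ln \<Lambda>)) - ln \<Lambda> = L"
  by simp

theorem classification:
  assumes dim: "DIM('a::euclidean_space) >= 2"
  shows
     "(\<forall>c>0. \<exists>!u :: 'a => real. is_c0 c u) \<and>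
     (low -->
        (\<forall>b>0. \<exists>!u :: 'a => real. is_binf b u) \<and>
        (\<forall>b>0. \<forall>c>0. \<exists>!u :: 'a => real. is_c0b c b u)) \<and>
     (sols :: ('a => real) set) =
       (if low
        then {U} \<union> {uc0 c |c. c > 0}
             \<union> {ubinf b |b. b > 0} \<union> {uc0b c b |b c. b > 0 \<and> c > 0}
        else {U} \<union> {uc0 c |c. c > 0})"
proof -
  let ?S = "sols :: ('a => real) set"
  have US: "(U :: 'a => real) \<in> ?S" unfolding U_sol_rad by (rule rad_solution[OF zero_sol])
  have c0: "(\<exists>!u :: 'a => real. is_c0 c u) \<and>
      (\<forall>z. is_c0 c (rad z :: 'a => real) \<longleftrightarrow> (rad z :: 'a => real) \<in> ?S \<and>
        ((%t. z t - ((\<beta> - s0) * t + e * ln (- t))) \<longlongrightarrow> ln c - ln \<Lambda>) at_bot \<and> (z \<longlongrightarrow> 0) at_top)"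
    if c: "c > 0" and s: "s0 < \<beta>" "f s0 = 0" "root_type f {s0..\<beta>} s0 e"
      and b: "!!c (v::'a => real). like_profile s0 e c v"
    for c s0 e
  proof
    have iff: "is_c0 c (rad z :: 'a => real) \<longleftrightarrow> (rad z :: 'a => real) \<in> ?S \<and>
        ((%t. z t - ((\<beta> - s0) * t + e * ln (- t))) \<longlongrightarrow> ln c - ln \<Lambda>) at_bot \<and> (z \<longlongrightarrow> 0) at_top" for z
      unfolding is_u_c0_def b rad_profile_iff(1)[OF c] rad_U_sol_iff by blast
    then show "\<forall>z. is_c0 c (rad z :: 'a => real) \<longleftrightarrow> (rad z :: 'a => real) \<in> ?S \<and>
        ((%t. z t - ((\<beta> - s0) * t + e * ln (- t))) \<longlongrightarrow> ln c - ln \<Lambda>) at_bot \<and> (z \<longlongrightarrow> 0) at_top" by blast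
    obtain z p where zp: "ode.sol z p" "((%t. z t - ((\<beta> - s0) * t + e * ln (- t))) \<longlongrightarrow> ln c - ln \<Lambda>) at_bot" "(z \<longlongrightarrow> 0) at_top"
      by (rule ode.end_increasing_exists[OF left_end_ok[OF s], where L="ln c - ln \<Lambda>"]) (rule that, assumption+)
    show "\<exists>!u :: 'a => real. is_c0 c u"
      by (rule unique_rad[where A'="%_. 0" and M=0, unfolded limit_zero_iff, OF dim iff _ zp]) (simp add: is_u_c0_def)
  qed
  show ?thesis
  proof (cases rule: exponents_cases[where 'a='a])
    case (one s0 e)
    note c1 = c0[OF _ one(3,4,5,7)]
    have e: "ode.end_ok (\<beta> - s0) (%t. (\<beta> - s0) * t + e * ln (- t))" by (rule left_end_ok[OF one(3,4,5)])
    have "?S = {U} \<union> {uc0 c |c. c > 0}"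
    proof (intro equalityI subsetI)
      fix u assume u: "u \<in> ?S"
      obtain z p B where zp: "u = rad z" "ode.sol z p" "!!t. z t <= B" "!!t. \<bar>p t\<bar> <= B"
        using solution_rad[OF dim u] by blast
      have Fp: "F x > 0" if "x <= 0" for x unfolding F_def using one(6) that by simp
      from ode.sol_cases_one_end[OF zp(2,3,4) e Fp]
      show "u \<in> {U} \<union> {uc0 c |c. c > 0}"
      proof
        assume "\<forall>t. z t = 0"
        then have "z = (%_. 0)" by auto
        then show ?thesis using zp(1) U_sol_rad[where 'a='a] by simp
      next
        assume "(\<exists>L. ((%t. z t - ((\<beta> - s0) * t + e * ln (- t))) \<longlongrightarrow> L) at_bot) \<and> (z \<longlongrightarrow> 0) at_top"
        then obtain L where L: "((%t. z t - ((\<beta> - s0) * t + e * ln (- t))) \<longlongrightarrow> L) at_bot" "(z \<longlongrightarrow> 0) at_top" by blast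
        define c where "c = exp (L + ln \<Lambda>)"
        have c: "c > 0" unfolding c_def by simp
        have "is_c0 c u" using c1[OF c] L u unfolding zp(1) c_def exp_limit by blast
        then have "uc0 c = u" unfolding u_c0_def by (rule the1_equality[OF conjunct1[OF c1[OF c]]])
        then show ?thesis using c by blast
      qed
    next
      fix u :: "'a => real"
      assume "u \<in> {U} \<union> {uc0 c |c. c > 0}"
      then show "u \<in> ?S"
      proof
        assume "u \<in> {uc0 c |c. c > 0}"
        then obtain c where c: "c > 0" "u = uc0 c" by blast
        have "is_c0 c u" unfolding c(2) u_c0_def by (rule theI'[OF conjunct1[OF c1[OF c(1)]]])
        then show ?thesis unfolding is_u_c0_def by blast
      qed (use US in simp)
    qed
    then show ?thesis using c1 one(1) by simp
  next
    case (two s2 e)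
    have z0: "f 0 = 0" by (rule f_0)
    note c1 = c0[OF _ \<beta> z0 two(5,6)]
    let ?A = "%t. (\<beta> - 0) * t + 0 * ln (- t)"
    let ?A' = "%t. (s2 - \<beta>) * t + e * ln (- t)"
    have e: "ode.end_ok (\<beta> - 0) ?A" by (rule left_end_ok[OF \<beta> z0 two(5)])
    have e': "autonomous_ode.end_ok (q - 1) (%x. F (- x)) (s2 - \<beta>) ?A'" by (rule right_end_ok[OF two(2,3,4)])
    \<comment> \<open>The form \<open>\<beta> - 0\<close> and the zero logarithmic term are kept so
      that the instance agrees with \<open>left_end_ok\<close> at the root 0.\<close>
    interpret T: two_ends "q - 1" F "\<beta> - 0" ?A "s2 - \<beta>" ?A'
      by standard (use e e' F_locally_lipschitz in auto)
    have ib: "is_binf b (rad z :: 'a => real) \<longleftrightarrow> (rad z :: 'a => real) \<in> ?S \<and>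
        (z \<longlongrightarrow> 0) at_bot \<and> ((%t. z t - ?A' (- t)) \<longlongrightarrow> ln b - ln \<Lambda>) at_top" if "b > 0" for b z
      unfolding is_u_binf_def two(8) rad_profile_iff(2)[OF that] rad_U_sol_iff by blast
    have icb: "is_c0b c b (rad z :: 'a => real) \<longleftrightarrow> (rad z :: 'a => real) \<in> ?S \<and>
        ((%t. z t - ?A t) \<longlongrightarrow> ln c - ln \<Lambda>) at_bot \<and> ((%t. z t - ?A' (- t)) \<longlongrightarrow> ln b - ln \<Lambda>) at_top" if "b > 0" "c > 0" for b c z
      unfolding is_u_c0b_def two(7,8) rad_profile_iff(2)[OF that(1)] rad_profile_iff(1)[OF that(2)] by blast
    have ub: "\<exists>!u :: 'a => real. is_binf b u" if b: "b > 0" for b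
    proof -
      obtain z p where zp: "ode.sol z p" "(z \<longlongrightarrow> 0) at_bot" "((%t. z t - ?A' (- t)) \<longlongrightarrow> ln b - ln \<Lambda>) at_top"
        by (rule T.end_decreasing_exists[where M="ln b - ln \<Lambda>"]) (rule that, assumption+)
      show ?thesis
        by (rule unique_rad[where A="%_. 0" and L=0 and A'="%t. ?A' (- t)", unfolded limit_zero_iff, OF dim ib[OF b] _ zp])
          (simp add: is_u_binf_def)
    qed
    have ucb: "\<exists>!u :: 'a => real. is_c0b c b u" if bc: "b > 0" "c > 0" for b c
    proof -
      obtain z p where zp: "ode.sol z p" "((%t. z t - ?A t) \<longlongrightarrow> ln c - ln \<Lambda>) at_bot" "((%t. z t - ?A' (- t)) \<longlongrightarrow> ln b - ln \<Lambda>) at_top"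
        by (rule T.two_ends_exists[where L="ln c - ln \<Lambda>" and M="ln b - ln \<Lambda>"]) (rule that, assumption+)
      show ?thesis
        by (rule unique_rad[where A="?A" and A'="%t. ?A' (- t)", OF dim icb[OF bc] _ zp]) (simp add: is_u_c0b_def)
    qed
    have "?S = {U} \<union> {uc0 c |c. c > 0}
             \<union> {ubinf b |b. b > 0} \<union> {uc0b c b |b c. b > 0 \<and> c > 0}" (is "_ = ?R")
    proof (intro equalityI subsetI)
      fix u assume u: "u \<in> ?S"
      obtain z p B where zp: "u = rad z" "ode.sol z p" "!!t. z t <= B" "!!t. \<bar>p t\<bar> <= B"
        using solution_rad[OF dim u] by blast
      have pos: "exp (L + ln \<Lambda>) > 0" for L by simp
      from T.sol_cases_two_ends[OF zp(2,3,4)]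
      show "u \<in> ?R"
      proof (elim disjE exE conjE)
        assume "\<forall>t. z t = 0"
        then have "z = (%_. 0)" by auto
        then show ?thesis using zp(1) U_sol_rad[where 'a='a] by simp
      next
        fix L assume L: "((%t. z t - ?A t) \<longlongrightarrow> L) at_bot" "(z \<longlongrightarrow> 0) at_top"
        have "is_c0 (exp (L + ln \<Lambda>)) u" using c1[OF pos] L u unfolding zp(1) exp_limit by blast
        then have "uc0 (exp (L + ln \<Lambda>)) = u" unfolding u_c0_def by (rule the1_equality[OF conjunct1[OF c1[OF pos]]])
        then show ?thesis using pos by blast
      next
        fix M assume M: "(z \<longlongrightarrow> 0) at_bot" "((%t. z t - ?A' (- t)) \<longlongrightarrow> M) at_top"
        have "is_binf (exp (M + ln \<Lambda>)) u" using ib[OF pos] M u unfolding zp(1) exp_limit by blast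
        then have "ubinf (exp (M + ln \<Lambda>)) = u" unfolding u_binf_def by (rule the1_equality[OF ub[OF pos]])
        then show ?thesis using pos by blast
      next
        fix L M assume LM: "((%t. z t - ?A t) \<longlongrightarrow> L) at_bot" "((%t. z t - ?A' (- t)) \<longlongrightarrow> M) at_top"
        have "is_c0b (exp (L + ln \<Lambda>)) (exp (M + ln \<Lambda>)) u"
          using icb[OF pos pos] LM u unfolding zp(1) exp_limit by blast
        then have "uc0b (exp (L + ln \<Lambda>)) (exp (M + ln \<Lambda>)) = u"
          unfolding u_c0b_def by (rule the1_equality[OF ucb[OF pos pos]])
        then show ?thesis using pos by blast
      qed
    next
      fix u assume "u \<in> ?R"
      then consider "u = U" | c where "c > 0" "u = uc0 c"
        | b where "b > 0" "u = ubinf b" | b c where "b > 0" "c > 0" "u = uc0b c b"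
        by blast
      then show "u \<in> ?S"
      proof cases
        case 1 then show ?thesis using US by simp
      next
        case (2 c)
        have "is_c0 c u" unfolding 2(2) u_c0_def by (rule theI'[OF conjunct1[OF c1[OF 2(1)]]])
        then show ?thesis unfolding is_u_c0_def by blast
      next
        case (3 b)
        have "is_binf b u" unfolding 3(2) u_binf_def by (rule theI'[OF ub[OF 3(1)]])
        then show ?thesis unfolding is_u_binf_def by blast
      next
        case (4 b c)
        have "is_c0b c b u" unfolding 4(3) u_c0b_def by (rule theI'[OF ucb[OF 4(1,2)]])
        then show ?thesis unfolding is_u_c0b_def by blast
      qed
    qed
    then show ?thesis using c1 ub ucb two(1) by simp
  qed
qed

end

theorem corollary1p3:
  fixes q \<tau> \<rho> lam \<theta> :: real
  assumes "DIM('a::euclidean_space) \<ge> 2"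
    and "q > 1" and "0 \<le> \<tau>" and "\<tau> < 1"
    and "\<theta> > -2" and "f_fun lam \<tau> \<rho> (beta q \<theta>) > 0"
  shows
    "(\<forall>u \<in> (positive_solutions q \<tau> \<rho> lam \<theta> :: ('a \<Rightarrow> real) set).
        \<exists>g :: real \<Rightarrow> real. (\<forall>x\<in>-{0}. u x = g (norm x)) \<and> (g \<longlongrightarrow> 0) at_top \<and>
          (\<forall>r>0. \<exists>d<0. (g has_real_derivative d) (at r))) \<and>
     (\<forall>c>0. \<exists>!u :: 'a \<Rightarrow> real. is_u_c0 q \<tau> \<rho> lam \<theta> c u) \<and>
     (case_N2_low lam \<tau> (-\<rho>) (beta q \<theta>) \<longrightarrow>
        (\<forall>b>0. \<exists>!u :: 'a \<Rightarrow> real. is_u_binf q \<tau> \<rho> lam \<theta> b u) \<and>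
        (\<forall>b>0. \<forall>c>0. \<exists>!u :: 'a \<Rightarrow> real. is_u_c0b q \<tau> \<rho> lam \<theta> c b u)) \<and>
     (positive_solutions q \<tau> \<rho> lam \<theta> :: ('a \<Rightarrow> real) set) =
       (if case_N2_low lam \<tau> (-\<rho>) (beta q \<theta>)
        then {U_sol q \<tau> \<rho> lam \<theta>} \<union> {u_c0 q \<tau> \<rho> lam \<theta> c |c. c > 0}
             \<union> {u_binf q \<tau> \<rho> lam \<theta> b |b. b > 0} \<union> {u_c0b q \<tau> \<rho> lam \<theta> c b |b c. b > 0 \<and> c > 0}
        else {U_sol q \<tau> \<rho> lam \<theta>} \<union> {u_c0 q \<tau> \<rho> lam \<theta> c |c. c > 0})"
proof -
  interpret exponents q \<tau> \<rho> lam \<theta> by standard (use assms in auto)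
  show ?thesis using solution_profile[OF assms(1)] classification[OF assms(1)] by blast
qed

end
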